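(* Let the function $f=\mathcal{I}(F)\in\mathcal{GS}(\Omega_D)$ with its stem function $F$ being Hölder continuous, and write $\Omega=\Omega_D$. Suppose $U$ is a $p$-symmetric domain in $\mathbb{R}^{p+q+1}$ such that $U_{\underline{\eta}}\subset\Omega_{\underline{\eta}}$ for some $\underline{\eta}\in\mathbb{S}$. Then, at any regular point $\boldsymbol{x}\in\partial U_{\underline{\eta}}$, $$\mathop{\mathrm{n.t.\,lim}}_{\boldsymbol{t}\to\boldsymbol{x}}\int_{\partial U_{\underline{\eta}}}\mathcal{E}_{\boldsymbol{y}}(\boldsymbol{t})\,n(\boldsymbol{y})\,f(\boldsymbol{y})\,dS_{\underline{\eta}}(\boldsymbol{y})=\frac12\left[\pm f(\boldsymbol{x})+2\int_{\partial U_{\underline{\eta}}}\mathcal{E}_{\boldsymbol{y}}(\boldsymbol{x})\,n(\boldsymbol{y})\,f(\boldsymbol{y})\,dS_{\underline{\eta}}(\boldsymbol{y})\right],$$ where the limit is taken non-tangentially with $\boldsymbol{t}\in U_{\underline{\eta}}^{\pm}$ (the sign $\pm$ on the right corresponding to $U_{\underline{\eta}}^{\pm}$), $U_{\underline{\eta}}^+=U_{\underline{\eta}}$, $U_{\underline{\eta}}^-=\Omega_{\underline{\eta}}\setminus\overline{U_{\underline{\eta}}}$, and the unit exterior normal vector to $\partial U_{\underline{\eta}}$ at $\boldsymbol{y}$ is $n(\boldsymbol{y})=\sum_{i=0}^p n_i(\boldsymbol{y})e_i+n_{p+1}(\boldsymbol{y})\underline{\eta}$.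
   Context: Let $p\ge 0$ and $q\ge 1$ be integers. $\mathbb{R}_{p+q}$ is the real Clifford algebra generated by $e_1,\dots,e_{p+q}$ with $e_ie_j+e_je_i=-2\delta_{ij}$, and $e_0=1$. For a paravector $\boldsymbol{x}=\sum_{i=0}^{p+q}x_ie_i$, the Clifford conjugate is $\overline{\boldsymbol{x}}=x_0-\sum_{i=1}^{p+q}x_ie_i$. The norm of $a=\sum_A a_Ae_A$ is $|a|=(\sum_A a_A^2)^{1/2}$. A point of $\mathbb{R}^{p+q+1}=\mathbb{R}^{p+1}\oplus\mathbb{R}^q$ is identified with the paravector $\boldsymbol{x}=\boldsymbol{x}_p+\underline{\boldsymbol{x}}_q$, $\boldsymbol{x}_p=\sum_{i=0}^p x_ie_i$, $\underline{\boldsymbol{x}}_q=\sum_{i=p+1}^{p+q}x_ie_i$. $\mathbb{S}=\{\underline{\boldsymbol{x}}_q:\underline{\boldsymbol{x}}_q^2=-1\}$ is the unit sphere of $\mathbb{R}^q$. Write $\boldsymbol{x}=\boldsymbol{x}_p+r\underline{\omega}$ with $r=|\underline{\boldsymbol{x}}_q|\ge 0$ and $\underline{\omega}\in\mathbb{S}$ ($\underline{\omega}=\underline{\boldsymbol{x}}_q/|\underline{\boldsymbol{x}}_q|$ if $\underline{\boldsymbol{x}}_q\neq0$, arbitrary otherwise). For open $\Omega\subset\mathbb{R}^{p+q+1}$ and $\underline{\eta}\in\mathbb{S}$, $\Omega_{\underline{\eta}}:=\Omega\cap(\mathbb{R}^{p+1}\oplus\underline{\eta}\mathbb{R})$, regarded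 as a subset of $\mathbb{R}^{p+2}$ via $\boldsymbol{x}_p+r\underline{\eta}\leftrightarrow(\boldsymbol{x}_p,r)$, $r\in\mathbb{R}$. A domain $\Omega$ is $p$-symmetric if $\boldsymbol{x}_p+r\underline{\omega}\in\Omega$ (with $\boldsymbol{x}_p\in\mathbb{R}^{p+1}$, $r>0$, $\underline{\omega}\in\mathbb{S}$) implies $\boldsymbol{x}_p+r\mathbb{S}\subseteq\Omega$. Let $D\subseteq\mathbb{R}^{p+2}$ be a domain invariant under the reflection $(\boldsymbol{x}_p,r)\mapsto(\boldsymbol{x}_p,-r)$ of the last variable. Its $p$-symmetric completion is $\Omega_D=\{\boldsymbol{x}_p+r\underline{\omega}:\underline{\omega}\in\mathbb{S},\ r\ge0,\ (\boldsymbol{x}_p,r)\in D\}\subset\mathbb{R}^{p+q+1}$; throughout, $\Omega_D$ is a $p$-symmetric domain. A stem function on $D$ is $F=F_1+iF_2:D\to\mathbb{R}_{p+q}\otimes_{\mathbb{R}}\mathbb{C}$ with $F_1,F_2$ being $\mathbb{R}_{p+q}$-valued, $F_1(\boldsymbol{x}_p,-r)=F_1(\boldsymbol{x}_p,r)$ and $F_2(\boldsymbol{x}_p,-r)=-F_2(\boldsymbol{x}_p,r)$. It induces $f=\mathcal{I}(F):\Omega_D\to\mathbb{R}_{p+q}$, $f(\boldsymbol{x}_p+r\underline{\omega})=F_1(\boldsymbol{x}_p,r)+\underline{\omega}F_2(\boldsymbol{x}_p,r)$. $\mathcal{GS}(\Omega_D)$ is the set of all such induced (generalized partial-slice) functions.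 The monogenic Cauchy kernel on $\mathbb{R}^{p+2}\setminus\{0\}$ is $E(\boldsymbol{x})=\frac{1}{\sigma_{p+1}}\frac{\overline{\boldsymbol{x}}}{|\boldsymbol{x}|^{p+2}}$, with $\sigma_{p+1}=2\Gamma(\tfrac12)^{p+2}/\Gamma(\tfrac{p+2}{2})$ the area of the unit sphere in $\mathbb{R}^{p+2}$, and $E_{\boldsymbol{y}}(\boldsymbol{x})=E(\boldsymbol{y}-\boldsymbol{x})$. For $\boldsymbol{y}\in\mathbb{R}^{p+1}\oplus\underline{\eta}\mathbb{R}$ and $\boldsymbol{x}=\boldsymbol{x}_p+r\underline{\omega}$, the left generalized partial-slice Cauchy kernel is $$\mathcal{E}_{\boldsymbol{y}}(\boldsymbol{x})=\tfrac12(1-\underline{\omega}\,\underline{\eta})E_{\boldsymbol{y}}(\boldsymbol{x}_p+r\underline{\eta})+\tfrac12(1+\underline{\omega}\,\underline{\eta})E_{\boldsymbol{y}}(\boldsymbol{x}_p-r\underline{\eta}).$$ $dS_{\underline{\eta}}$ is the surface measure on $\partial U_{\underline{\eta}}$, the boundary of $U_{\underline{\eta}}$ in $\mathbb{R}^{p+1}\oplus\underline{\eta}\mathbb{R}\cong\mathbb{R}^{p+2}$. The integral with $\mathcal{E}_{\boldsymbol{y}}(\boldsymbol{x})$, $\boldsymbol{x}\in\partial U_{\underline{\eta}}$, is singular and is read as a Cauchy principal value. A regular point of $\partial U_{\underline{\eta}}$ is a point near which $\partial U_{\underline{\eta}}$ is a smooth hypersurface with $U_{\underline{\eta}}$ locally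 on one side. The non-tangential limit ($\mathrm{n.t.\,lim}$) is taken with $\boldsymbol{t}\to\boldsymbol{x}$ inside a cone with vertex $\boldsymbol{x}$ around the normal direction whose closure meets the tangent hyperplane at $\boldsymbol{x}$ only at $\boldsymbol{x}$. *)

theory Defs
  imports "HOL-Analysis.Analysis"
begin

section \<open>The real Clifford algebra\<close>

text \<open>
  The generators \<open>e\<^sub>1, \<dots>, e\<^sub>n\<close> of the algebra are indexed by a finite linearly ordered type
  \<open>'n\<close> with \<open>n = p + q\<close> elements, and an element \<open>\<Sum>\<^sub>A a\<^sub>A e\<^sub>A\<close> is its family of coefficients,
  where \<open>e\<^sub>A\<close> is the product of the generators in \<open>A\<close> in increasing order. The Euclidean norm of
  the vector type is the norm \<open>(\<Sum>\<^sub>A a\<^sub>A\<^sup>2)\<^sup>1\<^sup>/\<^sup>2\<close>.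
\<close>

type_synonym 'n clifford = "(real, 'n set) vec"

definition blade :: "'n::{finite,linorder} set \<Rightarrow> 'n clifford" where
  "blade A = axis A 1"

abbreviation cl_one :: "'n::{finite,linorder} clifford" where
  "cl_one \<equiv> blade {}"

abbreviation gen :: "'n::{finite,linorder} \<Rightarrow> 'n clifford" where
  "gen i \<equiv> blade {i}"

text \<open>
  \<open>e\<^sub>A e\<^sub>B = \<plusminus> e\<^sub>C\<close> with \<open>C\<close> the symmetric difference. Sorting contributes a factor \<open>-1\<close> for every
  pair \<open>b < a\<close>, and every common generator contributes \<open>e\<^sub>i\<^sup>2 = -1\<close>.
\<close>

definition blade_sign :: "'n::{finite,linorder} set \<Rightarrow> 'n set \<Rightarrow> real" where
  "blade_sign A B = (-1) ^ card {(a, b). a \<in> A \<and> b \<in> B \<and> b \<le> a}"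

definition cl_mult :: "'n::{finite,linorder} clifford \<Rightarrow> 'n clifford \<Rightarrow> 'n clifford"
    (infixl "\<odot>" 70) where
  "a \<odot> b = (\<Sum>A\<in>UNIV. \<Sum>B\<in>UNIV. (a $ A * b $ B * blade_sign A B) *\<^sub>R blade (sym_diff A B))"

lemma cl_mult_blade: "blade A \<odot> blade B = blade_sign A B *\<^sub>R blade (sym_diff A B)"
proof -
  have "blade A \<odot> blade B = (\<Sum>A'\<in>UNIV. \<Sum>B'\<in>UNIV. if A' = A \<and> B' = B
      then blade_sign A B *\<^sub>R blade (sym_diff A B) else 0)"
    unfolding cl_mult_def by (intro sum.cong) (auto simp: blade_def axis_def)
  also have "\<dots> = (\<Sum>A'\<in>UNIV. if A' = A then blade_sign A B *\<^sub>R blade (sym_diff A B) else 0)"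
    by (intro sum.cong) auto
  finally show ?thesis by simp
qed

lemma gen_relations:
  fixes i j :: "'n::{finite,linorder}"
  shows "gen i \<odot> gen j + gen j \<odot> gen i = (if i = j then - 2 else 0) *\<^sub>R cl_one"
proof -
  have *: "{(a, b). a \<in> {i} \<and> b \<in> {j} \<and> b \<le> a} = (if j \<le> i then {(i, j)} else {})" for i j :: 'n
    by auto
  have s: "blade_sign {i} {j} = (if j \<le> i then -1 else 1)" for i j :: 'n
    unfolding blade_sign_def * by simp
  show ?thesis
  proof (cases "i = j")
    case True
    then show ?thesis by (simp add: cl_mult_blade s vec_eq_iff)
  next
    case False
    have "sym_diff {i} {j} = {i, j}" "sym_diff {j} {i} = {i, j}" using False by auto
    then have "gen i \<odot> gen j = blade_sign {i} {j} *\<^sub>R blade {i, j}"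
        "gen j \<odot> gen i = blade_sign {j} {i} *\<^sub>R blade {i, j}"
      by (simp_all only: cl_mult_blade)
    with False show ?thesis by (auto simp: s)
  qed
qed

lemma bilinear_cl_mult: "bilinear (\<odot>)"
proof -
  have "(a + b) \<odot> c = a \<odot> c + b \<odot> c" "c \<odot> (a + b) = c \<odot> a + c \<odot> b" for a b c :: "'a clifford"
    unfolding cl_mult_def sum.distrib[symmetric] scaleR_add_left[symmetric]
    by (simp_all add: distrib_left distrib_right)
  moreover have "(k *\<^sub>R a) \<odot> c = k *\<^sub>R (a \<odot> c)" "c \<odot> (k *\<^sub>R a) = k *\<^sub>R (c \<odot> a)"
    for a c :: "'a clifford" and k
    unfolding cl_mult_def scaleR_sum_right scaleR_scaleR by (simp_all add: mult_ac)
  ultimately show ?thesis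
    by (simp add: bilinear_def linear_iff)
qed

lemma clifford_expansion: "a = (\<Sum>A\<in>UNIV. (a $ A) *\<^sub>R blade A)"
  by (simp add: vec_eq_iff blade_def axis_def if_distrib cong: if_cong)

lemma blade_sign_prod:
  "blade_sign A B = (\<Prod>a\<in>A. \<Prod>b\<in>B. if b \<le> a then - 1 else 1)"
proof -
  have "{(a, b). a \<in> A \<and> b \<in> B \<and> b \<le> a} = {x \<in> A \<times> B. snd x \<le> fst x}" by auto
  then have "blade_sign A B = (\<Prod>x\<in>A \<times> B. if snd x \<le> fst x then - 1 else 1)"
    by (simp add: blade_sign_def prod.If_cases Int_def)
  then show ?thesis by (simp add: prod.cartesian_product case_prod_beta)
qed

lemma prod_sym_diff:
  fixes h :: "'b::finite \<Rightarrow> real"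
  assumes "\<And>x. h x * h x = 1"
  shows "prod h (sym_diff A B) = prod h A * prod h B"
proof -
  have 1: "prod h (sym_diff A B) = prod h (A - B) * prod h (B - A)"
    by (rule prod.union_disjoint) auto
  have 2: "prod h A = prod h (A - B) * prod h (A \<inter> B)"
    by (subst prod.Int_Diff[of A h B]) simp_all
  have 3: "prod h B = prod h (B - A) * prod h (A \<inter> B)"
    by (subst prod.Int_Diff[of B h A]) (simp_all add: Int_commute)
  have "prod h (A \<inter> B) * prod h (A \<inter> B) = 1"
    by (simp add: prod.distrib[symmetric] assms)
  then show ?thesis unfolding 1 2 3 by (simp add: algebra_simps)
qed

lemma blade_sign_sym_diff_left:
  "blade_sign (sym_diff A B) C = blade_sign A C * blade_sign B C"
  unfolding blade_sign_prod
  by (rule prod_sym_diff) (simp add: prod.distrib[symmetric] if_distrib cong: if_cong)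

lemma blade_sign_sym_diff_right:
  "blade_sign A (sym_diff B C) = blade_sign A B * blade_sign A C"
proof -
  have "(\<Prod>b\<in>sym_diff B C. if b \<le> a then - 1 else 1 :: real)
      = (\<Prod>b\<in>B. if b \<le> a then - 1 else 1) * (\<Prod>b\<in>C. if b \<le> a then - 1 else 1)" for a
    by (rule prod_sym_diff) simp
  then show ?thesis unfolding blade_sign_prod by (simp add: prod.distrib)
qed

lemma linear_eq_on_blades:
  assumes "linear f" "linear g" "\<And>A. f (blade A) = g (blade A)"
  shows "f a = g a"
proof -
  have *: "h a = (\<Sum>A\<in>UNIV. (a $ A) *\<^sub>R h (blade A))" if "linear h" for h :: "'a clifford \<Rightarrow> 'b"
    using that by (subst clifford_expansion[of a]) (simp add: linear_sum linear_scale)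
  show ?thesis
    unfolding *[OF assms(1)] *[OF assms(2)] assms(3) ..
qed

lemma cl_mult_assoc: "(a \<odot> b) \<odot> c = a \<odot> (b \<odot> c)"
proof -
  note bil = bilinear_cl_mult[unfolded bilinear_def linear_iff, rule_format]
  have 1: "(blade A \<odot> blade B) \<odot> blade C = blade A \<odot> (blade B \<odot> blade C)" for A B C :: "'a set"
  proof -
    have *: "sym_diff (sym_diff A B) C = sym_diff A (sym_diff B C)" by blast
    have "(blade A \<odot> blade B) \<odot> blade C
        = (blade_sign A B * blade_sign (sym_diff A B) C) *\<^sub>R blade (sym_diff (sym_diff A B) C)"
      by (simp only: cl_mult_blade bil scaleR_scaleR)
    also have "\<dots> = (blade_sign B C * blade_sign A (sym_diff B C)) *\<^sub>R blade (sym_diff A (sym_diff B C))"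
      by (simp only: * blade_sign_sym_diff_left blade_sign_sym_diff_right mult_ac)
    also have "\<dots> = blade A \<odot> (blade B \<odot> blade C)"
      by (simp only: cl_mult_blade bil scaleR_scaleR)
    finally show ?thesis .
  qed
  have 2: "(blade A \<odot> blade B) \<odot> c = blade A \<odot> (blade B \<odot> c)" for A B :: "'a set" and c
    by (rule linear_eq_on_blades) (simp_all only: linear_iff bil 1 simp_thms)
  have 3: "(blade A \<odot> b) \<odot> c = blade A \<odot> (b \<odot> c)" for A :: "'a set" and b c
    by (rule linear_eq_on_blades[where a = b]) (simp_all only: linear_iff bil 2 simp_thms)
  show ?thesis
    by (rule linear_eq_on_blades[where a = a]) (simp_all only: linear_iff bil 3 simp_thms)
qed

lemma cl_one_mult: "cl_one \<odot> a = a" and mult_cl_one: "a \<odot> cl_one = a"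
proof -
  note bil = bilinear_cl_mult[unfolded bilinear_def linear_iff, rule_format]
  have "cl_one \<odot> blade A = blade A" "blade A \<odot> cl_one = blade A" for A :: "'a set"
    by (simp_all add: cl_mult_blade) (simp_all add: blade_sign_def)
  note this [simp]
  show "cl_one \<odot> a = a"
    by (rule linear_eq_on_blades[where a = a]) (simp_all add: linear_iff bil)
  show "a \<odot> cl_one = a"
    by (rule linear_eq_on_blades[where a = a]) (simp_all add: linear_iff bil)
qed


section \<open>Paravectors and slices\<close>

text \<open>The position \<open>1, \<dots>, n\<close> of a generator.\<close>

definition idx :: "'n::{finite,linorder} \<Rightarrow> nat" where
  "idx i = card {j. j \<le> i}"

definition paravectors :: "'n::{finite,linorder} clifford set" where
  "paravectors = span (insert cl_one (range gen))"

definition Rp1 :: "nat \<Rightarrow> 'n::{finite,linorder} clifford set" where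
  "Rp1 p = span (insert cl_one (gen ` {i. idx i \<le> p}))"

definition Rq :: "nat \<Rightarrow> 'n::{finite,linorder} clifford set" where
  "Rq p = span (gen ` {i. p < idx i})"

definition p_part :: "nat \<Rightarrow> 'n::{finite,linorder} clifford \<Rightarrow> 'n clifford" where
  "p_part p x = (x $ {}) *\<^sub>R cl_one + (\<Sum>i | idx i \<le> p. (x $ {i}) *\<^sub>R gen i)"

definition q_part :: "nat \<Rightarrow> 'n::{finite,linorder} clifford \<Rightarrow> 'n clifford" where
  "q_part p x = (\<Sum>i | p < idx i. (x $ {i}) *\<^sub>R gen i)"

definition unit_sphere :: "nat \<Rightarrow> 'n::{finite,linorder} clifford set" where
  "unit_sphere p = {w \<in> Rq p. w \<odot> w = - cl_one}"

definition q_dir :: "nat \<Rightarrow> 'n::{finite,linorder} clifford \<Rightarrow> 'n clifford" where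
  "q_dir p x = (if q_part p x \<noteq> 0 then q_part p x /\<^sub>R norm (q_part p x)
                else (SOME w. w \<in> unit_sphere p))"

text \<open>The Clifford conjugate, for paravectors only.\<close>

definition para_conj :: "'n::{finite,linorder} clifford \<Rightarrow> 'n clifford" where
  "para_conj x = (x $ {}) *\<^sub>R cl_one - (\<Sum>i\<in>UNIV. (x $ {i}) *\<^sub>R gen i)"

definition domain_in :: "'a::topological_space set \<Rightarrow> 'a set \<Rightarrow> bool" where
  "domain_in X W \<longleftrightarrow> W \<noteq> {} \<and> openin (top_of_set X) W \<and> connected W"

definition p_symmetric :: "nat \<Rightarrow> 'n::{finite,linorder} clifford set \<Rightarrow> bool" where
  "p_symmetric p W \<longleftrightarrow> (\<forall>xp\<in>Rp1 p. \<forall>r>0. \<forall>w\<in>unit_sphere p.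
     xp + r *\<^sub>R w \<in> W \<longrightarrow> (\<lambda>w'. xp + r *\<^sub>R w') ` unit_sphere p \<subseteq> W)"

text \<open>The space \<open>\<real>\<^sup>p\<^sup>+\<^sup>1 \<oplus> \<eta> \<real>\<close>, the section of a set by it, and the boundary of the section
  relative to that space.\<close>

definition slice_space :: "nat \<Rightarrow> 'n::{finite,linorder} clifford \<Rightarrow> 'n clifford set" where
  "slice_space p \<eta> = {xp + r *\<^sub>R \<eta> | xp r. xp \<in> Rp1 p}"

definition slice :: "nat \<Rightarrow> 'n::{finite,linorder} clifford \<Rightarrow> 'n clifford set \<Rightarrow> 'n clifford set" where
  "slice p \<eta> W = W \<inter> slice_space p \<eta>"

definition slice_boundary ::
    "nat \<Rightarrow> 'n::{finite,linorder} clifford \<Rightarrow> 'n clifford set \<Rightarrow> 'n clifford set" where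
  "slice_boundary p \<eta> W = (top_of_set (slice_space p \<eta>)) frontier_of (slice p \<eta> W)"


section \<open>Generalized partial-slice functions\<close>

text \<open>
  A point \<open>(x\<^sub>p, r)\<close> of \<open>\<real>\<^sup>p\<^sup>+\<^sup>2\<close> is a pair with first component in \<open>Rp1 p\<close>, and an element
  \<open>a + i b\<close> of the complexified Clifford algebra is the pair \<open>(a, b)\<close>.
\<close>

definition reflection_invariant :: "('a \<times> real) set \<Rightarrow> bool" where
  "reflection_invariant D \<longleftrightarrow> (\<forall>(xp, r)\<in>D. (xp, - r) \<in> D)"

definition sym_completion ::
    "nat \<Rightarrow> ('n::{finite,linorder} clifford \<times> real) set \<Rightarrow> 'n clifford set" where
  "sym_completion p D = {xp + r *\<^sub>R w | xp r w. w \<in> unit_sphere p \<and> 0 \<le> r \<and> (xp, r) \<in> D}"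

definition stem_function ::
    "('n::{finite,linorder} clifford \<times> real) set
     \<Rightarrow> ('n clifford \<times> real \<Rightarrow> 'n clifford \<times> 'n clifford) \<Rightarrow> bool" where
  "stem_function D F \<longleftrightarrow> (\<forall>(xp, r)\<in>D.
     fst (F (xp, - r)) = fst (F (xp, r)) \<and> snd (F (xp, - r)) = - snd (F (xp, r)))"

definition induced ::
    "nat \<Rightarrow> ('n::{finite,linorder} clifford \<times> real \<Rightarrow> 'n clifford \<times> 'n clifford)
     \<Rightarrow> 'n clifford \<Rightarrow> 'n clifford" where
  "induced p F x = fst (F (p_part p x, norm (q_part p x)))
                 + q_dir p x \<odot> snd (F (p_part p x, norm (q_part p x)))"

definition hoelder_continuous_on ::
    "'a::metric_space set \<Rightarrow> ('a \<Rightarrow> 'b::metric_space) \<Rightarrow> bool" where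
  "hoelder_continuous_on D F \<longleftrightarrow> (\<exists>\<alpha> C. 0 < \<alpha> \<and> \<alpha> \<le> 1 \<and>
     (\<forall>x\<in>D. \<forall>y\<in>D. dist (F x) (F y) \<le> C * dist x y powr \<alpha>))"


section \<open>Cauchy kernels\<close>

definition sphere_area :: "nat \<Rightarrow> real" where
  "sphere_area p = 2 * Gamma (1/2) ^ (p + 2) / Gamma (real (p + 2) / 2)"

definition cauchy_kernel :: "nat \<Rightarrow> 'n::{finite,linorder} clifford \<Rightarrow> 'n clifford" where
  "cauchy_kernel p x = (1 / sphere_area p / norm x ^ (p + 2)) *\<^sub>R para_conj x"

definition slice_kernel ::
    "nat \<Rightarrow> 'n::{finite,linorder} clifford \<Rightarrow> 'n clifford \<Rightarrow> 'n clifford \<Rightarrow> 'n clifford" where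
  "slice_kernel p \<eta> y x =
     (let xp = p_part p x; r = norm (q_part p x); w = q_dir p x in
        (1/2) *\<^sub>R (cl_one - w \<odot> \<eta>) \<odot> cauchy_kernel p (y - (xp + r *\<^sub>R \<eta>))
      + (1/2) *\<^sub>R (cl_one + w \<odot> \<eta>) \<odot> cauchy_kernel p (y - (xp - r *\<^sub>R \<eta>)))"


section \<open>Regular boundary points and the exterior normal\<close>

text \<open>
  Here \<open>L\<close> is a linear subspace and \<open>W\<close> an open subset of \<open>L\<close>. On the neighbourhood \<open>V\<close>,
  \<open>\<phi>\<close> is a \<open>C\<^sup>1\<close> function with nowhere vanishing gradient \<open>g\<close> (taken in \<open>L\<close>), \<open>W\<close> is
  the side \<open>\<phi> < 0\<close>, and the boundary of \<open>W\<close> is the hypersurface \<open>\<phi> = 0\<close>.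
\<close>

definition boundary_chart ::
    "'a::euclidean_space set \<Rightarrow> 'a set \<Rightarrow> 'a set \<Rightarrow> ('a \<Rightarrow> real) \<Rightarrow> ('a \<Rightarrow> 'a) \<Rightarrow> bool" where
  "boundary_chart L W V \<phi> g \<longleftrightarrow>
     openin (top_of_set L) V \<and> continuous_on V g \<and>
     (\<forall>y\<in>V. g y \<in> L \<and> g y \<noteq> 0 \<and> (\<phi> has_derivative (\<lambda>h. g y \<bullet> h)) (at y within L)) \<and>
     W \<inter> V = {y \<in> V. \<phi> y < 0} \<and>
     (top_of_set L) frontier_of W \<inter> V = {y \<in> V. \<phi> y = 0}"

definition regular_point :: "'a::euclidean_space set \<Rightarrow> 'a set \<Rightarrow> 'a \<Rightarrow> bool" where
  "regular_point L W x \<longleftrightarrow>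
     x \<in> (top_of_set L) frontier_of W \<and> (\<exists>V \<phi> g. x \<in> V \<and> boundary_chart L W V \<phi> g)"

text \<open>At a regular point the normal does not depend on the chart; elsewhere it is set to \<open>0\<close>.\<close>

definition exterior_normal :: "'a::euclidean_space set \<Rightarrow> 'a set \<Rightarrow> 'a \<Rightarrow> 'a" where
  "exterior_normal L W x =
     (if regular_point L W x
      then (THE \<nu>. \<exists>V \<phi> g. x \<in> V \<and> boundary_chart L W V \<phi> g \<and> \<nu> = g x /\<^sub>R norm (g x))
      else 0)"

definition nontangential_cone :: "'a::euclidean_space set \<Rightarrow> 'a \<Rightarrow> 'a \<Rightarrow> 'a set \<Rightarrow> bool" where
  "nontangential_cone L \<nu> x K \<longleftrightarrow>
     K \<subseteq> L \<and> (\<forall>t\<in>K. \<forall>s>0. x + s *\<^sub>R (t - x) \<in> K) \<and>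
     closure K \<inter> {y \<in> L. (y - x) \<bullet> \<nu> = 0} \<subseteq> {x}"

text \<open>The limit as \<open>t \<rightarrow> x\<close> in \<open>T\<close>, inside any cone that is non-tangential to the boundary of \<open>W\<close>.\<close>

definition has_nt_limit ::
    "'a::euclidean_space set \<Rightarrow> 'a set \<Rightarrow> 'a \<Rightarrow> 'a set \<Rightarrow> ('a \<Rightarrow> 'b::topological_space) \<Rightarrow> 'b \<Rightarrow> bool" where
  "has_nt_limit L W x T h l \<longleftrightarrow>
     (\<forall>K. nontangential_cone L (exterior_normal L W x) x K \<longrightarrow> (h \<longlongrightarrow> l) (at x within (T \<inter> K)))"


section \<open>Surface integrals\<close>

text \<open>The unnormalized \<open>s\<close>-dimensional Hausdorff outer measure, for \<open>s > 0\<close>.\<close>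

definition hausdorff_outer :: "nat \<Rightarrow> 'a::metric_space set \<Rightarrow> ennreal" where
  "hausdorff_outer s A =
     (SUP \<delta>\<in>{0::real<..}. INF C\<in>{C :: nat \<Rightarrow> 'a set. A \<subseteq> (\<Union>i. C i) \<and>
        (\<forall>i. bounded (C i) \<and> diameter (C i) \<le> \<delta>)}. \<Sum>i. ennreal (diameter (C i) ^ s))"

definition unit_cube :: "nat \<Rightarrow> 'n::{finite,linorder} clifford set" where
  "unit_cube p = {x \<in> Rp1 p. \<forall>A. 0 \<le> x $ A \<and> x $ A \<le> 1}"

text \<open>
  Surface measure on hypersurfaces of the \<open>(p + 2)\<close>-dimensional slices: the \<open>(p + 1)\<close>-dimensional
  Hausdorff measure, normalized so that the unit cube of \<open>\<real>\<^sup>p\<^sup>+\<^sup>1\<close> has area \<open>1\<close>. This is the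
  normalization for which it agrees with \<open>(p + 1)\<close>-dimensional Lebesgue measure on hyperplanes.
\<close>

definition surface_measure :: "nat \<Rightarrow> 'n::{finite,linorder} clifford measure" where
  "surface_measure p = measure_of UNIV (sets borel)
     (\<lambda>A. hausdorff_outer (p + 1) A / hausdorff_outer (p + 1) (unit_cube p :: 'n clifford set))"

definition has_principal_value ::
    "'a::metric_space measure \<Rightarrow> 'a set \<Rightarrow> 'a \<Rightarrow> ('a \<Rightarrow> 'b::{banach,second_countable_topology}) \<Rightarrow> 'b \<Rightarrow> bool"
  where
  "has_principal_value M B x h I \<longleftrightarrow>
     (\<forall>\<epsilon>>0. set_integrable M {y \<in> B. \<epsilon> < dist y x} h) \<and>
     ((\<lambda>\<epsilon>. LINT y:{y \<in> B. \<epsilon> < dist y x}|M. h y) \<longlongrightarrow> I) (at_right 0)"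

text \<open>\<open>\<E>\<^sub>y(t) n(y) f(y)\<close>, with \<open>n\<close> the exterior normal of the section of \<open>U\<close>.\<close>

definition cauchy_integrand ::
    "nat \<Rightarrow> 'n::{finite,linorder} clifford \<Rightarrow> 'n clifford set \<Rightarrow> ('n clifford \<Rightarrow> 'n clifford)
     \<Rightarrow> 'n clifford \<Rightarrow> 'n clifford \<Rightarrow> 'n clifford" where
  "cauchy_integrand p \<eta> U f t y =
     slice_kernel p \<eta> y t \<odot> exterior_normal (slice_space p \<eta>) (slice p \<eta> U) y \<odot> f y"

end

theory Submission
  imports Defs "HOL-Probability.Distributions"
begin

text \<open>
  On a slice the slice kernel is just the Cauchy kernel \<open>E\<close> of the slice, so the statement is the
  Plemelj jump formula for \<open>E\<close>. Near a regular point \<open>x\<close> the boundary is a \<open>C\<^sup>1\<close> graph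
  \<open>x + u + \<psi>(u) \<nu>\<close> over the tangent hyperplane; since Hausdorff measure is Haar measure on
  hyperplanes and is controlled by Lipschitz maps, the area formula turns the singular part of the
  integral into the Lebesgue integral of \<open>E(u + \<psi>(u) \<nu> - \<tau>) (\<nu> - d\<psi>(u)) f\<close> with \<open>\<tau> = t - x\<close>.
  Hoelder continuity disposes of \<open>f(y) - f(x)\<close>, so only the flux of \<open>E\<close> matters. Because \<open>E\<close> is
  divergence free, the flux through the graph of \<open>s \<psi>\<close>, cut off smoothly, changes with \<open>s\<close> only by a
  term supported where the cut-off varies, away from the singularity. At \<open>s = 0\<close> the flux through the
  hyperplane is explicit: it vanishes by oddness for \<open>\<tau> = 0\<close> and tends to half the total flux of
  \<open>E\<close>, with the sign of the side, for non-tangential \<open>\<tau> \<rightarrow> 0\<close>. Away from \<open>x\<close> the integrand is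
  dominated by its value at a fixed \<open>t\<^sub>0\<close>, because \<open>E\<close> is invertible.
\<close>

section \<open>Hausdorff measure\<close>

text \<open>The chart at \<open>x\<close> is only \<open>C^1\<close>, so the slope
  \<open>\<psi> u / norm u\<close> tends to 0 without a rate, while
  \<open>E(u + \<psi> u \<nu>) (\<nu> - d\<psi> u)\<close> has the critical order -m in
  \<open>norm u\<close>: its integral over the graph need not converge absolutely and cannot be
  compared with the hyperplane by size estimates. Deforming the graph to the hyperplane leaves a
  term with \<psi> times the gradient of the cut-off. This term is invariant under scaling, so at
  radius \<epsilon> it is as small as the slope there, rate or no rate; hence the principal value
  exists.

  The principal value of the flux (\<open>A0\<close>) is never computed. It enters the boundary
  integral and both non-tangential limits alike and drops out of the jump. The only flux evaluated
  is the Poisson integral over a hyperplane, half of \<open>sphere_area p\<close>: this is the 1/2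
  of the statement.

  The boundary far from \<open>x\<close> is uncontrolled: it may be unbounded or irregular, and the
  normal is set to 0 at irregular points. What is known there is the convergence of the integral for
  points off the boundary, which is why a base point \<open>t0\<close> in the section of
  \<open>U\<close> is carried along.\<close>

lemma metric_outer_measure_borel:
  fixes O' :: "'a::metric_space set \<Rightarrow> ennreal"
  assumes zero: "O' {} = 0"
    and mono: "\<And>A B. A \<subseteq> B \<Longrightarrow> O' A \<le> O' B"
    and csub: "\<And>A :: nat \<Rightarrow> 'a set. O' (\<Union>i. A i) \<le> (\<Sum>i. O' (A i))"
    and metric: "\<And>A B d. 0 < d \<Longrightarrow> (\<And>x y. x \<in> A \<Longrightarrow> y \<in> B \<Longrightarrow> d \<le> dist x y) \<Longrightarrow> O' A + O' B \<le> O' (A \<union> B)"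
  shows "measure_space UNIV (sets borel) O'"
proof -
  have sub: "O' (A \<union> B) \<le> O' A + O' B" for A B
  proof -
    define S :: "nat \<Rightarrow> 'a set" where "S i = (if i = 0 then A else if i = 1 then B else {})" for i
    have "O' (\<Union>i. S i) \<le> (\<Sum>i. O' (S i))"
      by (rule csub)
    also have "(\<Union>i. S i) = A \<union> B"
      by (auto simp: S_def split: if_splits)
    also have "(\<Sum>i. O' (S i)) = (\<Sum>i\<in>{0,1}. O' (S i))"
      by (rule suminf_finite) (auto simp: zero S_def)
    also have "\<dots> = O' A + O' B" by (simp add: S_def)
    finally show ?thesis by simp
  qed
  \<comment> \<open>Caratheodory's criterion. \<open>T - F\<close> is exhausted by the sets
    \<open>A n\<close> at distance at least \<open>1 / (n + 1)\<close> from \<open>F\<close>, for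
    which metric additivity applies. What is missing from \<open>A n\<close> is covered by the
    layers \<open>R k\<close> with \<open>k \<ge> n\<close>; layers of equal parity are separated
    from one another, so each of the two series sums to at most \<open>O' T\<close> and the tail
    tends to 0.\<close>
  have closed: "O' (T \<inter> F) + O' (T - F) \<le> O' T" if F: "closed F" "F \<noteq> {}" and fin: "O' T < \<infinity>" for F T
  proof -
    define A where "A n = {x \<in> T. 1 / real (n + 1) \<le> infdist x F}" for n
    define R where "R k = A (Suc k) - A k" for k
    have A_mono: "A n \<subseteq> A (Suc n)" for n
    proof
      fix x assume x: "x \<in> A n"
      have "1 / real (Suc n + 1) \<le> 1 / real (n + 1)" by (rule divide_left_mono) auto
      then show "x \<in> A (Suc n)" using x by (auto simp: A_def)
    qed
    have sep: "O' (\<Union>k<n. R (2 * k + i)) = (\<Sum>k<n. O' (R (2 * k + i)))" for n i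
    proof (induction n)
      case 0 then show ?case by (simp add: zero)
    next
      case (Suc n)
      have "O' (\<Union>k<Suc n. R (2 * k + i)) = O' ((\<Union>k<n. R (2 * k + i)) \<union> R (2 * n + i))"
        by (simp add: lessThan_Suc Un_commute)
      also have "\<dots> = O' (\<Union>k<n. R (2 * k + i)) + O' (R (2 * n + i))"
      proof (rule antisym[OF sub])
        let ?N = "2 * n + i"
        show "O' (\<Union>k<n. R (2 * k + i)) + O' (R ?N) \<le> O' ((\<Union>k<n. R (2 * k + i)) \<union> R ?N)"
        \<comment> \<open>Separation of layer \<open>?N\<close> from the earlier ones of the same
          parity: these lie in \<open>A (?N - 1)\<close>, where the distance to \<open>F\<close> is
          at least \<open>1 / ?N\<close>, while off \<open>A ?N\<close> it is below
          \<open>1 / (?N + 1)\<close>. For \<open>n = 0\<close> the union is empty and any positive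
          number serves.\<close>
        proof (rule metric[of "if n = 0 then 1 else 1 / real ?N - 1 / real (?N + 1)"])
          show "0 < (if n = 0 then 1 else 1 / real ?N - 1 / real (?N + 1))"
            by (auto intro!: divide_strict_left_mono)
          fix x y assume "x \<in> (\<Union>k<n. R (2 * k + i))" "y \<in> R ?N"
          then obtain k where k: "k < n" "x \<in> R (2 * k + i)" and y: "y \<in> T" "y \<notin> A ?N" by (auto simp: R_def A_def)
          from k have "1 / real (Suc (2 * k + i) + 1) \<le> infdist x F" by (auto simp: R_def A_def)
          moreover have "1 / real ?N \<le> 1 / real (Suc (2 * k + i) + 1)"
            using k by (intro divide_left_mono) auto
          moreover have "infdist y F < 1 / real (?N + 1)" using y by (auto simp: A_def)
          moreover have "infdist x F \<le> infdist y F + dist x y" by (rule infdist_triangle)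
          ultimately show "(if n = 0 then 1 else 1 / real ?N - 1 / real (?N + 1)) \<le> dist x y"
            using k by auto
        qed
      qed
      finally show ?case using Suc by simp
    qed
    have RT: "R k \<subseteq> T" for k by (auto simp: R_def A_def)
    have half: "(\<Sum>k. O' (R (2 * k + i))) \<le> O' T" for i
    proof (rule suminf_le_const)
      fix n show "(\<Sum>k<n. O' (R (2 * k + i))) \<le> O' T"
        unfolding sep[symmetric] using RT by (intro mono) blast
    qed simp
    have part: "(\<Sum>k<n. O' (R k)) \<le> O' T + O' T" for n
    proof -
      have "(\<Sum>k<2 * n. O' (R k)) = (\<Sum>k<n. O' (R (2 * k + 0))) + (\<Sum>k<n. O' (R (2 * k + 1)))"
        by (induction n) (simp_all add: algebra_simps)
      also have "\<dots> \<le> O' T + O' T"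
        by (intro add_mono order_trans[OF sum_le_suminf half]) auto
      finally have "(\<Sum>k<2 * n. O' (R k)) \<le> O' T + O' T" .
      moreover have "(\<Sum>k<n. O' (R k)) \<le> (\<Sum>k<2 * n. O' (R k))"
        by (rule sum_mono2) auto
      ultimately show ?thesis by (rule order_trans[rotated])
    qed
    have finS: "(\<Sum>k. O' (R k)) < \<infinity>"
      using suminf_le_const[OF _ part] fin by (auto simp: less_top[symmetric] top_unique)
    have decomp: "O' (T - F) \<le> O' (A n) + (\<Sum>k. O' (R (k + n)))" for n
    proof -
      have "T - F \<subseteq> A n \<union> (\<Union>k. R (k + n))"
      proof
        fix x assume x: "x \<in> T - F"
        then have pos: "0 < infdist x F" using infdist_pos_not_in_closed F by auto
        then obtain N where N: "1 / real (N + 1) \<le> infdist x F"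
          by (metis nat_approx_posE less_imp_le Suc_eq_plus1)
        with x have *: "\<exists>N. x \<in> A N" by (auto simp: A_def)
        define N0 where "N0 = (LEAST N. x \<in> A N)"
        have N0: "x \<in> A N0" and least: "\<And>j. j < N0 \<Longrightarrow> x \<notin> A j"
          unfolding N0_def using LeastI_ex[OF *] not_less_Least by auto
        show "x \<in> A n \<union> (\<Union>k. R (k + n))"
        proof (cases "N0 \<le> n")
          case True
          then have "A N0 \<subseteq> A n" using A_mono by (rule lift_Suc_mono_le[rotated])
          with N0 show ?thesis by auto
        next
          case False
          then obtain k where k: "N0 = Suc (k + n)" using less_imp_Suc_add[of n N0] by (auto simp: add.commute)
          then have "x \<in> R (k + n)" using N0 least[of "k + n"] by (auto simp: R_def)
          then show ?thesis by blast
        qed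
      qed
      then have "O' (T - F) \<le> O' (A n \<union> (\<Union>k. R (k + n)))" by (rule mono)
      also have "\<dots> \<le> O' (A n) + O' (\<Union>k. R (k + n))" by (rule sub)
      also have "\<dots> \<le> O' (A n) + (\<Sum>k. O' (R (k + n)))" by (intro add_left_mono csub)
      finally show ?thesis .
    qed
    have sepA: "O' (T \<inter> F) + O' (A n) \<le> O' T" for n
    proof -
      have "O' (A n) + O' (T \<inter> F) \<le> O' (A n \<union> (T \<inter> F))"
      proof (rule metric[of "1 / real (n + 1)"])
        fix x y assume "x \<in> A n" "y \<in> T \<inter> F"
        then show "1 / real (n + 1) \<le> dist x y"
          using infdist_le[of y F x] by (auto simp: A_def)
      qed auto
      also have "\<dots> \<le> O' T" by (rule mono) (auto simp: A_def)
      finally show ?thesis by (simp add: add.commute)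
    qed
    have tail: "(\<lambda>n. \<Sum>k. O' (R (k + n))) \<longlonglongrightarrow> 0"
    proof -
      have eq: "(\<Sum>k. O' (R (k + n))) = (\<Sum>k. O' (R k)) - (\<Sum>k<n. O' (R k))" for n
      proof -
        have "(\<Sum>k. O' (R k)) = (\<Sum>k. O' (R (k + n))) + (\<Sum>k<n. O' (R k))"
          by (rule suminf_offset) simp
        moreover have "(\<Sum>k<n. O' (R k)) < top"
          using fin by (intro le_less_trans[OF part]) (simp add: ennreal_add_less_top)
        then have "(\<Sum>k<n. O' (R k)) \<noteq> top" by (rule less_imp_neq)
        ultimately show ?thesis by simp
      qed
      have "(\<lambda>n. (\<Sum>k. O' (R k)) - (\<Sum>k<n. O' (R k))) \<longlonglongrightarrow> (\<Sum>k. O' (R k)) - (\<Sum>k. O' (R k))"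
        using finS by (intro tendsto_diff_ennreal summable_LIMSEQ tendsto_const) auto
      then show ?thesis unfolding eq using finS by (simp add: less_top[symmetric])
    qed
    have "O' (T \<inter> F) + O' (T - F) \<le> O' T + (\<Sum>k. O' (R (k + n)))" for n
    proof -
      have "O' (T \<inter> F) + O' (T - F) \<le> O' (T \<inter> F) + (O' (A n) + (\<Sum>k. O' (R (k + n))))"
        by (intro add_left_mono decomp)
      also have "\<dots> \<le> O' T + (\<Sum>k. O' (R (k + n)))"
        unfolding add.assoc[symmetric] by (intro add_right_mono sepA)
      finally show ?thesis .
    qed
    moreover have "(\<lambda>n. O' T + (\<Sum>k. O' (R (k + n)))) \<longlonglongrightarrow> O' T + 0"
      by (intro tendsto_add tendsto_const tail)
    ultimately show ?thesis by (auto intro: LIMSEQ_le_const)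
  qed
  interpret sigma_algebra UNIV "UNIV :: 'a set set" by (metis Pow_UNIV sigma_algebra_Pow)
  let ?L = "lambda_system UNIV UNIV O'"
  have oms: "outer_measure_space UNIV O'"
    unfolding outer_measure_space_def positive_def increasing_def countably_subadditive_def
    using zero mono csub by auto
  have ms: "measure_space UNIV ?L O'" by (rule caratheodory_lemma[OF oms])
  have cl: "F \<in> ?L" if F: "closed F" for F
    unfolding lambda_system_eq
  proof safe
    fix T :: "'a set"
    show "O' (T \<inter> F) + O' (T - F) = O' T"
    proof (rule antisym)
      show "O' (T \<inter> F) + O' (T - F) \<le> O' T"
        using closed[OF F, of T] zero by (cases "F = {}"; cases "O' T = \<infinity>") (auto simp: less_top)
      show "O' T \<le> O' (T \<inter> F) + O' (T - F)"
        using sub[of "T \<inter> F" "T - F"] by (simp add: Un_Diff_Int Int_Diff_Un)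
    qed
  qed auto
  have sa: "sigma_algebra UNIV ?L" using ms by (simp add: measure_space_def)
  have sub_L: "sets borel \<subseteq> ?L"
    unfolding borel_eq_closed
    using sigma_algebra.sigma_sets_subset[OF sa, of "Collect closed"] cl by auto
  show ?thesis
    unfolding measure_space_def
    using sub_L ms sets.sigma_algebra_axioms[of "borel :: 'a measure"]
    by (auto simp: measure_space_def positive_def countably_additive_def subset_iff)
qed

section \<open>Hausdorff measure at a fixed scale\<close>

definition hausdorff_pre :: "nat \<Rightarrow> real \<Rightarrow> 'a::metric_space set \<Rightarrow> ennreal" where
  "hausdorff_pre s \<delta> A = (INF C\<in>{C :: nat \<Rightarrow> 'a set. A \<subseteq> (\<Union>i. C i) \<and>
        (\<forall>i. bounded (C i) \<and> diameter (C i) \<le> \<delta>)}. \<Sum>i. ennreal (diameter (C i) ^ s))"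

lemma hausdorff_outer_eq_SUP_pre: "hausdorff_outer s A = (SUP \<delta>\<in>{0<..}. hausdorff_pre s \<delta> A)"
  by (simp add: hausdorff_outer_def hausdorff_pre_def)

lemma hausdorff_pre_le:
  assumes "A \<subseteq> (\<Union>i. C i)" "\<And>i::nat. bounded (C i)" "\<And>i. diameter (C i) \<le> \<delta>"
  shows "hausdorff_pre s \<delta> A \<le> (\<Sum>i. ennreal (diameter (C i) ^ s))"
  unfolding hausdorff_pre_def using assms by (intro INF_lower) auto

lemma hausdorff_pre_greatest:
  assumes "\<And>C. A \<subseteq> (\<Union>i. C i) \<Longrightarrow> (\<And>i::nat. bounded (C i)) \<Longrightarrow> (\<And>i. diameter (C i) \<le> \<delta>)
             \<Longrightarrow> x \<le> (\<Sum>i. ennreal (diameter (C i) ^ s))"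
  shows "x \<le> hausdorff_pre s \<delta> A"
  unfolding hausdorff_pre_def using assms by (intro INF_greatest) auto

lemma hausdorff_pre_le_outer: "0 < \<delta> \<Longrightarrow> hausdorff_pre s \<delta> A \<le> hausdorff_outer s A"
  unfolding hausdorff_outer_eq_SUP_pre by (rule SUP_upper) auto

lemma hausdorff_outer_le:
  "(\<And>\<delta>. 0 < \<delta> \<Longrightarrow> hausdorff_pre s \<delta> A \<le> x) \<Longrightarrow> hausdorff_outer s A \<le> x"
  unfolding hausdorff_outer_eq_SUP_pre by (rule SUP_least) auto

lemma hausdorff_pre_mono: "A \<subseteq> B \<Longrightarrow> hausdorff_pre s \<delta> A \<le> hausdorff_pre s \<delta> B"
  by (rule hausdorff_pre_greatest, rule hausdorff_pre_le) auto

lemma hausdorff_pre_antimono: "\<delta> \<le> \<delta>' \<Longrightarrow> hausdorff_pre s \<delta>' A \<le> hausdorff_pre s \<delta> A"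
  by (rule hausdorff_pre_greatest, rule hausdorff_pre_le) (auto intro: order_trans)

lemma hausdorff_outer_mono: "A \<subseteq> B \<Longrightarrow> hausdorff_outer s A \<le> hausdorff_outer s B"
  by (rule hausdorff_outer_le)
    (metis hausdorff_pre_le_outer hausdorff_pre_mono order_trans)

lemma hausdorff_outer_empty: "1 \<le> s \<Longrightarrow> hausdorff_outer s {} = 0"
proof -
  assume s: "1 \<le> s"
  have "hausdorff_outer s ({} :: 'a set) \<le> 0"
  proof (rule hausdorff_outer_le)
    fix \<delta> :: real assume "0 < \<delta>"
    then have "hausdorff_pre s \<delta> ({} :: 'a set) \<le> (\<Sum>i::nat. ennreal (diameter ({} :: 'a set) ^ s))"
      by (intro hausdorff_pre_le) auto
    then show "hausdorff_pre s \<delta> ({} :: 'a set) \<le> 0" using s by (simp add: power_0_left)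
  qed
  then show ?thesis by simp
qed

text \<open>Covers that are optimal up to \<open>e * (1/2) ^ Suc n\<close> are merged into one
  sequence along \<open>prod_decode\<close>; the errors add up to \<open>e\<close>.\<close>

lemma hausdorff_pre_countable_subadditive:
  fixes A :: "nat \<Rightarrow> 'a::metric_space set"
  shows "hausdorff_pre s \<delta> (\<Union>n. A n) \<le> (\<Sum>n. hausdorff_pre s \<delta> (A n))"
proof (rule ennreal_le_epsilon)
  fix e :: real assume e: "0 < e" and fin: "(\<Sum>n. hausdorff_pre s \<delta> (A n)) < top"
  let ?D = "\<lambda>C. ennreal (diameter C ^ s)"
  have "\<exists>C. A n \<subseteq> (\<Union>i::nat. C i) \<and> (\<forall>i. bounded (C i) \<and> diameter (C i) \<le> \<delta>) \<and>
      (\<Sum>i. ?D (C i)) < hausdorff_pre s \<delta> (A n) + ennreal (e * (1/2) ^ Suc n)" for n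
  proof -
    have "hausdorff_pre s \<delta> (A n) < hausdorff_pre s \<delta> (A n) + ennreal (e * (1/2) ^ Suc n)"
      using fin e by (auto simp: less_top dest!: ennreal_suminf_lessD)
    then show ?thesis
      unfolding hausdorff_pre_def[of s \<delta> "A n", THEN eq_reflection] INF_less_iff by auto
  qed
  then obtain C where C: "\<And>n. A n \<subseteq> (\<Union>i::nat. C n i)" "\<And>n i. bounded (C n i)" "\<And>n i. diameter (C n i) \<le> \<delta>"
      and le: "\<And>n. (\<Sum>i. ?D (C n i)) < hausdorff_pre s \<delta> (A n) + ennreal (e * (1/2) ^ Suc n)"
    by metis
  let ?E = "\<lambda>k. case_prod C (prod_decode k)"
  have "(\<Union>n. A n) \<subseteq> (\<Union>k. ?E k)"
  proof
    fix x assume "x \<in> (\<Union>n. A n)"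
    then obtain n i where "x \<in> C n i" using C(1) by blast
    then have "x \<in> ?E (prod_encode (n, i))" by simp
    then show "x \<in> (\<Union>k. ?E k)" by (rule UN_I[OF UNIV_I])
  qed
  then have "hausdorff_pre s \<delta> (\<Union>n. A n) \<le> (\<Sum>k. ?D (?E k))"
    using C by (intro hausdorff_pre_le) (simp_all add: split_beta)
  also have "\<dots> = (\<Sum>n. \<Sum>i. ?D (C n i))"
    using suminf_ennreal_2dimen[of "\<lambda>n. \<Sum>i. ?D (C n i)" "\<lambda>(n, i). ?D (C n i)"]
    by (simp add: o_def split_beta)
  also have "\<dots> \<le> (\<Sum>n. hausdorff_pre s \<delta> (A n) + ennreal (e * (1/2) ^ Suc n))"
    using le by (intro suminf_le) (auto intro: less_imp_le)
  also have "\<dots> = (\<Sum>n. hausdorff_pre s \<delta> (A n)) + (\<Sum>n. ennreal e * ennreal ((1/2) ^ Suc n))"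
    using e by (subst suminf_add[symmetric])
      (auto simp del: ennreal_suminf_cmult simp add: ennreal_mult[symmetric])
  also have "\<dots> = (\<Sum>n. hausdorff_pre s \<delta> (A n)) + e"
    unfolding ennreal_suminf_cmult
    by (subst suminf_ennreal_eq[OF zero_le_power power_half_series]) auto
  finally show "hausdorff_pre s \<delta> (\<Union>n. A n) \<le> (\<Sum>n. hausdorff_pre s \<delta> (A n)) + e" .
qed

lemma hausdorff_outer_countable_subadditive:
  fixes A :: "nat \<Rightarrow> 'a::metric_space set"
  shows "hausdorff_outer s (\<Union>n. A n) \<le> (\<Sum>n. hausdorff_outer s (A n))"
  by (rule hausdorff_outer_le, rule order_trans[OF hausdorff_pre_countable_subadditive])
    (auto intro!: suminf_le hausdorff_pre_le_outer)

text \<open>A covering set of diameter below the separation \<open>d\<close> cannot meet both sets,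
  so every cover of the union splits into a cover of each. The sets dropped from either half are
  replaced by \<open>{}\<close>, which costs nothing because \<open>0 ^ s = 0\<close> for
  \<open>s \<ge> 1\<close>.\<close>

lemma hausdorff_pre_metric:
  assumes s: "1 \<le> s" and sep: "\<And>x y. x \<in> A \<Longrightarrow> y \<in> B \<Longrightarrow> d \<le> dist x y" and "0 \<le> \<delta>" "\<delta> < d"
  shows "hausdorff_pre s \<delta> A + hausdorff_pre s \<delta> B \<le> hausdorff_pre s \<delta> (A \<union> B)"
proof (rule hausdorff_pre_greatest)
  fix C :: "nat \<Rightarrow> 'a set"
  assume C: "A \<union> B \<subseteq> (\<Union>i. C i)" "\<And>i. bounded (C i)" "\<And>i. diameter (C i) \<le> \<delta>"
  let ?D = "\<lambda>C. ennreal (diameter C ^ s)"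
  let ?A = "\<lambda>i. if C i \<inter> A = {} then {} else C i" and ?B = "\<lambda>i. if C i \<inter> B = {} then {} else C i"
  have disj: "C i \<inter> A = {} \<or> C i \<inter> B = {}" for i
  proof (rule ccontr)
    assume "\<not> ?thesis"
    then obtain x y where "x \<in> C i" "x \<in> A" "y \<in> C i" "y \<in> B" by auto
    with diameter_bounded_bound[OF C(2), of x i y] C(3)[of i] sep[of x y] \<open>\<delta> < d\<close> show False by simp
  qed
  have "hausdorff_pre s \<delta> A \<le> (\<Sum>i. ?D (?A i))"
  proof (rule hausdorff_pre_le)
    show "A \<subseteq> (\<Union>i. ?A i)"
    proof
      fix x assume x: "x \<in> A"
      then obtain i where "x \<in> C i" using C(1) by blast
      with x have "x \<in> ?A i" by auto
      then show "x \<in> (\<Union>i. ?A i)" by blast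
    qed
  qed (use C \<open>0 \<le> \<delta>\<close> in auto)
  moreover have "hausdorff_pre s \<delta> B \<le> (\<Sum>i. ?D (?B i))"
  proof (rule hausdorff_pre_le)
    show "B \<subseteq> (\<Union>i. ?B i)"
    proof
      fix x assume x: "x \<in> B"
      then obtain i where "x \<in> C i" using C(1) by blast
      with x have "x \<in> ?B i" by auto
      then show "x \<in> (\<Union>i. ?B i)" by blast
    qed
  qed (use C \<open>0 \<le> \<delta>\<close> in auto)
  ultimately have "hausdorff_pre s \<delta> A + hausdorff_pre s \<delta> B \<le> (\<Sum>i. ?D (?A i)) + (\<Sum>i. ?D (?B i))"
    by (rule add_mono)
  also have "\<dots> = (\<Sum>i. ?D (?A i) + ?D (?B i))" by (rule suminf_add) auto
  also have "\<dots> \<le> (\<Sum>i. ?D (C i))"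
  proof (rule suminf_le)
    fix i show "?D (?A i) + ?D (?B i) \<le> ?D (C i)" using disj[of i] s by (auto simp: power_0_left)
  qed auto
  finally show "hausdorff_pre s \<delta> A + hausdorff_pre s \<delta> B \<le> (\<Sum>i. ?D (C i))" .
qed

lemma hausdorff_outer_metric:
  assumes "1 \<le> s" "0 < d" and sep: "\<And>x y. x \<in> A \<Longrightarrow> y \<in> B \<Longrightarrow> d \<le> dist x y"
  shows "hausdorff_outer s A + hausdorff_outer s B \<le> hausdorff_outer s (A \<union> B)"
proof -
  have *: "hausdorff_pre s \<delta> A + hausdorff_pre s \<epsilon> B \<le> hausdorff_outer s (A \<union> B)" if "0 < \<delta>" "0 < \<epsilon>" for \<delta> \<epsilon>
  proof -
    \<comment> \<open>One scale below both given ones and below the separation; the two suprema are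
      then taken one after the other, which is why \<open>*\<close> has independent scales.\<close>
    define r where "r = min (d/2) (min \<delta> \<epsilon>)"
    have "hausdorff_pre s \<delta> A + hausdorff_pre s \<epsilon> B \<le> hausdorff_pre s r A + hausdorff_pre s r B"
      by (intro add_mono hausdorff_pre_antimono) (auto simp: r_def)
    also have "\<dots> \<le> hausdorff_pre s r (A \<union> B)"
      using that assms(1,2) by (intro hausdorff_pre_metric[OF _ sep]) (auto simp: r_def)
    also have "\<dots> \<le> hausdorff_outer s (A \<union> B)"
      using that assms by (intro hausdorff_pre_le_outer) (auto simp: r_def)
    finally show ?thesis .
  qed
  have ne: "{0<..} \<noteq> ({} :: real set)" by (metis greaterThan_non_empty)
  have **: "hausdorff_pre s \<delta> A + hausdorff_outer s B \<le> hausdorff_outer s (A \<union> B)" if "0 < \<delta>" for \<delta>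
    unfolding hausdorff_outer_eq_SUP_pre[of s B]
    unfolding ennreal_SUP_add_right[OF ne]
    using * that by (auto intro!: SUP_least)
  show ?thesis
    unfolding hausdorff_outer_eq_SUP_pre[of s A]
    unfolding ennreal_SUP_add_left[OF ne, symmetric]
    using ** by (auto intro!: SUP_least)
qed

lemma hausdorff_measure_space:
  assumes "1 \<le> s"
  shows "measure_space UNIV (sets borel) (hausdorff_outer s :: 'a::metric_space set \<Rightarrow> ennreal)"
proof (rule metric_outer_measure_borel)
  fix A B :: "'a set" and d :: real
  assume "0 < d" "\<And>x y. x \<in> A \<Longrightarrow> y \<in> B \<Longrightarrow> d \<le> dist x y"
  then show "hausdorff_outer s A + hausdorff_outer s B \<le> hausdorff_outer s (A \<union> B)"
    by (rule hausdorff_outer_metric[OF assms])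
qed (use assms in \<open>simp_all add: hausdorff_outer_empty hausdorff_outer_mono hausdorff_outer_countable_subadditive\<close>)

lemma bounded_diameter_le:
  assumes "0 \<le> d" "\<And>x y. x \<in> S \<Longrightarrow> y \<in> S \<Longrightarrow> dist x y \<le> d"
  shows "bounded S" "diameter S \<le> d"
proof -
  show "bounded S" using assms by (auto simp: bounded_two_points)
  show "diameter S \<le> d" using assms by (auto simp: diameter_def intro!: cSUP_least)
qed

text \<open>A cover of \<open>A\<close> at scale \<open>\<delta> / K\<close> is carried to a cover
  of the image at scale \<delta>. The sets are cut down to \<open>A\<close> first, as the Lipschitz
  bound says nothing about the rest of \<open>C i\<close>.\<close>

lemma hausdorff_outer_Lipschitz:
  assumes K: "0 < K" and lip: "\<And>x y. x \<in> A \<Longrightarrow> y \<in> A \<Longrightarrow> dist (f x) (f y) \<le> K * dist x y"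
  shows "hausdorff_outer s (f ` A) \<le> ennreal (K ^ s) * hausdorff_outer s A"
proof (rule hausdorff_outer_le)
  fix \<delta> :: real assume \<delta>: "0 < \<delta>"
  \<comment> \<open>The constant sits on the left so that the bound has the form required for an
    infimum over covers of \<open>A\<close>.\<close>
  have "hausdorff_pre s \<delta> (f ` A) * ennreal (1 / K ^ s) \<le> hausdorff_pre s (\<delta> / K) A"
  proof (rule hausdorff_pre_greatest)
    fix C :: "nat \<Rightarrow> 'a set"
    assume C: "A \<subseteq> (\<Union>i. C i)" "\<And>i. bounded (C i)" "\<And>i. diameter (C i) \<le> \<delta> / K"
    have d0: "0 \<le> diameter (C i)" for i using C(2) by (rule diameter_ge_0)
    have d: "dist x y \<le> K * diameter (C i)" if "x \<in> f ` (C i \<inter> A)" "y \<in> f ` (C i \<inter> A)" for x y i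
    proof -
      from that obtain u v where uv: "u \<in> C i" "u \<in> A" "v \<in> C i" "v \<in> A" "x = f u" "y = f v" by auto
      then have "dist x y \<le> K * dist u v" using lip by simp
      also have "\<dots> \<le> K * diameter (C i)"
        using K uv diameter_bounded_bound[OF C(2)] by (intro mult_left_mono) auto
      finally show ?thesis .
    qed
    have "0 \<le> K * diameter (C i)" for i using K d0 by simp
    note b = bounded_diameter_le[OF this d]
    have bd: "bounded (f ` (C i \<inter> A))" "diameter (f ` (C i \<inter> A)) \<le> K * diameter (C i)" for i
      using b[of "f ` (C i \<inter> A)" i] by blast+
    have "hausdorff_pre s \<delta> (f ` A) \<le> (\<Sum>i. ennreal (diameter (f ` (C i \<inter> A)) ^ s))"
    proof (rule hausdorff_pre_le)
      show "f ` A \<subseteq> (\<Union>i. f ` (C i \<inter> A))" using C(1) by blast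
      show "diameter (f ` (C i \<inter> A)) \<le> \<delta>" for i
        using bd(2)[of i] C(3)[of i] K by (simp add: field_simps)
    qed (rule bd)
    also have "\<dots> \<le> (\<Sum>i. ennreal (K ^ s) * ennreal (diameter (C i) ^ s))"
    proof (rule suminf_le)
      fix i
      have "diameter (f ` (C i \<inter> A)) ^ s \<le> (K * diameter (C i)) ^ s"
        by (rule power_mono[OF bd(2) diameter_ge_0[OF bd(1)]])
      then show "ennreal (diameter (f ` (C i \<inter> A)) ^ s) \<le> ennreal (K ^ s) * ennreal (diameter (C i) ^ s)"
        using K d0 by (subst ennreal_mult[symmetric]) (auto simp: power_mult_distrib ennreal_leI)
    qed auto
    also have "\<dots> = ennreal (K ^ s) * (\<Sum>i. ennreal (diameter (C i) ^ s))" by simp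
    finally have "hausdorff_pre s \<delta> (f ` A) * ennreal (1 / K ^ s)
        \<le> ennreal (K ^ s) * (\<Sum>i. ennreal (diameter (C i) ^ s)) * ennreal (1 / K ^ s)"
      by (rule mult_right_mono) simp
    also have "\<dots> = ennreal (K ^ s) * ennreal (1 / K ^ s) * (\<Sum>i. ennreal (diameter (C i) ^ s))"
      by (simp only: mult_ac)
    also have "ennreal (K ^ s) * ennreal (1 / K ^ s) = 1"
      using K by (subst ennreal_mult[symmetric]) auto
    finally show "hausdorff_pre s \<delta> (f ` A) * ennreal (1 / K ^ s) \<le> (\<Sum>i. ennreal (diameter (C i) ^ s))"
      by simp
  qed
  also have "\<dots> \<le> hausdorff_outer s A" using \<delta> K by (intro hausdorff_pre_le_outer) simp
  finally have "ennreal (K ^ s) * (hausdorff_pre s \<delta> (f ` A) * ennreal (1 / K ^ s)) \<le> ennreal (K ^ s) * hausdorff_outer s A"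
    by (rule mult_left_mono) simp
  also have "ennreal (K ^ s) * (hausdorff_pre s \<delta> (f ` A) * ennreal (1 / K ^ s))
      = ennreal (K ^ s) * ennreal (1 / K ^ s) * hausdorff_pre s \<delta> (f ` A)"
    by (simp only: mult_ac)
  also have "ennreal (K ^ s) * ennreal (1 / K ^ s) = 1"
    using K by (subst ennreal_mult[symmetric]) auto
  finally show "hausdorff_pre s \<delta> (f ` A) \<le> ennreal (K ^ s) * hausdorff_outer s A" by simp
qed

section \<open>Lebesgue measure on a subspace\<close>

lemma nn_integral_gaussian:
  assumes "0 < c"
  shows "(\<integral>\<^sup>+x. ennreal (exp (- c * x\<^sup>2)) \<partial>lborel) = ennreal (sqrt (pi / c))"
proof -
  define s where "s = sqrt (1 / (2 * c))"
  have s: "0 < s" "2 * s\<^sup>2 = 1 / c" using assms by (auto simp: s_def)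
  have nd: "normal_density 0 s x = (1 / sqrt (pi / c)) * exp (- c * x\<^sup>2)" for x
  proof -
    have "2 * pi * s\<^sup>2 = pi / c" using s(2) assms by (simp add: field_simps)
    moreover have "x\<^sup>2 / (2 * s\<^sup>2) = c * x\<^sup>2" unfolding s(2) by simp
    ultimately show ?thesis unfolding normal_density_def by simp
  qed
  interpret prob_space "density lborel (\<lambda>x. ennreal (normal_density 0 s x))"
    by (rule prob_space_normal_density[OF s(1)])
  have "1 = (\<integral>\<^sup>+x. ennreal (normal_density 0 s x) \<partial>lborel)"
    using emeasure_space_1 by (simp add: emeasure_density)
  also have "\<dots> = (\<integral>\<^sup>+x. ennreal (1 / sqrt (pi / c)) * ennreal (exp (- c * x\<^sup>2)) \<partial>lborel)"
    unfolding nd using assms by (subst ennreal_mult[symmetric]) (auto intro!: divide_nonneg_nonneg)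
  also have "\<dots> = ennreal (1 / sqrt (pi / c)) * (\<integral>\<^sup>+x. ennreal (exp (- c * x\<^sup>2)) \<partial>lborel)"
    by (rule nn_integral_cmult) simp
  finally have "ennreal (sqrt (pi / c)) * 1
      = ennreal (sqrt (pi / c)) * (ennreal (1 / sqrt (pi / c)) * (\<integral>\<^sup>+x. ennreal (exp (- c * x\<^sup>2)) \<partial>lborel))"
    by simp
  also have "\<dots> = ennreal (sqrt (pi / c)) * ennreal (1 / sqrt (pi / c)) * (\<integral>\<^sup>+x. ennreal (exp (- c * x\<^sup>2)) \<partial>lborel)"
    by (simp only: mult.assoc)
  also have "ennreal (sqrt (pi / c)) * ennreal (1 / sqrt (pi / c)) = 1"
    using assms by (subst ennreal_mult[symmetric]) (auto intro!: divide_nonneg_nonneg)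
  finally show ?thesis by simp
qed

text \<open>For orthonormal \<open>B\<close> this is Lebesgue measure of \<open>span B\<close>, kept
  as a Borel measure on the whole space that is carried by the span. In this form it can be compared
  directly with Hausdorff measure, and sets need not be intersected with the span.\<close>

definition flat_measure :: "'a::euclidean_space set \<Rightarrow> 'a measure" where
  "flat_measure B = distr (Pi\<^sub>M B (\<lambda>_. lborel)) borel (\<lambda>g. \<Sum>b\<in>B. g b *\<^sub>R b)"

definition span_cube :: "'a::euclidean_space set \<Rightarrow> 'a set" where
  "span_cube B = {u \<in> span B. \<forall>b\<in>B. 0 \<le> u \<bullet> b \<and> u \<bullet> b \<le> 1}"

locale orthonormal_set =
  fixes B :: "'a::euclidean_space set"
  assumes finite_B: "finite B"
    and inner_B: "\<And>b c. b \<in> B \<Longrightarrow> c \<in> B \<Longrightarrow> b \<bullet> c = (if b = c then 1 else 0)"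
begin

lemma inner_comb: "c \<in> B \<Longrightarrow> (\<Sum>b\<in>B. g b *\<^sub>R b) \<bullet> c = g c"
  using finite_B by (simp add: inner_sum_left inner_B if_distrib cong: if_cong)

lemma comb_in_span: "(\<Sum>b\<in>B. g b *\<^sub>R b) \<in> span B"
  by (intro span_sum span_scale span_base)

lemma expand: "u \<in> span B \<Longrightarrow> (\<Sum>b\<in>B. (u \<bullet> b) *\<^sub>R b) = u"
proof -
  assume "u \<in> span B"
  then obtain g where "u = (\<Sum>b\<in>B. g b *\<^sub>R b)" using span_finite[OF finite_B] by auto
  then show ?thesis by (simp add: inner_comb cong: sum.cong)
qed

lemma norm_le_sum: "u \<in> span B \<Longrightarrow> norm u \<le> (\<Sum>b\<in>B. \<bar>u \<bullet> b\<bar>)"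
proof -
  assume "u \<in> span B"
  have "norm b = 1" if "b \<in> B" for b using inner_B[OF that that] by (simp add: norm_eq_sqrt_inner)
  then have "(\<Sum>b\<in>B. norm ((u \<bullet> b) *\<^sub>R b)) = (\<Sum>b\<in>B. \<bar>u \<bullet> b\<bar>)" by (intro sum.cong) auto
  moreover have "norm (\<Sum>b\<in>B. (u \<bullet> b) *\<^sub>R b) \<le> (\<Sum>b\<in>B. norm ((u \<bullet> b) *\<^sub>R b))" by (rule norm_sum)
  ultimately show ?thesis using expand[OF \<open>u \<in> span B\<close>] by simp
qed

lemma norm_B: "b \<in> B \<Longrightarrow> norm b = 1"
  using inner_B[of b b] by (simp add: norm_eq_sqrt_inner)

lemma inner_le_norm: "b \<in> B \<Longrightarrow> \<bar>u \<bullet> b\<bar> \<le> norm u"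
  using Cauchy_Schwarz_ineq2[of u b] by (simp add: norm_B)

lemma inner_self_sum: "u \<in> span B \<Longrightarrow> u \<bullet> u = (\<Sum>b\<in>B. (u \<bullet> b)\<^sup>2)"
proof -
  assume u: "u \<in> span B"
  have "u \<bullet> u = (\<Sum>b\<in>B. (u \<bullet> b) *\<^sub>R b) \<bullet> u" using expand[OF u] by simp
  also have "\<dots> = (\<Sum>b\<in>B. (u \<bullet> b)\<^sup>2)"
    unfolding inner_sum_left inner_scaleR_left power2_eq_square by (simp add: inner_commute)
  finally show ?thesis .
qed

lemma sets_flat [simp, measurable_cong]: "sets (flat_measure B) = sets borel"
  and space_flat [simp]: "space (flat_measure B) = UNIV"
  by (simp_all add: flat_measure_def)

lemma nn_integral_flat:
  "f \<in> borel_measurable borel \<Longrightarrow>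
    (\<integral>\<^sup>+u. f u \<partial>flat_measure B) = (\<integral>\<^sup>+g. f (\<Sum>b\<in>B. g b *\<^sub>R b) \<partial>Pi\<^sub>M B (\<lambda>_. lborel))"
  unfolding flat_measure_def by (rule nn_integral_distr) auto

sublocale product_sigma_finite "\<lambda>_::'a. lborel :: real measure"
  ..

sublocale finite_product_sigma_finite "\<lambda>_::'a. lborel :: real measure" B
  by standard (rule finite_B)

lemma sets_span_B [measurable]: "span B \<in> sets borel" by (simp add: borel_closed)

lemma AE_flat: "AE u in flat_measure B. u \<in> span B"
  unfolding flat_measure_def by (subst AE_distr_iff) (auto simp: comb_in_span)

lemma nn_integral_prod_flat:
  fixes f :: "'a \<Rightarrow> real \<Rightarrow> ennreal"
  assumes [measurable]: "\<And>b. f b \<in> borel_measurable borel"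
  shows "(\<integral>\<^sup>+u. (\<Prod>b\<in>B. f b (u \<bullet> b)) \<partial>flat_measure B) = (\<Prod>b\<in>B. \<integral>\<^sup>+x. f b x \<partial>lborel)"
proof -
  have "(\<integral>\<^sup>+u. (\<Prod>b\<in>B. f b (u \<bullet> b)) \<partial>flat_measure B)
      = (\<integral>\<^sup>+g. (\<Prod>b\<in>B. f b (g b)) \<partial>Pi\<^sub>M B (\<lambda>_. lborel))"
    by (subst nn_integral_flat) (auto simp: inner_comb intro!: nn_integral_cong prod.cong)
  also have "\<dots> = (\<Prod>b\<in>B. \<integral>\<^sup>+x. f b x \<partial>lborel)"
    by (rule product_nn_integral_prod[OF finite_B]) simp
  finally show ?thesis .
qed

lemma emeasure_flat_box:
  assumes "0 \<le> l"
  shows "emeasure (flat_measure B) {u. \<forall>b\<in>B. c b \<le> u \<bullet> b \<and> u \<bullet> b \<le> c b + l} = ennreal (l ^ card B)"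
proof -
  let ?S = "{u. \<forall>b\<in>B. c b \<le> u \<bullet> b \<and> u \<bullet> b \<le> c b + l}"
  have [measurable]: "?S \<in> sets borel"
    using finite_B by measurable
  have "emeasure (flat_measure B) ?S = (\<integral>\<^sup>+u. indicator ?S u \<partial>flat_measure B)"
    by simp
  also have "\<dots> = (\<integral>\<^sup>+u. (\<Prod>b\<in>B. indicator {c b..c b + l} (u \<bullet> b)) \<partial>flat_measure B)"
  proof (rule nn_integral_cong)
    fix u show "indicator ?S u = (\<Prod>b\<in>B. indicator {c b..c b + l} (u \<bullet> b) :: ennreal)"
      using finite_B by (auto simp: indicator_def prod_zero_iff)
  qed
  also have "\<dots> = (\<Prod>b\<in>B. ennreal l)"
    using assms by (subst nn_integral_prod_flat) auto
  finally show ?thesis using assms by (simp add: ennreal_power)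
qed

text \<open>A translation by \<open>h\<close> acts on the coordinates as a shift by
  \<open>h \<bullet> b\<close> in each factor, so invariance reduces to that of
  \<open>lborel\<close> on boxes.\<close>

lemma distr_flat_translation:
  assumes h: "h \<in> span B"
  shows "distr (flat_measure B) borel (\<lambda>u. u + h) = flat_measure B"
proof -
  let ?P = "Pi\<^sub>M B (\<lambda>_. lborel :: real measure)"
  let ?s = "\<lambda>g. \<lambda>b\<in>B. g b + h \<bullet> b"
  have ms [measurable]: "?s \<in> ?P \<rightarrow>\<^sub>M ?P"
    by measurable
  have "distr ?P ?P ?s = ?P"
  proof (rule PiM_eqI)
    fix A :: "'a \<Rightarrow> real set" assume A: "\<And>i. i \<in> B \<Longrightarrow> A i \<in> sets lborel"
    have "emeasure (distr ?P ?P ?s) (Pi\<^sub>E B A) = emeasure ?P (?s -` Pi\<^sub>E B A \<inter> space ?P)"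
      using A by (intro emeasure_distr ms sets_PiM_I_finite finite_B) auto
    also have "?s -` Pi\<^sub>E B A \<inter> space ?P = Pi\<^sub>E B (\<lambda>b. (\<lambda>x. x + h \<bullet> b) -` A b)"
      by (auto simp: space_PiM PiE_def Pi_def)
    also have "emeasure ?P \<dots> = (\<Prod>b\<in>B. emeasure lborel ((\<lambda>x. x + h \<bullet> b) -` A b))"
    proof (rule emeasure_PiM[OF finite_B])
      fix i assume "i \<in> B"
      then have [measurable]: "A i \<in> sets borel" using A by auto
      have "(\<lambda>x. x + h \<bullet> i) -` A i \<inter> space borel \<in> sets borel" by measurable
      then show "(\<lambda>x. x + h \<bullet> i) -` A i \<in> sets lborel" by simp
    qed
    also have "\<dots> = (\<Prod>b\<in>B. emeasure lborel (A b))"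
    proof (rule prod.cong[OF refl])
      fix b assume "b \<in> B"
      then have [measurable]: "A b \<in> sets borel" using A by auto
      have "emeasure lborel (A b) = emeasure (distr lborel borel ((+) (h \<bullet> b))) (A b)"
        by (simp add: lborel_distr_plus)
      also have "\<dots> = emeasure lborel ((\<lambda>x. x + h \<bullet> b) -` A b)"
        by (subst emeasure_distr) (simp_all add: add.commute vimage_def)
      finally show "emeasure lborel ((\<lambda>x. x + h \<bullet> b) -` A b) = emeasure lborel (A b)" by simp
    qed
    finally show "emeasure (distr ?P ?P ?s) (Pi\<^sub>E B A) = (\<Prod>i\<in>B. emeasure lborel (A i))" .
  qed (auto simp: finite_B)
  then have "flat_measure B = distr (distr ?P ?P ?s) borel (\<lambda>g. \<Sum>b\<in>B. g b *\<^sub>R b)"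
    unfolding flat_measure_def by simp
  also have "\<dots> = distr ?P borel ((\<lambda>g. \<Sum>b\<in>B. g b *\<^sub>R b) \<circ> ?s)"
    by (rule distr_distr) measurable
  also have "(\<lambda>g. \<Sum>b\<in>B. g b *\<^sub>R b) \<circ> ?s = (\<lambda>u. u + h) \<circ> (\<lambda>g. \<Sum>b\<in>B. g b *\<^sub>R b)"
  proof
    fix g :: "'a \<Rightarrow> real"
    show "((\<lambda>g. \<Sum>b\<in>B. g b *\<^sub>R b) \<circ> ?s) g = ((\<lambda>u. u + h) \<circ> (\<lambda>g. \<Sum>b\<in>B. g b *\<^sub>R b)) g"
      using expand[OF h] by (simp add: scaleR_left_distrib sum.distrib)
  qed
  also have "distr ?P borel \<dots> = distr (flat_measure B) borel (\<lambda>u. u + h)"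
    unfolding flat_measure_def by (rule distr_distr[symmetric]) measurable
  finally show ?thesis ..
qed

text \<open>The upper bound keeps the unsimplified form \<open>- real n + 2 * real n\<close> to
  match the pattern \<open>c b + l\<close> of \<open>emeasure_flat_box\<close>.\<close>

lemma span_UN_boxes: "UNIV = (\<Union>n::nat. {u. \<forall>b\<in>B. - real n \<le> u \<bullet> b \<and> u \<bullet> b \<le> - real n + 2 * real n})"
proof -
  have "\<exists>n::nat. \<forall>b\<in>B. - real n \<le> u \<bullet> b \<and> u \<bullet> b \<le> - real n + 2 * real n" for u
  proof -
    obtain n :: nat where "norm u \<le> real n" using real_arch_simple by blast
    then show ?thesis using inner_le_norm[of _ u] by (intro exI[of _ n] ballI) (smt (verit))
  qed
  then show ?thesis by blast
qed

lemma sigma_finite_flat: "sigma_finite_measure (flat_measure B)"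
proof
  let ?A = "\<lambda>n::nat. {u. \<forall>b\<in>B. - real n \<le> u \<bullet> b \<and> u \<bullet> b \<le> - real n + 2 * real n}"
  have "?A n \<in> sets borel" for n
    using finite_B by measurable
  moreover have "emeasure (flat_measure B) (?A n) \<noteq> \<infinity>" for n
    using emeasure_flat_box[of "2 * real n" "\<lambda>_. - real n"] by simp
  ultimately show "\<exists>A. countable A \<and> A \<subseteq> sets (flat_measure B) \<and> \<Union> A = space (flat_measure B) \<and> (\<forall>a\<in>A. emeasure (flat_measure B) a \<noteq> \<infinity>)"
    using span_UN_boxes by (intro exI[of _ "range ?A"]) auto
qed

lemma sets_span_cube [measurable]: "span_cube B \<in> sets borel"
proof -
  have "span_cube B = span B \<inter> {u. \<forall>b\<in>B. 0 \<le> u \<bullet> b \<and> u \<bullet> b \<le> 1}" by (auto simp: span_cube_def)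
  moreover have "{u. \<forall>b\<in>B. 0 \<le> u \<bullet> b \<and> u \<bullet> b \<le> 1} \<in> sets borel" using finite_B by measurable
  ultimately show ?thesis by (simp add: sets.Int)
qed

lemma emeasure_flat_Int_span: "A \<in> sets borel \<Longrightarrow> emeasure (flat_measure B) (A \<inter> span B) = emeasure (flat_measure B) A"
  using AE_flat by (intro emeasure_eq_AE) (auto)

lemma emeasure_flat_span_cube: "emeasure (flat_measure B) (span_cube B) = 1"
proof -
  let ?S = "{u. \<forall>b\<in>B. 0 \<le> u \<bullet> b \<and> u \<bullet> b \<le> 0 + 1}"
  have "?S \<in> sets borel" using finite_B by measurable
  then have "emeasure (flat_measure B) (?S \<inter> span B) = emeasure (flat_measure B) ?S"
    by (rule emeasure_flat_Int_span)
  also have "\<dots> = 1" using emeasure_flat_box[of 1 "\<lambda>_. 0"] by simp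
  also have "?S \<inter> span B = span_cube B" by (auto simp: span_cube_def)
  finally show ?thesis .
qed

text \<open>Uniqueness of Haar measure: evaluate
  \<open>\<integral>\<integral> 1\<^sub>A(x) 1\<^sub>Q(y - x)\<close> in both orders, using the invariance of each measure once.\<close>

lemma translation_invariant_eq_flat:
  assumes sets_\<mu> [measurable_cong]: "sets \<mu> = sets borel" and sf: "sigma_finite_measure \<mu>"
    and AE_\<mu>: "AE u in \<mu>. u \<in> span B"
    and inv: "\<And>h. h \<in> span B \<Longrightarrow> distr \<mu> borel (\<lambda>u. u + h) = \<mu>"
    and A [measurable]: "A \<in> sets borel"
  shows "emeasure \<mu> A = emeasure \<mu> (span_cube B) * emeasure (flat_measure B) A"
proof -
  let ?L = "flat_measure B"
  interpret \<mu>: sigma_finite_measure \<mu> by (rule sf)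
  interpret L: sigma_finite_measure ?L by (rule sigma_finite_flat)
  interpret pair_sigma_finite \<mu> ?L ..
  have shift: "(\<integral>\<^sup>+u. f (u + h) \<partial>N) = (\<integral>\<^sup>+u. f u \<partial>N)"
    if "distr N borel (\<lambda>u. u + h) = N" "sets N = sets borel" "f \<in> borel_measurable borel" for N f and h :: 'a
  proof -
    have "(\<integral>\<^sup>+u. f u \<partial>N) = (\<integral>\<^sup>+u. f u \<partial>distr N borel (\<lambda>u. u + h))" by (simp add: that(1))
    also have "\<dots> = (\<integral>\<^sup>+u. f (u + h) \<partial>N)"
      using that(2,3) by (intro nn_integral_distr) (auto simp: measurable_cong_sets[OF that(2) refl])
    finally show ?thesis ..
  qed
  have main: "emeasure \<mu> A * emeasure ?L Q = emeasure ?L A * emeasure \<mu> (uminus -` Q)"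
    if [measurable]: "A \<in> sets borel" "Q \<in> sets borel" for A Q :: "'a set"
  proof -
    have mQ: "uminus -` Q \<in> sets borel"
    proof -
      have "uminus -` Q \<inter> space borel \<in> sets (borel :: 'a measure)" by measurable
      then show ?thesis by simp
    qed
    have "emeasure \<mu> A * emeasure ?L Q = (\<integral>\<^sup>+x. indicator A x * emeasure ?L Q \<partial>\<mu>)"
      by (subst nn_integral_multc) (auto simp: sets_\<mu>)
    also have "\<dots> = (\<integral>\<^sup>+x. (\<integral>\<^sup>+y. indicator A x * indicator Q (y - x) \<partial>?L) \<partial>\<mu>)"
    proof (rule nn_integral_cong_AE)
      show "AE x in \<mu>. indicator A x * emeasure ?L Q = (\<integral>\<^sup>+y. indicator A x * indicator Q (y - x) \<partial>?L)"
        using AE_\<mu>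
      proof eventually_elim
        case (elim x)
        have "(\<integral>\<^sup>+y. indicator Q (y - x) \<partial>?L) = emeasure ?L Q"
          using shift[of ?L "- x" "indicator Q"] distr_flat_translation[of "- x"] elim
          by (simp add: span_neg)
        moreover have "(\<lambda>y. indicator Q (y - x) :: ennreal) \<in> borel_measurable ?L" by measurable
        ultimately show ?case by (simp add: nn_integral_cmult)
      qed
    qed
    also have "\<dots> = (\<integral>\<^sup>+y. (\<integral>\<^sup>+x. indicator A x * indicator Q (y - x) \<partial>\<mu>) \<partial>?L)"
      by (rule Fubini'[symmetric]) measurable
    also have "\<dots> = (\<integral>\<^sup>+y. (\<integral>\<^sup>+x. indicator A (x + y) * indicator Q (- x) \<partial>\<mu>) \<partial>?L)"
    proof (rule nn_integral_cong_AE)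
      show "AE y in ?L. (\<integral>\<^sup>+x. indicator A x * indicator Q (y - x) \<partial>\<mu>)
          = (\<integral>\<^sup>+x. indicator A (x + y) * indicator Q (- x) \<partial>\<mu>)"
        using AE_flat
      proof eventually_elim
        case (elim y)
        show ?case
          using shift[OF inv[OF elim] sets_\<mu>, of "\<lambda>x. indicator A x * indicator Q (y - x)"] by simp
      qed
    qed
    also have "\<dots> = (\<integral>\<^sup>+x. (\<integral>\<^sup>+y. indicator A (x + y) * indicator Q (- x) \<partial>?L) \<partial>\<mu>)"
      by (rule Fubini') measurable
    also have "\<dots> = (\<integral>\<^sup>+x. emeasure ?L A * indicator (uminus -` Q) x \<partial>\<mu>)"
    proof (rule nn_integral_cong_AE)
      show "AE x in \<mu>. (\<integral>\<^sup>+y. indicator A (x + y) * indicator Q (- x) \<partial>?L) = emeasure ?L A * indicator (uminus -` Q) x"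
        using AE_\<mu>
      proof eventually_elim
        case (elim x)
        have "(\<integral>\<^sup>+y. indicator A (x + y) \<partial>?L) = emeasure ?L A"
          using shift[of ?L x "indicator A"] distr_flat_translation[OF elim]
          by (simp add: add.commute)
        then show ?case by (subst nn_integral_multc) (measurable, simp add: indicator_def)
      qed
    qed
    also have "\<dots> = emeasure ?L A * emeasure \<mu> (uminus -` Q)"
      using mQ by (subst nn_integral_cmult) (auto simp: sets_\<mu>)
    finally show ?thesis .
  qed
  \<comment> \<open>\<open>main\<close> is used twice with \<open>Q\<close> the cube: for
    \<open>A\<close> itself, and for \<open>A\<close> the cube, which shows that \<mu> gives the
    reflected cube the same mass as the cube.\<close>
  have "emeasure \<mu> A * 1 = emeasure ?L A * emeasure \<mu> (uminus -` span_cube B)"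
    using main[OF A sets_span_cube] by (simp add: emeasure_flat_span_cube)
  moreover have "emeasure \<mu> (span_cube B) * 1 = 1 * emeasure \<mu> (uminus -` span_cube B)"
    using main[OF sets_span_cube sets_span_cube] by (simp add: emeasure_flat_span_cube)
  ultimately show ?thesis by (simp add: mult.commute)
qed

lemma nn_integral_gaussian_flat:
  assumes "\<And>b. b \<in> B \<Longrightarrow> 0 < c b"
  shows "(\<integral>\<^sup>+u. ennreal (exp (- (\<Sum>b\<in>B. c b * (u \<bullet> b)\<^sup>2))) \<partial>flat_measure B) = (\<Prod>b\<in>B. ennreal (sqrt (pi / c b)))"
proof -
  have "(\<integral>\<^sup>+u. ennreal (exp (- (\<Sum>b\<in>B. c b * (u \<bullet> b)\<^sup>2))) \<partial>flat_measure B)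
      = (\<integral>\<^sup>+u. (\<Prod>b\<in>B. ennreal (exp (- c b * (u \<bullet> b)\<^sup>2))) \<partial>flat_measure B)"
    using finite_B by (simp add: sum_negf[symmetric] exp_sum prod_ennreal)
  also have "\<dots> = (\<Prod>b\<in>B. \<integral>\<^sup>+x. ennreal (exp (- c b * x\<^sup>2)) \<partial>lborel)"
    by (rule nn_integral_prod_flat) measurable
  also have "\<dots> = (\<Prod>b\<in>B. ennreal (sqrt (pi / c b)))"
    by (intro prod.cong refl nn_integral_gaussian assms)
  finally show ?thesis .
qed

end

section \<open>Hausdorff measure of subspaces\<close>

lemma hausdorff_pre_finite:
  assumes "finite I" "1 \<le> s" and C: "A \<subseteq> (\<Union>i\<in>I. C i)" "\<And>i. i \<in> I \<Longrightarrow> bounded (C i)"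
      "\<And>i. i \<in> I \<Longrightarrow> diameter (C i) \<le> \<delta>" "0 \<le> \<delta>"
  shows "hausdorff_pre s \<delta> A \<le> (\<Sum>i\<in>I. ennreal (diameter (C i) ^ s))"
proof -
  obtain h where h: "bij_betw h {..<card I} I"
    using ex_bij_betw_nat_finite[OF \<open>finite I\<close>] by (auto simp: atLeast0LessThan)
  define D where "D n = (if n < card I then C (h n) else {})" for n
  have hI: "h n \<in> I" if "n < card I" for n using h that by (auto simp: bij_betw_def)
  have "hausdorff_pre s \<delta> A \<le> (\<Sum>n. ennreal (diameter (D n) ^ s))"
  proof (rule hausdorff_pre_le)
    show "A \<subseteq> (\<Union>n. D n)"
    proof
      fix x assume "x \<in> A"
      then obtain i where i: "i \<in> I" "x \<in> C i" using C(1) by blast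
      then obtain n where "n < card I" "i = h n" using h by (auto simp: bij_betw_def)
      with i have "x \<in> D n" by (simp add: D_def)
      then show "x \<in> (\<Union>n. D n)" by blast
    qed
  qed (use C hI in \<open>auto simp: D_def\<close>)
  also have "\<dots> = (\<Sum>n<card I. ennreal (diameter (D n) ^ s))"
    using \<open>1 \<le> s\<close> by (intro suminf_finite) (auto simp: D_def power_0_left)
  also have "\<dots> = (\<Sum>n<card I. ennreal (diameter (C (h n)) ^ s))"
    by (simp add: D_def)
  also have "\<dots> = (\<Sum>i\<in>I. ennreal (diameter (C i) ^ s))"
    by (rule sum.reindex_bij_betw[OF h])
  finally show ?thesis .
qed

context orthonormal_set begin

text \<open>With \<open>m = card B\<close>, cutting the cube into \<open>N ^ m\<close> cubes of side
  \<open>1/N\<close>, each of diameter at most \<open>m/N\<close> by the crude coordinate-sum bound,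
  costs \<open>m ^ m\<close> for every \<open>N\<close>.\<close>

lemma hausdorff_span_cube_finite:
  assumes m: "1 \<le> card B"
  shows "hausdorff_outer (card B) (span_cube B) < \<infinity>"
proof -
  let ?m = "card B"
  have "hausdorff_outer ?m (span_cube B) \<le> ennreal (real ?m ^ ?m)"
  proof (rule hausdorff_outer_le)
    fix \<delta> :: real assume "0 < \<delta>"
    obtain N :: nat where N: "real ?m / \<delta> < real N" using reals_Archimedean2 by blast
    with \<open>0 < \<delta>\<close> m have N0: "0 < N" by (cases N) (auto simp: field_simps)
    have N\<delta>: "real ?m / real N \<le> \<delta>" using N N0 \<open>0 < \<delta>\<close> by (simp add: field_simps)
    define P where "P k = {u \<in> span B. \<forall>b\<in>B. real (k b) / real N \<le> u \<bullet> b \<and> u \<bullet> b \<le> (real (k b) + 1) / real N}"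
      for k :: "'a \<Rightarrow> nat"
    let ?I = "B \<rightarrow>\<^sub>E {..<N}"
    have dP: "dist x y \<le> real ?m / real N" if "x \<in> P k" "y \<in> P k" for x y k
    proof -
      have "norm (x - y) \<le> (\<Sum>b\<in>B. \<bar>(x - y) \<bullet> b\<bar>)"
        using that by (intro norm_le_sum span_diff) (auto simp: P_def)
      also have "\<dots> \<le> (\<Sum>b\<in>B. 1 / real N)"
      proof (rule sum_mono)
        fix b assume "b \<in> B"
        with that have "real (k b) / real N \<le> x \<bullet> b" "x \<bullet> b \<le> (real (k b) + 1) / real N"
           "real (k b) / real N \<le> y \<bullet> b" "y \<bullet> b \<le> (real (k b) + 1) / real N" by (auto simp: P_def)
        then show "\<bar>(x - y) \<bullet> b\<bar> \<le> 1 / real N"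
          by (simp add: inner_diff_left add_divide_distrib abs_le_iff)
      qed
      finally show ?thesis by (simp add: dist_norm)
    qed
    note bd = bounded_diameter_le[OF _ dP]
    have "hausdorff_pre ?m \<delta> (span_cube B) \<le> (\<Sum>k\<in>?I. ennreal (diameter (P k) ^ ?m))"
    proof (rule hausdorff_pre_finite)
      show "finite ?I" by (intro finite_PiE finite_B) auto
      show "span_cube B \<subseteq> (\<Union>k\<in>?I. P k)"
      proof
        fix u assume u: "u \<in> span_cube B"
        \<comment> \<open>The minimum puts a coordinate equal to 1, whose cell number would be
          \<open>N\<close>, into the last cell \<open>N - 1\<close>.\<close>
        define k where "k = (\<lambda>b\<in>B. min (N - 1) (nat \<lfloor>(u \<bullet> b) * real N\<rfloor>))"
        have "k \<in> ?I" using N0 by (auto simp: k_def)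
        moreover have "real (k b) / real N \<le> u \<bullet> b \<and> u \<bullet> b \<le> (real (k b) + 1) / real N" if b: "b \<in> B" for b
        proof -
          let ?t = "u \<bullet> b"
          have t: "0 \<le> ?t" "?t \<le> 1" using u b by (auto simp: span_cube_def)
          have f: "real (nat \<lfloor>?t * real N\<rfloor>) \<le> ?t * real N" "?t * real N \<le> real (nat \<lfloor>?t * real N\<rfloor>) + 1"
            using t by (auto intro!: mult_nonneg_nonneg)
          have "?t * real N \<le> real N" using t by (simp add: mult_left_le_one_le)
          with f have "real (min (N - 1) (nat \<lfloor>?t * real N\<rfloor>)) \<le> ?t * real N"
            "?t * real N \<le> real (min (N - 1) (nat \<lfloor>?t * real N\<rfloor>)) + 1"
            using N0 by (auto simp: min_def of_nat_diff)
          then show ?thesis using b N0 by (simp add: k_def field_simps)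
        qed
        ultimately have "u \<in> P k" "k \<in> ?I" using u by (auto simp: P_def span_cube_def)
        then show "u \<in> (\<Union>k\<in>?I. P k)" by blast
      qed
      show "bounded (P k)" for k by (rule bd(1)) auto
      show "diameter (P k) \<le> \<delta>" for k by (rule order_trans[OF bd(2) N\<delta>]) auto
    qed (use m \<open>0 < \<delta>\<close> in auto)
    also have "\<dots> \<le> (\<Sum>k\<in>?I. ennreal ((real ?m / real N) ^ ?m))"
    proof (intro sum_mono ennreal_leI power_mono)
      show "diameter (P k) \<le> real ?m / real N" for k by (rule bd(2)) auto
      show "0 \<le> diameter (P k)" for k by (rule diameter_ge_0, rule bd(1)) auto
    qed
    also have "\<dots> = ennreal (real (N ^ ?m) * (real ?m / real N) ^ ?m)"
      using finite_B by (simp add: card_PiE ennreal_mult ennreal_of_nat_eq_real_of_nat)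
    also have "real (N ^ ?m) * (real ?m / real N) ^ ?m = real ?m ^ ?m"
      using N0 by (simp add: power_divide)
    finally show "hausdorff_pre ?m \<delta> (span_cube B) \<le> ennreal (real ?m ^ ?m)" .
  qed
  then show ?thesis by (rule le_less_trans) simp
qed

text \<open>Mass distribution principle: a set of diameter \<open>d\<close> lies in a box of side
  \<open>2 * d\<close>, which has flat measure \<open>(2 * d) ^ m\<close> for
  \<open>m = card B\<close>, whereas the cube has flat measure 1. Hence no cover can be cheaper than
  \<open>1 / 2 ^ m\<close>.\<close>

lemma hausdorff_span_cube_positive:
  assumes m: "1 \<le> card B"
  shows "0 < hausdorff_outer (card B) (span_cube B)"
proof -
  let ?m = "card B"
  have "1 \<le> ennreal (2 ^ ?m) * hausdorff_pre ?m 1 (span_cube B)"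
  proof -
    have "ennreal (1 / 2 ^ ?m) \<le> hausdorff_pre ?m 1 (span_cube B)"
    proof (rule hausdorff_pre_greatest)
      fix C :: "nat \<Rightarrow> 'a set"
      assume C: "span_cube B \<subseteq> (\<Union>i. C i)" "\<And>i. bounded (C i)" "\<And>i. diameter (C i) \<le> 1"
      \<comment> \<open>Centre of the box around \<open>C i\<close>; for empty \<open>C i\<close> it
        is an arbitrary point and the box covers vacuously.\<close>
      define c where "c i = (SOME x. x \<in> C i)" for i
      define d where "d i = diameter (C i)" for i
      define S where "S i = {u. \<forall>b\<in>B. c i \<bullet> b - d i \<le> u \<bullet> b \<and> u \<bullet> b \<le> c i \<bullet> b - d i + 2 * d i}" for i
      have d0: "0 \<le> d i" for i unfolding d_def by (rule diameter_ge_0[OF C(2)])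
      have S [measurable]: "S i \<in> sets borel" for i unfolding S_def using finite_B by measurable
      have CS: "C i \<subseteq> S i" for i
      proof
        fix u assume u: "u \<in> C i"
        then have "c i \<in> C i" unfolding c_def by (rule someI)
        then have "norm (u - c i) \<le> d i"
          using diameter_bounded_bound[OF C(2) u] by (simp add: d_def dist_norm)
        then have i: "\<bar>(u - c i) \<bullet> b\<bar> \<le> d i" if "b \<in> B" for b
          using inner_le_norm[OF that, of "u - c i"] by linarith
        have "c i \<bullet> b - d i \<le> u \<bullet> b \<and> u \<bullet> b \<le> c i \<bullet> b - d i + 2 * d i" if "b \<in> B" for b
          using i[OF that] by (auto simp: inner_diff_left abs_le_iff)
        then show "u \<in> S i" by (simp add: S_def)
      qed
      have "span_cube B \<subseteq> (\<Union>i. S i)" by (rule order_trans[OF C(1) UN_mono[OF order_refl CS]])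
      then have "1 \<le> emeasure (flat_measure B) (\<Union>i. S i)"
        using emeasure_mono[of "span_cube B" "\<Union>i. S i" "flat_measure B"] by (simp add: emeasure_flat_span_cube)
      also have "\<dots> \<le> (\<Sum>i. emeasure (flat_measure B) (S i))"
        by (rule emeasure_subadditive_countably) (auto simp: S)
      also have "\<dots> = (\<Sum>i. ennreal (2 ^ ?m) * ennreal (d i ^ ?m))"
        unfolding S_def using d0 by (subst emeasure_flat_box) (auto simp: power_mult_distrib ennreal_mult)
      also have "\<dots> = ennreal (2 ^ ?m) * (\<Sum>i. ennreal (d i ^ ?m))" by simp
      finally have "ennreal (1 / 2 ^ ?m) * 1 \<le> ennreal (1 / 2 ^ ?m) * (ennreal (2 ^ ?m) * (\<Sum>i. ennreal (d i ^ ?m)))"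
        by (rule mult_left_mono) simp
      also have "\<dots> = ennreal (1 / 2 ^ ?m) * ennreal (2 ^ ?m) * (\<Sum>i. ennreal (d i ^ ?m))"
        by (simp only: mult.assoc)
      also have "ennreal (1 / 2 ^ ?m) * ennreal (2 ^ ?m) = 1"
        by (subst ennreal_mult[symmetric]) auto
      finally show "ennreal (1 / 2 ^ ?m) \<le> (\<Sum>i. ennreal (diameter (C i) ^ ?m))" by (simp add: d_def)
    qed
    then have "ennreal (2 ^ ?m) * ennreal (1 / 2 ^ ?m) \<le> ennreal (2 ^ ?m) * hausdorff_pre ?m 1 (span_cube B)"
      by (rule mult_left_mono) simp
    moreover have "ennreal (2 ^ ?m) * ennreal (1 / 2 ^ ?m) = 1"
      by (subst ennreal_mult[symmetric]) auto
    ultimately show ?thesis by simp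
  qed
  then have "0 < hausdorff_pre ?m 1 (span_cube B)"
    by (cases "hausdorff_pre ?m 1 (span_cube B) = 0") (auto simp: zero_less_iff_neq_zero)
  also have "\<dots> \<le> hausdorff_outer ?m (span_cube B)" by (rule hausdorff_pre_le_outer) simp
  finally show ?thesis .
qed

text \<open>Translations are isometries in both directions, so the restriction of Hausdorff measure
  to the span is invariant; it is finite on boxes, which are covered by similar images of the unit
  cube. Uniqueness of Haar measure leaves one constant, the measure of the unit cube.\<close>

lemma hausdorff_Int_span:
  assumes m: "1 \<le> card B" and A: "A \<in> sets borel"
  shows "hausdorff_outer (card B) (A \<inter> span B)
    = hausdorff_outer (card B) (span_cube B) * emeasure (flat_measure B) A"
proof -
  let ?m = "card B"
  define H :: "'a measure" where "H = measure_of UNIV (sets borel) (hausdorff_outer ?m)"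
  have sH [measurable_cong]: "sets H = sets borel" "space H = UNIV"
    using sets.sigma_sets_eq[of "borel :: 'a measure"] by (simp_all add: H_def)
  have eH: "emeasure H A = hausdorff_outer ?m A" if "A \<in> sets borel" for A
  proof -
    have "measure_space UNIV (sets borel) (hausdorff_outer ?m :: 'a set \<Rightarrow> ennreal)"
      by (rule hausdorff_measure_space[OF m])
    then show ?thesis
      unfolding H_def using that
      by (intro emeasure_measure_of_sigma) (auto simp: measure_space_def)
  qed
  define \<mu> where "\<mu> = density H (indicator (span B))"
  have s\<mu> [measurable_cong]: "sets \<mu> = sets borel" "space \<mu> = UNIV" by (simp_all add: \<mu>_def sH)
  have e\<mu>: "emeasure \<mu> A = hausdorff_outer ?m (A \<inter> span B)" if [measurable]: "A \<in> sets borel" for A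
  proof -
    have "emeasure \<mu> A = (\<integral>\<^sup>+x. indicator (span B) x * indicator A x \<partial>H)"
      unfolding \<mu>_def by (subst emeasure_density) (auto simp: sH)
    also have "\<dots> = (\<integral>\<^sup>+x. indicator (A \<inter> span B) x \<partial>H)"
      by (rule nn_integral_cong) (simp split: split_indicator)
    also have "\<dots> = emeasure H (A \<inter> span B)" by (rule nn_integral_indicator) (simp add: sH)
    also have "\<dots> = hausdorff_outer ?m (A \<inter> span B)" by (rule eH) simp
    finally show ?thesis .
  qed
  have trans: "hausdorff_outer ?m ((\<lambda>u. u + h) ` S) \<le> hausdorff_outer ?m S" for h :: 'a and S
    using hausdorff_outer_Lipschitz[of 1 S "\<lambda>u. u + h" ?m] by (simp add: dist_norm)
  have "emeasure \<mu> A = emeasure \<mu> (span_cube B) * emeasure (flat_measure B) A"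
  proof (rule translation_invariant_eq_flat)
    show "sets \<mu> = sets borel" by (rule s\<mu>)
    show "AE u in \<mu>. u \<in> span B"
      unfolding \<mu>_def by (subst AE_density) (auto intro!: AE_I2 simp: indicator_def sH split: if_splits)
    show "distr \<mu> borel (\<lambda>u. u + h) = \<mu>" if h: "h \<in> span B" for h
    proof (rule measure_eqI)
      fix A assume "A \<in> sets (distr \<mu> borel (\<lambda>u. u + h))"
      then have A [measurable]: "A \<in> sets borel" by simp
      have pre: "(\<lambda>u. u + h) -` A \<in> sets borel"
      proof -
        have "(\<lambda>u. u + h) -` A \<inter> space borel \<in> sets borel" by measurable
        then show ?thesis by simp
      qed
      have "emeasure (distr \<mu> borel (\<lambda>u. u + h)) A = emeasure \<mu> ((\<lambda>u. u + h) -` A)"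
        by (subst emeasure_distr) (auto simp: s\<mu>)
      also have "\<dots> = hausdorff_outer ?m ((\<lambda>u. u + h) -` A \<inter> span B)" by (rule e\<mu>[OF pre])
      also have "\<dots> = hausdorff_outer ?m (A \<inter> span B)"
      proof (rule antisym)
        have "(\<lambda>u. u + h) -` A \<inter> span B \<subseteq> (\<lambda>u. u + (- h)) ` (A \<inter> span B)"
        proof
          fix u assume "u \<in> (\<lambda>u. u + h) -` A \<inter> span B"
          then have "u + h \<in> A \<inter> span B" using h by (simp add: span_add)
          then show "u \<in> (\<lambda>u. u + (- h)) ` (A \<inter> span B)" by (rule rev_image_eqI) simp
        qed
        then show "hausdorff_outer ?m ((\<lambda>u. u + h) -` A \<inter> span B) \<le> hausdorff_outer ?m (A \<inter> span B)"
          by (rule order_trans[OF hausdorff_outer_mono trans])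
        have "A \<inter> span B \<subseteq> (\<lambda>u. u + h) ` ((\<lambda>u. u + h) -` A \<inter> span B)"
        proof
          fix u assume "u \<in> A \<inter> span B"
          then have "u - h \<in> (\<lambda>u. u + h) -` A \<inter> span B" using h by (simp add: span_diff)
          then show "u \<in> (\<lambda>u. u + h) ` ((\<lambda>u. u + h) -` A \<inter> span B)" by (rule rev_image_eqI) simp
        qed
        then show "hausdorff_outer ?m (A \<inter> span B) \<le> hausdorff_outer ?m ((\<lambda>u. u + h) -` A \<inter> span B)"
          by (rule order_trans[OF hausdorff_outer_mono trans])
      qed
      finally show "emeasure (distr \<mu> borel (\<lambda>u. u + h)) A = emeasure \<mu> A" using e\<mu>[OF A] by simp
    qed (simp add: s\<mu>)
    show "sigma_finite_measure \<mu>"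
    proof
      let ?A = "\<lambda>n::nat. {u. \<forall>b\<in>B. - real n \<le> u \<bullet> b \<and> u \<bullet> b \<le> - real n + 2 * real n}"
      have mA: "?A n \<in> sets borel" for n using finite_B by measurable
      moreover have "emeasure \<mu> (?A n) \<noteq> \<infinity>" for n
      proof (cases "n = 0")
        case True
        have "\<exists>n'>0. ?A n \<subseteq> ?A n'" using True by (intro exI[of _ 1]) auto
        have "?A 0 \<inter> span B \<subseteq> {0}"
        proof
          fix u assume u: "u \<in> ?A 0 \<inter> span B"
          then have "u \<bullet> b = 0" if "b \<in> B" for b using that by (auto intro: antisym)
          then show "u \<in> {0}" using expand[of u] u by simp
        qed
        then have "?A 0 \<inter> span B \<subseteq> span_cube B" by (auto simp: span_cube_def span_zero)
        then have "emeasure \<mu> (?A 0) \<le> hausdorff_outer ?m (span_cube B)"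
          unfolding e\<mu>[OF mA] by (rule hausdorff_outer_mono)
        then show ?thesis using hausdorff_span_cube_finite[OF m] True by (auto simp: top_unique)
      next
        case False
        define h where "h = (\<Sum>b\<in>B. (- real n) *\<^sub>R b)"
        have hb: "h \<bullet> b = - real n" if "b \<in> B" for b unfolding h_def using inner_comb[OF that, of "\<lambda>_. - real n"] by simp
        have hs: "h \<in> span B" unfolding h_def by (intro span_sum span_scale span_base)
        have "?A n \<inter> span B \<subseteq> (\<lambda>u. (2 * real n) *\<^sub>R u + h) ` span_cube B"
        proof
          fix u assume u: "u \<in> ?A n \<inter> span B"
          have "(1 / (2 * real n)) *\<^sub>R (u - h) \<in> span_cube B"
            unfolding span_cube_def using u hs False
            by (auto intro!: span_scale span_diff simp: inner_diff_left hb field_simps)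
          moreover have "u = (2 * real n) *\<^sub>R ((1 / (2 * real n)) *\<^sub>R (u - h)) + h" using False by simp
          ultimately show "u \<in> (\<lambda>u. (2 * real n) *\<^sub>R u + h) ` span_cube B" by (rule rev_image_eqI)
        qed
        then have "emeasure \<mu> (?A n) \<le> hausdorff_outer ?m ((\<lambda>u. (2 * real n) *\<^sub>R u + h) ` span_cube B)"
          unfolding e\<mu>[OF mA] by (rule hausdorff_outer_mono)
        also have "\<dots> \<le> ennreal ((2 * real n) ^ ?m) * hausdorff_outer ?m (span_cube B)"
          using False by (intro hausdorff_outer_Lipschitz) (auto simp: dist_norm scaleR_diff_right[symmetric])
        also have "\<dots> < \<infinity>" using hausdorff_span_cube_finite[OF m] by (simp add: ennreal_mult_less_top)
        finally show ?thesis by simp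
      qed
      ultimately show "\<exists>A. countable A \<and> A \<subseteq> sets \<mu> \<and> \<Union> A = space \<mu> \<and> (\<forall>a\<in>A. emeasure \<mu> a \<noteq> \<infinity>)"
        using span_UN_boxes by (intro exI[of _ "range ?A"]) (auto simp: s\<mu>)
    qed
  qed (rule A)
  moreover have "span_cube B \<inter> span B = span_cube B" by (auto simp: span_cube_def)
  ultimately show ?thesis using e\<mu>[OF A] e\<mu>[OF sets_span_cube] by simp
qed

lemma isometry_exists:
  assumes "orthonormal_set B'" "card B' = card B"
  obtains \<sigma> where "linear \<sigma>" "bij_betw \<sigma> B B'" "\<And>u. u \<in> span B \<Longrightarrow> norm (\<sigma> u) = norm u"
    "\<And>u b. b \<in> B \<Longrightarrow> \<sigma> u \<bullet> \<sigma> b = u \<bullet> b" "\<sigma> ` span B = span B'"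
proof -
  interpret B': orthonormal_set B' by fact
  obtain \<tau> where \<tau>: "bij_betw \<tau> B B'"
    using finite_same_card_bij[OF finite_B B'.finite_B] assms(2) by auto
  then have inj: "inj_on \<tau> B" and im: "\<tau> ` B = B'" by (auto simp: bij_betw_def)
  define \<sigma> where "\<sigma> u = (\<Sum>b\<in>B. (u \<bullet> b) *\<^sub>R \<tau> b)" for u
  have lin: "linear \<sigma>"
    unfolding \<sigma>_def by (auto intro!: linearI simp: inner_add_left scaleR_left_distrib sum.distrib scaleR_sum_right)
  have \<sigma>b: "\<sigma> b = \<tau> b" if "b \<in> B" for b
  proof -
    have "\<sigma> b = (\<Sum>c\<in>B. if c = b then \<tau> c else 0)"
      unfolding \<sigma>_def using that by (intro sum.cong) (auto simp: inner_B)
    then show ?thesis using that finite_B by simp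
  qed
  have \<tau>i: "\<tau> c \<bullet> \<tau> b = (if c = b then 1 else 0)" if "b \<in> B" "c \<in> B" for b c
    using B'.inner_B[of "\<tau> c" "\<tau> b"] that im inj by (auto simp: inj_on_eq_iff)
  have ib: "\<sigma> u \<bullet> \<sigma> b = u \<bullet> b" if "b \<in> B" for u b
  proof -
    have "\<sigma> u \<bullet> \<sigma> b = (\<Sum>c\<in>B. (u \<bullet> c) * (\<tau> c \<bullet> \<tau> b))"
      by (simp add: \<sigma>b[OF that]) (simp add: \<sigma>_def inner_sum_left)
    also have "\<dots> = (\<Sum>c\<in>B. if c = b then u \<bullet> c else 0)"
      using that by (intro sum.cong) (auto simp: \<tau>i)
    finally show ?thesis using that finite_B by simp
  qed
  have \<sigma>s: "\<sigma> u \<in> span B'" for u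
    unfolding \<sigma>_def using im by (intro span_sum span_scale span_base) auto
  have bij: "bij_betw \<sigma> B B'" using \<tau> \<sigma>b by (subst bij_betw_cong[of B \<sigma> \<tau>]) auto
  have n: "norm (\<sigma> u) = norm u" if "u \<in> span B" for u
  proof -
    have "\<sigma> u \<bullet> \<sigma> u = (\<Sum>b\<in>B'. (\<sigma> u \<bullet> b)\<^sup>2)" by (rule B'.inner_self_sum[OF \<sigma>s])
    also have "\<dots> = (\<Sum>b\<in>B. (\<sigma> u \<bullet> \<sigma> b)\<^sup>2)" by (rule sum.reindex_bij_betw[OF bij, symmetric])
    also have "\<dots> = u \<bullet> u" using inner_self_sum[OF that] by (simp add: ib)
    finally show ?thesis by (simp add: norm_eq_sqrt_inner)
  qed
  have "\<sigma> ` span B = span B'"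
    using bij linear_span_image[OF lin, of B] by (simp add: bij_betw_def)
  then show ?thesis by (intro that[OF lin bij n ib])
qed

text \<open>Used in both directions: the unit cubes of two orthonormal frames of equal size are
  isometric, so one normalizing constant fits hyperplanes in every position.\<close>

lemma hausdorff_span_cube_le:
  assumes "orthonormal_set B'" "card B' = card B"
  shows "hausdorff_outer s (span_cube B') \<le> hausdorff_outer s (span_cube B)"
proof -
  obtain \<sigma> where \<sigma>: "linear \<sigma>" "bij_betw \<sigma> B B'" "\<And>u. u \<in> span B \<Longrightarrow> norm (\<sigma> u) = norm u"
    "\<And>u b. b \<in> B \<Longrightarrow> \<sigma> u \<bullet> \<sigma> b = u \<bullet> b" "\<sigma> ` span B = span B'"
    by (rule isometry_exists[OF assms]) blast
  have "span_cube B' \<subseteq> \<sigma> ` span_cube B"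
  proof
    fix v assume v: "v \<in> span_cube B'"
    then obtain u where u: "u \<in> span B" "v = \<sigma> u" using \<sigma>(5) by (auto simp: span_cube_def)
    have "0 \<le> u \<bullet> b \<and> u \<bullet> b \<le> 1" if "b \<in> B" for b
      using v \<sigma>(2) that \<sigma>(4)[OF that, of u] u(2) by (force simp: span_cube_def bij_betw_def)
    then show "v \<in> \<sigma> ` span_cube B" using u by (auto simp: span_cube_def)
  qed
  then have "hausdorff_outer s (span_cube B') \<le> hausdorff_outer s (\<sigma> ` span_cube B)"
    by (rule hausdorff_outer_mono)
  also have "\<dots> \<le> ennreal (1 ^ s) * hausdorff_outer s (span_cube B)"
  proof (rule hausdorff_outer_Lipschitz)
    fix x y assume "x \<in> span_cube B" "y \<in> span_cube B"
    then have "norm (\<sigma> (x - y)) = norm (x - y)" by (intro \<sigma>(3) span_diff) (auto simp: span_cube_def)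
    then show "dist (\<sigma> x) (\<sigma> y) \<le> 1 * dist x y" by (simp add: dist_norm linear_diff[OF \<sigma>(1)])
  qed simp
  finally show ?thesis by simp
qed

lemma emeasure_flat_box_sides:
  assumes "\<And>b. b \<in> B \<Longrightarrow> 0 \<le> l b"
  shows "emeasure (flat_measure B) {u. \<forall>b\<in>B. c b \<le> u \<bullet> b \<and> u \<bullet> b \<le> c b + l b} = ennreal (\<Prod>b\<in>B. l b)"
proof -
  let ?S = "{u. \<forall>b\<in>B. c b \<le> u \<bullet> b \<and> u \<bullet> b \<le> c b + l b}"
  have [measurable]: "?S \<in> sets borel"
    using finite_B by measurable
  have "emeasure (flat_measure B) ?S = (\<integral>\<^sup>+u. indicator ?S u \<partial>flat_measure B)"
    by simp
  also have "\<dots> = (\<integral>\<^sup>+u. (\<Prod>b\<in>B. indicator {c b..c b + l b} (u \<bullet> b)) \<partial>flat_measure B)"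
  proof (rule nn_integral_cong)
    fix u show "indicator ?S u = (\<Prod>b\<in>B. indicator {c b..c b + l b} (u \<bullet> b) :: ennreal)"
      using finite_B by (auto simp: indicator_def prod_zero_iff)
  qed
  also have "\<dots> = (\<Prod>b\<in>B. \<integral>\<^sup>+x. indicator {c b..c b + l b} x \<partial>lborel)"
    by (rule nn_integral_prod_flat) measurable
  also have "\<dots> = (\<Prod>b\<in>B. ennreal (l b))"
    using assms by (intro prod.cong) auto
  finally show ?thesis using assms by (simp add: prod_ennreal)
qed

definition proj :: "'a \<Rightarrow> 'a" where "proj y = (\<Sum>b\<in>B. (y \<bullet> b) *\<^sub>R b)"

lemma proj_in_span [simp]: "proj y \<in> span B" unfolding proj_def by (rule comb_in_span)

lemma proj_span: "u \<in> span B \<Longrightarrow> proj u = u" unfolding proj_def by (rule expand)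

lemma linear_proj: "linear proj"
  unfolding proj_def by (auto intro!: linearI simp: inner_add_left scaleR_left_distrib sum.distrib scaleR_sum_right)

lemma continuous_on_proj [continuous_intros]:
  "continuous_on S f \<Longrightarrow> continuous_on S (\<lambda>x. proj (f x))"
  unfolding proj_def by (intro continuous_intros)

lemma measurable_proj [measurable]: "proj \<in> borel_measurable borel"
  by (intro borel_measurable_continuous_onI continuous_intros)

lemma inner_span_proj: "u \<in> span B \<Longrightarrow> u \<bullet> proj y = u \<bullet> y"
proof -
  assume u: "u \<in> span B"
  have "u \<bullet> proj y = (\<Sum>b\<in>B. (y \<bullet> b) * (u \<bullet> b))"
    unfolding proj_def by (simp add: inner_sum_right)
  also have "\<dots> = (\<Sum>b\<in>B. (u \<bullet> b) *\<^sub>R b) \<bullet> y"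
    unfolding inner_sum_left inner_scaleR_left by (simp add: inner_commute mult.commute)
  finally show ?thesis by (simp add: expand[OF u])
qed

lemma norm_proj_le: "norm (proj y) \<le> norm y"
proof -
  have "norm (proj y) * norm (proj y) = proj y \<bullet> y"
    using inner_span_proj[of "proj y" y] by (simp add: dot_square_norm power2_eq_square)
  also have "\<dots> \<le> norm (proj y) * norm y" by (rule norm_cauchy_schwarz)
  finally show ?thesis by (cases "norm (proj y) = 0") auto
qed

end

section \<open>Surface area of graphs\<close>

text \<open>
  The normalized Hausdorff measure enters the area formula only through these two properties.
\<close>

locale area_measure =
  fixes M :: "'a::euclidean_space measure" and m :: nat
  assumes sets_M [measurable_cong]: "sets M = sets borel"
    and m_pos: "1 \<le> m"
    and M_lipschitz: "\<And>A f K. \<lbrakk>A \<in> sets borel; f ` A \<in> sets borel; 0 < K;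
        \<And>x y. x \<in> A \<Longrightarrow> y \<in> A \<Longrightarrow> dist (f x) (f y) \<le> K * dist x y\<rbrakk>
        \<Longrightarrow> emeasure M (f ` A) \<le> ennreal (K ^ m) * emeasure M A"
    and M_flat: "\<And>B A. \<lbrakk>orthonormal_set B; card B = m; A \<in> sets borel\<rbrakk>
        \<Longrightarrow> emeasure M (A \<inter> span B) = emeasure (flat_measure B) A"

locale hyperplane = area_measure M m + orthonormal_set B
  for M :: "'a::euclidean_space measure" and m and B :: "'a set" +
  fixes \<nu> :: 'a
  assumes card_B: "card B = m" and norm_\<nu>: "norm \<nu> = 1" and B_\<nu>: "\<And>b. b \<in> B \<Longrightarrow> b \<bullet> \<nu> = 0"
begin

abbreviation "T \<equiv> span B"
abbreviation "lam \<equiv> flat_measure B"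

lemma space_M [simp]: "space M = UNIV"
  using sets_eq_imp_space_eq[OF sets_M] by simp

lemma span_\<nu>: "u \<in> T \<Longrightarrow> u \<bullet> \<nu> = 0"
proof -
  assume "u \<in> T"
  then have "u \<bullet> \<nu> = (\<Sum>b\<in>B. (u \<bullet> b) *\<^sub>R b) \<bullet> \<nu>" by (simp only: expand)
  also have "\<dots> = 0" unfolding inner_sum_left inner_scaleR_left by (simp add: B_\<nu>)
  finally show ?thesis .
qed

lemma \<nu>\<nu>: "\<nu> \<bullet> \<nu> = 1" using norm_\<nu> by (simp add: norm_eq_sqrt_inner)

lemma proj_\<nu>: "proj \<nu> = 0"
  unfolding proj_def using B_\<nu> by (simp add: inner_commute)

lemma proj_add_\<nu>: "u \<in> T \<Longrightarrow> proj (u + s *\<^sub>R \<nu>) = u"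
  by (simp add: linear_add[OF linear_proj] linear_scale[OF linear_proj] proj_\<nu> proj_span)

lemma norm_add_\<nu>: "u \<in> T \<Longrightarrow> (norm (u + s *\<^sub>R \<nu>))\<^sup>2 = (norm u)\<^sup>2 + s\<^sup>2"
  unfolding power2_norm_eq_inner
  by (simp add: inner_simps span_\<nu> \<nu>\<nu> inner_commute[of \<nu> u] power2_eq_square)

lemma norm_le_add_\<nu>: "u \<in> T \<Longrightarrow> norm u \<le> norm (u + s *\<^sub>R \<nu>)"
proof -
  assume "u \<in> T"
  from norm_add_\<nu>[OF this, of s] have "(norm u)\<^sup>2 \<le> (norm (u + s *\<^sub>R \<nu>))\<^sup>2" by simp
  then show ?thesis by (rule power2_le_imp_le) simp
qed

lemma M_Int_T: "A \<in> sets borel \<Longrightarrow> emeasure M (A \<inter> T) = emeasure lam A"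
  by (rule M_flat[OF orthonormal_set_axioms card_B])

text \<open>Both sides are the trace of \<open>M\<close> on the same subspace, so a change of
  orthonormal basis needs no determinant.\<close>

lemma flat_eq_lam:
  assumes "orthonormal_set B'" "span B' = T" "card B' = m"
  shows "flat_measure B' = lam"
proof (rule measure_eqI)
  interpret B': orthonormal_set B' by fact
  show "sets (flat_measure B') = sets lam" by simp
  fix A assume "A \<in> sets (flat_measure B')"
  then have "A \<in> sets borel" by simp
  then show "emeasure (flat_measure B') A = emeasure lam A"
    using M_flat[OF assms(1,3), of A] M_Int_T[of A] assms(2) by simp
qed

text \<open>The scaling law is read off from \<open>M_lipschitz\<close> for the similarity and for
  its inverse. A negative \<open>c\<close> is allowed; \<open>c = - 1\<close> yields the reflection
  behind \<open>integral_odd\<close>.\<close>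

lemma distr_lam_similarity:
  assumes c: "c \<noteq> 0" and h: "h \<in> T"
  shows "distr lam borel (\<lambda>u. c *\<^sub>R u + h) = density lam (\<lambda>_. ennreal (1 / \<bar>c\<bar> ^ m))"
proof (rule measure_eqI)
  show "sets (distr lam borel (\<lambda>u. c *\<^sub>R u + h)) = sets (density lam (\<lambda>_. ennreal (1 / \<bar>c\<bar> ^ m)))" by simp
  fix A assume "A \<in> sets (distr lam borel (\<lambda>u. c *\<^sub>R u + h))"
  then have A [measurable]: "A \<in> sets borel" by simp
  let ?P = "(\<lambda>u. c *\<^sub>R u + h) -` A"
  have P [measurable]: "?P \<in> sets borel"
  proof -
    have "?P \<inter> space borel \<in> sets borel" by measurable
    then show ?thesis by simp
  qed
  have "A \<inter> T = (\<lambda>u. c *\<^sub>R u + h) ` (?P \<inter> T)"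
  proof (intro set_eqI iffI)
    fix u assume u: "u \<in> A \<inter> T"
    have "(1 / c) *\<^sub>R (u - h) \<in> ?P \<inter> T" using u h c by (auto intro!: span_scale span_diff)
    then show "u \<in> (\<lambda>u. c *\<^sub>R u + h) ` (?P \<inter> T)" using c by (rule_tac rev_image_eqI) auto
  qed (use h in \<open>auto intro!: span_add span_scale\<close>)
  then have i1: "A \<inter> T = (\<lambda>u. c *\<^sub>R u + h) ` (?P \<inter> T)" .
  have i2: "?P \<inter> T = (\<lambda>u. (1 / c) *\<^sub>R (u - h)) ` (A \<inter> T)"
    unfolding i1 image_image using c by simp
  have "emeasure M (A \<inter> T) \<le> ennreal (\<bar>c\<bar> ^ m) * emeasure M (?P \<inter> T)"
    unfolding i1 using c
    by (intro M_lipschitz) (auto simp: i1[symmetric] dist_norm scaleR_diff_right[symmetric] sets.Int)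
  then have le1: "emeasure lam A \<le> ennreal (\<bar>c\<bar> ^ m) * emeasure lam ?P" by (simp add: M_Int_T)
  have "emeasure M (?P \<inter> T) \<le> ennreal ((1 / \<bar>c\<bar>) ^ m) * emeasure M (A \<inter> T)"
    unfolding i2 using c
    by (intro M_lipschitz) (auto simp: i2[symmetric] dist_norm scaleR_diff_right[symmetric] sets.Int divide_simps)
  then have le2: "emeasure lam ?P \<le> ennreal (1 / \<bar>c\<bar> ^ m) * emeasure lam A"
    by (simp add: M_Int_T power_one_over)
  have "ennreal (1 / \<bar>c\<bar> ^ m) * emeasure lam A \<le> ennreal (1 / \<bar>c\<bar> ^ m) * (ennreal (\<bar>c\<bar> ^ m) * emeasure lam ?P)"
    by (intro mult_left_mono le1) simp
  also have "\<dots> = (ennreal (1 / \<bar>c\<bar> ^ m) * ennreal (\<bar>c\<bar> ^ m)) * emeasure lam ?P" by (simp only: mult.assoc)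
  also have "ennreal (1 / \<bar>c\<bar> ^ m) * ennreal (\<bar>c\<bar> ^ m) = 1" using c by (subst ennreal_mult[symmetric]) auto
  finally have "emeasure lam ?P = ennreal (1 / \<bar>c\<bar> ^ m) * emeasure lam A" using le2 by simp
  moreover have "emeasure (distr lam borel (\<lambda>u. c *\<^sub>R u + h)) A = emeasure lam ?P"
    by (subst emeasure_distr) auto
  moreover have "emeasure (density lam (\<lambda>_. ennreal (1 / \<bar>c\<bar> ^ m))) A = ennreal (1 / \<bar>c\<bar> ^ m) * emeasure lam A"
    by (simp add: emeasure_density nn_integral_cmult)
  ultimately show "emeasure (distr lam borel (\<lambda>u. c *\<^sub>R u + h)) A = emeasure (density lam (\<lambda>_. ennreal (1 / \<bar>c\<bar> ^ m))) A"
    by simp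
qed

lemma nn_integral_lam_similarity:
  assumes "c \<noteq> 0" "h \<in> T" and [measurable]: "f \<in> borel_measurable borel"
  shows "(\<integral>\<^sup>+u. f (c *\<^sub>R u + h) \<partial>lam) = ennreal (1 / \<bar>c\<bar> ^ m) * (\<integral>\<^sup>+u. f u \<partial>lam)"
proof -
  have "(\<integral>\<^sup>+u. f (c *\<^sub>R u + h) \<partial>lam) = (\<integral>\<^sup>+u. f u \<partial>distr lam borel (\<lambda>u. c *\<^sub>R u + h))"
    by (rule nn_integral_distr[symmetric]) auto
  also have "\<dots> = ennreal (1 / \<bar>c\<bar> ^ m) * (\<integral>\<^sup>+u. f u \<partial>lam)"
    unfolding distr_lam_similarity[OF assms(1,2)] by (subst nn_integral_density) (auto simp: nn_integral_cmult)
  finally show ?thesis .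
qed

lemma integral_lam_similarity:
  fixes f :: "'a \<Rightarrow> 'b::{banach, second_countable_topology}"
  assumes "c \<noteq> 0" "h \<in> T" and [measurable]: "f \<in> borel_measurable borel"
  shows "(\<integral>u. f (c *\<^sub>R u + h) \<partial>lam) = (1 / \<bar>c\<bar> ^ m) *\<^sub>R (\<integral>u. f u \<partial>lam)"
proof -
  have "(\<integral>u. f (c *\<^sub>R u + h) \<partial>lam) = (\<integral>u. f u \<partial>distr lam borel (\<lambda>u. c *\<^sub>R u + h))"
    by (rule integral_distr[symmetric]) auto
  also have "\<dots> = (1 / \<bar>c\<bar> ^ m) *\<^sub>R (\<integral>u. f u \<partial>lam)"
    unfolding distr_lam_similarity[OF assms(1,2)] by (subst integral_density) auto
  finally show ?thesis .
qed

lemma emeasure_lam_cball_finite: "emeasure lam (cball (0::'a) r) < \<infinity>"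
proof -
  have "emeasure lam (cball (0::'a) r) \<le> emeasure lam {u. \<forall>b\<in>B. - \<bar>r\<bar> \<le> u \<bullet> b \<and> u \<bullet> b \<le> - \<bar>r\<bar> + 2 * \<bar>r\<bar>}"
  proof (rule emeasure_mono)
    show "cball (0::'a) r \<subseteq> {u. \<forall>b\<in>B. - \<bar>r\<bar> \<le> u \<bullet> b \<and> u \<bullet> b \<le> - \<bar>r\<bar> + 2 * \<bar>r\<bar>}"
    proof safe
      fix u b assume "u \<in> cball (0::'a) r" "b \<in> B"
      then have "\<bar>u \<bullet> b\<bar> \<le> \<bar>r\<bar>" using inner_le_norm[of b u] by auto
      then show "- \<bar>r\<bar> \<le> u \<bullet> b" "u \<bullet> b \<le> - \<bar>r\<bar> + 2 * \<bar>r\<bar>" by linarith+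
    qed
  qed (use finite_B in measurable)
  also have "\<dots> < \<infinity>" by (subst emeasure_flat_box) auto
  finally show ?thesis .
qed

lemma emeasure_lam_cball: "0 < r \<Longrightarrow> emeasure lam (cball (0::'a) r) = ennreal (r ^ m) * emeasure lam (cball (0::'a) 1)"
proof -
  assume r: "0 < r"
  have "(\<integral>\<^sup>+u. indicator (cball (0::'a) 1) ((1 / r) *\<^sub>R u + 0) \<partial>lam) = ennreal (1 / \<bar>1 / r\<bar> ^ m) * (\<integral>\<^sup>+u. indicator (cball (0::'a) 1) u \<partial>lam)"
    using r by (intro nn_integral_lam_similarity borel_measurable_indicator) (auto simp: span_zero)
  also have "(\<lambda>u. indicator (cball (0::'a) 1) ((1 / r) *\<^sub>R u + 0) :: ennreal) = indicator (cball (0::'a) r)"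
    using r by (auto simp: indicator_def fun_eq_iff field_simps)
  finally show ?thesis using r by (simp add: power_divide)
qed

text \<open>The sphere is disjoint from the ball of radius \<open>c < 1\<close>, which carries the
  fraction \<open>c ^ m\<close> of the unit ball; let \<open>c\<close> tend to 1.\<close>

lemma emeasure_lam_sphere: "emeasure lam (sphere (0::'a) 1) = 0"
proof -
  let ?w = "emeasure lam (cball (0::'a) 1)"
  have fin: "?w < \<infinity>" by (rule emeasure_lam_cball_finite)
  have le: "emeasure lam (sphere (0::'a) 1) + ?w * ennreal (c ^ m) \<le> ?w" if c: "0 < c" "c < 1" for c
  proof -
    have "emeasure lam (sphere (0::'a) 1) + ?w * ennreal (c ^ m) = emeasure lam (sphere (0::'a) 1) + emeasure lam (cball (0::'a) c)"
      unfolding emeasure_lam_cball[OF c(1)] by (simp only: mult.commute)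
    also have "\<dots> = emeasure lam (sphere (0::'a) 1 \<union> cball (0::'a) c)"
      using c by (intro plus_emeasure) auto
    also have "\<dots> \<le> ?w" using c by (intro emeasure_mono) auto
    finally show ?thesis .
  qed
  \<comment> \<open>Radii \<open>1 - 1 / (n + 2)\<close>: the shift by 2 keeps them
    positive.\<close>
  have "emeasure lam (sphere (0::'a) 1) + ?w * ennreal ((1 - 1 / real (Suc (Suc n))) ^ m) \<le> ?w" for n
  proof (rule le)
    have "1 / real (Suc (Suc n)) < 1" "0 < 1 / real (Suc (Suc n))" by (simp_all add: divide_less_eq)
    then show "0 < 1 - 1 / real (Suc (Suc n))" "1 - 1 / real (Suc (Suc n)) < 1" by linarith+
  qed
  moreover have "(\<lambda>n. emeasure lam (sphere (0::'a) 1) + ?w * ennreal ((1 - 1 / real (Suc (Suc n))) ^ m))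
      \<longlonglongrightarrow> emeasure lam (sphere (0::'a) 1) + ?w * ennreal ((1 - 0) ^ m)"
  proof (intro tendsto_add tendsto_const tendsto_mult_ennreal tendsto_ennrealI tendsto_power tendsto_diff)
    show "(\<lambda>n. 1 / real (Suc (Suc n))) \<longlonglongrightarrow> 0"
      using LIMSEQ_Suc[OF LIMSEQ_inverse_real_of_nat]
      by (simp add: inverse_eq_divide)
  qed (use fin in auto)
  ultimately have "emeasure lam (sphere (0::'a) 1) + ?w * ennreal ((1 - 0) ^ m) \<le> ?w"
    by (intro LIMSEQ_le_const2) auto
  then have "emeasure lam (sphere (0::'a) 1) + ?w \<le> 0 + ?w" by simp
  then show ?thesis using fin by (simp add: ennreal_add_left_cancel_le add.commute[of _ ?w] less_top[symmetric])
qed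

text \<open>
  The graph map fixes the orthogonal complement of \<open>a\<close> in \<open>T\<close> and sends \<open>a / |a|\<close> to a vector of
  length \<open>sqrt (1 + |a|\<^sup>2)\<close> orthogonal to it.
\<close>

lemma M_linear_graph:
  assumes a: "a \<in> T" and A [measurable]: "A \<in> sets borel" and AT: "A \<subseteq> T"
  shows "emeasure M ((\<lambda>u. u + (a \<bullet> u) *\<^sub>R \<nu>) ` A) = ennreal (sqrt (1 + (norm a)\<^sup>2)) * emeasure lam A"
proof (cases "a = 0")
  case True
  have "A \<inter> T = A" using AT by blast
  then show ?thesis using M_Int_T[OF A] True by simp
next
  case False
  define \<Phi> where "\<Phi> u = u + (a \<bullet> u) *\<^sub>R \<nu>" for u
  have lin\<Phi>: "linear \<Phi>" unfolding \<Phi>_def by (auto intro!: linearI simp: inner_simps algebra_simps)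
  define e where "e = a /\<^sub>R norm a"
  have e: "norm e = 1" "e \<in> T" "a = norm a *\<^sub>R e" using False a by (auto simp: e_def span_scale)
  have ee: "e \<bullet> e = 1" using e(1) by (simp add: norm_eq_sqrt_inner)
  define T' where "T' = {u \<in> T. u \<bullet> e = 0}"
  have "subspace T'" unfolding T'_def subspace_def
    by (auto simp: span_zero span_add span_scale inner_simps)
  then obtain C where C: "C \<subseteq> T'" "pairwise orthogonal C" "\<And>x. x \<in> C \<Longrightarrow> norm x = 1"
      "independent C" "span C = T'"
    by (rule orthonormal_basis_subspace) blast
  have finC: "finite C" using C(4) independent_imp_finite by blast
  have eC: "e \<bullet> c = 0" "c \<bullet> e = 0" "c \<in> T" "c \<bullet> \<nu> = 0" "\<nu> \<bullet> c = 0" if "c \<in> C" for c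
    using C(1) that span_\<nu>[of c] by (auto simp: T'_def inner_commute)
  have CC: "c \<bullet> d = (if c = d then 1 else 0)" if "c \<in> C" "d \<in> C" for c d
    using C(2,3) that by (auto simp: pairwise_def orthogonal_def norm_eq_1)
  have eC': "e \<notin> C" using eC ee by force
  define k where "k = sqrt (1 + (norm a)\<^sup>2)"
  have k: "1 \<le> k" "k * k = 1 + norm a * norm a" by (auto simp: k_def power2_eq_square)
  \<comment> \<open>The normalized image of \<open>e\<close>. Together with the vectors of
    \<open>C\<close>, which the graph map fixes, it is an orthonormal basis of the image of
    \<open>T\<close>.\<close>
  define f where "f = (1 / k) *\<^sub>R (e + norm a *\<^sub>R \<nu>)"
  have ev: "e \<bullet> \<nu> = 0" "\<nu> \<bullet> e = 0" using span_\<nu>[OF e(2)] by (auto simp: inner_commute)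
  have ff: "f \<bullet> f = 1"
  proof -
    have "f \<bullet> f = (1 + norm a * norm a) / (k * k)"
      by (simp add: f_def inner_simps ee ev \<nu>\<nu> add_divide_distrib)
    then have "f \<bullet> f = (k * k) / (k * k)" by (simp only: k(2))
    then show ?thesis using k(1) by simp
  qed
  have fC: "f \<bullet> c = 0" "c \<bullet> f = 0" if "c \<in> C" for c
    using eC[OF that] by (auto simp: f_def inner_simps)
  have fC': "f \<notin> C" using fC ff by force
  have B2: "orthonormal_set (insert e C)"
    by standard (use finC CC eC ee eC' in auto)
  have B3: "orthonormal_set (insert f C)"
    by standard (use finC CC fC ff fC' in auto)
  interpret B2: orthonormal_set "insert e C" by (rule B2)
  interpret B3: orthonormal_set "insert f C" by (rule B3)
  have span2: "span (insert e C) = T"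
  proof
    show "span (insert e C) \<subseteq> T" using e(2) eC by (intro span_minimal) auto
    show "T \<subseteq> span (insert e C)"
    proof
      fix u assume u: "u \<in> T"
      have "u - (u \<bullet> e) *\<^sub>R e \<in> T'" using u e(2) by (auto simp: T'_def span_diff span_scale inner_simps ee)
      then have "u - (u \<bullet> e) *\<^sub>R e \<in> span C" using C(5) by simp
      then show "u \<in> span (insert e C)" by (auto simp: span_insert)
    qed
  qed
  have ind2: "independent S" if "orthonormal_set S" for S :: "'a set"
  proof -
    interpret S: orthonormal_set S by fact
    show ?thesis
      by (rule pairwise_orthogonal_independent)
        (use S.inner_B S.norm_B in \<open>force simp: pairwise_def orthogonal_def\<close>)+
  qed
  have card2: "card (insert e C) = m"
    using ind2[OF B2] ind2[OF orthonormal_set_axioms] span2 card_B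
    by (metis dim_eq_card_independent dim_span)
  then have card3: "card (insert f C) = m" using finC eC' fC' by simp
  have \<Phi>c: "\<Phi> c = c" if "c \<in> C" for c
  proof -
    have "a \<bullet> c = 0" using e(3) eC(1)[OF that] by (metis inner_scaleR_left mult_zero_right)
    then show "\<Phi> c = c" by (simp add: \<Phi>_def)
  qed
  have \<Phi>e: "\<Phi> e = k *\<^sub>R f"
  proof -
    have "a \<bullet> e = norm a" using e(3) ee by (metis inner_scaleR_left mult.right_neutral)
    then show "\<Phi> e = k *\<^sub>R f" using k by (simp add: \<Phi>_def f_def)
  qed
  have im: "\<Phi> ` T = span (insert f C)"
  proof -
    have "\<Phi> ` T = span (\<Phi> ` insert e C)" using linear_span_image[OF lin\<Phi>, of "insert e C"] span2 by simp
    also have "\<Phi> ` insert e C = insert (k *\<^sub>R f) C" using \<Phi>e \<Phi>c by force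
    also have "span (insert (k *\<^sub>R f) C) = span (insert f C)"
    proof (rule span_eq[THEN iffD2], safe)
      show "k *\<^sub>R f \<in> span (insert f C)" by (intro span_scale span_base) auto
      show "f \<in> span (insert (k *\<^sub>R f) C)"
      proof -
        have "(1 / k) *\<^sub>R (k *\<^sub>R f) \<in> span (insert (k *\<^sub>R f) C)" by (intro span_scale span_base) auto
        then show ?thesis using k by simp
      qed
    qed (auto intro: span_base)
    finally show ?thesis .
  qed
  have proj\<Phi>: "proj (\<Phi> u) = u" if "u \<in> T" for u using that by (simp add: \<Phi>_def proj_add_\<nu>)
  \<comment> \<open>The flat measure of the image, projected back to \<open>T\<close>. It is
    invariant under translations of \<open>T\<close>, hence a multiple of Lebesgue measure, and the
    multiple is found on a single cube.\<close>
  define \<mu> where "\<mu> = distr (flat_measure (insert f C)) borel proj"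
  have e\<mu>: "emeasure \<mu> S = emeasure (flat_measure (insert f C)) (proj -` S)" if "S \<in> sets borel" for S
    unfolding \<mu>_def using that by (subst emeasure_distr) auto
  have \<mu>_eq: "emeasure \<mu> S = emeasure \<mu> (span_cube (insert e C)) * emeasure (flat_measure (insert e C)) S"
    if "S \<in> sets borel" for S
  proof (rule B2.translation_invariant_eq_flat)
    show "AE u in \<mu>. u \<in> span (insert e C)"
      unfolding \<mu>_def span2 by (subst AE_distr_iff) auto
    show "distr \<mu> borel (\<lambda>u. u + h) = \<mu>" if "h \<in> span (insert e C)" for h
    proof -
      have h: "h \<in> T" using that span2 by simp
      then have "\<Phi> h \<in> span (insert f C)" using im by blast
      note tr = B3.distr_flat_translation[OF this]
      have "distr \<mu> borel (\<lambda>u. u + h) = distr (flat_measure (insert f C)) borel ((\<lambda>u. u + h) \<circ> proj)"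
        unfolding \<mu>_def by (rule distr_distr) auto
      also have "(\<lambda>u. u + h) \<circ> proj = proj \<circ> (\<lambda>u. u + \<Phi> h)"
        by (auto simp: fun_eq_iff linear_add[OF linear_proj] proj\<Phi>[OF h])
      also have "distr (flat_measure (insert f C)) borel (proj \<circ> (\<lambda>u. u + \<Phi> h))
          = distr (distr (flat_measure (insert f C)) borel (\<lambda>u. u + \<Phi> h)) borel proj"
        by (rule distr_distr[symmetric]) auto
      finally show ?thesis unfolding tr \<mu>_def .
    qed
    show "sigma_finite_measure \<mu>"
    proof
      let ?A = "\<lambda>n::nat. {u. \<forall>b\<in>insert e C. - real n \<le> u \<bullet> b \<and> u \<bullet> b \<le> - real n + 2 * real n}"
      have mA: "?A n \<in> sets borel" for n using B2.finite_B by measurable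
      moreover have "emeasure \<mu> (?A n) \<noteq> \<infinity>" for n
      proof -
        let ?S = "{u. \<forall>b\<in>insert f C. - (k * real n) \<le> u \<bullet> b \<and> u \<bullet> b \<le> - (k * real n) + 2 * (k * real n)}"
        have "emeasure \<mu> (?A n) = emeasure (flat_measure (insert f C)) (proj -` ?A n)" by (rule e\<mu>[OF mA])
        also have "\<dots> \<le> emeasure (flat_measure (insert f C)) ?S"
        proof (rule emeasure_mono_AE)
          show "AE u in flat_measure (insert f C). u \<in> proj -` ?A n \<longrightarrow> u \<in> ?S"
            using B3.AE_flat
          proof eventually_elim
            case (elim y)
            then obtain u where u: "u \<in> T" "y = \<Phi> u" using im by auto
            have yf: "y \<bullet> f = k * (u \<bullet> e)"
            proof -
              have "a \<bullet> u = norm a * (u \<bullet> e)" using e(3) by (metis inner_commute inner_scaleR_left)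
              then have "y \<bullet> f = (1 / k) * ((u \<bullet> e) + norm a * (norm a * (u \<bullet> e)))"
                using u span_\<nu>[OF u(1)] by (simp add: \<Phi>_def f_def inner_simps ev \<nu>\<nu>)
              also have "\<dots> = (1 / k) * (k * k) * (u \<bullet> e)" unfolding k(2) by (simp add: algebra_simps)
              also have "(1 / k) * (k * k) * (u \<bullet> e) = k * (u \<bullet> e)" using k(1) by simp
              finally show ?thesis .
            qed
            have yc: "y \<bullet> c = u \<bullet> c" if "c \<in> C" for c
              using u eC[OF that] by (simp add: \<Phi>_def inner_simps)
            show ?case
            proof (intro impI)
              assume "y \<in> proj -` ?A n"
              then have *: "- real n \<le> u \<bullet> b \<and> u \<bullet> b \<le> real n" if "b \<in> insert e C" for b
                using that proj\<Phi>[OF u(1)] u(2) by auto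
              have kn: "real n \<le> k * real n" using k by (simp add: mult_le_cancel_right1)
              have "\<bar>u \<bullet> e\<bar> \<le> real n" using *[of e] by auto
              then have "\<bar>k * (u \<bullet> e)\<bar> \<le> k * real n" using k by (simp add: abs_mult mult_left_mono)
              moreover have "- (k * real n) \<le> u \<bullet> c \<and> u \<bullet> c \<le> k * real n" if "c \<in> C" for c
                using *[of c] that kn by auto
              ultimately show "y \<in> ?S" using yf yc by (auto simp: abs_le_iff)
            qed
          qed
        qed (use B3.finite_B in measurable)
        also have "\<dots> = ennreal ((2 * (k * real n)) ^ card (insert f C))"
          using k by (intro B3.emeasure_flat_box) auto
        finally show ?thesis by (auto simp: top_unique)
      qed
      ultimately show "\<exists>A. countable A \<and> A \<subseteq> sets \<mu> \<and> \<Union> A = space \<mu> \<and> (\<forall>a\<in>A. emeasure \<mu> a \<noteq> \<infinity>)"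
        using B2.span_UN_boxes by (intro exI[of _ "range ?A"]) (auto simp: \<mu>_def)
    qed
  qed (use that in \<open>auto simp: \<mu>_def\<close>)
  have "emeasure \<mu> (span_cube (insert e C)) = ennreal k"
  proof -
    \<comment> \<open>Over the unit cube the coordinate along \<open>f\<close> runs from 0 to
      \<open>k\<close> and the others from 0 to 1, so up to a null set the preimage under
      \<open>proj\<close> is a box of volume \<open>k\<close>.\<close>
    let ?S = "{u. \<forall>b\<in>insert f C. 0 \<le> u \<bullet> b \<and> u \<bullet> b \<le> 0 + (if b = f then k else 1)}"
    have "emeasure \<mu> (span_cube (insert e C)) = emeasure (flat_measure (insert f C)) (proj -` span_cube (insert e C))"
      by (rule e\<mu>) (rule B2.sets_span_cube)
    also have "\<dots> = emeasure (flat_measure (insert f C)) ?S"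
    proof (rule emeasure_eq_AE)
      show "AE u in flat_measure (insert f C). u \<in> proj -` span_cube (insert e C) \<longleftrightarrow> u \<in> ?S"
        using B3.AE_flat
      proof eventually_elim
        case (elim y)
        then obtain u where u: "u \<in> T" "y = \<Phi> u" using im by auto
        have yf: "y \<bullet> f = k * (u \<bullet> e)"
        proof -
          have "a \<bullet> u = norm a * (u \<bullet> e)" using e(3) by (metis inner_commute inner_scaleR_left)
          then have "y \<bullet> f = (1 / k) * ((u \<bullet> e) + norm a * (norm a * (u \<bullet> e)))"
            using u span_\<nu>[OF u(1)] by (simp add: \<Phi>_def f_def inner_simps ev \<nu>\<nu>)
          also have "\<dots> = (1 / k) * (k * k) * (u \<bullet> e)" unfolding k(2) by (simp add: algebra_simps)
          also have "(1 / k) * (k * k) * (u \<bullet> e) = k * (u \<bullet> e)" using k(1) by simp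
          finally show ?thesis .
        qed
        have yc: "y \<bullet> c = u \<bullet> c" if "c \<in> C" for c
          using u eC[OF that] by (simp add: \<Phi>_def inner_simps)
        have "0 \<le> k * (u \<bullet> e) \<longleftrightarrow> 0 \<le> u \<bullet> e" "k * (u \<bullet> e) \<le> k \<longleftrightarrow> u \<bullet> e \<le> 1"
          using k by (auto simp: zero_le_mult_iff mult_le_cancel_left2)
        then show ?case using u proj\<Phi>[OF u(1)] yf yc fC'
          by (auto simp: span_cube_def span2)
      qed
      show "proj -` span_cube (insert e C) \<in> sets (flat_measure (insert f C))"
        using measurable_sets[OF measurable_proj B2.sets_span_cube] by simp
      show "?S \<in> sets (flat_measure (insert f C))" using B3.finite_B by measurable
    qed
    also have "\<dots> = ennreal (\<Prod>b\<in>insert f C. if b = f then k else 1)"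
      using k by (intro B3.emeasure_flat_box_sides) auto
    also have "(\<Prod>b\<in>insert f C. if b = f then k else 1) = k" using finC fC' by (subst prod.insert) auto
    finally show ?thesis .
  qed
  then have "emeasure \<mu> A = ennreal k * emeasure lam A"
    using \<mu>_eq[OF A] flat_eq_lam[OF B2 span2 card2] by simp
  moreover have "emeasure \<mu> A = emeasure M (proj -` A \<inter> span (insert f C))"
  proof -
    have "proj -` A \<in> sets borel" using measurable_sets[OF measurable_proj A] by simp
    then show ?thesis using M_flat[OF B3 card3] e\<mu>[OF A] by simp
  qed
  moreover have "proj -` A \<inter> span (insert f C) = \<Phi> ` A"
    unfolding im[symmetric] using AT proj\<Phi> by auto
  ultimately show ?thesis unfolding k_def \<Phi>_def by simp
qed

end

text \<open>\<psi> is a function on the whole space rather than on \<open>T\<close>, so that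
  derivatives are taken in full neighbourhoods; \<open>chart_graph\<close> provides such a \<psi> by
  composing with \<open>proj\<close>.\<close>

locale graph = hyperplane M m B \<nu>
  for M :: "'a::euclidean_space measure" and m B \<nu> +
  fixes \<psi> :: "'a \<Rightarrow> real" and d\<psi> :: "'a \<Rightarrow> 'a" and x :: 'a
  assumes \<psi>_deriv: "\<And>u. (\<psi> has_derivative (\<lambda>h. d\<psi> u \<bullet> h)) (at u)"
    and d\<psi>_T: "\<And>u. d\<psi> u \<in> span B"
    and d\<psi>_cont: "continuous_on UNIV d\<psi>"
begin

definition \<Phi> :: "'a \<Rightarrow> 'a" where "\<Phi> u = x + u + \<psi> u *\<^sub>R \<nu>"
definition J :: "'a \<Rightarrow> real" where "J u = sqrt (1 + (norm (d\<psi> u))\<^sup>2)"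

lemma \<psi>_cont: "continuous_on UNIV \<psi>"
  using \<psi>_deriv by (auto intro!: has_derivative_continuous_on)

lemma measurable_\<psi> [measurable]: "\<psi> \<in> borel_measurable borel"
  and measurable_d\<psi> [measurable]: "d\<psi> \<in> borel_measurable borel"
  by (auto intro: borel_measurable_continuous_onI \<psi>_cont d\<psi>_cont)

lemma measurable_\<Phi> [measurable]: "\<Phi> \<in> borel_measurable borel"
  and measurable_J [measurable]: "J \<in> borel_measurable borel"
  unfolding \<Phi>_def J_def by measurable

lemma J_ge_1: "1 \<le> J u" by (simp add: J_def)

lemma proj_\<Phi>: "u \<in> T \<Longrightarrow> proj (\<Phi> u - x) = u"
  using proj_add_\<nu>[of u "\<psi> u"] by (simp add: \<Phi>_def add.assoc)

lemma inj_\<Phi>: "inj_on \<Phi> T"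
  by (rule inj_on_inverseI[where g = "\<lambda>y. proj (y - x)"]) (rule proj_\<Phi>)

lemma \<Phi>_image_eq: "A \<subseteq> T \<Longrightarrow> \<Phi> ` A = {y. proj (y - x) \<in> A \<and> y = \<Phi> (proj (y - x))}"
  using proj_\<Phi> by (auto simp: image_iff subset_iff)

text \<open>The projection onto \<open>T\<close> inverts the graph map, so the image is cut out by a
  Borel condition.\<close>

lemma sets_\<Phi>_image: "A \<in> sets borel \<Longrightarrow> A \<subseteq> T \<Longrightarrow> \<Phi> ` A \<in> sets borel"
proof -
  assume [measurable]: "A \<in> sets borel" and "A \<subseteq> T"
  have "{y \<in> space borel. proj (y - x) \<in> A \<and> y = \<Phi> (proj (y - x))} \<in> sets borel"
    by measurable
  then show ?thesis using \<Phi>_image_eq[OF \<open>A \<subseteq> T\<close>] by simp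
qed

text \<open>Continuity of the gradient upgrades differentiability at \<open>u0\<close> to a bound
  for all pairs near \<open>u0\<close>, by the mean value inequality for \<psi> minus its linear
  part.\<close>

lemma dist_\<Phi>_linearization:
  assumes "0 < e" and u0: "u0 \<in> T"
  obtains \<delta> where "0 < \<delta>" "\<And>u v. u \<in> ball u0 \<delta> \<Longrightarrow> v \<in> ball u0 \<delta> \<Longrightarrow> \<bar>\<psi> u - \<psi> v - d\<psi> u0 \<bullet> (u - v)\<bar> \<le> e * norm (u - v)"
    "\<And>u. u \<in> ball u0 \<delta> \<Longrightarrow> norm (d\<psi> u - d\<psi> u0) \<le> e"
proof -
  have "isCont d\<psi> u0" using d\<psi>_cont by (simp add: continuous_on_eq_continuous_at)
  then obtain \<delta> where \<delta>: "0 < \<delta>" "\<And>u. dist u u0 < \<delta> \<Longrightarrow> dist (d\<psi> u) (d\<psi> u0) < e"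
    using \<open>0 < e\<close> unfolding continuous_at_eps_delta by blast
  have n: "norm (d\<psi> u - d\<psi> u0) \<le> e" if "u \<in> ball u0 \<delta>" for u
    using \<delta>(2)[of u] that by (simp add: dist_norm norm_minus_commute less_imp_le)
  have "\<bar>\<psi> u - \<psi> v - d\<psi> u0 \<bullet> (u - v)\<bar> \<le> e * norm (u - v)" if "u \<in> ball u0 \<delta>" "v \<in> ball u0 \<delta>" for u v
  proof -
    have "norm ((\<psi> u - d\<psi> u0 \<bullet> u) - (\<psi> v - d\<psi> u0 \<bullet> v)) \<le> e * norm (u - v)"
    proof (rule differentiable_bound[OF convex_ball[of u0 \<delta>]])
      fix w assume w: "w \<in> ball u0 \<delta>"
      have "((\<lambda>u. \<psi> u - d\<psi> u0 \<bullet> u) has_derivative (\<lambda>h. d\<psi> w \<bullet> h - d\<psi> u0 \<bullet> h)) (at w)"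
        by (intro has_derivative_diff \<psi>_deriv has_derivative_inner_right has_derivative_ident)
      then show "((\<lambda>u. \<psi> u - d\<psi> u0 \<bullet> u) has_derivative (\<lambda>h. d\<psi> w \<bullet> h - d\<psi> u0 \<bullet> h)) (at w within ball u0 \<delta>)"
        by (rule has_derivative_at_withinI)
      show "onorm (\<lambda>h. d\<psi> w \<bullet> h - d\<psi> u0 \<bullet> h) \<le> e"
      proof (rule onorm_bound)
        fix h
        have "\<bar>(d\<psi> w - d\<psi> u0) \<bullet> h\<bar> \<le> norm (d\<psi> w - d\<psi> u0) * norm h" by (rule Cauchy_Schwarz_ineq2)
        also have "\<dots> \<le> e * norm h" using n[OF w] by (rule mult_right_mono) simp
        finally show "norm (d\<psi> w \<bullet> h - d\<psi> u0 \<bullet> h) \<le> e * norm h" by (simp add: inner_diff_left)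
      qed (use \<open>0 < e\<close> in simp)
    qed (use that in auto)
    then show ?thesis by (simp add: inner_diff_right algebra_simps)
  qed
  with \<delta>(1) n show ?thesis using that by blast
qed

text \<open>Near \<open>u0\<close> the graph and the graph of the linear part are related by maps
  with Lipschitz constant \<open>1 + e\<close> both ways, which costs \<open>(1 + e) ^ m\<close>;
  replacing \<open>J u\<close> by \<open>J u0\<close> costs one more factor, hence the exponent
  \<open>m + 1\<close>.\<close>

lemma area_local:
  assumes e: "0 < e" and u0: "u0 \<in> T"
  obtains \<delta> where "0 < \<delta>" "\<And>A. A \<in> sets borel \<Longrightarrow> A \<subseteq> T \<Longrightarrow> A \<subseteq> ball u0 \<delta> \<Longrightarrow>
     emeasure M (\<Phi> ` A) \<le> ennreal ((1 + e) ^ (m + 1)) * emeasure (density lam J) A \<and>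
     emeasure (density lam J) A \<le> ennreal ((1 + e) ^ (m + 1)) * emeasure M (\<Phi> ` A)"
proof -
  obtain \<delta> where \<delta>: "0 < \<delta>"
    "\<And>u v. u \<in> ball u0 \<delta> \<Longrightarrow> v \<in> ball u0 \<delta> \<Longrightarrow> \<bar>\<psi> u - \<psi> v - d\<psi> u0 \<bullet> (u - v)\<bar> \<le> e * norm (u - v)"
    "\<And>u. u \<in> ball u0 \<delta> \<Longrightarrow> norm (d\<psi> u - d\<psi> u0) \<le> e"
    by (rule dist_\<Phi>_linearization[OF e u0]) blast
  have "emeasure M (\<Phi> ` A) \<le> ennreal ((1 + e) ^ (m + 1)) * emeasure (density lam J) A \<and>
     emeasure (density lam J) A \<le> ennreal ((1 + e) ^ (m + 1)) * emeasure M (\<Phi> ` A)"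
    if A [measurable]: "A \<in> sets borel" and AT: "A \<subseteq> T" and AB: "A \<subseteq> ball u0 \<delta>" for A
  proof -
    let ?L = "\<lambda>u. u + (d\<psi> u0 \<bullet> u) *\<^sub>R \<nu>"
    let ?K = "ennreal ((1 + e) ^ m)"
    have projL: "proj (?L u) = u" if "u \<in> T" for u by (rule proj_add_\<nu>[OF that])
    have LA: "?L ` A \<in> sets borel"
    proof -
      have "?L ` A = {y. proj y \<in> A \<and> y = ?L (proj y)}" using projL AT by (auto simp: image_iff subset_iff)
      moreover have "{y \<in> space borel. proj y \<in> A \<and> y = ?L (proj y)} \<in> sets borel" by measurable
      ultimately show ?thesis by simp
    qed
    have PA: "\<Phi> ` A \<in> sets borel" by (rule sets_\<Phi>_image[OF A AT])
    have cmp: "norm ((\<Phi> u - \<Phi> v) - (?L u - ?L v)) \<le> e * norm (u - v)" if "u \<in> A" "v \<in> A" for u v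
    proof -
      have "(\<Phi> u - \<Phi> v) - (?L u - ?L v) = (\<psi> u - \<psi> v - d\<psi> u0 \<bullet> (u - v)) *\<^sub>R \<nu>"
        by (simp add: \<Phi>_def inner_diff_right algebra_simps)
      moreover have "u \<in> ball u0 \<delta>" "v \<in> ball u0 \<delta>" using that AB by auto
      ultimately show ?thesis using \<delta>(2)[of u v] norm_\<nu> by simp
    qed
    have le\<Phi>: "norm (u - v) \<le> norm (\<Phi> u - \<Phi> v)" and leL: "norm (u - v) \<le> norm (?L u - ?L v)" if "u \<in> A" "v \<in> A" for u v
    proof -
      have T: "u - v \<in> T" using that AT by (auto intro: span_diff)
      have "\<Phi> u - \<Phi> v = (u - v) + (\<psi> u - \<psi> v) *\<^sub>R \<nu>" by (simp add: \<Phi>_def algebra_simps)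
      then show "norm (u - v) \<le> norm (\<Phi> u - \<Phi> v)" using norm_le_add_\<nu>[OF T] by (simp only:)
      have "?L u - ?L v = (u - v) + (d\<psi> u0 \<bullet> (u - v)) *\<^sub>R \<nu>" by (simp add: inner_diff_right algebra_simps)
      then show "norm (u - v) \<le> norm (?L u - ?L v)" using norm_le_add_\<nu>[OF T] by (simp only:)
    qed
    have "emeasure M ((\<lambda>y. \<Phi> (proj y)) ` (?L ` A)) \<le> ?K * emeasure M (?L ` A)"
    proof (rule M_lipschitz)
      show "(\<lambda>y. \<Phi> (proj y)) ` ?L ` A \<in> sets borel"
        using PA projL AT by (simp add: image_image subset_iff cong: image_cong)
      fix y z assume "y \<in> ?L ` A" "z \<in> ?L ` A"
      then obtain u v where uv: "u \<in> A" "v \<in> A" "y = ?L u" "z = ?L v" by auto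
      have "norm (\<Phi> u - \<Phi> v) \<le> norm (?L u - ?L v) + norm ((\<Phi> u - \<Phi> v) - (?L u - ?L v))"
        by (rule norm_triangle_sub)
      also have "\<dots> \<le> norm (?L u - ?L v) + e * norm (?L u - ?L v)"
        using order_trans[OF cmp[OF uv(1,2)] mult_left_mono[OF leL[OF uv(1,2)]]] e by simp
      finally show "dist (\<Phi> (proj y)) (\<Phi> (proj z)) \<le> (1 + e) * dist y z"
        using uv projL AT by (simp add: dist_norm subset_iff algebra_simps)
    qed (use LA e in auto)
    moreover have "(\<lambda>y. \<Phi> (proj y)) ` (?L ` A) = \<Phi> ` A"
      using projL AT by (simp add: image_image subset_iff cong: image_cong)
    ultimately have up: "emeasure M (\<Phi> ` A) \<le> ?K * emeasure M (?L ` A)" by simp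
    have "emeasure M ((\<lambda>y. ?L (proj (y - x))) ` (\<Phi> ` A)) \<le> ?K * emeasure M (\<Phi> ` A)"
    proof (rule M_lipschitz)
      show "(\<lambda>y. ?L (proj (y - x))) ` \<Phi> ` A \<in> sets borel"
        using LA proj_\<Phi> AT by (simp add: image_image subset_iff cong: image_cong)
      fix y z assume "y \<in> \<Phi> ` A" "z \<in> \<Phi> ` A"
      then obtain u v where uv: "u \<in> A" "v \<in> A" "y = \<Phi> u" "z = \<Phi> v" by auto
      have "norm (?L u - ?L v) \<le> norm (\<Phi> u - \<Phi> v) + norm ((?L u - ?L v) - (\<Phi> u - \<Phi> v))"
        by (rule norm_triangle_sub)
      also have "norm ((?L u - ?L v) - (\<Phi> u - \<Phi> v)) = norm ((\<Phi> u - \<Phi> v) - (?L u - ?L v))"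
        by (rule norm_minus_commute)
      also have "norm (\<Phi> u - \<Phi> v) + \<dots> \<le> norm (\<Phi> u - \<Phi> v) + e * norm (\<Phi> u - \<Phi> v)"
        using order_trans[OF cmp[OF uv(1,2)] mult_left_mono[OF le\<Phi>[OF uv(1,2)]]] e by simp
      finally show "dist (?L (proj (y - x))) (?L (proj (z - x))) \<le> (1 + e) * dist y z"
        using uv proj_\<Phi> AT by (simp add: dist_norm subset_iff algebra_simps)
    qed (use PA e in auto)
    moreover have "(\<lambda>y. ?L (proj (y - x))) ` (\<Phi> ` A) = ?L ` A"
      using proj_\<Phi> AT by (simp add: image_image subset_iff cong: image_cong)
    ultimately have dn: "emeasure M (?L ` A) \<le> ?K * emeasure M (\<Phi> ` A)" by simp
    have L: "emeasure M (?L ` A) = ennreal (J u0) * emeasure lam A"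
      unfolding J_def by (rule M_linear_graph[OF d\<psi>_T A AT])
    have Jcmp: "J u \<le> (1 + e) * J u0" "J u0 \<le> (1 + e) * J u" if u: "u \<in> A" for u
    proof -
      \<comment> \<open>\<open>J\<close> is the Euclidean norm of the pair
        \<open>(1, d\<psi> w)\<close>, hence 1-Lipschitz in the gradient; \<open>J \<ge> 1\<close>
        turns the additive error into a factor.\<close>
      have nJ: "J w = norm (1::real, d\<psi> w)" for w by (simp add: J_def norm_prod_def)
      have "\<bar>J u - J u0\<bar> \<le> norm ((1::real, d\<psi> u) - (1, d\<psi> u0))" unfolding nJ by (rule norm_triangle_ineq3)
      also have "\<dots> \<le> e" using \<delta>(3)[of u] u AB by (auto simp: norm_prod_def)
      finally have "\<bar>J u - J u0\<bar> \<le> e" .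
      moreover have "e \<le> e * J u" "e \<le> e * J u0" using J_ge_1[of u] J_ge_1[of u0] e by (simp_all add: mult_le_cancel_left1)
      ultimately show "J u \<le> (1 + e) * J u0" "J u0 \<le> (1 + e) * J u" unfolding distrib_right by linarith+
    qed
    have N: "emeasure (density lam J) A = (\<integral>\<^sup>+u. ennreal (J u) * indicator A u \<partial>lam)"
      by (subst emeasure_density) auto
    have c: "(\<integral>\<^sup>+u. ennreal c * indicator A u \<partial>lam) = ennreal c * emeasure lam A" for c :: real
      by (subst nn_integral_cmult) auto
    have up2: "ennreal (J u0) * emeasure lam A \<le> ennreal (1 + e) * emeasure (density lam J) A"
    proof -
      have "ennreal (J u0) * emeasure lam A = (\<integral>\<^sup>+u. ennreal (J u0) * indicator A u \<partial>lam)" by (simp add: c)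
      also have "\<dots> \<le> (\<integral>\<^sup>+u. ennreal (1 + e) * (ennreal (J u) * indicator A u) \<partial>lam)"
      proof (rule nn_integral_mono)
        fix u show "ennreal (J u0) * indicator A u \<le> ennreal (1 + e) * (ennreal (J u) * indicator A u)"
          using Jcmp(2)[of u] J_ge_1[of u] e
          by (auto simp: indicator_def ennreal_mult[symmetric] simp del: ennreal_plus intro!: ennreal_leI)
      qed
      also have "\<dots> = ennreal (1 + e) * emeasure (density lam J) A"
        unfolding N by (rule nn_integral_cmult) auto
      finally show ?thesis .
    qed
    have dn2: "emeasure (density lam J) A \<le> ennreal (1 + e) * (ennreal (J u0) * emeasure lam A)"
    proof -
      have "emeasure (density lam J) A \<le> (\<integral>\<^sup>+u. ennreal ((1 + e) * J u0) * indicator A u \<partial>lam)"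
        unfolding N
      proof (rule nn_integral_mono)
        fix u show "ennreal (J u) * indicator A u \<le> ennreal ((1 + e) * J u0) * indicator A u"
          using Jcmp(1)[of u] by (auto simp: indicator_def intro!: ennreal_leI)
      qed
      also have "\<dots> = ennreal (1 + e) * (ennreal (J u0) * emeasure lam A)"
        unfolding c using e J_ge_1[of u0] by (simp add: ennreal_mult mult.assoc)
      finally show ?thesis .
    qed
    have K: "ennreal ((1 + e) ^ (m + 1)) = ?K * ennreal (1 + e)"
      using e by (simp add: ennreal_mult mult.commute)
    show ?thesis
    proof
      have "emeasure M (\<Phi> ` A) \<le> ?K * (ennreal (1 + e) * emeasure (density lam J) A)"
        by (rule order_trans[OF up]) (unfold L, rule mult_left_mono[OF up2], simp)
      then show "emeasure M (\<Phi> ` A) \<le> ennreal ((1 + e) ^ (m + 1)) * emeasure (density lam J) A"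
        unfolding K by (simp only: mult.assoc)
      have "emeasure (density lam J) A \<le> ennreal (1 + e) * (?K * emeasure M (\<Phi> ` A))"
        by (rule order_trans[OF dn2]) (unfold L[symmetric], rule mult_left_mono[OF dn], simp)
      then show "emeasure (density lam J) A \<le> ennreal ((1 + e) ^ (m + 1)) * emeasure M (\<Phi> ` A)"
        unfolding K by (simp only: mult_ac)
    qed
  qed
  with \<delta>(1) show ?thesis using that by blast
qed

text \<open>The local estimates are summed over a countable disjoint refinement of the balls
  (Lindelof); both sides are additive along it, the left one because \<Phi> is injective on
  \<open>T\<close>.\<close>

lemma area_up_to:
  assumes e: "0 < e" and A [measurable]: "A \<in> sets borel" and AT: "A \<subseteq> T"
  shows "emeasure M (\<Phi> ` A) \<le> ennreal ((1 + e) ^ (m + 1)) * emeasure (density lam J) A"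
    and "emeasure (density lam J) A \<le> ennreal ((1 + e) ^ (m + 1)) * emeasure M (\<Phi> ` A)"
proof -
  let ?K = "ennreal ((1 + e) ^ (m + 1))"
  let ?N = "density lam J"
  have "\<exists>\<delta>>0. \<forall>A. A \<in> sets borel \<longrightarrow> A \<subseteq> T \<longrightarrow> A \<subseteq> ball u \<delta> \<longrightarrow>
     emeasure M (\<Phi> ` A) \<le> ?K * emeasure ?N A \<and> emeasure ?N A \<le> ?K * emeasure M (\<Phi> ` A)" if "u \<in> T" for u
    using area_local[OF e that] by metis
  then obtain \<delta> where \<delta>: "\<And>u. u \<in> T \<Longrightarrow> 0 < \<delta> u" and loc: "\<And>u A. u \<in> T \<Longrightarrow> A \<in> sets borel \<Longrightarrow> A \<subseteq> T \<Longrightarrow> A \<subseteq> ball u (\<delta> u) \<Longrightarrow>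
     emeasure M (\<Phi> ` A) \<le> ?K * emeasure ?N A \<and> emeasure ?N A \<le> ?K * emeasure M (\<Phi> ` A)"
    by metis
  let ?F = "(\<lambda>u. ball u (\<delta> u)) ` T"
  obtain F' where F': "F' \<subseteq> ?F" "countable F'" "\<Union>F' = \<Union>?F"
    by (rule Lindelof[of ?F]) auto
  have cov: "T \<subseteq> \<Union>F'" unfolding F'(3) using \<delta> by force
  then have "F' \<noteq> {}" using span_zero[of B] by blast
  define C where "C = disjointed (from_nat_into F')"
  have Fi: "from_nat_into F' n \<in> F'" for n using \<open>F' \<noteq> {}\<close> by (rule from_nat_into)
  have Fb: "from_nat_into F' n \<in> sets borel" for n using Fi[of n] F'(1) by auto
  have Cb [measurable]: "C n \<in> sets borel" for n
  proof -
    have "range C \<subseteq> sets borel" unfolding C_def by (rule sets.range_disjointed_sets) (use Fb in auto)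
    then show ?thesis by auto
  qed
  have UC: "(\<Union>n. C n) = \<Union>F'"
    unfolding C_def UN_disjointed_eq using F'(2) \<open>F' \<noteq> {}\<close> by (simp add: range_from_nat_into)
  have dC: "disjoint_family C" unfolding C_def by (rule disjoint_family_disjointed)
  have UA: "(\<Union>n. A \<inter> C n) = A" using AT cov UC by blast
  have dA: "disjoint_family (\<lambda>n. A \<inter> C n)" using dC by (auto simp: disjoint_family_on_def)
  have N: "emeasure ?N A = (\<Sum>n. emeasure ?N (A \<inter> C n))"
  proof -
    have "(\<Sum>n. emeasure ?N (A \<inter> C n)) = emeasure ?N (\<Union>n. A \<inter> C n)"
      by (rule suminf_emeasure[OF _ dA]) auto
    then show ?thesis unfolding UA ..
  qed
  have PM: "emeasure M (\<Phi> ` A) = (\<Sum>n. emeasure M (\<Phi> ` (A \<inter> C n)))"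
  proof -
    have "(\<Sum>n. emeasure M (\<Phi> ` (A \<inter> C n))) = emeasure M (\<Union>n. \<Phi> ` (A \<inter> C n))"
    proof (rule suminf_emeasure)
      have "\<Phi> ` (A \<inter> C n) \<in> sets borel" for n by (rule sets_\<Phi>_image) (use AT in auto)
      then show "range (\<lambda>n. \<Phi> ` (A \<inter> C n)) \<subseteq> sets M" by (auto simp: sets_M)
      show "disjoint_family (\<lambda>n. \<Phi> ` (A \<inter> C n))"
        unfolding disjoint_family_on_def
      proof (intro ballI impI)
        fix i j :: nat assume "i \<noteq> j"
        then have "(A \<inter> C i) \<inter> (A \<inter> C j) = {}" using dA by (auto simp: disjoint_family_on_def)
        then show "\<Phi> ` (A \<inter> C i) \<inter> \<Phi> ` (A \<inter> C j) = {}"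
          using inj_on_image_Int[OF inj_\<Phi>, of "A \<inter> C i" "A \<inter> C j"] AT by auto
      qed
    qed
    also have "(\<Union>n. \<Phi> ` (A \<inter> C n)) = \<Phi> ` A" unfolding image_UN[symmetric] UA ..
    finally show ?thesis ..
  qed
  have each: "emeasure M (\<Phi> ` (A \<inter> C n)) \<le> ?K * emeasure ?N (A \<inter> C n) \<and> emeasure ?N (A \<inter> C n) \<le> ?K * emeasure M (\<Phi> ` (A \<inter> C n))" for n
  proof -
    obtain u where u: "u \<in> T" "from_nat_into F' n = ball u (\<delta> u)" using Fi[of n] F'(1) by auto
    have "C n \<subseteq> from_nat_into F' n" unfolding C_def by (rule disjointed_subset)
    then show ?thesis using u AT by (intro loc[OF u(1)]) auto
  qed
  show "emeasure M (\<Phi> ` A) \<le> ?K * emeasure ?N A"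
    unfolding PM N ennreal_suminf_cmult[symmetric] using each by (intro suminf_le) auto
  show "emeasure ?N A \<le> ?K * emeasure M (\<Phi> ` A)"
    unfolding PM N ennreal_suminf_cmult[symmetric] using each by (intro suminf_le) auto
qed

theorem area_formula:
  assumes A: "A \<in> sets borel" and AT: "A \<subseteq> T"
  shows "emeasure M (\<Phi> ` A) = emeasure (density lam J) A"
proof -
  \<comment> \<open>The loss \<open>(1 + e) ^ (m + 1)\<close> tends to 1; an infinite
    \<open>Y\<close> is trivial.\<close>
  have lim: "X \<le> Y" if le: "\<And>e. 0 < e \<Longrightarrow> X \<le> ennreal ((1 + e) ^ (m + 1)) * Y" for X Y
  proof (cases "Y = \<infinity>")
    case False
    have "(\<lambda>n. ennreal ((1 + 1 / real (Suc n)) ^ (m + 1)) * Y) \<longlonglongrightarrow> ennreal ((1 + 0) ^ (m + 1)) * Y"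
    proof (intro tendsto_mult_ennreal tendsto_const tendsto_ennrealI tendsto_power tendsto_add)
      show "(\<lambda>n. 1 / real (Suc n)) \<longlonglongrightarrow> 0" using LIMSEQ_inverse_real_of_nat by (simp add: inverse_eq_divide)
    qed (use False in auto)
    then have "X \<le> ennreal ((1 + 0) ^ (m + 1)) * Y"
      by (rule LIMSEQ_le_const) (use le in auto)
    then show ?thesis by simp
  qed simp
  show ?thesis
    by (rule antisym; rule lim; rule area_up_to[OF _ A AT])
qed

lemma integral_graph:
  fixes h :: "'a \<Rightarrow> 'b::{banach, second_countable_topology}"
  assumes S [measurable]: "S \<in> sets borel" and ST: "S \<subseteq> T"
    and h: "(\<lambda>y. indicator (\<Phi> ` S) y *\<^sub>R h y) \<in> borel_measurable borel"
  shows "set_integrable M (\<Phi> ` S) h \<longleftrightarrow> integrable lam (\<lambda>u. indicator S u *\<^sub>R (J u *\<^sub>R h (\<Phi> u)))"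
    and "(LINT y:\<Phi> ` S|M. h y) = (\<integral>u. indicator S u *\<^sub>R (J u *\<^sub>R h (\<Phi> u)) \<partial>lam)"
proof -
  let ?h = "\<lambda>y. indicator (\<Phi> ` S) y *\<^sub>R h y"
  have PS [measurable]: "\<Phi> ` S \<in> sets borel" by (rule sets_\<Phi>_image[OF S ST])
  \<comment> \<open>The area formula as an identity of measures: \<open>M\<close> on the graph is
    the image under \<Phi> of \<open>lam\<close> with density \<open>J\<close> on \<open>S\<close>.
    Both claims are then changes of variables.\<close>
  have eq: "density M (indicator (\<Phi> ` S)) = distr (density lam (\<lambda>u. ennreal (J u) * indicator S u)) borel \<Phi>"
  proof (rule measure_eqI)
    fix E assume "E \<in> sets (density M (indicator (\<Phi> ` S)))"
    then have E [measurable]: "E \<in> sets borel" by (simp add: sets_M)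
    have pre: "\<Phi> -` E \<in> sets borel"
      using measurable_sets[OF measurable_\<Phi> E] by simp
    have img: "\<Phi> ` (S \<inter> \<Phi> -` E) = \<Phi> ` S \<inter> E" by auto
    have "emeasure (density M (indicator (\<Phi> ` S))) E = emeasure M (\<Phi> ` S \<inter> E)"
    proof -
      have "emeasure (density M (indicator (\<Phi> ` S))) E = (\<integral>\<^sup>+y. indicator (\<Phi> ` S) y * indicator E y \<partial>M)"
        by (subst emeasure_density) (auto simp: sets_M)
      also have "\<dots> = (\<integral>\<^sup>+y. indicator (\<Phi> ` S \<inter> E) y \<partial>M)"
        by (rule nn_integral_cong) (simp split: split_indicator)
      finally show ?thesis by (simp add: sets_M)
    qed
    also have "\<dots> = emeasure (density lam J) (S \<inter> \<Phi> -` E)"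
      unfolding img[symmetric] by (rule area_formula) (use pre ST in auto)
    also have "\<dots> = (\<integral>\<^sup>+u. ennreal (J u) * indicator (S \<inter> \<Phi> -` E) u \<partial>lam)"
      using pre by (subst emeasure_density) auto
    also have "\<dots> = (\<integral>\<^sup>+u. ennreal (J u) * indicator S u * indicator (\<Phi> -` E) u \<partial>lam)"
      by (rule nn_integral_cong) (simp split: split_indicator)
    also have "\<dots> = emeasure (distr (density lam (\<lambda>u. ennreal (J u) * indicator S u)) borel \<Phi>) E"
      using pre by (subst emeasure_distr) (auto simp: emeasure_density)
    finally show "emeasure (density M (indicator (\<Phi> ` S))) E
       = emeasure (distr (density lam (\<lambda>u. ennreal (J u) * indicator S u)) borel \<Phi>) E" .
  qed (simp add: sets_M)
  have h\<Phi> [measurable]: "(\<lambda>u. ?h (\<Phi> u)) \<in> borel_measurable borel" using h by measurable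
  have ind: "indicator S u *\<^sub>R ?h (\<Phi> u) = indicator S u *\<^sub>R h (\<Phi> u)" for u by (auto simp: indicator_def)
  have dens: "density lam (\<lambda>u. ennreal (J u) * indicator S u) = density lam (\<lambda>u. ennreal (J u * indicator S u))"
    by (rule density_cong) (auto simp: indicator_def)
  have densM: "density M (indicator (\<Phi> ` S)) = density M (\<lambda>y. ennreal (indicator (\<Phi> ` S) y))"
    by (rule density_cong) (auto simp: indicator_def sets_M)
  have fin: "(J u * indicator S u) *\<^sub>R ?h (\<Phi> u) = indicator S u *\<^sub>R (J u *\<^sub>R h (\<Phi> u))" for u
    by (auto simp: indicator_def)
  have idem: "indicator (\<Phi> ` S) y * indicator (\<Phi> ` S) y = (indicator (\<Phi> ` S) y :: real)" for y
    by (auto simp: indicator_def)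
  have hM: "?h \<in> borel_measurable M" using h by (simp add: measurable_cong_sets[OF sets_M refl])
  have iM: "(indicator (\<Phi> ` S) :: 'a \<Rightarrow> real) \<in> borel_measurable M" by (simp add: sets_M)
  have J0: "0 \<le> J u * indicator S u" for u using J_ge_1[of u] by (auto simp: indicator_def)
  have "set_integrable M (\<Phi> ` S) h \<longleftrightarrow> integrable (density M (\<lambda>y. ennreal (indicator (\<Phi> ` S) y))) ?h"
    unfolding set_integrable_def
    by (subst integrable_density[OF hM iM]) (simp_all only: scaleR_scaleR idem, simp)
  also have "\<dots> \<longleftrightarrow> integrable (density lam (\<lambda>u. ennreal (J u * indicator S u))) (\<lambda>u. ?h (\<Phi> u))"
    unfolding densM[symmetric] eq dens using h by (subst integrable_distr_eq) auto
  also have "\<dots> \<longleftrightarrow> integrable lam (\<lambda>u. (J u * indicator S u) *\<^sub>R ?h (\<Phi> u))"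
    by (subst integrable_density) (use J0 in auto)
  finally show "set_integrable M (\<Phi> ` S) h \<longleftrightarrow> integrable lam (\<lambda>u. indicator S u *\<^sub>R (J u *\<^sub>R h (\<Phi> u)))"
    unfolding fin .
  have "(LINT y:\<Phi> ` S|M. h y) = integral\<^sup>L (density M (\<lambda>y. ennreal (indicator (\<Phi> ` S) y))) ?h"
    unfolding set_lebesgue_integral_def
    by (subst integral_density[OF hM iM]) (simp_all only: scaleR_scaleR idem, simp)
  also have "\<dots> = (\<integral>u. ?h (\<Phi> u) \<partial>density lam (\<lambda>u. ennreal (J u * indicator S u)))"
    unfolding densM[symmetric] eq dens using h by (subst integral_distr) auto
  also have "\<dots> = (\<integral>u. (J u * indicator S u) *\<^sub>R ?h (\<Phi> u) \<partial>lam)"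
    by (subst integral_density) (use J0 in auto)
  finally show "(LINT y:\<Phi> ` S|M. h y) = (\<integral>u. indicator S u *\<^sub>R (J u *\<^sub>R h (\<Phi> u)) \<partial>lam)"
    unfolding fin .
qed

end

section \<open>Integrals over a hyperplane\<close>

lemma sets_cball [measurable]: "cball (a :: 'a::metric_space) r \<in> sets borel"
  by (simp add: borel_closed)

text \<open>Writes a negative power of \<open>w\<close> as a mixture of exponentials in
  \<open>w\<close>, which turns the integral of the Poisson kernel below into Gaussian ones.\<close>

lemma nn_integral_Gamma:
  assumes "0 < (a::real)" "0 < w"
  shows "(\<integral>\<^sup>+s. ennreal (indicator {0<..} s * (s powr (a - 1) * exp (- s * w))) \<partial>lborel) = ennreal (Gamma a / w powr a)"
proof -
  let ?f = "\<lambda>s::real. indicator {0<..} s * (s powr (a - 1) * exp (- s))"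
  have [measurable]: "?f \<in> borel_measurable borel" by measurable
  have "((\<lambda>t. t powr (a - 1) / exp t) has_integral Gamma a) {0..}" by (rule Gamma_integral_real) fact
  then have "((\<lambda>t. if t \<in> {0..} then t powr (a - 1) / exp t else 0) has_integral Gamma a) UNIV"
    by (simp only: has_integral_restrict_UNIV)
  then have "(?f has_integral Gamma a) UNIV"
    by (rule has_integral_spike[of "{0}", rotated 2]) (auto simp: indicator_def exp_minus divide_inverse)
  then have G: "(\<integral>\<^sup>+s. ennreal (?f s) \<partial>lborel) = ennreal (Gamma a)"
    by (intro nn_integral_has_integral_lborel) (auto simp: indicator_def)
  have "ennreal (Gamma a) = ennreal \<bar>w\<bar> * (\<integral>\<^sup>+s. ennreal (?f (0 + w * s)) \<partial>lborel)"
    unfolding G[symmetric] using assms(2) by (intro nn_integral_real_affine) auto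
  also have "(\<lambda>s. ennreal (?f (0 + w * s))) = (\<lambda>s. ennreal (w powr (a - 1)) * ennreal (indicator {0<..} s * (s powr (a - 1) * exp (- s * w))))"
    using assms(2)
    by (auto simp: fun_eq_iff indicator_def powr_mult zero_less_mult_iff ennreal_mult[symmetric] mult_ac)
  also have "ennreal \<bar>w\<bar> * (\<integral>\<^sup>+s. ennreal (w powr (a - 1)) * ennreal (indicator {0<..} s * (s powr (a - 1) * exp (- s * w))) \<partial>lborel)
     = ennreal \<bar>w\<bar> * ennreal (w powr (a - 1)) * (\<integral>\<^sup>+s. ennreal (indicator {0<..} s * (s powr (a - 1) * exp (- s * w))) \<partial>lborel)"
    by (subst nn_integral_cmult) (auto simp: mult.assoc)
  also have "ennreal \<bar>w\<bar> * ennreal (w powr (a - 1)) = ennreal (w powr a)"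
    using assms(2) by (simp add: ennreal_mult[symmetric] powr_mult_base)
  finally have "ennreal (1 / w powr a) * ennreal (Gamma a) = ennreal (1 / w powr a) * ennreal (w powr a) *
      (\<integral>\<^sup>+s. ennreal (indicator {0<..} s * (s powr (a - 1) * exp (- s * w))) \<partial>lborel)"
    by (simp only: mult.assoc)
  also have "ennreal (1 / w powr a) * ennreal (w powr a) = 1"
    using assms(2) by (subst ennreal_mult[symmetric]) auto
  also have "ennreal (1 / w powr a) * ennreal (Gamma a) = ennreal (Gamma a / w powr a)"
    using assms Gamma_real_pos[of a] by (subst ennreal_mult[symmetric]) auto
  finally show ?thesis by simp
qed

context hyperplane begin

text \<open>The integrand is, up to a constant, the Poisson kernel of a half-space at height 1. With
  the power written by \<open>nn_integral_Gamma\<close> and the integrals exchanged, the inner one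
  is a product of one-dimensional Gaussians. For \<open>m = p + 1\<close> the value is half of
  \<open>sphere_area p\<close>.\<close>

lemma nn_integral_poisson:
  "(\<integral>\<^sup>+v. ennreal (1 / sqrt (1 + (norm v)\<^sup>2) ^ (m + 1)) \<partial>lam)
    = ennreal (Gamma (1/2) ^ (m + 1) / Gamma (real (m + 1) / 2))"
proof -
  let ?a = "real (m + 1) / 2"
  have a: "0 < ?a" by simp
  interpret L: sigma_finite_measure lam by (rule sigma_finite_flat)
  interpret pair_sigma_finite lam lborel ..
  let ?g = "\<lambda>(v::'a) (s::real). ennreal (indicator {0<..} s * (s powr (?a - 1) * exp (- s * (1 + (norm v)\<^sup>2))))"
  have w: "sqrt (1 + (norm v)\<^sup>2) ^ (m + 1) = (1 + (norm v)\<^sup>2) powr ?a" for v :: 'a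
  proof -
    have p: "0 < 1 + (norm v)\<^sup>2" by (simp add: add_pos_nonneg)
    then have "(1 + (norm v)\<^sup>2) powr ?a = ((1 + (norm v)\<^sup>2) powr (1/2)) powr real (m + 1)"
      by (simp add: powr_powr)
    also have "\<dots> = sqrt (1 + (norm v)\<^sup>2) ^ (m + 1)"
      using p by (subst powr_realpow) (auto simp: powr_half_sqrt)
    finally show ?thesis ..
  qed
  have "ennreal (Gamma ?a) * (\<integral>\<^sup>+v. ennreal (1 / sqrt (1 + (norm v)\<^sup>2) ^ (m + 1)) \<partial>lam)
      = (\<integral>\<^sup>+v. ennreal (Gamma ?a) * ennreal (1 / sqrt (1 + (norm v)\<^sup>2) ^ (m + 1)) \<partial>lam)"
    by (rule nn_integral_cmult[symmetric]) measurable
  also have "\<dots> = (\<integral>\<^sup>+v. (\<integral>\<^sup>+s. ?g v s \<partial>lborel) \<partial>lam)"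
  proof (rule nn_integral_cong)
    fix v :: 'a
    have "0 < 1 + (norm v)\<^sup>2" by (simp add: add_pos_nonneg)
    then show "ennreal (Gamma ?a) * ennreal (1 / sqrt (1 + (norm v)\<^sup>2) ^ (m + 1)) = (\<integral>\<^sup>+s. ?g v s \<partial>lborel)"
      unfolding w using Gamma_real_pos[OF a] by (subst nn_integral_Gamma[OF a]) (auto simp: ennreal_mult[symmetric])
  qed
  also have "\<dots> = (\<integral>\<^sup>+s. (\<integral>\<^sup>+v. ?g v s \<partial>lam) \<partial>lborel)"
    by (rule Fubini'[symmetric]) measurable
  also have "\<dots> = (\<integral>\<^sup>+s. ennreal (sqrt pi ^ m) * ennreal (indicator {0<..} s * (s powr (1/2 - 1) * exp (- s * 1))) \<partial>lborel)"
  proof (rule nn_integral_cong)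
    fix s :: real
    show "(\<integral>\<^sup>+v. ?g v s \<partial>lam) = ennreal (sqrt pi ^ m) * ennreal (indicator {0<..} s * (s powr (1/2 - 1) * exp (- s * 1)))"
    proof (cases "0 < s")
      case True
      have "(\<integral>\<^sup>+v. ?g v s \<partial>lam) = (\<integral>\<^sup>+v. ennreal (s powr (?a - 1) * exp (- s)) * ennreal (exp (- (\<Sum>b\<in>B. s * (v \<bullet> b)\<^sup>2))) \<partial>lam)"
      proof (rule nn_integral_cong_AE)
        show "AE v in lam. ?g v s = ennreal (s powr (?a - 1) * exp (- s)) * ennreal (exp (- (\<Sum>b\<in>B. s * (v \<bullet> b)\<^sup>2)))"
          using AE_flat
        proof eventually_elim
          case (elim v)
          have "(\<Sum>b\<in>B. s * (v \<bullet> b)\<^sup>2) = s * (norm v)\<^sup>2"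
            using inner_self_sum[OF elim] by (simp add: sum_distrib_left[symmetric] power2_norm_eq_inner)
          then show ?case
            using True by (simp add: ennreal_mult[symmetric] exp_add[symmetric] algebra_simps)
        qed
      qed
      also have "\<dots> = ennreal (s powr (?a - 1) * exp (- s)) * (\<Prod>b\<in>B. ennreal (sqrt (pi / s)))"
        using True by (subst nn_integral_cmult) (auto simp: nn_integral_gaussian_flat)
      also have "(\<Prod>b\<in>B. ennreal (sqrt (pi / s))) = ennreal (sqrt (pi / s) ^ m)"
        using card_B True by (simp add: ennreal_power)
      also have "ennreal (s powr (?a - 1) * exp (- s)) * ennreal (sqrt (pi / s) ^ m)
          = ennreal (s powr (?a - 1) * exp (- s) * sqrt (pi / s) ^ m)"
        using True by (intro ennreal_mult[symmetric]) auto
      \<comment> \<open>The \<open>m\<close> Gaussian factors contribute \<open>s\<close> to the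
        power \<open>- m / 2\<close>, so that the remaining power is the one of
        \<open>Gamma (1/2)\<close>.\<close>
      also have "s powr (?a - 1) * exp (- s) * sqrt (pi / s) ^ m = sqrt pi ^ m * (s powr (1/2 - 1) * exp (- s * 1))"
      proof -
        have "sqrt s ^ m = s powr (real m / 2)"
          using True by (simp add: powr_half_sqrt[symmetric] powr_powr powr_realpow[symmetric] del: powr_half_sqrt)
        then have "s powr (?a - 1) / sqrt s ^ m = s powr (?a - 1 - real m / 2)" by (simp add: powr_diff)
        moreover have "?a - 1 - real m / 2 = 1/2 - 1" by (simp add: field_simps)
        ultimately have "s powr (?a - 1) / sqrt s ^ m = s powr (1/2 - 1)" by simp
        moreover have "s powr (?a - 1) * exp (- s) * sqrt (pi / s) ^ m = sqrt pi ^ m * (s powr (?a - 1) / sqrt s ^ m * exp (- s * 1))"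
          by (simp only: real_sqrt_divide power_divide) simp
        ultimately show ?thesis by (simp only:)
      qed
      finally show ?thesis using True by (simp add: ennreal_mult[symmetric])
    qed simp
  qed
  also have "\<dots> = ennreal (sqrt pi ^ m) * (\<integral>\<^sup>+s. ennreal (indicator {0<..} s * (s powr (1/2 - 1) * exp (- s * 1))) \<partial>lborel)"
    by (rule nn_integral_cmult) measurable
  also have "\<dots> = ennreal (sqrt pi ^ m) * ennreal (Gamma (1/2) / 1 powr (1/2))"
    by (subst nn_integral_Gamma) auto
  also have "\<dots> = ennreal (Gamma (1/2) ^ (m + 1))"
    by (simp add: Gamma_one_half_real ennreal_mult[symmetric] mult.commute)
  finally have eq: "ennreal (Gamma ?a) * (\<integral>\<^sup>+v. ennreal (1 / sqrt (1 + (norm v)\<^sup>2) ^ (m + 1)) \<partial>lam)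
      = ennreal (Gamma (1/2) ^ (m + 1))" .
  have "ennreal (1 / g) * ennreal g = 1" if "0 < g" for g :: real
    using that by (subst ennreal_mult[symmetric]) auto
  from this[OF Gamma_real_pos[OF a]] have "ennreal (1 / Gamma ?a) * ennreal (Gamma ?a) = 1" .
  then have "(\<integral>\<^sup>+v. ennreal (1 / sqrt (1 + (norm v)\<^sup>2) ^ (m + 1)) \<partial>lam)
      = ennreal (1 / Gamma ?a) * (ennreal (Gamma ?a) * (\<integral>\<^sup>+v. ennreal (1 / sqrt (1 + (norm v)\<^sup>2) ^ (m + 1)) \<partial>lam))"
    by (simp add: mult.assoc[symmetric])
  also have "\<dots> = ennreal (Gamma (1/2) ^ (m + 1) / Gamma ?a)"
    unfolding eq using Gamma_real_pos[OF a] by (subst ennreal_mult[symmetric]) (auto simp: Gamma_one_half_real)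
  finally show ?thesis .
qed

text \<open>Up to sign, the scalar part of the flux of the unnormalized kernel through a whole
  hyperplane that misses the pole; it does not depend on the distance.\<close>

definition poisson_const :: real where
  "poisson_const = Gamma (1/2) ^ (m + 1) / Gamma (real (m + 1) / 2)"

lemma poisson_integral:
  "integrable lam (\<lambda>v. 1 / sqrt (1 + (norm v)\<^sup>2) ^ (m + 1))"
  "(\<integral>v. 1 / sqrt (1 + (norm v)\<^sup>2) ^ (m + 1) \<partial>lam) = poisson_const"
proof -
  have pos: "0 \<le> poisson_const"
    using Gamma_real_pos[of "real (m + 1) / 2"] by (auto simp: poisson_const_def Gamma_one_half_real)
  have "has_bochner_integral lam (\<lambda>v. 1 / sqrt (1 + (norm v)\<^sup>2) ^ (m + 1)) poisson_const"
    using nn_integral_poisson pos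
    by (intro has_bochner_integral_nn_integral) (auto simp: poisson_const_def)
  then show "integrable lam (\<lambda>v. 1 / sqrt (1 + (norm v)\<^sup>2) ^ (m + 1))"
    "(\<integral>v. 1 / sqrt (1 + (norm v)\<^sup>2) ^ (m + 1) \<partial>lam) = poisson_const"
    by (auto simp: has_bochner_integral_iff)
qed

lemma integrable_lam_bounded:
  fixes f :: "'a \<Rightarrow> 'b::{banach, second_countable_topology}"
  assumes [measurable]: "f \<in> borel_measurable borel"
    and bound: "\<And>u. u \<in> T \<Longrightarrow> norm (f u) \<le> C * indicator (cball 0 R) u"
  shows "integrable lam f"
proof (rule Bochner_Integration.integrable_bound)
  show "integrable lam (\<lambda>u. C * indicator (cball 0 R) u)"
    using emeasure_lam_cball_finite[of R] by (intro integrable_mult_right integrable_real_indicator) auto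
  show "AE u in lam. norm (f u) \<le> norm (C * indicator (cball 0 R) u)"
    using AE_flat by eventually_elim (use bound in \<open>force intro: order_trans[OF _ abs_ge_self]\<close>)
qed measurable

text \<open>Dyadic shells: where \<open>R / 2 ^ Suc k < norm u \<le> R / 2 ^ k\<close> the power is
  at most \<open>C k\<close>, and the ball has measure of order \<open>(R / 2 ^ k) ^ m\<close>. The
  products form a geometric series with ratio \<open>(1/2) powr \<alpha>\<close>.\<close>

lemma integrable_norm_powr:
  assumes \<alpha>: "0 < \<alpha>" "\<alpha> \<le> 1" and R: "0 < R"
  shows "integrable lam (\<lambda>u. indicator (cball 0 R) u * norm u powr (\<alpha> - real m))"
proof -
  let ?w = "emeasure lam (cball 0 1)"
  define C where "C k = (R / 2 ^ Suc k) powr (\<alpha> - real m)" for k :: nat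
  have le: "ennreal (indicator (cball 0 R) u * norm u powr (\<alpha> - real m))
      \<le> (\<Sum>k. ennreal (C k) * indicator (cball 0 (R / 2 ^ k)) u)" for u :: 'a
  proof (cases "u = 0 \<or> R < norm u")
    case True
    then show ?thesis by auto
  next
    case False
    then have u: "0 < norm u" "norm u \<le> R" by auto
    have ex: "\<exists>k. R / 2 ^ Suc k < norm u"
    proof -
      obtain k where "R / norm u < 2 ^ k" using real_arch_pow[of 2 "R / norm u"] by auto
      then have "R / norm u < 2 ^ Suc k" using u by (simp add: less_le_trans)
      then have "R / 2 ^ Suc k < norm u" using u by (simp add: field_simps)
      then show ?thesis ..
    qed
    define k where "k = (LEAST k. R / 2 ^ Suc k < norm u)"
    have k: "R / 2 ^ Suc k < norm u" unfolding k_def by (rule LeastI_ex[OF ex])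
    have k': "norm u \<le> R / 2 ^ k"
    proof (cases k)
      case (Suc j)
      then have "\<not> R / 2 ^ Suc j < norm u" using not_less_Least[of j "\<lambda>k. R / 2 ^ Suc k < norm u"] k_def by simp
      then show ?thesis using Suc by simp
    qed (use u in simp)
    have "norm u powr (\<alpha> - real m) \<le> C k"
      unfolding C_def using k u R \<alpha> m_pos by (intro powr_mono2') auto
    define g where "g k = ennreal (C k) * indicator (cball 0 (R / 2 ^ k)) u" for k
    have "ennreal (indicator (cball 0 R) u * norm u powr (\<alpha> - real m)) \<le> g k"
      using \<open>norm u powr (\<alpha> - real m) \<le> C k\<close> k' u by (auto simp: g_def intro!: ennreal_leI)
    also have "\<dots> \<le> (\<Sum>k. g k)" using sum_le_suminf[of g "{k}"] by simp
    finally show ?thesis by (simp only: g_def)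
  qed
  define q where "q = (1/2::real) powr \<alpha>"
  have q: "0 < q" "q < 1" using \<alpha> powr_less_mono'[of "1/2" 0 \<alpha>] by (auto simp: q_def)
  define c where "c = (R/2) powr (\<alpha> - real m) * R ^ m"
  have cq: "C k * (R / 2 ^ k) ^ m = c * q ^ k" for k
  proof -
    have e: "R / 2 ^ Suc k = (R/2) * (1/2) powr real k" "R / 2 ^ k = R * (1/2) powr real k"
      by (simp_all add: powr_realpow power_one_over)
    have "C k = (R/2) powr (\<alpha> - real m) * (1/2) powr (real k * (\<alpha> - real m))"
      unfolding C_def e(1) using R by (subst powr_mult) (auto simp: powr_powr)
    moreover have "(R / 2 ^ k) ^ m = R ^ m * (1/2) powr (real k * real m)"
      unfolding e(2) by (simp add: power_mult_distrib powr_realpow[symmetric] powr_powr)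
    ultimately have "C k * (R / 2 ^ k) ^ m = c * ((1/2) powr (real k * (\<alpha> - real m)) * (1/2) powr (real k * real m))"
      by (simp add: c_def)
    also have "(1/2) powr (real k * (\<alpha> - real m)) * (1/2) powr (real k * real m) = (1/2::real) powr (real k * \<alpha>)"
      by (simp add: powr_add[symmetric] algebra_simps)
    also have "(1/2::real) powr (real k * \<alpha>) = q ^ k"
      unfolding q_def by (simp add: powr_realpow[symmetric] powr_powr mult.commute)
    finally show ?thesis .
  qed
  have "(\<integral>\<^sup>+u. ennreal (indicator (cball 0 R) u * norm u powr (\<alpha> - real m)) \<partial>lam)
      \<le> (\<integral>\<^sup>+u. (\<Sum>k. ennreal (C k) * indicator (cball 0 (R / 2 ^ k)) u) \<partial>lam)"
    by (rule nn_integral_mono) (rule le)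
  also have "\<dots> = (\<Sum>k. \<integral>\<^sup>+u. ennreal (C k) * indicator (cball 0 (R / 2 ^ k)) u \<partial>lam)"
    by (rule nn_integral_suminf) measurable
  also have "\<dots> = (\<Sum>k. ennreal (c * q ^ k) * ?w)"
  proof (rule suminf_cong)
    fix k
    have "(\<integral>\<^sup>+u. ennreal (C k) * indicator (cball 0 (R / 2 ^ k)) u \<partial>lam) = ennreal (C k) * emeasure lam (cball 0 (R / 2 ^ k))"
      by (rule nn_integral_cmult_indicator) auto
    also have "\<dots> = ennreal (C k) * (ennreal ((R / 2 ^ k) ^ m) * ?w)"
      using R emeasure_lam_cball[of "R / 2 ^ k"] by simp
    also have "\<dots> = ennreal (C k * (R / 2 ^ k) ^ m) * ?w"
      using R by (simp add: ennreal_mult mult.assoc C_def)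
    finally show "(\<integral>\<^sup>+u. ennreal (C k) * indicator (cball 0 (R / 2 ^ k)) u \<partial>lam) = ennreal (c * q ^ k) * ?w"
      unfolding cq .
  qed
  also have "\<dots> = (\<Sum>k. ennreal (c * q ^ k)) * ?w" by simp
  also have "(\<Sum>k. ennreal (c * q ^ k)) = ennreal (\<Sum>k. c * q ^ k)"
    using q R by (intro suminf_ennreal2 summable_mult summable_geometric) (auto simp: c_def)
  also have "ennreal (\<Sum>k. c * q ^ k) * ?w < \<infinity>"
    using emeasure_lam_cball_finite[of 1] by (simp add: ennreal_mult_less_top)
  finally show ?thesis
    by (intro integrableI_nonneg) auto
qed

text \<open>Differentiation under the integral sign, relative to \<open>S\<close>, since the
  deformation parameter runs over \<open>{0..1}\<close>. By the mean value inequality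
  \<open>2 * w\<close> dominates the remainder quotients \<open>Q\<close>.\<close>

lemma has_vector_derivative_integral_lam:
  fixes f f' :: "real \<Rightarrow> 'a \<Rightarrow> 'b::{banach, second_countable_topology}"
  assumes S: "convex S" "s0 \<in> S"
    and int: "\<And>s. s \<in> S \<Longrightarrow> integrable lam (f s)"
    and deriv: "\<And>s u. s \<in> S \<Longrightarrow> u \<in> T \<Longrightarrow> ((\<lambda>s. f s u) has_vector_derivative f' s u) (at s within S)"
    and meas: "f' s0 \<in> borel_measurable borel"
    and w: "integrable lam w"
    and bound: "\<And>s u. s \<in> S \<Longrightarrow> u \<in> T \<Longrightarrow> norm (f' s u) \<le> w u"
  shows "((\<lambda>s. \<integral>u. f s u \<partial>lam) has_vector_derivative (\<integral>u. f' s0 u \<partial>lam)) (at s0 within S)"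
proof -
  have mf [measurable]: "f s \<in> borel_measurable lam" if "s \<in> S" for s
    using int[OF that] by auto
  have mf' [measurable]: "f' s0 \<in> borel_measurable lam" using meas by simp
  have int': "integrable lam (f' s0)"
    by (rule Bochner_Integration.integrable_bound[OF w mf'], use AE_flat in eventually_elim)
      (use bound[OF S(2)] in \<open>force intro: order_trans[OF _ abs_ge_self]\<close>)
  have lip: "norm (f y u - f s0 u) \<le> w u * \<bar>y - s0\<bar>" if "y \<in> S" "u \<in> T" for y u
  proof -
    have "norm (f y u - f s0 u) \<le> w u * norm (y - s0)"
    proof (rule differentiable_bound[OF S(1) _ _ that(1) S(2)])
      fix s assume s: "s \<in> S"
      show "((\<lambda>s. f s u) has_derivative (\<lambda>h. h *\<^sub>R f' s u)) (at s within S)"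
        using deriv[OF s that(2)] by (simp add: has_vector_derivative_def)
      show "onorm (\<lambda>h. h *\<^sub>R f' s u) \<le> w u"
      proof (rule onorm_bound)
        show "0 \<le> w u" using bound[OF s that(2)] norm_ge_zero order_trans by blast
        fix h :: real show "norm (h *\<^sub>R f' s u) \<le> w u * norm h"
          using mult_left_mono[OF bound[OF s that(2)], of "\<bar>h\<bar>"] by (simp add: mult.commute)
      qed
    qed
    then show ?thesis by simp
  qed
  define Q where "Q y u = (1 / \<bar>y - s0\<bar>) *\<^sub>R (f y u - (f s0 u + (y - s0) *\<^sub>R f' s0 u))" for y u
  have "((\<lambda>y. (1 / norm (y - s0)) *\<^sub>R ((\<integral>u. f y u \<partial>lam) - ((\<integral>u. f s0 u \<partial>lam) + (y - s0) *\<^sub>R (\<integral>u. f' s0 u \<partial>lam)))) \<longlongrightarrow> 0) (at s0 within S)"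
    unfolding tendsto_at_iff_sequentially
  proof (intro allI impI)
    fix Y assume Y: "\<forall>i. Y i \<in> S - {s0}" and lim: "Y \<longlonglongrightarrow> s0"
    have YS: "Y i \<in> S" "Y i \<noteq> s0" for i using Y by auto
    have eq: "(1 / norm (Y i - s0)) *\<^sub>R ((\<integral>u. f (Y i) u \<partial>lam) - ((\<integral>u. f s0 u \<partial>lam) + (Y i - s0) *\<^sub>R (\<integral>u. f' s0 u \<partial>lam)))
        = (\<integral>u. Q (Y i) u \<partial>lam)" for i
      unfolding Q_def using int[OF YS(1)] int[OF S(2)] int' by simp
    have "(\<lambda>i. \<integral>u. Q (Y i) u \<partial>lam) \<longlonglongrightarrow> (\<integral>u. 0 \<partial>lam)"
    proof (rule integral_dominated_convergence[where w = "\<lambda>u. 2 * w u"])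
      show "Q (Y i) \<in> borel_measurable lam" for i
      proof -
        note [measurable] = mf[OF YS(1)[of i]] mf[OF S(2)]
        show ?thesis unfolding Q_def by measurable
      qed
      show "integrable lam (\<lambda>u. 2 * w u)" using w by simp
      show "AE u in lam. (\<lambda>i. Q (Y i) u) \<longlonglongrightarrow> 0"
        using AE_flat
      proof eventually_elim
        case (elim u)
        have "((\<lambda>y. (1 / norm (y - s0)) *\<^sub>R (f y u - (f s0 u + (y - s0) *\<^sub>R f' s0 u))) \<longlongrightarrow> 0) (at s0 within S)"
          using deriv[OF S(2) elim] by (simp add: has_vector_derivative_def has_derivative_within)
        then show ?case
          using Y lim unfolding tendsto_at_iff_sequentially Q_def by (auto simp: o_def)
      qed
      show "AE u in lam. norm (Q (Y i) u) \<le> 2 * w u" for i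
        using AE_flat
      proof eventually_elim
        case (elim u)
        have "norm (f (Y i) u - (f s0 u + (Y i - s0) *\<^sub>R f' s0 u)) \<le> norm (f (Y i) u - f s0 u) + norm ((Y i - s0) *\<^sub>R f' s0 u)"
          using norm_triangle_ineq4[of "f (Y i) u - f s0 u" "(Y i - s0) *\<^sub>R f' s0 u"] by (simp add: algebra_simps)
        also have "\<dots> \<le> w u * \<bar>Y i - s0\<bar> + \<bar>Y i - s0\<bar> * w u"
          using lip[OF YS(1) elim] bound[OF S(2) elim] by (intro add_mono) (auto intro: mult_left_mono)
        finally show ?case using YS(2)[of i] by (simp add: Q_def divide_simps mult_ac)
      qed
    qed simp
    then show "((\<lambda>y. (1 / norm (y - s0)) *\<^sub>R ((\<integral>u. f y u \<partial>lam) - ((\<integral>u. f s0 u \<partial>lam) + (y - s0) *\<^sub>R (\<integral>u. f' s0 u \<partial>lam)))) \<circ> Y) \<longlonglongrightarrow> 0"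
      unfolding o_def eq by simp
  qed
  then show ?thesis
    unfolding has_vector_derivative_def has_derivative_within by (simp add: bounded_linear_scaleR_left)
qed

text \<open>Replaces integration by parts: the integral of \<open>X\<close> translated along
  \<open>h\<close> does not depend on the translation, and its derivative at 0 is the integral of
  \<open>DX\<close>.\<close>

lemma integral_directional_derivative:
  fixes X :: "'a \<Rightarrow> 'b::{banach, second_countable_topology}"
  assumes h: "h \<in> T" and [measurable]: "X \<in> borel_measurable borel" "DX \<in> borel_measurable borel"
    and deriv: "\<And>u. u \<in> T \<Longrightarrow> ((\<lambda>s. X (u + s *\<^sub>R h)) has_vector_derivative DX u) (at 0)"
    and bX: "\<And>u. u \<in> T \<Longrightarrow> norm (X u) \<le> C * indicator (cball 0 R) u"
    and bDX: "\<And>u. u \<in> T \<Longrightarrow> norm (DX u) \<le> C * indicator (cball 0 R) u"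
  shows "(\<integral>u. DX u \<partial>lam) = 0"
proof -
  have C: "0 \<le> C * indicator (cball 0 R) u" if "u \<in> T" for u
    using bX[OF that] norm_ge_zero order_trans by blast
  have const: "(\<integral>u. X (u + s *\<^sub>R h) \<partial>lam) = (\<integral>u. X u \<partial>lam)" for s
    using integral_lam_similarity[of 1 "s *\<^sub>R h" X] h by (simp add: span_scale)
  have "((\<lambda>s. \<integral>u. X (u + s *\<^sub>R h) \<partial>lam) has_vector_derivative (\<integral>u. DX (u + 0 *\<^sub>R h) \<partial>lam)) (at 0 within {0..1})"
  \<comment> \<open>For \<open>s\<close> in \<open>{0..1}\<close> the support of the translated
    function moves by at most \<open>norm h\<close>, so one ball dominates the whole family.\<close>
  proof (rule has_vector_derivative_integral_lam[where w = "\<lambda>u. \<bar>C\<bar> * indicator (cball 0 (R + norm h)) u"])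
    have shift: "C * indicator (cball 0 R) (u + s *\<^sub>R h) \<le> \<bar>C\<bar> * indicator (cball 0 (R + norm h)) u" if s: "s \<in> {0..1}" for s and u :: 'a
    proof (cases "norm (u + s *\<^sub>R h) \<le> R")
      case True
      have "norm u \<le> norm (u + s *\<^sub>R h) + norm (s *\<^sub>R h)" by (metis add_diff_cancel norm_triangle_ineq4)
      also have "norm (s *\<^sub>R h) \<le> norm h" using s by (simp add: mult_left_le_one_le)
      finally show ?thesis using True by (auto simp: indicator_def)
    qed (auto simp: indicator_def)
    show "integrable lam (\<lambda>u. X (u + s *\<^sub>R h))" if "s \<in> {0..1}" for s
      using h that by (intro integrable_lam_bounded[where C = "\<bar>C\<bar>" and R = "R + norm h"])
        (auto intro!: order_trans[OF bX shift] span_add span_scale)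
    show "norm (DX (u + s *\<^sub>R h)) \<le> \<bar>C\<bar> * indicator (cball 0 (R + norm h)) u" if "s \<in> {0..1}" "u \<in> T" for s u
      using h that by (intro order_trans[OF bDX shift] span_add span_scale)
    show "integrable lam (\<lambda>u. \<bar>C\<bar> * indicator (cball 0 (R + norm h)) u)"
      by (rule integrable_lam_bounded[where C = "\<bar>C\<bar>" and R = "R + norm h"]) auto
    show "((\<lambda>s. X (u + s *\<^sub>R h)) has_vector_derivative DX (u + s *\<^sub>R h)) (at s within {0..1})" if "u \<in> T" for s u
    proof -
      have "u + s *\<^sub>R h \<in> T" using that h by (intro span_add span_scale)
      from deriv[OF this] have "((\<lambda>t. X (u + s *\<^sub>R h + t *\<^sub>R h)) has_derivative (\<lambda>k. k *\<^sub>R DX (u + s *\<^sub>R h))) (at (s - s))"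
        by (simp add: has_vector_derivative_def)
      moreover have "((\<lambda>t. t - s) has_derivative (\<lambda>k. k)) (at s)" by (auto intro!: derivative_eq_intros)
      ultimately have "((\<lambda>t. X (u + s *\<^sub>R h + (t - s) *\<^sub>R h)) has_derivative (\<lambda>k. k *\<^sub>R DX (u + s *\<^sub>R h))) (at s)"
        by (rule has_derivative_compose[rotated])
      then show ?thesis
        by (simp add: has_vector_derivative_def algebra_simps has_derivative_at_withinI)
    qed
  qed auto
  then have "((\<lambda>s. \<integral>u. X u \<partial>lam) has_vector_derivative (\<integral>u. DX u \<partial>lam)) (at 0 within {0..1})"
    by (simp add: const)
  then show ?thesis
    using vector_derivative_unique_within_closed_interval[of 0 1 0 "\<lambda>s. \<integral>u. X u \<partial>lam" "\<integral>u. DX u \<partial>lam" 0]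
    by (auto simp: box_real)
qed

end

section \<open>The flux of the Cauchy kernel through a graph\<close>

lemma line_has_vector_derivative:
  fixes X :: "'a::real_normed_vector \<Rightarrow> 'b::real_normed_vector"
  assumes "(X has_derivative D) (at u)"
  shows "((\<lambda>t. X (u + t *\<^sub>R h)) has_vector_derivative D h) (at 0)"
proof -
  have "((\<lambda>t. u + t *\<^sub>R h) has_derivative (\<lambda>t. t *\<^sub>R h)) (at (0::real))"
    by (auto intro!: derivative_eq_intros)
  moreover have "(X has_derivative D) (at (u + 0 *\<^sub>R h))" using assms by simp
  ultimately have "((\<lambda>t. X (u + t *\<^sub>R h)) has_derivative (\<lambda>t. D (t *\<^sub>R h))) (at (0::real))"
    by (rule has_derivative_compose)
  moreover have "D (t *\<^sub>R h) = t *\<^sub>R D h" for t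
    using assms by (simp add: linear_scale has_derivative_linear)
  ultimately show ?thesis by (simp add: has_vector_derivative_def)
qed

text \<open>
  \<open>P z b\<close> stands for the Clifford product of the conjugate of \<open>z\<close> with \<open>b\<close>, and \<open>e0\<close> for the unit; \<open>E\<close> is
  the Cauchy kernel without its normalizing constant, and \<open>DE w h b\<close> its derivative in \<open>w\<close> along \<open>h\<close>.
\<close>

locale flux = graph M m B \<nu> \<psi> d\<psi> x
  for M :: "'a::euclidean_space measure" and m B \<nu> \<psi> d\<psi> x +
  fixes P :: "'a \<Rightarrow> 'a \<Rightarrow> 'b::euclidean_space" and e0 :: 'b
  assumes P_bilinear: "bounded_bilinear P"
    and P_sq: "\<And>u s. u \<in> span B \<Longrightarrow> P (u + s *\<^sub>R \<nu>) (u + s *\<^sub>R \<nu>) = (norm (u + s *\<^sub>R \<nu>))\<^sup>2 *\<^sub>R e0"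
begin

sublocale P: bounded_bilinear P by (rule P_bilinear)

definition E :: "'a \<Rightarrow> 'a \<Rightarrow> 'b" where "E w b = (1 / norm w ^ (m + 1)) *\<^sub>R P w b"

definition DE :: "'a \<Rightarrow> 'a \<Rightarrow> 'a \<Rightarrow> 'b" where
  "DE w h b = (1 / norm w ^ (m + 1)) *\<^sub>R P h b - (real (m + 1) * (w \<bullet> h) / norm w ^ (m + 3)) *\<^sub>R P w b"

lemma E_linear: "linear (E w)"
  unfolding E_def by (auto intro!: linearI simp: P.add_right P.scaleR_right scaleR_add_right)

lemma DE_linear_dir: "linear (\<lambda>h. DE w h b)"
  unfolding DE_def
  by (auto intro!: linearI simp: P.add_left P.scaleR_left inner_simps algebra_simps add_divide_distrib)

lemma DE_linear: "linear (DE w h)"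
  unfolding DE_def by (auto intro!: linearI simp: P.add_right P.scaleR_right algebra_simps)

lemma E_deriv:
  assumes "w \<noteq> 0"
  shows "((\<lambda>w. E w b) has_derivative (\<lambda>h. DE w h b)) (at w)"
proof -
  have n: "0 < norm w" using assms by simp
  have "(norm has_derivative (\<lambda>h. sgn w \<bullet> h)) (at w)"
    using has_derivative_norm[OF assms] by (simp add: inner_commute)
  then have "((\<lambda>w. norm w ^ (m + 1)) has_derivative (\<lambda>h. real (m + 1) * (sgn w \<bullet> h) * norm w ^ m)) (at w)"
    using has_derivative_power[of norm "\<lambda>h. sgn w \<bullet> h" w UNIV "m + 1"] by (simp add: mult_ac)
  moreover have "norm w ^ (m + 1) \<noteq> 0" using n by simp
  ultimately have "((\<lambda>w. inverse (norm w ^ (m + 1))) has_derivative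
     (\<lambda>h. - (inverse (norm w ^ (m + 1)) * (real (m + 1) * (sgn w \<bullet> h) * norm w ^ m) * inverse (norm w ^ (m + 1))))) (at w)"
    by (intro Deriv.has_derivative_inverse)
  moreover have "- (inverse (norm w ^ (m + 1)) * (real (m + 1) * (sgn w \<bullet> h) * norm w ^ m) * inverse (norm w ^ (m + 1)))
      = - (real (m + 1) * (w \<bullet> h) / norm w ^ (m + 3))" for h
    using n by (simp add: sgn_div_norm divide_simps power_add power2_eq_square power3_eq_cube eval_nat_numeral)
  ultimately have "((\<lambda>w. inverse (norm w ^ (m + 1))) has_derivative (\<lambda>h. - (real (m + 1) * (w \<bullet> h) / norm w ^ (m + 3)))) (at w)"
    by (simp only:)
  moreover have "((\<lambda>w. P w b) has_derivative (\<lambda>h. P h b)) (at w)"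
    by (rule bounded_linear.has_derivative[OF P.bounded_linear_left has_derivative_ident])
  ultimately have "((\<lambda>w. inverse (norm w ^ (m + 1)) *\<^sub>R P w b) has_derivative
      (\<lambda>h. inverse (norm w ^ (m + 1)) *\<^sub>R P h b + (- (real (m + 1) * (w \<bullet> h) / norm w ^ (m + 3))) *\<^sub>R P w b)) (at w)"
    by (rule has_derivative_scaleR)
  then show ?thesis unfolding E_def DE_def by (simp add: inverse_eq_divide)
qed

lemma measurable_P [measurable (raw)]:
  "f \<in> borel_measurable N \<Longrightarrow> g \<in> borel_measurable N \<Longrightarrow> (\<lambda>u. P (f u) (g u)) \<in> borel_measurable N"
  by (rule borel_measurable_continuous_Pair) (auto intro!: P.continuous_on continuous_intros)

lemma measurable_E [measurable (raw)]:
  "f \<in> borel_measurable N \<Longrightarrow> g \<in> borel_measurable N \<Longrightarrow> (\<lambda>u. E (f u) (g u)) \<in> borel_measurable N"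
  unfolding E_def
  by (intro borel_measurable_scaleR measurable_P borel_measurable_divide borel_measurable_power
      measurable_compose[OF _ borel_measurable_norm]
      borel_measurable_const)

lemma measurable_DE [measurable (raw)]:
  "f \<in> borel_measurable N \<Longrightarrow> g \<in> borel_measurable N \<Longrightarrow> k \<in> borel_measurable N
    \<Longrightarrow> (\<lambda>u. DE (f u) (g u) (k u)) \<in> borel_measurable N"
  unfolding DE_def
  by (intro borel_measurable_scaleR measurable_P borel_measurable_divide borel_measurable_power
      measurable_compose[OF _ borel_measurable_norm]
      borel_measurable_const borel_measurable_diff borel_measurable_times borel_measurable_inner)

lemma continuous_on_E:
  "continuous_on S f \<Longrightarrow> continuous_on S g \<Longrightarrow> (\<And>u. u \<in> S \<Longrightarrow> f u \<noteq> 0) \<Longrightarrow> continuous_on S (\<lambda>u. E (f u) (g u))"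
  unfolding E_def by (intro continuous_intros P.continuous_on) auto

lemma continuous_on_DE:
  "continuous_on S f \<Longrightarrow> continuous_on S g \<Longrightarrow> continuous_on S k \<Longrightarrow> (\<And>u. u \<in> S \<Longrightarrow> f u \<noteq> 0)
    \<Longrightarrow> continuous_on S (\<lambda>u. DE (f u) (g u) (k u))"
  unfolding DE_def by (intro continuous_intros P.continuous_on) auto

definition P_bound :: real where "P_bound = (SOME K. 0 < K \<and> (\<forall>w b. norm (P w b) \<le> K * (norm w * norm b)))"

lemma P_bound: "0 < P_bound" "norm (P w b) \<le> P_bound * (norm w * norm b)"
proof -
  have "\<exists>K. 0 < K \<and> (\<forall>w b. norm (P w b) \<le> K * (norm w * norm b))"
    using P.pos_bounded by (auto simp: mult_ac)
  from someI_ex[OF this] show "0 < P_bound" "norm (P w b) \<le> P_bound * (norm w * norm b)"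
    unfolding P_bound_def[symmetric] by auto
qed

lemma norm_E_le: "norm (E w b) \<le> P_bound * norm b / norm w ^ m"
proof (cases "w = 0")
  case True
  then show ?thesis using P_bound(1) by (simp add: E_def P.zero_left)
next
  case False
  have "norm (E w b) = norm (P w b) / norm w ^ (m + 1)" by (simp add: E_def)
  also have "\<dots> \<le> P_bound * (norm w * norm b) / norm w ^ (m + 1)"
    by (intro divide_right_mono P_bound) auto
  also have "\<dots> = P_bound * norm b / norm w ^ m" using False by simp
  finally show ?thesis .
qed

lemma E_minus: "E (- w) b = - E w b" by (simp add: E_def P.minus_left)

text \<open>The kernel is annihilated by the Dirac operator: \<open>\<Sum>\<^sub>b \<partial>\<^sub>b E(w) b + \<partial>\<^sub>\<nu> E(w) \<nu> = 0\<close>.\<close>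

lemma DE_trace:
  assumes u: "u \<in> T" and w: "w = u + s *\<^sub>R \<nu>" "w \<noteq> 0"
  shows "(\<Sum>b\<in>B. DE w b b) + DE w \<nu> \<nu> = 0"
proof -
  have one: "P b b = e0" if "b \<in> B" for b
    using P_sq[of b 0] that norm_B[OF that] by (simp add: span_base)
  have one\<nu>: "P \<nu> \<nu> = e0" using P_sq[of 0 1] norm_\<nu> by (simp add: span_zero)
  have wb: "w \<bullet> b = u \<bullet> b" if "b \<in> B" for b using B_\<nu>[OF that] w by (simp add: inner_simps inner_commute)
  have w\<nu>: "w \<bullet> \<nu> = s" using w span_\<nu>[OF u] \<nu>\<nu> by (simp add: inner_simps)
  \<comment> \<open>The contraction with the coordinates of \<open>w\<close> produces
    \<open>P w w\<close>, and \<open>P_sq\<close> evaluates it. Besides bilinearity this identity is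
    the only algebraic fact about the Clifford product that enters the flux computation.\<close>
  have "(\<Sum>b\<in>B. (w \<bullet> b) *\<^sub>R P w b) + (w \<bullet> \<nu>) *\<^sub>R P w \<nu> = P w ((\<Sum>b\<in>B. (u \<bullet> b) *\<^sub>R b) + s *\<^sub>R \<nu>)"
    by (simp add: P.add_right P.sum_right P.scaleR_right wb w\<nu>)
  also have "\<dots> = (norm w)\<^sup>2 *\<^sub>R e0" unfolding expand[OF u] w(1) by (rule P_sq[OF u])
  finally have sum: "(\<Sum>b\<in>B. (w \<bullet> b) *\<^sub>R P w b) + (w \<bullet> \<nu>) *\<^sub>R P w \<nu> = (norm w)\<^sup>2 *\<^sub>R e0" .
  define c where "c = real (m + 1) / norm w ^ (m + 3)"
  define d where "d = 1 / norm w ^ (m + 1)"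
  have DE': "DE w h b = d *\<^sub>R P h b - c *\<^sub>R ((w \<bullet> h) *\<^sub>R P w b)" for h b
    by (simp add: DE_def c_def d_def)
  have "(\<Sum>b\<in>B. DE w b b) + DE w \<nu> \<nu> = (\<Sum>b\<in>B. d *\<^sub>R P b b) + d *\<^sub>R P \<nu> \<nu>
      - c *\<^sub>R ((\<Sum>b\<in>B. (w \<bullet> b) *\<^sub>R P w b) + (w \<bullet> \<nu>) *\<^sub>R P w \<nu>)"
    unfolding DE' by (simp add: sum_subtractf scaleR_sum_right scaleR_add_right)
  also have "(\<Sum>b\<in>B. d *\<^sub>R P b b) = (real m * d) *\<^sub>R e0"
    using one card_B by (simp add: sum_constant_scaleR)
  also have "(real m * d) *\<^sub>R e0 + d *\<^sub>R P \<nu> \<nu> = (real (m + 1) * d) *\<^sub>R e0"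
    unfolding one\<nu> by (simp add: algebra_simps)
  \<comment> \<open>The exponents match: \<open>norm w ^ 2\<close> against
    \<open>norm w ^ (m + 3)\<close> leaves the same \<open>(m + 1) * d\<close> as the
    \<open>m + 1\<close> terms \<open>P b b\<close> and \<open>P \<nu> \<nu>\<close>.\<close>
  also have "c *\<^sub>R ((\<Sum>b\<in>B. (w \<bullet> b) *\<^sub>R P w b) + (w \<bullet> \<nu>) *\<^sub>R P w \<nu>) = (real (m + 1) * d) *\<^sub>R e0"
    unfolding sum c_def d_def using w(2) by (simp add: power_add power2_eq_square power3_eq_cube eval_nat_numeral)
  finally show ?thesis by simp
qed

text \<open>
  The vanishing divergence lets the \<open>s\<close>-derivative of the integrand be written as \<open>\<psi> E(\<dots>) d\<zeta>\<close> plus a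
  divergence in \<open>T\<close>, which integrates to \<open>0\<close>.
\<close>

lemma interpolation:
  fixes \<zeta> :: "'a \<Rightarrow> real" and d\<zeta> :: "'a \<Rightarrow> 'a"
  assumes \<zeta>: "\<And>u. (\<zeta> has_derivative (\<lambda>h. d\<zeta> u \<bullet> h)) (at u)" "\<And>u. u \<in> T \<Longrightarrow> d\<zeta> u \<in> T" "continuous_on UNIV d\<zeta>"
    and S: "compact S" "\<And>u. u \<notin> S \<Longrightarrow> \<zeta> u = 0"
    and \<tau>: "\<tau> = \<tau>' + t *\<^sub>R \<nu>" "\<tau>' \<in> T"
    and nz: "\<And>u s. u \<in> S \<Longrightarrow> u \<in> T \<Longrightarrow> s \<in> {0..1} \<Longrightarrow> u + (s * \<psi> u) *\<^sub>R \<nu> \<noteq> \<tau>"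
    and s0: "s0 \<in> {0..1}"
  shows "((\<lambda>s. \<integral>u. \<zeta> u *\<^sub>R E (u + (s * \<psi> u) *\<^sub>R \<nu> - \<tau>) (\<nu> - s *\<^sub>R d\<psi> u) \<partial>lam) has_vector_derivative
     (\<integral>u. \<psi> u *\<^sub>R E (u + (s0 * \<psi> u) *\<^sub>R \<nu> - \<tau>) (d\<zeta> u) \<partial>lam)) (at s0 within {0..1})"
proof -
  define w where "w s u = u + (s * \<psi> u) *\<^sub>R \<nu> - \<tau>" for s u
  define f where "f s u = \<zeta> u *\<^sub>R E (w s u) (\<nu> - s *\<^sub>R d\<psi> u)" for s u
  define f' where "f' s u = \<zeta> u *\<^sub>R (DE (w s u) (\<psi> u *\<^sub>R \<nu>) (\<nu> - s *\<^sub>R d\<psi> u) - E (w s u) (d\<psi> u))" for s u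
  \<comment> \<open>For fixed \<open>s\<close> these are the components of a vector field in
    \<open>T\<close>, and \<open>DX\<close> their derivatives along \<open>b\<close>;
    \<open>trace\<close> shows that the divergence is \<open>R0 s - f' s\<close>.\<close>
  define X where "X s b u = (\<zeta> u * \<psi> u) *\<^sub>R E (w s u) b" for s b u
  define DX where "DX s b u = (d\<zeta> u \<bullet> b * \<psi> u + \<zeta> u * (d\<psi> u \<bullet> b)) *\<^sub>R E (w s u) b
      + (\<zeta> u * \<psi> u) *\<^sub>R DE (w s u) (b + (s * (d\<psi> u \<bullet> b)) *\<^sub>R \<nu>) b" for s b u
  define R0 where "R0 s u = \<psi> u *\<^sub>R E (w s u) (d\<zeta> u)" for s u
  have \<zeta>_cont: "continuous_on UNIV \<zeta>" using \<zeta>(1) by (auto intro!: has_derivative_continuous_on)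
  have [measurable]: "\<zeta> \<in> borel_measurable borel" "d\<zeta> \<in> borel_measurable borel"
    by (auto intro: borel_measurable_continuous_onI \<zeta>_cont \<zeta>(3))
  have mw [measurable]: "w s \<in> borel_measurable borel" for s unfolding w_def by measurable
  have mf [measurable]: "f s \<in> borel_measurable borel" "f' s \<in> borel_measurable borel"
    "R0 s \<in> borel_measurable borel" for s
    unfolding f_def f'_def R0_def by measurable
  have mX [measurable]: "X s b \<in> borel_measurable borel" "DX s b \<in> borel_measurable borel" for s b
    unfolding X_def DX_def by measurable
  have opS: "open (- S)" using S(1) by (simp add: compact_imp_closed open_Compl)
  have d\<zeta>0: "d\<zeta> u = 0" if "u \<notin> S" for u
  proof -
    have "((\<lambda>_. 0::real) has_derivative (\<lambda>h. d\<zeta> u \<bullet> h)) (at u)"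
      by (rule has_derivative_transform_within_open[OF \<zeta>(1) opS]) (use that S(2) in auto)
    moreover have "((\<lambda>_. 0::real) has_derivative (\<lambda>h. 0)) (at u)" by simp
    ultimately have "(\<lambda>h. d\<zeta> u \<bullet> h) = (\<lambda>h. 0)" by (rule has_derivative_unique)
    then have "d\<zeta> u \<bullet> d\<zeta> u = 0" by (rule fun_cong)
    then show ?thesis by simp
  qed
  obtain R where R: "\<And>u. u \<in> S \<Longrightarrow> norm u \<le> R" using compact_imp_bounded[OF S(1)] unfolding bounded_iff by blast
  have compact: "compact ((S \<inter> T) \<times> {0..1::real})"
    by (intro compact_Times compact_Int_closed S(1)) auto
  \<comment> \<open>All five integrands are continuous in \<open>u\<close> and \<open>s\<close> on a
    compact set that avoids the pole, and they vanish off \<open>S\<close>. This gives the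
    dominating function for every exchange of limits below.\<close>
  have bounded: "\<exists>C. \<forall>s\<in>{0..1}. \<forall>u\<in>T. norm (F s u) \<le> C * indicator (cball 0 R) u"
    if cont: "continuous_on ((S \<inter> T) \<times> {0..1}) (\<lambda>z. F (snd z) (fst z))" and zero: "\<And>s u. u \<notin> S \<Longrightarrow> F s u = 0"
    for F :: "real \<Rightarrow> 'a \<Rightarrow> 'b"
  proof -
    have "bounded ((\<lambda>z. F (snd z) (fst z)) ` ((S \<inter> T) \<times> {0..1}))"
      by (rule compact_imp_bounded[OF compact_continuous_image[OF cont compact]])
    then obtain C where "\<forall>y\<in>(\<lambda>z. F (snd z) (fst z)) ` ((S \<inter> T) \<times> {0..1}). norm y \<le> C"
      unfolding bounded_iff by blast
    then have C: "norm (F (snd z) (fst z)) \<le> C" if "z \<in> (S \<inter> T) \<times> {0..1}" for z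
      using that by blast
    have "norm (F s u) \<le> \<bar>C\<bar> * indicator (cball 0 R) u" if "s \<in> {0..1}" "u \<in> T" for s u
    proof (cases "u \<in> S")
      case True
      then have "norm (F s u) \<le> C" using C[of "(u, s)"] that by auto
      then show ?thesis using True R by (auto simp: indicator_def)
    qed (simp add: zero)
    then show ?thesis by blast
  qed
  have contc: "continuous_on Z (\<lambda>z. \<psi> (fst z))" "continuous_on Z (\<lambda>z. d\<psi> (fst z))"
    "continuous_on Z (\<lambda>z. \<zeta> (fst z))" "continuous_on Z (\<lambda>z. d\<zeta> (fst z))" for Z :: "('a \<times> real) set"
    by (auto intro!: continuous_on_compose2[OF \<psi>_cont] continuous_on_compose2[OF d\<psi>_cont]
        continuous_on_compose2[OF \<zeta>_cont] continuous_on_compose2[OF \<zeta>(3)] continuous_intros)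
  have contw: "continuous_on Z (\<lambda>z. w (snd z) (fst z))" for Z
    unfolding w_def by (intro continuous_intros contc)
  have wnz: "w (snd z) (fst z) \<noteq> 0" if "z \<in> (S \<inter> T) \<times> {0..1}" for z
    using that nz[of "fst z" "snd z"] by (auto simp: w_def)
  have bf: "\<exists>C. \<forall>s\<in>{0..1}. \<forall>u\<in>T. norm (f s u) \<le> C * indicator (cball 0 R) u"
    by (rule bounded) (unfold f_def, auto intro!: continuous_intros continuous_on_E contc contw simp: S(2), use wnz in force)
  have bf': "\<exists>C. \<forall>s\<in>{0..1}. \<forall>u\<in>T. norm (f' s u) \<le> C * indicator (cball 0 R) u"
    by (rule bounded) (unfold f'_def, auto intro!: continuous_intros continuous_on_E continuous_on_DE contc contw simp: S(2), (use wnz in force)+)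
  have bX: "\<exists>C. \<forall>s\<in>{0..1}. \<forall>u\<in>T. norm (X s b u) \<le> C * indicator (cball 0 R) u" for b
    by (rule bounded) (unfold X_def, auto intro!: continuous_intros continuous_on_E contc contw simp: S(2), (use wnz in force)+)
  have bDX: "\<exists>C. \<forall>s\<in>{0..1}. \<forall>u\<in>T. norm (DX s b u) \<le> C * indicator (cball 0 R) u" for b
    by (rule bounded) (unfold DX_def, auto intro!: continuous_intros continuous_on_E continuous_on_DE contc contw simp: S(2) d\<zeta>0, (use wnz in force)+)
  have bR: "\<exists>C. \<forall>s\<in>{0..1}. \<forall>u\<in>T. norm (R0 s u) \<le> C * indicator (cball 0 R) u"
    by (rule bounded) (unfold R0_def, auto intro!: continuous_intros continuous_on_E contc contw simp: d\<zeta>0 linear_0[OF E_linear], (use wnz in force)+)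
  have intb: "integrable lam (F s)"
    if F: "\<exists>C. \<forall>s\<in>{0..1}. \<forall>u\<in>T. norm (F s u) \<le> C * indicator (cball 0 R) u" "s \<in> {0..1}" "F s \<in> borel_measurable borel"
    for F :: "real \<Rightarrow> 'a \<Rightarrow> 'b" and s
  proof -
    obtain C where "\<forall>u\<in>T. norm (F s u) \<le> C * indicator (cball 0 R) u" using F(1,2) by blast
    then show ?thesis by (intro integrable_lam_bounded[OF F(3)]) blast
  qed
  note int_f = intb[OF bf _ mf(1)] and int_R = intb[OF bR _ mf(3)] and int_f' = intb[OF bf' _ mf(2)]
    and int_DX = intb[OF bDX _ mX(2)]
  have deriv_f: "((\<lambda>s. f s u) has_vector_derivative f' s u) (at s within {0..1})" if s: "s \<in> {0..1}" and u: "u \<in> T" for s u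
  proof (cases "u \<in> S")
    case True
    have w0: "w s u \<noteq> 0" using wnz[of "(u, s)"] True s u by simp
    have dw: "((\<lambda>s. w s u) has_vector_derivative (\<psi> u *\<^sub>R \<nu>)) (at s within {0..1})"
      unfolding w_def by (auto intro!: derivative_eq_intros simp: has_vector_derivative_def scaleR_scaleR[symmetric] simp del: scaleR_scaleR)
    have dE: "((\<lambda>s. E (w s u) b) has_vector_derivative DE (w s u) (\<psi> u *\<^sub>R \<nu>) b) (at s within {0..1})" for b
    proof -
      have "((\<lambda>s. E (w s u) b) has_derivative (\<lambda>t. DE (w s u) (t *\<^sub>R (\<psi> u *\<^sub>R \<nu>)) b)) (at s within {0..1})"
        using dw unfolding has_vector_derivative_def by (rule has_derivative_compose) (rule E_deriv[OF w0])
      then show ?thesis unfolding has_vector_derivative_def linear_scale[OF DE_linear_dir] .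
    qed
    have "f s u = \<zeta> u *\<^sub>R (E (w s u) \<nu> - s *\<^sub>R E (w s u) (d\<psi> u))" for s
      by (simp add: f_def linear_diff[OF E_linear] linear_scale[OF E_linear])
    moreover have "f' s u = \<zeta> u *\<^sub>R (DE (w s u) (\<psi> u *\<^sub>R \<nu>) \<nu> - (s *\<^sub>R DE (w s u) (\<psi> u *\<^sub>R \<nu>) (d\<psi> u) + 1 *\<^sub>R E (w s u) (d\<psi> u)))"
      by (simp add: f'_def linear_diff[OF DE_linear] linear_scale[OF DE_linear])
    moreover have "((\<lambda>s. \<zeta> u *\<^sub>R (E (w s u) \<nu> - s *\<^sub>R E (w s u) (d\<psi> u))) has_vector_derivative
        \<zeta> u *\<^sub>R (DE (w s u) (\<psi> u *\<^sub>R \<nu>) \<nu> - (s *\<^sub>R DE (w s u) (\<psi> u *\<^sub>R \<nu>) (d\<psi> u) + 1 *\<^sub>R E (w s u) (d\<psi> u)))) (at s within {0..1})"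
      by (intro bounded_linear.has_vector_derivative[OF bounded_linear_scaleR_right] has_vector_derivative_diff
          has_vector_derivative_scaleR dE DERIV_ident)
    ultimately show ?thesis by simp
  next
    case False
    then show ?thesis by (simp add: f_def f'_def S(2))
  qed
  have deriv_X: "((\<lambda>t. X s b (u + t *\<^sub>R b)) has_vector_derivative DX s b u) (at 0)" if s: "s \<in> {0..1}" and u: "u \<in> T" for s u b
  proof (cases "u \<in> S")
    case True
    have w0: "w s u \<noteq> 0" using wnz[of "(u, s)"] True s u by simp
    have dw: "(w s has_derivative (\<lambda>h. h + (s * (d\<psi> u \<bullet> h)) *\<^sub>R \<nu>)) (at u)"
      unfolding w_def by (auto intro!: derivative_eq_intros \<psi>_deriv simp: algebra_simps)
    have dE: "((\<lambda>u. E (w s u) b) has_derivative (\<lambda>h. DE (w s u) (h + (s * (d\<psi> u \<bullet> h)) *\<^sub>R \<nu>) b)) (at u)"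
      by (rule has_derivative_compose[OF dw E_deriv[OF w0]])
    have d\<zeta>\<psi>: "((\<lambda>u. \<zeta> u * \<psi> u) has_derivative (\<lambda>h. \<zeta> u * (d\<psi> u \<bullet> h) + d\<zeta> u \<bullet> h * \<psi> u)) (at u)"
      by (rule has_derivative_mult[OF \<zeta>(1) \<psi>_deriv])
    have "(X s b has_derivative (\<lambda>h. (\<zeta> u * \<psi> u) *\<^sub>R DE (w s u) (h + (s * (d\<psi> u \<bullet> h)) *\<^sub>R \<nu>) b
        + (\<zeta> u * (d\<psi> u \<bullet> h) + d\<zeta> u \<bullet> h * \<psi> u) *\<^sub>R E (w s u) b)) (at u)"
      unfolding X_def by (rule has_derivative_scaleR[OF d\<zeta>\<psi> dE])
    from line_has_vector_derivative[OF this, of b] show ?thesis by (simp add: DX_def add.commute)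
  next
    case False
    have "((\<lambda>_. 0 :: 'b) has_derivative (\<lambda>h. 0)) (at u)" by simp
    then have "(X s b has_derivative (\<lambda>h. 0)) (at u)"
      by (rule has_derivative_transform_within_open[OF _ opS]) (use False S(2) in \<open>auto simp: X_def\<close>)
    from line_has_vector_derivative[OF this, of b] show ?thesis using False S(2) d\<zeta>0 by (simp add: DX_def)
  qed
  have int0: "(\<integral>u. DX s b u \<partial>lam) = 0" if s: "s \<in> {0..1}" and b: "b \<in> B" for s b
  proof -
    obtain C1 C2 where C: "\<forall>u\<in>T. norm (X s b u) \<le> C1 * indicator (cball 0 R) u"
      "\<forall>u\<in>T. norm (DX s b u) \<le> C2 * indicator (cball 0 R) u"
      using bX[of b] bDX[of b] s by blast
    have "C1 * indicator (cball 0 R) u \<le> max C1 C2 * indicator (cball 0 R) u"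
      "C2 * indicator (cball 0 R) u \<le> max C1 C2 * indicator (cball 0 R) u" for u :: 'a
      by (auto simp: indicator_def)
    then show ?thesis
      using b C by (intro integral_directional_derivative[of b "X s b" "DX s b" "max C1 C2" R] deriv_X[OF s] mX)
        (auto simp: span_base intro: order_trans)
  qed
  \<comment> \<open>The sums over \<open>B\<close> contract by \<open>ex\<close>: against
    \<open>d\<zeta>\<close> to \<open>R0\<close>, against \<open>d\<psi>\<close> to the terms of
    \<open>f'\<close> that contain \<open>d\<psi>\<close>. The remaining trace of \<open>DE\<close>
    is traded for \<open>- DE w \<nu> \<nu>\<close> by \<open>DE_trace\<close>.\<close>
  have trace: "(\<Sum>b\<in>B. DX s b u) = R0 s u - f' s u" if s: "s \<in> {0..1}" and u: "u \<in> T" for s u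
  proof (cases "u \<in> S")
    case True
    have w0: "w s u \<noteq> 0" using wnz[of "(u, s)"] True s u by simp
    have wL: "w s u = (u - \<tau>') + (s * \<psi> u - t) *\<^sub>R \<nu>" by (simp add: w_def \<tau> algebra_simps)
    note tr = DE_trace[OF span_diff[OF u \<tau>(2)] wL w0]
    have ex: "(\<Sum>b\<in>B. (v \<bullet> b) *\<^sub>R L b) = L v" if "linear L" "v \<in> T" for v and L :: "'a \<Rightarrow> 'b"
    proof -
      have "L v = L (\<Sum>b\<in>B. (v \<bullet> b) *\<^sub>R b)" by (simp only: expand[OF that(2)])
      then show ?thesis by (simp add: linear_sum[OF that(1)] linear_scale[OF that(1)])
    qed
    have "(\<Sum>b\<in>B. DX s b u) = \<psi> u *\<^sub>R (\<Sum>b\<in>B. (d\<zeta> u \<bullet> b) *\<^sub>R E (w s u) b) + \<zeta> u *\<^sub>R (\<Sum>b\<in>B. (d\<psi> u \<bullet> b) *\<^sub>R E (w s u) b)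
        + (\<zeta> u * \<psi> u) *\<^sub>R ((\<Sum>b\<in>B. DE (w s u) b b) + s *\<^sub>R (\<Sum>b\<in>B. (d\<psi> u \<bullet> b) *\<^sub>R DE (w s u) \<nu> b))"
      unfolding DX_def linear_add[OF DE_linear_dir] linear_scale[OF DE_linear_dir]
      by (simp add: sum.distrib scaleR_sum_right scaleR_add_right scaleR_add_left mult_ac)
    also have "\<dots> = \<psi> u *\<^sub>R E (w s u) (d\<zeta> u) + \<zeta> u *\<^sub>R E (w s u) (d\<psi> u)
        + (\<zeta> u * \<psi> u) *\<^sub>R ((\<Sum>b\<in>B. DE (w s u) b b) + s *\<^sub>R DE (w s u) \<nu> (d\<psi> u))"
      using \<zeta>(2)[OF u] d\<psi>_T by (simp add: ex[OF E_linear] ex[OF DE_linear])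
    also have "(\<Sum>b\<in>B. DE (w s u) b b) = - DE (w s u) \<nu> \<nu>" using tr by (simp add: eq_neg_iff_add_eq_0)
    finally show ?thesis
      by (simp add: R0_def f'_def linear_scale[OF DE_linear_dir] linear_diff[OF DE_linear] linear_scale[OF DE_linear] algebra_simps)
  next
    case False
    then show ?thesis using S(2) d\<zeta>0 by (simp add: DX_def R0_def f'_def linear_0[OF E_linear])
  qed
  have eq: "(\<integral>u. f' s0 u \<partial>lam) = (\<integral>u. R0 s0 u \<partial>lam)"
  proof -
    have "0 = (\<Sum>b\<in>B. \<integral>u. DX s0 b u \<partial>lam)" using int0[OF s0] by simp
    also have "\<dots> = (\<integral>u. (\<Sum>b\<in>B. DX s0 b u) \<partial>lam)"
      by (rule Bochner_Integration.integral_sum[symmetric]) (rule int_DX[OF s0])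
    also have "\<dots> = (\<integral>u. R0 s0 u - f' s0 u \<partial>lam)"
      by (rule integral_cong_AE) (measurable, use AE_flat in \<open>eventually_elim\<close>, rule trace[OF s0])
    also have "\<dots> = (\<integral>u. R0 s0 u \<partial>lam) - (\<integral>u. f' s0 u \<partial>lam)"
      by (rule Bochner_Integration.integral_diff[OF int_R[OF s0] int_f'[OF s0]])
    finally show ?thesis by simp
  qed
  obtain C where C: "\<forall>s\<in>{0..1}. \<forall>u\<in>T. norm (f' s u) \<le> C * indicator (cball 0 R) u" using bf' by blast
  have "((\<lambda>s. \<integral>u. f s u \<partial>lam) has_vector_derivative (\<integral>u. f' s0 u \<partial>lam)) (at s0 within {0..1})"
  proof (rule has_vector_derivative_integral_lam[where w = "\<lambda>u. C * indicator (cball 0 R) u"])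
    show "integrable lam (\<lambda>u. C * indicator (cball 0 R) u)"
      using emeasure_lam_cball_finite[of R] by (intro integrable_mult_right integrable_real_indicator) auto
  qed (use s0 int_f deriv_f C in auto)
  moreover have "R0 s0 = (\<lambda>u. \<psi> u *\<^sub>R E (u + (s0 * \<psi> u) *\<^sub>R \<nu> - \<tau>) (d\<zeta> u))"
    by (simp add: fun_eq_iff R0_def w_def)
  ultimately show ?thesis unfolding eq by (simp only: f_def w_def)
qed

end

section \<open>A \<open>C^1\<close> cut-off with gradient bounds\<close>

definition smooth_step :: "real \<Rightarrow> real" where
  "smooth_step t = 1 - (max 0 (1 - (max 0 (2 - t))\<^sup>2))\<^sup>2"

definition smooth_step' :: "real \<Rightarrow> real" where
  "smooth_step' t = - 4 * max 0 (1 - (max 0 (2 - t))\<^sup>2) * max 0 (2 - t)"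

text \<open>The squared positive part is \<open>C^1\<close>. \<open>smooth_step\<close> composes it
  twice: the inner copy is at least 1 for \<open>t \<le> 1\<close> and vanishes for
  \<open>t \<ge> 2\<close>, so the function drops from 1 to 0 on \<open>{1..2}\<close>.\<close>

lemma has_real_derivative_max_square: "((\<lambda>t. (max 0 t)\<^sup>2) has_real_derivative 2 * max 0 t) (at t)"
  for t :: real
proof -
  consider "t < 0" | "t = 0" | "0 < t" by linarith
  then show ?thesis
  proof cases
    case 1
    have "((\<lambda>_. 0::real) has_real_derivative 0) (at t)" by simp
    then have "((\<lambda>t. (max 0 t)\<^sup>2) has_real_derivative 0) (at t)"
      by (rule has_field_derivative_transform_within_open[where S = "{..<0}"]) (use 1 in auto)
    then show ?thesis using 1 by simp
  next
    case 3
    have "((\<lambda>t. t\<^sup>2) has_real_derivative 2 * t) (at t)" by (auto intro!: derivative_eq_intros)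
    then have "((\<lambda>t. (max 0 t)\<^sup>2) has_real_derivative 2 * t) (at t)"
      by (rule has_field_derivative_transform_within_open[where S = "{0<..}"]) (use 3 in auto)
    then show ?thesis using 3 by simp
  next
    case 2
    have "((\<lambda>h. ((max 0 (0 + h))\<^sup>2 - (max 0 0)\<^sup>2) / h) \<longlongrightarrow> (0::real)) (at 0)"
    proof (rule tendsto_sandwich[of "\<lambda>h. - \<bar>h\<bar>" _ _ "\<lambda>h. \<bar>h\<bar>"])
      show "\<forall>\<^sub>F h::real in at 0. ((max 0 (0 + h))\<^sup>2 - (max 0 0)\<^sup>2) / h \<le> \<bar>h\<bar>"
        by (rule always_eventually) (auto simp: max_def power2_eq_square)
      show "\<forall>\<^sub>F h::real in at 0. - \<bar>h\<bar> \<le> ((max 0 (0 + h))\<^sup>2 - (max 0 0)\<^sup>2) / h"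
        by (rule always_eventually) (auto simp: max_def power2_eq_square)
      show "((\<lambda>h::real. - \<bar>h\<bar>) \<longlongrightarrow> 0) (at 0)" "((\<lambda>h::real. \<bar>h\<bar>) \<longlongrightarrow> 0) (at 0)"
        by (auto intro!: tendsto_eq_intros)
    qed
    then show ?thesis using 2 by (simp add: DERIV_def)
  qed
qed

lemma has_real_derivative_smooth_step: "(smooth_step has_real_derivative smooth_step' t) (at t)"
proof -
  have a: "((\<lambda>t. (max 0 (2 - t))\<^sup>2) has_real_derivative 2 * max 0 (2 - t) * (- 1)) (at t)"
    by (rule DERIV_chain2[OF has_real_derivative_max_square]) (auto intro!: derivative_eq_intros)
  have "((\<lambda>t. (max 0 (1 - (max 0 (2 - t))\<^sup>2))\<^sup>2) has_real_derivative
      2 * max 0 (1 - (max 0 (2 - t))\<^sup>2) * (0 - 2 * max 0 (2 - t) * (- 1))) (at t)"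
    by (rule DERIV_chain2[OF has_real_derivative_max_square]) (intro DERIV_diff DERIV_const a)
  then have "((\<lambda>t. 1 - (max 0 (1 - (max 0 (2 - t))\<^sup>2))\<^sup>2) has_real_derivative
      0 - 2 * max 0 (1 - (max 0 (2 - t))\<^sup>2) * (0 - 2 * max 0 (2 - t) * (- 1))) (at t)"
    by (intro DERIV_diff DERIV_const)
  then show ?thesis
    by (simp add: smooth_step_def[abs_def] smooth_step'_def mult_ac)
qed

lemma smooth_step_bounds: "0 \<le> smooth_step t" "smooth_step t \<le> 1"
proof -
  have "max 0 (1 - (max 0 (2 - t))\<^sup>2) \<le> 1" by simp
  then show "0 \<le> smooth_step t" unfolding smooth_step_def by (simp add: power_le_one)
  show "smooth_step t \<le> 1" unfolding smooth_step_def by simp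
qed

lemma smooth_step_eq_1: "t \<le> 1 \<Longrightarrow> smooth_step t = 1" "t \<le> 1 \<Longrightarrow> smooth_step' t = 0"
proof -
  assume "t \<le> 1"
  then have "1 \<le> (max 0 (2 - t))\<^sup>2" by (simp add: one_le_power)
  then show "smooth_step t = 1" "smooth_step' t = 0" by (simp_all add: smooth_step_def smooth_step'_def)
qed

lemma smooth_step_eq_0: "2 \<le> t \<Longrightarrow> smooth_step t = 0" "2 \<le> t \<Longrightarrow> smooth_step' t = 0"
  by (simp_all add: smooth_step_def smooth_step'_def)

lemma smooth_step'_bound: "0 \<le> t \<Longrightarrow> \<bar>smooth_step' t\<bar> \<le> 8"
proof -
  assume "0 \<le> t"
  then have "max 0 (1 - (max 0 (2 - t))\<^sup>2) * max 0 (2 - t) \<le> 1 * 2"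
    by (intro mult_mono) auto
  then show ?thesis unfolding smooth_step'_def by (simp add: abs_mult mult.commute)
qed

text \<open>Cut-off of the ball of radius \<open>r\<close> within the ball of radius
  \<open>2 * r\<close>. The squared norm keeps it differentiable at the origin, and its value
  depends on \<open>norm u / r\<close> only, as the rescaling in \<open>sharp_minus_smooth\<close>
  requires.\<close>

definition bump :: "real \<Rightarrow> 'a::real_inner \<Rightarrow> real" where "bump r u = smooth_step ((u \<bullet> u) / r\<^sup>2)"
definition dbump :: "real \<Rightarrow> 'a::real_inner \<Rightarrow> 'a" where
  "dbump r u = (smooth_step' ((u \<bullet> u) / r\<^sup>2) * 2 / r\<^sup>2) *\<^sub>R u"

lemma bump_deriv: "(bump r has_derivative (\<lambda>h. dbump r u \<bullet> h)) (at u)"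
proof -
  have "((\<lambda>u. (u \<bullet> u) / r\<^sup>2) has_derivative (\<lambda>h. 2 * (u \<bullet> h) / r\<^sup>2)) (at u)"
    by (auto intro!: derivative_eq_intros simp: inner_commute divide_inverse algebra_simps)
  from DERIV_compose_FDERIV[OF has_real_derivative_smooth_step this]
  show ?thesis by (simp add: bump_def[abs_def] dbump_def mult_ac)
qed

lemma continuous_smooth_step': "continuous_on S smooth_step'"
  unfolding smooth_step'_def[abs_def] by (intro continuous_intros)

lemma continuous_dbump: "continuous_on S (dbump r)"
  unfolding dbump_def[abs_def] divide_inverse
  by (intro continuous_intros continuous_on_compose2[OF continuous_smooth_step'[of UNIV]]) auto

lemma continuous_bump: "continuous_on S (bump r)"
  by (rule has_derivative_continuous_on[OF has_derivative_at_withinI[OF bump_deriv]])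

lemma measurable_bump [measurable]: "bump r \<in> borel_measurable borel"
  and measurable_dbump [measurable]: "(dbump r :: 'a::euclidean_space \<Rightarrow> 'a) \<in> borel_measurable borel"
  by (auto intro: borel_measurable_continuous_onI continuous_bump continuous_dbump)

lemma bump_bounds: "0 \<le> bump r u" "bump r u \<le> 1"
  unfolding bump_def by (rule smooth_step_bounds)+

lemma bump_eq_1: "0 < r \<Longrightarrow> norm u \<le> r \<Longrightarrow> bump r u = 1" "0 < r \<Longrightarrow> norm u \<le> r \<Longrightarrow> dbump r u = 0"
proof -
  assume "0 < r" "norm u \<le> r"
  then have "(u \<bullet> u) / r\<^sup>2 \<le> 1" by (simp add: power2_norm_eq_inner[symmetric] power_mono)
  then show "bump r u = 1" "dbump r u = 0" by (simp_all add: bump_def dbump_def smooth_step_eq_1)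
qed

lemma bump_eq_0: "0 < r \<Longrightarrow> 2 * r \<le> norm u \<Longrightarrow> bump r u = 0" "0 < r \<Longrightarrow> 2 * r \<le> norm u \<Longrightarrow> dbump r u = 0"
proof -
  assume r: "0 < r" "2 * r \<le> norm u"
  then have "(2 * r)\<^sup>2 \<le> (norm u)\<^sup>2" by (intro power_mono) auto
  then have "4 * r\<^sup>2 \<le> u \<bullet> u" by (simp add: power2_norm_eq_inner power_mult_distrib)
  then have "2 * r\<^sup>2 \<le> u \<bullet> u" using zero_le_power2[of r] by linarith
  then have "2 \<le> (u \<bullet> u) / r\<^sup>2" using r by (simp add: field_simps)
  then show "bump r u = 0" "dbump r u = 0" by (simp_all add: bump_def dbump_def smooth_step_eq_0)
qed

lemma norm_dbump_le: "0 < r \<Longrightarrow> norm (dbump r u) \<le> 32 / r"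
proof (cases "2 * r \<le> norm u")
  case False
  assume r: "0 < r"
  have "norm (dbump r u) = \<bar>smooth_step' ((u \<bullet> u) / r\<^sup>2)\<bar> * 2 / r\<^sup>2 * norm u"
    by (simp add: dbump_def abs_mult)
  \<comment> \<open>8 bounds \<open>smooth_step'\<close>, the factor 2 over \<open>r\<close> squared
    is the chain rule, and \<open>norm u < 2 * r\<close> in this case.\<close>
  also have "\<dots> \<le> 8 * 2 / r\<^sup>2 * (2 * r)"
    using False r by (intro mult_mono divide_right_mono smooth_step'_bound) auto
  also have "\<dots> = 32 / r" using r by (simp add: power2_eq_square field_simps)
  finally show ?thesis .
qed (simp add: bump_eq_0)

lemma bump_scale: "0 < r \<Longrightarrow> bump r (r *\<^sub>R u) = bump 1 u"
  by (simp add: bump_def power2_eq_square)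

lemma bump_minus: "bump r (- u) = bump r u" by (simp add: bump_def)

context hyperplane begin

definition ball_vol :: real where "ball_vol = measure lam (cball 0 1)"

lemma integral_indicator_cball: "0 < R \<Longrightarrow> (\<integral>u. C * indicator (cball 0 R) u \<partial>lam) = C * (R ^ m * ball_vol)"
proof -
  assume "0 < R"
  then have "measure lam (cball 0 R) = R ^ m * ball_vol"
    unfolding ball_vol_def measure_def by (subst emeasure_lam_cball) (auto simp: enn2real_mult)
  then show ?thesis using emeasure_lam_cball_finite[of R] by simp
qed

lemma norm_integral_lam_le:
  fixes f :: "'a \<Rightarrow> 'b::{banach, second_countable_topology}"
  assumes "0 < R" and f: "f \<in> borel_measurable borel"
    and bound: "\<And>u. u \<in> T \<Longrightarrow> norm (f u) \<le> C * indicator (cball 0 R) u"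
  shows "norm (\<integral>u. f u \<partial>lam) \<le> C * (R ^ m * ball_vol)"
proof -
  have "norm (\<integral>u. f u \<partial>lam) \<le> (\<integral>u. norm (f u) \<partial>lam)" by (rule integral_norm_bound)
  also have "\<dots> \<le> (\<integral>u. C * indicator (cball 0 R) u \<partial>lam)"
  proof (rule integral_mono_AE)
    show "integrable lam (\<lambda>u. norm (f u))"
      using integrable_lam_bounded[OF f bound] by (rule integrable_norm)
    show "integrable lam (\<lambda>u. C * indicator (cball 0 R) u)"
      using emeasure_lam_cball_finite[of R] by (intro integrable_mult_right integrable_real_indicator) auto
    show "AE u in lam. norm (f u) \<le> C * indicator (cball 0 R) u"
      using AE_flat by eventually_elim (rule bound)
  qed
  also have "\<dots> = C * (R ^ m * ball_vol)" by (rule integral_indicator_cball[OF \<open>0 < R\<close>])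
  finally show ?thesis .
qed

lemma integral_odd:
  fixes f :: "'a \<Rightarrow> 'b::{banach, second_countable_topology}"
  assumes [measurable]: "f \<in> borel_measurable borel" and odd: "\<And>u. f (- u) = - f u"
  shows "(\<integral>u. f u \<partial>lam) = 0"
proof -
  have "(\<integral>u. f u \<partial>lam) = (\<integral>u. f ((- 1) *\<^sub>R u + 0) \<partial>lam)"
    by (subst integral_lam_similarity) (auto simp: span_zero)
  also have "\<dots> = - (\<integral>u. f u \<partial>lam)" using odd by simp
  finally have "2 *\<^sub>R (\<integral>u. f u \<partial>lam) = 0" by (metis add.right_inverse scaleR_2)
  then show ?thesis by simp
qed

end

text \<open>The graph touches \<open>T\<close> at the origin. \<delta> bounds the slope seen from
  the origin and is chosen at the end, in terms of the non-tangential cone; \<open>r\<close> is the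
  scale of the cut-off.\<close>

locale flux_origin = flux +
  fixes \<delta> r :: real
  assumes \<psi>0: "\<psi> 0 = 0" and d\<psi>0: "d\<psi> 0 = 0"
    and \<delta>: "0 < \<delta>" "\<delta> \<le> 1" and \<psi>_le: "\<And>u. u \<in> span B \<Longrightarrow> \<bar>\<psi> u\<bar> \<le> \<delta> * norm u"
    and r_pos: "0 < r"
begin

text \<open>The flux through the graph of \<open>s \<psi>\<close> with cut-off \<open>\<zeta>\<close>; \<open>Rint\<close> is its derivative in \<open>s\<close>.\<close>

definition G :: "('a \<Rightarrow> real) \<Rightarrow> 'a \<Rightarrow> real \<Rightarrow> 'b" where
  "G \<zeta> \<tau> s = (\<integral>u. \<zeta> u *\<^sub>R E (u + (s * \<psi> u) *\<^sub>R \<nu> - \<tau>) (\<nu> - s *\<^sub>R d\<psi> u) \<partial>lam)"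

definition Rint :: "real \<Rightarrow> 'a \<Rightarrow> real \<Rightarrow> 'b" where
  "Rint \<epsilon> \<tau> s = (\<integral>u. \<psi> u *\<^sub>R E (u + (s * \<psi> u) *\<^sub>R \<nu> - \<tau>) (dbump \<epsilon> u) \<partial>lam)"

lemma dbump_T: "u \<in> T \<Longrightarrow> dbump \<epsilon> u \<in> T"
  unfolding dbump_def by (rule span_scale)

lemma \<psi>_little: "0 < e \<Longrightarrow> \<exists>\<rho>>0. \<forall>u. norm u < \<rho> \<longrightarrow> \<bar>\<psi> u\<bar> \<le> e * norm u"
proof -
  assume "0 < e"
  have "(\<psi> has_derivative (\<lambda>h. 0)) (at 0)" using \<psi>_deriv[of 0] d\<psi>0 by simp
  then obtain \<rho> where "0 < \<rho>" "\<And>u. norm (u - 0) < \<rho> \<Longrightarrow> norm (\<psi> u - \<psi> 0 - 0) \<le> e * norm (u - 0)"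
    using \<open>0 < e\<close> unfolding has_derivative_at_alt by metis
  then show ?thesis using \<psi>0 by auto
qed

lemma norm_graph_ge: "u \<in> T \<Longrightarrow> norm u \<le> norm (u + (s * \<psi> u) *\<^sub>R \<nu>)"
  by (rule norm_le_add_\<nu>)

lemma norm_graph_le: "u \<in> T \<Longrightarrow> s \<in> {0..1} \<Longrightarrow> norm (u + (s * \<psi> u) *\<^sub>R \<nu>) \<le> 2 * norm u"
proof -
  assume u: "u \<in> T" and s: "s \<in> {0..1}"
  have "norm (u + (s * \<psi> u) *\<^sub>R \<nu>) \<le> norm u + \<bar>s\<bar> * \<bar>\<psi> u\<bar>"
    using norm_triangle_ineq[of u "(s * \<psi> u) *\<^sub>R \<nu>"] norm_\<nu> by (simp add: abs_mult)
  also have "\<bar>s\<bar> * \<bar>\<psi> u\<bar> \<le> 1 * (1 * norm u)"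
    using s \<delta> \<psi>_le[OF u] by (intro mult_mono order_trans[OF \<psi>_le[OF u]] mult_right_mono) auto
  finally show ?thesis by simp
qed

text \<open>Stated with an arbitrary slope bound \<open>c\<close> on the support:
  \<open>c = \<delta>\<close> gives integrability, and an arbitrarily small \<open>c\<close> gives
  \<open>Rint_small\<close>.\<close>

lemma integrable_Rint:
  assumes "0 < \<epsilon>" "s \<in> {0..1}"
  shows "integrable lam (\<lambda>u. \<psi> u *\<^sub>R E (u + (s * \<psi> u) *\<^sub>R \<nu> - 0) (dbump \<epsilon> u))"
    and "\<And>c u. u \<in> T \<Longrightarrow> (\<And>u. u \<in> T \<Longrightarrow> norm u \<le> 2 * \<epsilon> \<Longrightarrow> \<bar>\<psi> u\<bar> \<le> c * norm u) \<Longrightarrow> 0 \<le> c \<Longrightarrow>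
      norm (\<psi> u *\<^sub>R E (u + (s * \<psi> u) *\<^sub>R \<nu> - 0) (dbump \<epsilon> u)) \<le> (64 * P_bound / \<epsilon> ^ m * c) * indicator (cball 0 (2 * \<epsilon>)) u"
proof -
  show b: "norm (\<psi> u *\<^sub>R E (u + (s * \<psi> u) *\<^sub>R \<nu> - 0) (dbump \<epsilon> u)) \<le> (64 * P_bound / \<epsilon> ^ m * c) * indicator (cball 0 (2 * \<epsilon>)) u"
    if u: "u \<in> T" and c: "\<And>u. u \<in> T \<Longrightarrow> norm u \<le> 2 * \<epsilon> \<Longrightarrow> \<bar>\<psi> u\<bar> \<le> c * norm u" "0 \<le> c" for c u
  proof (cases "\<epsilon> \<le> norm u \<and> norm u \<le> 2 * \<epsilon>")
    case True
    have "norm (E (u + (s * \<psi> u) *\<^sub>R \<nu> - 0) (dbump \<epsilon> u)) \<le> P_bound * norm (dbump \<epsilon> u) / norm (u + (s * \<psi> u) *\<^sub>R \<nu>) ^ m"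
      using norm_E_le[of "u + (s * \<psi> u) *\<^sub>R \<nu>"] by simp
    also have "\<dots> \<le> P_bound * (32 / \<epsilon>) / \<epsilon> ^ m"
      using assms(1) True P_bound(1) norm_graph_ge[OF u, of s] norm_dbump_le[OF assms(1), of u]
      by (intro frac_le mult_left_mono power_mono) auto
    finally have "\<bar>\<psi> u\<bar> * norm (E (u + (s * \<psi> u) *\<^sub>R \<nu> - 0) (dbump \<epsilon> u)) \<le> (c * (2 * \<epsilon>)) * (P_bound * (32 / \<epsilon>) / \<epsilon> ^ m)"
      using True c u by (intro mult_mono order_trans[OF c(1)] mult_left_mono) auto
    also have "\<dots> = 64 * P_bound / \<epsilon> ^ m * c" using assms(1) by simp
    finally show ?thesis using True by simp
  next
    case False
    then have "dbump \<epsilon> u = 0" using bump_eq_1(2)[of \<epsilon> u] bump_eq_0(2)[of \<epsilon> u] assms(1) by force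
    then show ?thesis using c(2) P_bound(1) assms(1) by (simp add: linear_0[OF E_linear])
  qed
  show "integrable lam (\<lambda>u. \<psi> u *\<^sub>R E (u + (s * \<psi> u) *\<^sub>R \<nu> - 0) (dbump \<epsilon> u))"
  proof (rule integrable_lam_bounded)
    show "(\<lambda>u. \<psi> u *\<^sub>R E (u + (s * \<psi> u) *\<^sub>R \<nu> - 0) (dbump \<epsilon> u)) \<in> borel_measurable borel" by measurable
  qed (rule b, use \<psi>_le \<delta> in auto)
qed

text \<open>Up to constants, on the annulus of size \<epsilon> the factor \<psi> is at most
  \<open>c * \<epsilon>\<close>, the gradient of the cut-off is of order
  \<open>1 / \<epsilon>\<close>, the kernel of order \<open>1 / \<epsilon> ^ m\<close> and the
  volume of order \<open>\<epsilon> ^ m\<close>. All powers cancel, so smallness comes from the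
  slope \<open>c\<close> alone.\<close>

lemma Rint_small: "0 < e \<Longrightarrow> \<exists>\<epsilon>0>0. \<forall>\<epsilon>. 0 < \<epsilon> \<longrightarrow> \<epsilon> < \<epsilon>0 \<longrightarrow> (\<forall>s\<in>{0..1}. norm (Rint \<epsilon> 0 s) \<le> e)"
proof -
  assume e: "0 < e"
  \<comment> \<open>Chosen to cancel the constants of \<open>integrable_Rint(2)\<close> and the
    volume of the ball of radius \<open>2 * \<epsilon>\<close>; \<open>ball_vol + 1\<close> keeps
    the denominator positive.\<close>
  define c where "c = e / (64 * P_bound * 2 ^ m * (ball_vol + 1))"
  have bv: "0 \<le> ball_vol" by (simp add: ball_vol_def)
  have c: "0 < c" using e P_bound(1) bv by (auto simp: c_def)
  from \<psi>_little[OF c] obtain \<rho> where \<rho>: "0 < \<rho>" "\<And>u. norm u < \<rho> \<Longrightarrow> \<bar>\<psi> u\<bar> \<le> c * norm u" by auto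
  have "norm (Rint \<epsilon> 0 s) \<le> e" if \<epsilon>: "0 < \<epsilon>" "\<epsilon> < \<rho> / 2" and s: "s \<in> {0..1}" for \<epsilon> s
  proof -
    have "norm (Rint \<epsilon> 0 s) \<le> (64 * P_bound / \<epsilon> ^ m * c) * ((2 * \<epsilon>) ^ m * ball_vol)"
      unfolding Rint_def using \<epsilon> s \<rho>(2) c by (intro norm_integral_lam_le integrable_Rint(2)) auto
    also have "\<dots> = e * (ball_vol / (ball_vol + 1))"
      using \<epsilon>(1) P_bound(1) bv by (simp add: c_def power_mult_distrib divide_simps)
    also have "\<dots> \<le> e * 1" using e bv by (intro mult_left_mono) auto
    finally show ?thesis by simp
  qed
  then show ?thesis using \<rho>(1) by (intro exI[of _ "\<rho> / 2"]) auto
qed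

text \<open>The difference of the two cut-offs lives on
  \<open>\<epsilon> \<le> norm u \<le> 2 * r\<close>, off the pole, so \<open>interpolation\<close>
  applies even with the pole on the graph itself.\<close>

lemma G0_deriv:
  assumes \<epsilon>: "0 < \<epsilon>" "\<epsilon> \<le> r" and s: "s \<in> {0..1}"
  shows "(G (\<lambda>u. bump r u - bump \<epsilon> u) 0 has_vector_derivative Rint r 0 s - Rint \<epsilon> 0 s) (at s within {0..1})"
proof -
  let ?S = "{u::'a. \<epsilon> \<le> norm u \<and> norm u \<le> 2 * r}"
  have "((\<lambda>s. \<integral>u. (bump r u - bump \<epsilon> u) *\<^sub>R E (u + (s * \<psi> u) *\<^sub>R \<nu> - 0) (\<nu> - s *\<^sub>R d\<psi> u) \<partial>lam) has_vector_derivative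
     (\<integral>u. \<psi> u *\<^sub>R E (u + (s * \<psi> u) *\<^sub>R \<nu> - 0) (dbump r u - dbump \<epsilon> u) \<partial>lam)) (at s within {0..1})"
  proof (rule interpolation[where S = ?S and \<tau>' = 0 and t = 0])
    show "((\<lambda>u. bump r u - bump \<epsilon> u) has_derivative (\<lambda>h. (dbump r u - dbump \<epsilon> u) \<bullet> h)) (at u)" for u
      unfolding inner_diff_left by (intro has_derivative_diff bump_deriv)
    show "continuous_on UNIV (\<lambda>u. dbump r u - dbump \<epsilon> u)" by (intro continuous_intros continuous_dbump)
    have "?S = cball 0 (2 * r) - ball 0 \<epsilon>" by auto
    then show "compact ?S" by (simp only: compact_diff compact_cball open_ball)
    show "bump r u - bump \<epsilon> u = 0" if "u \<notin> ?S" for u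
      using that \<epsilon> r_pos bump_eq_1(1)[of \<epsilon> u] bump_eq_1(1)[of r u] bump_eq_0(1)[of r u] bump_eq_0(1)[of \<epsilon> u] by force
    show "u + (s * \<psi> u) *\<^sub>R \<nu> \<noteq> 0" if "u \<in> ?S" "u \<in> T" for u s
      using norm_graph_ge[OF that(2), of s] that(1) \<epsilon>(1) by auto
  qed (auto simp: span_zero intro!: span_diff dbump_T s[unfolded atLeastAtMost_iff, THEN conjunct1] s[unfolded atLeastAtMost_iff, THEN conjunct2])
  moreover have "(\<integral>u. \<psi> u *\<^sub>R E (u + (s * \<psi> u) *\<^sub>R \<nu> - 0) (dbump r u - dbump \<epsilon> u) \<partial>lam) = Rint r 0 s - Rint \<epsilon> 0 s"
    unfolding Rint_def linear_diff[OF E_linear] scaleR_diff_right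
    by (rule Bochner_Integration.integral_diff; rule integrable_Rint(1)) (use \<epsilon> r_pos s in auto)
  ultimately show ?thesis unfolding G_def by simp
qed

lemma G0_flat: "G (\<lambda>u. bump r u - bump \<epsilon> u) 0 0 = 0"
  unfolding G_def
  by (simp, rule integral_odd) (measurable, simp add: bump_minus E_minus)

lemma vector_derivative_bound_01:
  fixes h :: "real \<Rightarrow> 'c::real_normed_vector"
  assumes "\<And>s. s \<in> {0..1} \<Longrightarrow> (h has_vector_derivative h' s) (at s within {0..1})"
    and "\<And>s. s \<in> {0..1} \<Longrightarrow> norm (h' s) \<le> C"
  shows "norm (h 1 - h 0) \<le> C"
proof -
  have "norm (h 1 - h 0) \<le> C * norm (1 - (0::real))"
  proof (rule differentiable_bound[of "{0..1}" h "\<lambda>s k. k *\<^sub>R h' s"])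
    show "(h has_derivative (\<lambda>k. k *\<^sub>R h' s)) (at s within {0..1})" if "s \<in> {0..1}" for s
      using assms(1)[OF that] by (simp add: has_vector_derivative_def)
    show "onorm (\<lambda>k. k *\<^sub>R h' s) \<le> C" if "s \<in> {0..1}" for s
    proof (rule onorm_bound)
      show "0 \<le> C" using assms(2)[OF that] norm_ge_zero order_trans by blast
      show "norm (k *\<^sub>R h' s) \<le> C * norm k" for k :: real
        using mult_left_mono[OF assms(2)[OF that], of "\<bar>k\<bar>"] by (simp add: mult.commute)
    qed
  qed auto
  then show ?thesis by simp
qed

text \<open>Flux through the graph with the pole on it and an \<epsilon>-ball smoothly cut
  out.\<close>

definition Jint :: "real \<Rightarrow> 'b" where "Jint \<epsilon> = G (\<lambda>u. bump r u - bump \<epsilon> u) 0 1"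

text \<open>Along the deformation the contribution \<open>Rint r\<close> of the outer cut-off
  cancels in the difference, the inner ones are small, and both fluxes start from 0 at the
  hyperplane.\<close>

lemma Jint_Cauchy:
  assumes "0 < e"
  obtains \<epsilon>0 where "0 < \<epsilon>0" "\<And>\<epsilon> \<epsilon>'. 0 < \<epsilon> \<Longrightarrow> \<epsilon> < \<epsilon>0 \<Longrightarrow> 0 < \<epsilon>' \<Longrightarrow> \<epsilon>' < \<epsilon>0 \<Longrightarrow> norm (Jint \<epsilon> - Jint \<epsilon>') \<le> e"
    "\<And>\<epsilon> s. 0 < \<epsilon> \<Longrightarrow> \<epsilon> < \<epsilon>0 \<Longrightarrow> s \<in> {0..1} \<Longrightarrow> norm (Rint \<epsilon> 0 s) \<le> e" "\<epsilon>0 \<le> r"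
proof -
  obtain \<epsilon>1 where \<epsilon>1: "0 < \<epsilon>1" "\<And>\<epsilon> s. 0 < \<epsilon> \<Longrightarrow> \<epsilon> < \<epsilon>1 \<Longrightarrow> s \<in> {0..1} \<Longrightarrow> norm (Rint \<epsilon> 0 s) \<le> e / 2"
    using Rint_small[of "e / 2"] assms by auto
  have "norm (Jint \<epsilon> - Jint \<epsilon>') \<le> e" if a: "0 < \<epsilon>" "\<epsilon> < min \<epsilon>1 r" "0 < \<epsilon>'" "\<epsilon>' < min \<epsilon>1 r" for \<epsilon> \<epsilon>'
  proof -
    let ?h = "\<lambda>s. G (\<lambda>u. bump r u - bump \<epsilon> u) 0 s - G (\<lambda>u. bump r u - bump \<epsilon>' u) 0 s"
    have "norm (?h 1 - ?h 0) \<le> e"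
    proof (rule vector_derivative_bound_01)
      fix s :: real assume s: "s \<in> {0..1}"
      show "(?h has_vector_derivative ((Rint r 0 s - Rint \<epsilon> 0 s) - (Rint r 0 s - Rint \<epsilon>' 0 s))) (at s within {0..1})"
        using a by (intro has_vector_derivative_diff G0_deriv s) auto
      have "norm ((Rint r 0 s - Rint \<epsilon> 0 s) - (Rint r 0 s - Rint \<epsilon>' 0 s)) \<le> norm (Rint \<epsilon>' 0 s) + norm (Rint \<epsilon> 0 s)"
        using norm_triangle_ineq4[of "Rint \<epsilon>' 0 s" "Rint \<epsilon> 0 s"] by simp
      also have "\<dots> \<le> e / 2 + e / 2" using a s by (intro add_mono \<epsilon>1(2)) auto
      finally show "norm ((Rint r 0 s - Rint \<epsilon> 0 s) - (Rint r 0 s - Rint \<epsilon>' 0 s)) \<le> e" by simp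
    qed
    then show ?thesis by (simp add: G0_flat Jint_def)
  qed
  moreover have "norm (Rint \<epsilon> 0 s) \<le> e" if "0 < \<epsilon>" "\<epsilon> < min \<epsilon>1 r" "s \<in> {0..1}" for \<epsilon> s
    using \<epsilon>1(2)[of \<epsilon> s] that assms by auto
  ultimately show ?thesis using \<epsilon>1(1) r_pos by (intro that[of "min \<epsilon>1 r"]) auto
qed

lemma Jint_limit: "\<exists>A. (Jint \<longlongrightarrow> A) (at_right 0)"
proof -
  have "Cauchy (\<lambda>n. Jint (1 / real (Suc n)))"
  proof (rule CauchyI)
    fix e :: real assume "0 < e"
    then obtain \<epsilon>0 where \<epsilon>0: "0 < \<epsilon>0" "\<And>\<epsilon> \<epsilon>'. 0 < \<epsilon> \<Longrightarrow> \<epsilon> < \<epsilon>0 \<Longrightarrow> 0 < \<epsilon>' \<Longrightarrow> \<epsilon>' < \<epsilon>0 \<Longrightarrow> norm (Jint \<epsilon> - Jint \<epsilon>') \<le> e / 2"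
      using Jint_Cauchy[of "e / 2"] by (metis half_gt_zero)
    obtain N where N: "1 / real (Suc N) < \<epsilon>0" using nat_approx_posE[OF \<epsilon>0(1)] .
    have lt: "1 / real (Suc n) < \<epsilon>0" if "N \<le> n" for n
    proof -
      have "1 / real (Suc n) \<le> 1 / real (Suc N)" using that by (intro divide_left_mono) auto
      then show ?thesis using N by (rule le_less_trans)
    qed
    have le: "norm (Jint (1 / real (Suc n)) - Jint (1 / real (Suc k))) \<le> e / 2" if "N \<le> n" "N \<le> k" for n k
      by (rule \<epsilon>0(2)[OF _ lt[OF that(1)] _ lt[OF that(2)]]) simp_all
    have "e / 2 < e" using \<open>0 < e\<close> by simp
    then show "\<exists>N. \<forall>n\<ge>N. \<forall>k\<ge>N. norm (Jint (1 / real (Suc n)) - Jint (1 / real (Suc k))) < e"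
      by (intro exI[of _ N] allI impI le_less_trans[OF le])
  qed
  then obtain A where A: "(\<lambda>n. Jint (1 / real (Suc n))) \<longlonglongrightarrow> A"
    using Cauchy_convergent_iff convergent_def by blast
  have "(Jint \<longlongrightarrow> A) (at_right 0)"
  proof (rule tendstoI)
    fix e :: real assume "0 < e"
    then obtain \<epsilon>0 where \<epsilon>0: "0 < \<epsilon>0" "\<And>\<epsilon> \<epsilon>'. 0 < \<epsilon> \<Longrightarrow> \<epsilon> < \<epsilon>0 \<Longrightarrow> 0 < \<epsilon>' \<Longrightarrow> \<epsilon>' < \<epsilon>0 \<Longrightarrow> norm (Jint \<epsilon> - Jint \<epsilon>') \<le> e / 2"
      using Jint_Cauchy[of "e / 2"] by (metis half_gt_zero)
    have "dist (Jint \<epsilon>) A < e" if \<epsilon>: "0 < \<epsilon>" "\<epsilon> < \<epsilon>0" for \<epsilon>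
    proof -
      have "(\<lambda>n. norm (Jint \<epsilon> - Jint (1 / real (Suc n)))) \<longlonglongrightarrow> norm (Jint \<epsilon> - A)"
        by (intro tendsto_intros A)
      moreover have "\<forall>\<^sub>F n in sequentially. norm (Jint \<epsilon> - Jint (1 / real (Suc n))) \<le> e / 2"
      proof -
        have "\<forall>\<^sub>F n in sequentially. 1 / real (Suc n) < \<epsilon>0"
          using order_tendstoD(2)[OF LIMSEQ_inverse_real_of_nat \<epsilon>0(1)] by (simp add: inverse_eq_divide)
        then show ?thesis by eventually_elim (use \<epsilon> \<epsilon>0(2) in auto)
      qed
      ultimately have "norm (Jint \<epsilon> - A) \<le> e / 2" by (rule tendsto_upperbound) simp
      then show ?thesis using \<open>0 < e\<close> by (simp add: dist_norm)
    qed
    then show "\<forall>\<^sub>F \<epsilon> in at_right 0. dist (Jint \<epsilon>) A < e"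
      unfolding eventually_at_right_field using \<epsilon>0(1) by blast
  qed
  then show ?thesis ..
qed

text \<open>A principal value that is never evaluated: \<open>principal_value_flux\<close> and
  \<open>nontangential_flux\<close> contain the same \<open>A0\<close>.\<close>

definition A0 :: 'b where "A0 = (SOME A. (Jint \<longlongrightarrow> A) (at_right 0))"

lemma Jint_tendsto: "(Jint \<longlongrightarrow> A0) (at_right 0)"
  unfolding A0_def by (rule someI_ex[OF Jint_limit])

text \<open>\<open>dbump r\<close> is supported away from the pole, where the kernel is uniformly
  continuous; hence moving the pole to \<open>\<tau> n\<close> perturbs \<open>Rint r\<close>
  uniformly in \<open>s\<close>.\<close>

lemma Rint_uniform:
  assumes \<tau>: "\<tau> \<longlonglongrightarrow> 0" and e: "0 < e"
  shows "\<forall>\<^sub>F n in sequentially. \<forall>s\<in>{0..1}. norm (Rint r (\<tau> n) s - Rint r 0 s) \<le> e \<and>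
     integrable lam (\<lambda>u. \<psi> u *\<^sub>R E (u + (s * \<psi> u) *\<^sub>R \<nu> - \<tau> n) (dbump r u))"
proof -
  \<comment> \<open>Graph points over the annulus \<open>r \<le> norm u \<le> 2 * r\<close> have
    norm between \<open>r\<close> and \<open>4 * r\<close>; a pole with
    \<open>norm (\<tau> n) < r / 2\<close> shifts this at most to the range from
    \<open>r / 2\<close> to \<open>5 * r\<close>. The second factor holds the values of
    \<open>dbump r\<close>.\<close>
  define Z where "Z = (cball (0::'a) (5 * r) - ball 0 (r / 2)) \<times> cball (0::'a) (32 / r)"
  have "uniformly_continuous_on Z (\<lambda>z. E (fst z) (snd z))"
  proof (rule compact_uniformly_continuous)
    show "continuous_on Z (\<lambda>z. E (fst z) (snd z))"
      using r_pos by (intro continuous_on_E continuous_intros) (auto simp: Z_def)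
    show "compact Z" unfolding Z_def by (intro compact_Times compact_diff) auto
  qed
  define c where "c = e / ((2 * r) * ((2 * r) ^ m * (ball_vol + 1)))"
  have bv: "0 \<le> ball_vol" by (simp add: ball_vol_def)
  have c: "0 < c" using e r_pos bv by (auto simp: c_def)
  obtain d where d: "0 < d" "\<And>z z'. z \<in> Z \<Longrightarrow> z' \<in> Z \<Longrightarrow> dist z' z < d \<Longrightarrow> dist (E (fst z') (snd z')) (E (fst z) (snd z)) < c"
    using \<open>uniformly_continuous_on Z _\<close> c unfolding uniformly_continuous_on_def by metis
  have "\<forall>\<^sub>F n in sequentially. norm (\<tau> n) < min d (r / 2)"
    using order_tendstoD(2)[OF tendsto_norm[OF \<tau>], of "min d (r / 2)"] d(1) r_pos by simp
  then show ?thesis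
  proof eventually_elim
    case (elim n)
    have diff: "norm (\<psi> u *\<^sub>R E (u + (s * \<psi> u) *\<^sub>R \<nu> - \<tau> n) (dbump r u) - \<psi> u *\<^sub>R E (u + (s * \<psi> u) *\<^sub>R \<nu> - 0) (dbump r u))
        \<le> (2 * r * c) * indicator (cball 0 (2 * r)) u" if s: "s \<in> {0..1}" and u: "u \<in> T" for s u
    proof (cases "r \<le> norm u \<and> norm u \<le> 2 * r")
      case True
      let ?w = "u + (s * \<psi> u) *\<^sub>R \<nu>"
      have w: "r \<le> norm ?w" "norm ?w \<le> 4 * r"
        using norm_graph_ge[OF u, of s] norm_graph_le[OF u s] True by auto
      have b: "norm (dbump r u) \<le> 32 / r" by (rule norm_dbump_le[OF r_pos])
      have "norm (?w - \<tau> n) \<le> norm ?w + norm (\<tau> n)" "norm ?w - norm (\<tau> n) \<le> norm (?w - \<tau> n)"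
        by (rule norm_triangle_ineq4, rule norm_triangle_ineq2)
      then have "(?w - \<tau> n, dbump r u) \<in> Z" "(?w, dbump r u) \<in> Z"
        using w b elim r_pos by (auto simp: Z_def)
      then have "dist (E (?w - \<tau> n) (dbump r u)) (E ?w (dbump r u)) < c"
        using d(2)[of "(?w, dbump r u)" "(?w - \<tau> n, dbump r u)"] elim by (simp add: dist_Pair_Pair dist_norm)
      then have "\<bar>\<psi> u\<bar> * norm (E (?w - \<tau> n) (dbump r u) - E (?w - 0) (dbump r u)) \<le> (1 * (2 * r)) * c"
        using True \<delta> r_pos \<psi>_le[OF u]
        by (intro mult_mono order_trans[OF \<psi>_le[OF u]]) (auto simp: dist_norm)
      then show ?thesis using True by (simp add: scaleR_diff_right[symmetric])
    next
      case False
      then have "dbump r u = 0" using bump_eq_1(2)[of r u] bump_eq_0(2)[of r u] r_pos by force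
      then show ?thesis using c r_pos by (simp add: linear_0[OF E_linear])
    qed
    show ?case
    proof
      fix s :: real assume s: "s \<in> {0..1}"
      let ?f = "\<lambda>\<tau> u. \<psi> u *\<^sub>R E (u + (s * \<psi> u) *\<^sub>R \<nu> - \<tau>) (dbump r u)"
      have i0: "integrable lam (?f 0)" by (rule integrable_Rint(1)[OF r_pos s])
      have "integrable lam (\<lambda>u. ?f (\<tau> n) u - ?f 0 u)"
        by (rule integrable_lam_bounded[OF _ diff[OF s]]) measurable
      then have "integrable lam (\<lambda>u. (?f (\<tau> n) u - ?f 0 u) + ?f 0 u)" using i0 by (rule Bochner_Integration.integrable_add)
      then have i1: "integrable lam (?f (\<tau> n))" by simp
      have "Rint r (\<tau> n) s - Rint r 0 s = (\<integral>u. ?f (\<tau> n) u - ?f 0 u \<partial>lam)"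
        unfolding Rint_def by (rule Bochner_Integration.integral_diff[OF i1 i0, symmetric])
      also have "norm \<dots> \<le> (2 * r * c) * ((2 * r) ^ m * ball_vol)"
        using r_pos by (intro norm_integral_lam_le diff[OF s]) auto
      also have "\<dots> = e * (ball_vol / (ball_vol + 1))"
        using r_pos bv by (simp add: c_def divide_simps)
      also have "\<dots> \<le> e * 1" using e bv by (intro mult_left_mono) auto
      finally show "norm (Rint r (\<tau> n) s - Rint r 0 s) \<le> e \<and> integrable lam (?f (\<tau> n))" using i1 by simp
    qed
  qed
qed

lemma G\<tau>_deriv:
  assumes \<tau>: "\<tau> = \<tau>' + t *\<^sub>R \<nu>" "\<tau>' \<in> T" and nz: "\<And>u s. u \<in> T \<Longrightarrow> s \<in> {0..1} \<Longrightarrow> u + (s * \<psi> u) *\<^sub>R \<nu> \<noteq> \<tau>"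
    and s: "s \<in> {0..1}"
  shows "(G (bump r) \<tau> has_vector_derivative Rint r \<tau> s) (at s within {0..1})"
  unfolding G_def Rint_def
proof (rule interpolation[where S = "cball 0 (2 * r)" and \<tau>' = \<tau>' and t = t])
  show "bump r u = 0" if "u \<notin> cball 0 (2 * r)" for u
    using that r_pos bump_eq_0(1)[of r u] by auto
qed (use \<tau> nz s in \<open>auto intro: bump_deriv dbump_T continuous_dbump\<close>)

text \<open>Two deformations are compared: with the pole at \<open>\<tau> n\<close> and the full
  cut-off, and with the pole at 0 and an \<epsilon>-ball removed. Their derivatives in
  \<open>s\<close> differ by \<open>Rint r (\<tau> n) s - Rint r 0 s\<close> and
  \<open>Rint \<epsilon> 0 s\<close>, both small; the second flux runs from 0 to
  \<open>Jint \<epsilon>\<close>, which is close to \<open>A0\<close>.\<close>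

lemma interpolation_limit:
  assumes \<tau>: "\<And>n. \<tau> n = \<tau>' n + t n *\<^sub>R \<nu>" "\<And>n. \<tau>' n \<in> T" and lim: "\<tau> \<longlonglongrightarrow> 0"
    and nz: "\<And>n u s. u \<in> T \<Longrightarrow> s \<in> {0..1} \<Longrightarrow> u + (s * \<psi> u) *\<^sub>R \<nu> \<noteq> \<tau> n"
  shows "(\<lambda>n. G (bump r) (\<tau> n) 1 - G (bump r) (\<tau> n) 0) \<longlonglongrightarrow> A0"
proof (rule LIMSEQ_I)
  fix e :: real assume e: "0 < e"
  obtain \<epsilon>0 where \<epsilon>0: "0 < \<epsilon>0" "\<And>\<epsilon> s. 0 < \<epsilon> \<Longrightarrow> \<epsilon> < \<epsilon>0 \<Longrightarrow> s \<in> {0..1} \<Longrightarrow> norm (Rint \<epsilon> 0 s) \<le> e / 4" "\<epsilon>0 \<le> r"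
    using Jint_Cauchy[of "e / 4"] e by (metis zero_less_divide_iff zero_less_numeral)
  have "\<forall>\<^sub>F \<epsilon> in at_right 0. dist (Jint \<epsilon>) A0 < e / 4" using Jint_tendsto e by (intro tendstoD) auto
  then obtain \<epsilon>1 where \<epsilon>1: "0 < \<epsilon>1" "\<And>\<epsilon>. 0 < \<epsilon> \<Longrightarrow> \<epsilon> < \<epsilon>1 \<Longrightarrow> dist (Jint \<epsilon>) A0 < e / 4"
    unfolding eventually_at_right_field by blast
  define \<epsilon> where "\<epsilon> = min \<epsilon>0 \<epsilon>1 / 2"
  have \<epsilon>: "0 < \<epsilon>" "\<epsilon> < \<epsilon>0" "\<epsilon> < \<epsilon>1" "\<epsilon> \<le> r" using \<epsilon>0 \<epsilon>1(1) by (auto simp: \<epsilon>_def)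
  obtain N where N: "\<And>n s. N \<le> n \<Longrightarrow> s \<in> {0..1} \<Longrightarrow> norm (Rint r (\<tau> n) s - Rint r 0 s) \<le> e / 4"
    using Rint_uniform[OF lim, of "e / 4"] e unfolding eventually_sequentially by force
  have "norm (G (bump r) (\<tau> n) 1 - G (bump r) (\<tau> n) 0 - A0) < e" if n: "N \<le> n" for n
  proof -
    let ?h = "\<lambda>s. G (bump r) (\<tau> n) s - G (\<lambda>u. bump r u - bump \<epsilon> u) 0 s"
    have "norm (?h 1 - ?h 0) \<le> e / 2"
    proof (rule vector_derivative_bound_01)
      fix s :: real assume s: "s \<in> {0..1}"
      show "(?h has_vector_derivative (Rint r (\<tau> n) s - (Rint r 0 s - Rint \<epsilon> 0 s))) (at s within {0..1})"
        by (intro has_vector_derivative_diff G0_deriv G\<tau>_deriv[OF \<tau>(1) \<tau>(2)] nz \<epsilon> s)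
      have "norm (Rint r (\<tau> n) s - (Rint r 0 s - Rint \<epsilon> 0 s)) \<le> norm (Rint r (\<tau> n) s - Rint r 0 s) + norm (Rint \<epsilon> 0 s)"
        unfolding diff_diff_eq2 diff_add_eq[symmetric] by (rule norm_triangle_ineq)
      also have "\<dots> \<le> e / 4 + e / 4" using \<epsilon> s n by (intro add_mono N \<epsilon>0(2)) auto
      finally show "norm (Rint r (\<tau> n) s - (Rint r 0 s - Rint \<epsilon> 0 s)) \<le> e / 2" by simp
    qed
    then have "norm (G (bump r) (\<tau> n) 1 - Jint \<epsilon> - G (bump r) (\<tau> n) 0) \<le> e / 2"
      by (simp add: G0_flat Jint_def)
    moreover have "norm (Jint \<epsilon> - A0) < e / 4" using \<epsilon>1(2)[of \<epsilon>] \<epsilon> by (simp add: dist_norm)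
    ultimately show ?thesis
      using norm_triangle_ineq[of "G (bump r) (\<tau> n) 1 - Jint \<epsilon> - G (bump r) (\<tau> n) 0" "Jint \<epsilon> - A0"] e
      by (simp add: algebra_simps)
  qed
  then show "\<exists>N. \<forall>n\<ge>N. norm (G (bump r) (\<tau> n) 1 - G (bump r) (\<tau> n) 0 - A0) < e" by blast
qed

end

section \<open>Sharp cut-offs and non-tangential approach\<close>

lemma sets_ball [measurable]: "ball (a :: 'a::metric_space) r \<in> sets borel"
  by (simp add: borel_open)

context flux_origin begin

lemma E_scale: "0 < c \<Longrightarrow> E (c *\<^sub>R w) b = (1 / c ^ m) *\<^sub>R E w b"
  by (simp add: E_def P.scaleR_left power_mult_distrib)

lemma P_\<nu>_\<nu>: "P \<nu> \<nu> = e0"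
  using P_sq[of 0 1] norm_\<nu> by (simp add: span_zero)

text \<open>The vector \<open>\<nu> - d\<psi> u\<close> is the unit normal of the graph times the
  Jacobian of the area formula, so integrals of \<open>kern\<close> over \<open>T\<close> are
  surface integrals already.\<close>

definition kern :: "'a \<Rightarrow> 'a \<Rightarrow> 'b" where
  "kern \<tau> u = E (u + \<psi> u *\<^sub>R \<nu> - \<tau>) (\<nu> - d\<psi> u)"

lemma measurable_kern [measurable]: "kern \<tau> \<in> borel_measurable borel"
  unfolding kern_def by measurable

definition D_bound :: real where "D_bound = (SOME D. \<forall>u\<in>cball 0 (2 * r). norm (\<nu> - d\<psi> u) \<le> D)"

lemma D_bound: "norm u \<le> 2 * r \<Longrightarrow> norm (\<nu> - d\<psi> u) \<le> D_bound"
proof -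
  have "compact ((\<lambda>u. \<nu> - d\<psi> u) ` cball 0 (2 * r))"
    by (intro compact_continuous_image continuous_intros continuous_on_subset[OF d\<psi>_cont]) auto
  from compact_imp_bounded[OF this]
  have "\<exists>D. \<forall>u\<in>cball 0 (2 * r). norm (\<nu> - d\<psi> u) \<le> D"
    unfolding bounded_iff by (simp only: ball_simps)
  from someI_ex[OF this] have "\<forall>u\<in>cball 0 (2 * r). norm (\<nu> - d\<psi> u) \<le> D_bound" unfolding D_bound_def .
  then show "norm u \<le> 2 * r \<Longrightarrow> norm (\<nu> - d\<psi> u) \<le> D_bound" by simp
qed

lemma D_bound_nonneg: "0 \<le> D_bound"
  using D_bound[of 0] r_pos by (auto intro: order_trans[OF norm_ge_zero])

lemma norm_kern_le:
  assumes "norm u \<le> 2 * r" "0 < a" "a \<le> norm (u + \<psi> u *\<^sub>R \<nu> - \<tau>)"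
  shows "norm (kern \<tau> u) \<le> P_bound * D_bound / a ^ m"
proof -
  have "norm (kern \<tau> u) \<le> P_bound * norm (\<nu> - d\<psi> u) / norm (u + \<psi> u *\<^sub>R \<nu> - \<tau>) ^ m"
    unfolding kern_def by (rule norm_E_le)
  also have "\<dots> \<le> P_bound * D_bound / a ^ m"
    using assms P_bound(1) D_bound_nonneg by (intro frac_le mult_left_mono power_mono D_bound mult_nonneg_nonneg) auto
  finally show ?thesis .
qed

lemma integrable_kern:
  assumes [measurable]: "q \<in> borel_measurable borel" and a: "0 < a"
    and q: "\<And>u. u \<in> T \<Longrightarrow> \<bar>q u\<bar> \<le> 1" "\<And>u. u \<in> T \<Longrightarrow> q u \<noteq> 0 \<Longrightarrow> norm u \<le> 2 * r \<and> a \<le> norm (u + \<psi> u *\<^sub>R \<nu> - \<tau>)"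
  shows "integrable lam (\<lambda>u. q u *\<^sub>R kern \<tau> u)"
    and "u \<in> T \<Longrightarrow> norm (q u *\<^sub>R kern \<tau> u) \<le> (P_bound * D_bound / a ^ m) * indicator (cball 0 (2 * r)) u"
proof -
  show b: "norm (q u *\<^sub>R kern \<tau> u) \<le> (P_bound * D_bound / a ^ m) * indicator (cball 0 (2 * r)) u" if u: "u \<in> T" for u
  proof (cases "q u = 0")
    case True
    then show ?thesis using P_bound(1) D_bound_nonneg a by simp
  next
    case False
    have "\<bar>q u\<bar> * norm (kern \<tau> u) \<le> 1 * (P_bound * D_bound / a ^ m)"
      using q(1)[OF u] q(2)[OF u False] a by (intro mult_mono norm_kern_le) auto
    then show ?thesis using q(2)[OF u False] by simp
  qed
  show "integrable lam (\<lambda>u. q u *\<^sub>R kern \<tau> u)"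
    by (rule integrable_lam_bounded[OF _ b]) measurable
qed

text \<open>Corrects the smooth outer cut-off to the sharp one of radius \<open>2 * r\<close>. The
  integrand vanishes for \<open>norm u < r\<close>, so it depends continuously on small admissible
  displacements of the pole.\<close>

definition annulus_part :: 'b where
  "annulus_part = (\<integral>u. (indicator (ball 0 (2 * r)) u - bump r u) *\<^sub>R kern 0 u \<partial>lam)"

lemma cutoff_bounds: "\<bar>indicator (ball 0 (2 * r)) u - bump r u\<bar> \<le> 1"
  "indicator (ball 0 (2 * r)) u - bump r u \<noteq> 0 \<Longrightarrow> norm u \<le> 2 * r \<and> r \<le> norm u"
proof -
  show "\<bar>indicator (ball 0 (2 * r)) u - bump r u\<bar> \<le> 1"
    using bump_bounds[of r u] by (auto simp: indicator_def)
  assume q: "indicator (ball 0 (2 * r)) u - bump r u \<noteq> 0"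
  have "\<not> 2 * r < norm u" using q bump_eq_0(1)[OF r_pos, of u] by auto
  moreover have "\<not> norm u < r" using q bump_eq_1(1)[OF r_pos, of u] r_pos by (auto simp: indicator_def)
  ultimately show "norm u \<le> 2 * r \<and> r \<le> norm u" by simp
qed

lemma graph_ge: "u \<in> T \<Longrightarrow> norm u \<le> norm (u + \<psi> u *\<^sub>R \<nu>)"
  by (rule norm_le_add_\<nu>)

lemma graph_le: "u \<in> T \<Longrightarrow> norm (u + \<psi> u *\<^sub>R \<nu>) \<le> 2 * norm u"
  using norm_graph_le[of u 1] by simp

text \<open>\<open>Jint\<close> removes a smooth ball in the parameter space, the principal value a
  sharp ball in the ambient space. Under the substitution \<open>u = \<epsilon> v\<close> the
  homogeneity of the kernel absorbs the volume factor, and the integrand converges to the odd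
  function \<open>g0\<close> on the hyperplane.\<close>

lemma sharp_minus_smooth:
  assumes \<epsilon>: "\<And>n. 0 < \<epsilon> n" and lim: "\<epsilon> \<longlonglongrightarrow> 0"
  shows "(\<lambda>n. \<integral>u. (bump (\<epsilon> n) u - indicator {u. norm (u + \<psi> u *\<^sub>R \<nu>) \<le> \<epsilon> n} u) *\<^sub>R kern 0 u \<partial>lam) \<longlonglongrightarrow> 0"
proof -
  define f where "f \<epsilon> u = (bump \<epsilon> u - indicator {u. norm (u + \<psi> u *\<^sub>R \<nu>) \<le> \<epsilon>} u) *\<^sub>R kern 0 u" for \<epsilon> u
  have [measurable]: "f \<epsilon> \<in> borel_measurable borel" for \<epsilon> unfolding f_def by measurable
  define g where "g \<epsilon> v = (bump 1 v - indicator {v. norm (v + (\<psi> (\<epsilon> *\<^sub>R v) / \<epsilon>) *\<^sub>R \<nu>) \<le> 1} v)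
      *\<^sub>R E (v + (\<psi> (\<epsilon> *\<^sub>R v) / \<epsilon>) *\<^sub>R \<nu>) (\<nu> - d\<psi> (\<epsilon> *\<^sub>R v))" for \<epsilon> v
  have [measurable]: "g \<epsilon> \<in> borel_measurable borel" for \<epsilon> unfolding g_def by measurable
  have scale: "(\<integral>u. f (\<epsilon> n) u \<partial>lam) = (\<integral>v. g (\<epsilon> n) v \<partial>lam)" for n
  proof -
    note e = \<epsilon>[of n]
    have eq: "\<epsilon> n *\<^sub>R v + \<psi> (\<epsilon> n *\<^sub>R v) *\<^sub>R \<nu> = \<epsilon> n *\<^sub>R (v + (\<psi> (\<epsilon> n *\<^sub>R v) / \<epsilon> n) *\<^sub>R \<nu>)" for v
      using e by (simp add: scaleR_add_right)
    have "f (\<epsilon> n) (\<epsilon> n *\<^sub>R v + 0) = (1 / \<epsilon> n ^ m) *\<^sub>R g (\<epsilon> n) v" for v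
    proof -
      have "norm (\<epsilon> n *\<^sub>R (v + (\<psi> (\<epsilon> n *\<^sub>R v) / \<epsilon> n) *\<^sub>R \<nu>)) \<le> \<epsilon> n \<longleftrightarrow> norm (v + (\<psi> (\<epsilon> n *\<^sub>R v) / \<epsilon> n) *\<^sub>R \<nu>) \<le> 1"
        using e by (simp add: mult_le_cancel_left2 del: scaleR_add_right)
      then show ?thesis
        unfolding f_def g_def kern_def using e
        by (simp add: eq E_scale bump_scale indicator_def del: scaleR_add_right)
    qed
    then have "(\<integral>u. f (\<epsilon> n) (\<epsilon> n *\<^sub>R u + 0) \<partial>lam) = (1 / \<epsilon> n ^ m) *\<^sub>R (\<integral>v. g (\<epsilon> n) v \<partial>lam)" by simp
    moreover have "(\<integral>u. f (\<epsilon> n) (\<epsilon> n *\<^sub>R u + 0) \<partial>lam) = (1 / \<bar>\<epsilon> n\<bar> ^ m) *\<^sub>R (\<integral>u. f (\<epsilon> n) u \<partial>lam)"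
      using e by (intro integral_lam_similarity) (auto simp: span_zero)
    ultimately show ?thesis using e by simp
  qed
  define g0 where "g0 v = (bump 1 v - indicator (cball 0 1) v) *\<^sub>R E v \<nu>" for v
  have [measurable]: "g0 \<in> borel_measurable borel" unfolding g0_def by measurable
  have "(\<lambda>n. \<integral>v. g (\<epsilon> n) v \<partial>lam) \<longlonglongrightarrow> (\<integral>v. g0 v \<partial>lam)"
  proof -
    have "\<forall>\<^sub>F n in sequentially. \<epsilon> n < r" using order_tendstoD(2)[OF lim r_pos] .
    then obtain N where N: "\<And>n. N \<le> n \<Longrightarrow> \<epsilon> n < r" unfolding eventually_sequentially by blast
    let ?C = "P_bound * D_bound / (1/2) ^ m"
    have "(\<lambda>n. \<integral>v. g (\<epsilon> (n + N)) v \<partial>lam) \<longlonglongrightarrow> (\<integral>v. g0 v \<partial>lam)"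
    proof (rule integral_dominated_convergence[where w = "\<lambda>v. ?C * indicator (cball 0 2) v"])
      show "integrable lam (\<lambda>v. ?C * indicator (cball 0 2) v)"
        using emeasure_lam_cball_finite[of 2] by (intro integrable_mult_right integrable_real_indicator) auto
      show "AE v in lam. norm (g (\<epsilon> (n + N)) v) \<le> ?C * indicator (cball 0 2) v" for n
        using AE_flat
      proof eventually_elim
        case (elim v)
        let ?e = "\<epsilon> (n + N)"
        let ?w = "v + (\<psi> (?e *\<^sub>R v) / ?e) *\<^sub>R \<nu>"
        have e: "0 < ?e" "?e < r" using \<epsilon> N by auto
        have w1: "norm v \<le> norm ?w" by (rule norm_le_add_\<nu>[OF elim])
        have w2: "norm ?w \<le> 2 * norm v"
        proof -
          have "?e *\<^sub>R ?w = ?e *\<^sub>R v + \<psi> (?e *\<^sub>R v) *\<^sub>R \<nu>" using e by (simp add: scaleR_add_right)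
          then have "?e * norm ?w \<le> 2 * (?e * norm v)"
            using graph_le[of "?e *\<^sub>R v"] elim e by (metis abs_of_pos norm_scaleR span_scale)
          then show ?thesis using e by simp
        qed
        have c: "\<bar>bump 1 v - indicator {v. norm (v + (\<psi> (?e *\<^sub>R v) / ?e) *\<^sub>R \<nu>) \<le> 1} v\<bar> \<le> 1"
          using bump_bounds[of 1 v] by (auto simp: indicator_def)
        \<comment> \<open>Both cut-offs equal 1 for \<open>norm v < 1/2\<close> and 0 for
          \<open>norm v > 2\<close>, since \<open>norm v \<le> norm ?w \<le> 2 * norm v\<close>; the
          difference lives on an annulus with a uniform kernel bound.\<close>
        have z: "bump 1 v - indicator {v. norm (v + (\<psi> (?e *\<^sub>R v) / ?e) *\<^sub>R \<nu>) \<le> 1} v = 0"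
          if "\<not> (1/2 \<le> norm v \<and> norm v \<le> 2)"
          using that w1 w2 bump_eq_1(1)[of 1 v] bump_eq_0(1)[of 1 v] by (auto simp: indicator_def)
        show ?case
        proof (cases "1/2 \<le> norm v \<and> norm v \<le> 2")
          case True
          have "norm (E ?w (\<nu> - d\<psi> (?e *\<^sub>R v))) \<le> P_bound * norm (\<nu> - d\<psi> (?e *\<^sub>R v)) / norm ?w ^ m" by (rule norm_E_le)
          also have "\<dots> \<le> ?C"
          proof (intro frac_le mult_left_mono power_mono D_bound mult_nonneg_nonneg D_bound_nonneg)
            have "norm (?e *\<^sub>R v) = ?e * norm v" using e by simp
            also have "\<dots> \<le> r * 2" using True e by (intro mult_mono) auto
            finally show "norm (?e *\<^sub>R v) \<le> 2 * r" by simp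
          qed (use P_bound(1) True w1 in auto)
          finally have "\<bar>bump 1 v - indicator {v. norm (v + (\<psi> (?e *\<^sub>R v) / ?e) *\<^sub>R \<nu>) \<le> 1} v\<bar> * norm (E ?w (\<nu> - d\<psi> (?e *\<^sub>R v))) \<le> 1 * ?C"
            using c by (intro mult_mono) auto
          then show ?thesis using True by (simp add: g_def)
        next
          case False
          then show ?thesis using z[OF False] P_bound(1) D_bound_nonneg by (simp add: g_def)
        qed
      qed
      \<comment> \<open>The unit sphere is where the sharp indicator may fail to converge.\<close>
      have AE1: "AE v in lam. v \<notin> sphere 0 1"
        using emeasure_lam_sphere by (intro AE_I[where N = "sphere 0 1"]) auto
      show "AE v in lam. (\<lambda>n. g (\<epsilon> (n + N)) v) \<longlonglongrightarrow> g0 v"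
        using AE_flat AE1
      proof eventually_elim
        case (elim v)
        show ?case
        proof (cases "v = 0")
          case True
          then show ?thesis using bump_eq_1(1)[of 1 "0::'a"] \<psi>0 by (simp add: g_def g0_def)
        next
          case False
          have l: "(\<lambda>n. \<epsilon> (n + N) *\<^sub>R v) \<longlonglongrightarrow> 0"
            using tendsto_scaleR[OF LIMSEQ_ignore_initial_segment[OF lim, of N] tendsto_const[of v]] by simp
          have l1: "(\<lambda>n. d\<psi> (\<epsilon> (n + N) *\<^sub>R v)) \<longlonglongrightarrow> 0"
            using continuous_on_tendsto_compose[OF d\<psi>_cont l] d\<psi>0 by simp
          have l2: "(\<lambda>n. \<psi> (\<epsilon> (n + N) *\<^sub>R v) / \<epsilon> (n + N)) \<longlonglongrightarrow> 0"
          proof (rule LIMSEQ_I)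
            fix e :: real assume "0 < e"
            then have e': "0 < e / (2 * norm v)" using False by simp
            from \<psi>_little[OF e'] obtain \<rho> where \<rho>: "0 < \<rho>" "\<And>u. norm u < \<rho> \<Longrightarrow> \<bar>\<psi> u\<bar> \<le> e / (2 * norm v) * norm u" by auto
            from LIMSEQ_D[OF l \<rho>(1)] obtain K where K: "\<And>n. K \<le> n \<Longrightarrow> norm (\<epsilon> (n + N) *\<^sub>R v) < \<rho>" by auto
            have "norm (\<psi> (\<epsilon> (n + N) *\<^sub>R v) / \<epsilon> (n + N) - 0) < e" if "K \<le> n" for n
            proof -
              have "\<bar>\<psi> (\<epsilon> (n + N) *\<^sub>R v)\<bar> \<le> e / (2 * norm v) * norm (\<epsilon> (n + N) *\<^sub>R v)" by (rule \<rho>(2)[OF K[OF that]])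
              also have "\<dots> = e / 2 * \<epsilon> (n + N)" using False \<epsilon>[of "n + N"] by simp
              also have "\<dots> < e * \<epsilon> (n + N)" using \<open>0 < e\<close> \<epsilon>[of "n + N"] by simp
              finally show ?thesis using \<epsilon>[of "n + N"] by (simp add: field_simps)
            qed
            then show "\<exists>K. \<forall>n\<ge>K. norm (\<psi> (\<epsilon> (n + N) *\<^sub>R v) / \<epsilon> (n + N) - 0) < e" by blast
          qed
          have l3: "(\<lambda>n. v + (\<psi> (\<epsilon> (n + N) *\<^sub>R v) / \<epsilon> (n + N)) *\<^sub>R \<nu>) \<longlonglongrightarrow> v"
            using tendsto_add[OF tendsto_const[of v] tendsto_scaleR[OF l2 tendsto_const[of \<nu>]]] by simp
          have lE: "(\<lambda>n. E (v + (\<psi> (\<epsilon> (n + N) *\<^sub>R v) / \<epsilon> (n + N)) *\<^sub>R \<nu>) (\<nu> - d\<psi> (\<epsilon> (n + N) *\<^sub>R v))) \<longlonglongrightarrow> E v (\<nu> - 0)"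
            unfolding E_def by (intro tendsto_intros l3 l1 P.tendsto) (use False in simp)
          have nv: "norm v \<noteq> 1" using elim by auto
          have lI: "\<forall>\<^sub>F n in sequentially. indicator {v. norm (v + (\<psi> (\<epsilon> (n + N) *\<^sub>R v) / \<epsilon> (n + N)) *\<^sub>R \<nu>) \<le> 1} v = (indicator (cball 0 1) v :: real)"
          proof (cases "norm v < 1")
            case True
            from order_tendstoD(2)[OF tendsto_norm[OF l3] True] show ?thesis
              by eventually_elim (use True in \<open>auto simp: indicator_def\<close>)
          next
            case False
            then have "1 < norm v" using nv by simp
            from order_tendstoD(1)[OF tendsto_norm[OF l3] this] show ?thesis
              by eventually_elim (use \<open>1 < norm v\<close> in \<open>auto simp: indicator_def\<close>)
          qed
          then have "(\<lambda>n. indicator {v. norm (v + (\<psi> (\<epsilon> (n + N) *\<^sub>R v) / \<epsilon> (n + N)) *\<^sub>R \<nu>) \<le> 1} v) \<longlonglongrightarrow> (indicator (cball 0 1) v :: real)"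
            by (rule tendsto_eventually)
          then show ?thesis using lE unfolding g_def g0_def by (intro tendsto_intros) auto
        qed
      qed
    qed auto
    then show ?thesis by (rule LIMSEQ_offset)
  qed
  moreover have "(\<integral>v. g0 v \<partial>lam) = 0"
    by (rule integral_odd) (auto simp: g0_def bump_minus E_minus indicator_def)
  ultimately show ?thesis unfolding scale[symmetric] f_def by simp
qed

lemma principal_value_flux:
  assumes \<epsilon>: "\<And>n. 0 < \<epsilon> n" and lim: "\<epsilon> \<longlonglongrightarrow> 0"
  shows "(\<lambda>n. \<integral>u. (indicator (ball 0 (2 * r)) u * indicator {u. \<epsilon> n < norm (u + \<psi> u *\<^sub>R \<nu>)} u) *\<^sub>R kern 0 u \<partial>lam)
     \<longlonglongrightarrow> A0 + annulus_part"
proof -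
  let ?W = "\<lambda>\<epsilon>. \<integral>u. (bump \<epsilon> u - indicator {u. norm (u + \<psi> u *\<^sub>R \<nu>) \<le> \<epsilon>} u) *\<^sub>R kern 0 u \<partial>lam"
  have eq: "(\<integral>u. (indicator (ball 0 (2 * r)) u * indicator {u. \<epsilon> < norm (u + \<psi> u *\<^sub>R \<nu>)} u) *\<^sub>R kern 0 u \<partial>lam)
      = Jint \<epsilon> + annulus_part + ?W \<epsilon>" if e: "0 < \<epsilon>" "\<epsilon> < r" for \<epsilon>
  proof -
    \<comment> \<open>The three cut-offs telescope to the indicator of the ball minus that of the
      excised set; they produce \<open>Jint \<epsilon>\<close>, \<open>annulus_part\<close> and the
      term of \<open>sharp_minus_smooth\<close>.\<close>
    let ?q1 = "\<lambda>u. bump r u - bump \<epsilon> u" and ?q2 = "\<lambda>u. indicator (ball 0 (2 * r)) u - bump r u"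
      and ?q3 = "\<lambda>u. bump \<epsilon> u - indicator {u. norm (u + \<psi> u *\<^sub>R \<nu>) \<le> \<epsilon>} u"
    have i1: "integrable lam (\<lambda>u. ?q1 u *\<^sub>R kern 0 u)"
    proof (rule integrable_kern[where a = \<epsilon>])
      fix u assume u: "u \<in> T"
      show "\<bar>?q1 u\<bar> \<le> 1" using bump_bounds[of r u] bump_bounds[of \<epsilon> u] by linarith
      assume "?q1 u \<noteq> 0"
      then have "norm u \<le> 2 * r \<and> \<epsilon> \<le> norm u"
        using e r_pos bump_eq_1(1)[of \<epsilon> u] bump_eq_1(1)[of r u] bump_eq_0(1)[of r u] bump_eq_0(1)[of \<epsilon> u] by force
      then show "norm u \<le> 2 * r \<and> \<epsilon> \<le> norm (u + \<psi> u *\<^sub>R \<nu> - 0)" using graph_ge[OF u] by auto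
    qed (use e in auto)
    have i2: "integrable lam (\<lambda>u. ?q2 u *\<^sub>R kern 0 u)"
      by (rule integrable_kern[where a = r]) (use r_pos cutoff_bounds graph_ge in \<open>force+\<close>)
    have i3: "integrable lam (\<lambda>u. ?q3 u *\<^sub>R kern 0 u)"
    \<comment> \<open>\<open>\<epsilon> / 2\<close> because the ambient ball of radius \<epsilon>
      contains the graph over \<open>norm u < \<epsilon> / 2\<close>, by
      \<open>graph_le\<close>.\<close>
    proof (rule integrable_kern[where a = "\<epsilon> / 2"])
      fix u assume u: "u \<in> T"
      show "\<bar>?q3 u\<bar> \<le> 1" using bump_bounds[of \<epsilon> u] by (auto simp: indicator_def)
      assume q3: "?q3 u \<noteq> 0"
      have "\<not> 2 * \<epsilon> < norm u"
        using q3 e bump_eq_0(1)[of \<epsilon> u] graph_ge[OF u] by auto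
      moreover have "\<not> norm u < \<epsilon> / 2"
        using q3 e bump_eq_1(1)[of \<epsilon> u] graph_le[OF u] by auto
      ultimately have "norm u \<le> 2 * \<epsilon> \<and> \<epsilon> / 2 \<le> norm u" by simp
      then show "norm u \<le> 2 * r \<and> \<epsilon> / 2 \<le> norm (u + \<psi> u *\<^sub>R \<nu> - 0)" using graph_ge[OF u] e by auto
    qed (use e in auto)
    have "(\<integral>u. (indicator (ball 0 (2 * r)) u * indicator {u. \<epsilon> < norm (u + \<psi> u *\<^sub>R \<nu>)} u) *\<^sub>R kern 0 u \<partial>lam)
        = (\<integral>u. ?q1 u *\<^sub>R kern 0 u + ?q2 u *\<^sub>R kern 0 u + ?q3 u *\<^sub>R kern 0 u \<partial>lam)"
    proof (rule integral_cong_AE)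
      show "AE u in lam. (indicator (ball 0 (2 * r)) u * indicator {u. \<epsilon> < norm (u + \<psi> u *\<^sub>R \<nu>)} u) *\<^sub>R kern 0 u
          = ?q1 u *\<^sub>R kern 0 u + ?q2 u *\<^sub>R kern 0 u + ?q3 u *\<^sub>R kern 0 u"
        using AE_flat
      proof eventually_elim
        case (elim u)
        have "indicator (ball 0 (2 * r)) u * indicator {u. \<epsilon> < norm (u + \<psi> u *\<^sub>R \<nu>)} u = ?q1 u + ?q2 u + ?q3 u"
          using e graph_ge[OF elim] by (auto simp: indicator_def)
        then show ?case by (simp only: scaleR_add_left)
      qed
    qed measurable
    also have "\<dots> = Jint \<epsilon> + annulus_part + ?W \<epsilon>"
      using i1 i2 i3 by (simp add: Jint_def G_def annulus_part_def kern_def)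
    finally show ?thesis .
  qed
  have "\<forall>\<^sub>F n in sequentially. \<epsilon> n < r" using order_tendstoD(2)[OF lim r_pos] .
  then have ev: "\<forall>\<^sub>F n in sequentially. Jint (\<epsilon> n) + annulus_part + ?W (\<epsilon> n)
     = (\<integral>u. (indicator (ball 0 (2 * r)) u * indicator {u. \<epsilon> n < norm (u + \<psi> u *\<^sub>R \<nu>)} u) *\<^sub>R kern 0 u \<partial>lam)"
    by eventually_elim (use eq \<epsilon> in simp)
  have "(\<lambda>n. Jint (\<epsilon> n)) \<longlonglongrightarrow> A0"
  proof (rule filterlim_compose[OF Jint_tendsto])
    show "filterlim \<epsilon> (at_right 0) sequentially"
      unfolding filterlim_at using lim \<epsilon> less_imp_neq[OF \<epsilon>] by (auto intro!: always_eventually)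
  qed
  then have "(\<lambda>n. Jint (\<epsilon> n) + annulus_part + ?W (\<epsilon> n)) \<longlonglongrightarrow> A0 + annulus_part + 0"
    by (intro tendsto_add tendsto_const sharp_minus_smooth \<epsilon> lim)
  then show ?thesis using Lim_transform_eventually[OF _ ev] by simp
qed

text \<open>A small distance would force \<open>norm u\<close> to be at most about
  \<open>norm \<tau>\<close>; but the graph of \<open>s \<psi>\<close> then has height at most
  \<open>\<delta> * norm u\<close>, while the pole has height at least
  \<open>2 * \<delta> * norm \<tau>\<close>. Twice the slope is thus enough room, and the distance
  is bounded below by a multiple of \<open>norm \<tau>\<close> and of \<open>norm u\<close>,
  uniformly in \<open>s\<close>.\<close>

lemma cone_bounds:
  assumes \<tau>: "\<tau> = \<tau>' + t *\<^sub>R \<nu>" "\<tau>' \<in> T" and cone: "2 * \<delta> * norm \<tau> \<le> \<bar>t\<bar>" and u: "u \<in> T" and s: "s \<in> {0..1}"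
  shows "\<delta> / (1 + 2 * \<delta>) * norm \<tau> \<le> norm (u + (s * \<psi> u) *\<^sub>R \<nu> - \<tau>)"
    and "\<delta> / (1 + 2 * \<delta>) * norm u \<le> norm (u + (s * \<psi> u) *\<^sub>R \<nu> - \<tau>)"
proof -
  let ?w = "u + (s * \<psi> u) *\<^sub>R \<nu> - \<tau>"
  have w: "?w = (u - \<tau>') + (s * \<psi> u - t) *\<^sub>R \<nu>" by (simp add: \<tau> algebra_simps)
  have uT: "u - \<tau>' \<in> T" by (intro span_diff u \<tau>)
  have a: "norm (u - \<tau>') \<le> norm ?w" unfolding w by (rule norm_le_add_\<nu>[OF uT])
  have b: "\<bar>s * \<psi> u - t\<bar> \<le> norm ?w"
  proof -
    have "?w \<bullet> \<nu> = s * \<psi> u - t" unfolding w using span_\<nu>[OF uT] \<nu>\<nu> by (simp add: inner_add_left)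
    then show ?thesis using Cauchy_Schwarz_ineq2[of ?w \<nu>] norm_\<nu> by simp
  qed
  have c: "norm \<tau>' \<le> norm \<tau>" unfolding \<tau>(1) by (rule norm_le_add_\<nu>[OF \<tau>(2)])
  have d: "norm u \<le> norm \<tau> + norm ?w" using norm_triangle_ineq[of "u - \<tau>'" \<tau>'] a c by simp
  have "\<bar>s * \<psi> u\<bar> \<le> 1 * (\<delta> * norm u)" unfolding abs_mult using s \<psi>_le[OF u] by (intro mult_mono) auto
  then have f: "2 * \<delta> * norm \<tau> - \<delta> * norm u \<le> norm ?w" using b cone by linarith
  have "\<delta> * norm u \<le> \<delta> * (norm \<tau> + norm ?w)" using d \<delta> by (intro mult_left_mono) auto
  then have g: "\<delta> * norm \<tau> \<le> (1 + \<delta>) * norm ?w" using f by (simp add: algebra_simps)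
  also have "\<dots> \<le> (1 + 2 * \<delta>) * norm ?w" using \<delta> by (intro mult_right_mono) auto
  finally show "\<delta> / (1 + 2 * \<delta>) * norm \<tau> \<le> norm ?w" using \<delta> by (simp add: field_simps)
  have "\<delta> * norm u \<le> \<delta> * norm \<tau> + \<delta> * norm ?w" using d \<delta> by (simp add: distrib_left[symmetric])
  also have "\<dots> \<le> (1 + 2 * \<delta>) * norm ?w" using g by (simp add: algebra_simps)
  finally show "\<delta> / (1 + 2 * \<delta>) * norm u \<le> norm ?w" using \<delta> by (simp add: field_simps)
qed

text \<open>After a translation by the tangential part of the pole the kernel splits into a
  tangential term \<open>p\<close>, odd apart from the cut-off, and a normal term \<open>q\<close>,
  a multiple of the Poisson kernel at height \<open>t n\<close> and thus an approximate identity up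
  to a constant. The sign \<open>sg\<close> is 1 for poles on the side opposite to \<nu>, which will
  be the inside.\<close>

lemma flat_limit:
  assumes \<tau>: "\<And>n. \<tau> n = \<tau>' n + t n *\<^sub>R \<nu>" "\<And>n. \<tau>' n \<in> T" and lim: "\<tau> \<longlonglongrightarrow> 0"
    and t: "\<And>n. t n \<noteq> 0" "\<And>n. t n = - sg * \<bar>t n\<bar>"
  shows "(\<lambda>n. G (bump r) (\<tau> n) 0) \<longlonglongrightarrow> (sg * poisson_const) *\<^sub>R e0"
proof -
  have lim': "\<tau>' \<longlonglongrightarrow> 0"
    by (rule tendsto_norm_zero_cancel, rule tendsto_sandwich[OF _ _ tendsto_const tendsto_norm_zero[OF lim]])
      (auto intro!: always_eventually simp: \<tau>(1) norm_le_add_\<nu>[OF \<tau>(2)])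
  have limt: "t \<longlonglongrightarrow> 0"
  proof -
    have "t n = \<tau> n \<bullet> \<nu>" for n using span_\<nu>[OF \<tau>(2)[of n]] \<nu>\<nu> by (simp add: \<tau>(1) inner_add_left)
    then have "t = (\<lambda>n. \<tau> n \<bullet> \<nu>)" by auto
    then show ?thesis using tendsto_inner[OF lim tendsto_const[of \<nu>]] by simp
  qed
  \<comment> \<open>Distance of \<open>u\<close> in \<open>T\<close> from a pole at height
    \<open>t\<close> over the origin.\<close>
  define N where "N t u = sqrt ((norm u)\<^sup>2 + t\<^sup>2)" for t and u :: 'a
  have N: "norm u \<le> N t u" "\<bar>t\<bar> \<le> N t u" for t and u :: 'a
    by (rule power2_le_imp_le; simp add: N_def)+
  have NT: "norm (u - t *\<^sub>R \<nu>) = N t u" if "u \<in> T" for t u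
    unfolding N_def using norm_add_\<nu>[OF that, of "- t"] by (simp add: real_sqrt_unique)
  define p where "p t \<tau>' u = bump r (u + \<tau>') *\<^sub>R ((1 / N t u ^ (m + 1)) *\<^sub>R P u \<nu>)" for t \<tau>' u
  define q where "q t \<tau>' u = bump r (u + \<tau>') * (t / N t u ^ (m + 1))" for t \<tau>' u
  have [measurable]: "p t \<tau>' \<in> borel_measurable borel" "q t \<tau>' \<in> borel_measurable borel" for t \<tau>'
    unfolding p_def q_def N_def by measurable
  have supp: "bump r (u + \<tau>') = 0" if "\<not> norm u \<le> 2 * r + norm \<tau>'" for u \<tau>' :: 'a
    using that norm_triangle_ineq4[of "u + \<tau>'" \<tau>'] by (intro bump_eq_0(1)[OF r_pos]) auto
  have ip: "integrable lam (p (t n) \<tau>')" for n \<tau>'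
  proof (rule integrable_lam_bounded)
    show "norm (p (t n) \<tau>' u) \<le> (P_bound / \<bar>t n\<bar> ^ m) * indicator (cball 0 (2 * r + norm \<tau>')) u" if u: "u \<in> T" for u
    proof (cases "norm u \<le> 2 * r + norm \<tau>'")
      case True
      have n0: "0 < N (t n) u" using N(2)[of "t n" u] t(1)[of n] by linarith
      have "norm ((1 / N (t n) u ^ (m + 1)) *\<^sub>R P u \<nu>) = norm (P u \<nu>) / N (t n) u ^ (m + 1)" using n0 by simp
      also have "\<dots> \<le> P_bound * (norm u * norm \<nu>) / N (t n) u ^ (m + 1)"
        using n0 by (intro divide_right_mono P_bound) auto
      also have "\<dots> \<le> P_bound * N (t n) u / N (t n) u ^ (m + 1)"
        using n0 P_bound(1) N(1)[of u "t n"] norm_\<nu> by (intro divide_right_mono mult_left_mono) auto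
      also have "\<dots> = P_bound / N (t n) u ^ m" using n0 by simp
      also have "\<dots> \<le> P_bound / \<bar>t n\<bar> ^ m"
        using N(2)[of "t n" u] t(1)[of n] P_bound(1) by (intro divide_left_mono power_mono) (use n0 in auto)
      finally have "\<bar>bump r (u + \<tau>')\<bar> * norm ((1 / N (t n) u ^ (m + 1)) *\<^sub>R P u \<nu>) \<le> 1 * (P_bound / \<bar>t n\<bar> ^ m)"
        using bump_bounds[of r "u + \<tau>'"] by (intro mult_mono) auto
      then show ?thesis using True by (simp add: p_def)
    qed (simp add: p_def supp)
  qed measurable
  have iq: "integrable lam (q (t n) \<tau>')" for n \<tau>'
  proof (rule integrable_lam_bounded)
    show "norm (q (t n) \<tau>' u) \<le> (1 / \<bar>t n\<bar> ^ m) * indicator (cball 0 (2 * r + norm \<tau>')) u" if u: "u \<in> T" for u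
    proof (cases "norm u \<le> 2 * r + norm \<tau>'")
      case True
      have n0: "0 < N (t n) u" using N(2)[of "t n" u] t(1)[of n] by linarith
      have "\<bar>t n / N (t n) u ^ (m + 1)\<bar> = \<bar>t n\<bar> / N (t n) u ^ (m + 1)" using n0 by simp
      also have "\<dots> \<le> \<bar>t n\<bar> / \<bar>t n\<bar> ^ (m + 1)"
        using N(2)[of "t n" u] t(1)[of n] by (intro divide_left_mono power_mono) (use n0 in auto)
      also have "\<dots> = 1 / \<bar>t n\<bar> ^ m" using t(1)[of n] by simp
      finally have "\<bar>bump r (u + \<tau>')\<bar> * \<bar>t n / N (t n) u ^ (m + 1)\<bar> \<le> 1 * (1 / \<bar>t n\<bar> ^ m)"
        using bump_bounds[of r "u + \<tau>'"] by (intro mult_mono) auto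
      then show ?thesis using True by (simp add: q_def abs_mult)
    qed (simp add: q_def supp)
  qed measurable
  have decomp: "G (bump r) (\<tau> n) 0 = (\<integral>u. p (t n) (\<tau>' n) u \<partial>lam) - (\<integral>u. q (t n) (\<tau>' n) u \<partial>lam) *\<^sub>R e0" for n
  proof -
    define f where "f u = bump r u *\<^sub>R E (u - \<tau> n) \<nu>" for u
    have [measurable]: "f \<in> borel_measurable borel" unfolding f_def by measurable
    have "G (bump r) (\<tau> n) 0 = (\<integral>u. f u \<partial>lam)" by (simp add: G_def f_def)
    also have "\<dots> = (\<integral>u. f (1 *\<^sub>R u + \<tau>' n) \<partial>lam)" by (subst integral_lam_similarity) (auto simp: \<tau>(2))
    also have "\<dots> = (\<integral>u. p (t n) (\<tau>' n) u - q (t n) (\<tau>' n) u *\<^sub>R e0 \<partial>lam)"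
    proof (rule integral_cong_AE)
      show "AE u in lam. f (1 *\<^sub>R u + \<tau>' n) = p (t n) (\<tau>' n) u - q (t n) (\<tau>' n) u *\<^sub>R e0"
        using AE_flat
      proof eventually_elim
        case (elim u)
        have "1 *\<^sub>R u + \<tau>' n - \<tau> n = u - t n *\<^sub>R \<nu>" by (simp add: \<tau>(1))
        then have "f (1 *\<^sub>R u + \<tau>' n) = bump r (u + \<tau>' n) *\<^sub>R E (u - t n *\<^sub>R \<nu>) \<nu>"
          unfolding f_def by (simp only: scaleR_one)
        also have "E (u - t n *\<^sub>R \<nu>) \<nu> = (1 / N (t n) u ^ (m + 1)) *\<^sub>R P u \<nu> - (t n / N (t n) u ^ (m + 1)) *\<^sub>R e0"
          unfolding E_def NT[OF elim] by (simp add: P.diff_left P.scaleR_left P_\<nu>_\<nu> scaleR_diff_right)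
        finally show ?case by (simp add: p_def q_def scaleR_diff_right)
      qed
    qed measurable
    also have "\<dots> = (\<integral>u. p (t n) (\<tau>' n) u \<partial>lam) - (\<integral>u. q (t n) (\<tau>' n) u \<partial>lam) *\<^sub>R e0"
      using ip iq by simp
    finally show ?thesis .
  qed
  have pb: "norm ((1 / N t u ^ (m + 1)) *\<^sub>R P u \<nu>) \<le> P_bound / norm u ^ m" if "u \<noteq> 0" for t u
  proof -
    have n0: "0 < norm u" "0 < N t u" using that N(1)[of u t] by (auto intro: less_le_trans[of 0 "norm u"])
    have "norm ((1 / N t u ^ (m + 1)) *\<^sub>R P u \<nu>) = norm (P u \<nu>) / N t u ^ (m + 1)" using n0 by simp
    also have "\<dots> \<le> P_bound * (norm u * norm \<nu>) / norm u ^ (m + 1)"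
      using n0 P_bound(1) N(1)[of u t] by (intro frac_le P_bound power_mono mult_nonneg_nonneg) auto
    also have "\<dots> = P_bound / norm u ^ m" using n0 norm_\<nu> by simp
    finally show ?thesis .
  qed
  have "(\<lambda>n. \<integral>u. p (t n) (\<tau>' n) u \<partial>lam) \<longlonglongrightarrow> 0"
  proof -
    \<comment> \<open>With the centred cut-off the integrand is odd. What remains is the difference
      of two cut-offs, which eventually vanishes for \<open>norm u \<le> r / 2\<close> and for
      \<open>norm u > 3 * r\<close>, so that the kernel is bounded on its support.\<close>
    have odd: "(\<integral>u. p (t n) 0 u \<partial>lam) = 0" for n
      by (rule integral_odd) (auto simp: p_def bump_minus P.minus_left N_def)
    have dp: "p (t n) (\<tau>' n) u - p (t n) 0 u = (bump r (u + \<tau>' n) - bump r u) *\<^sub>R ((1 / N (t n) u ^ (m + 1)) *\<^sub>R P u \<nu>)" for n u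
      unfolding p_def add_0_right by (rule scaleR_diff_left[symmetric])
    have "\<forall>\<^sub>F n in sequentially. norm (\<tau>' n) < r / 2"
      using order_tendstoD(2)[OF tendsto_norm_zero[OF lim'], of "r / 2"] r_pos by simp
    then obtain K where K: "\<And>n. K \<le> n \<Longrightarrow> norm (\<tau>' n) < r / 2" unfolding eventually_sequentially by blast
    have "(\<lambda>n. \<integral>u. p (t (n + K)) (\<tau>' (n + K)) u - p (t (n + K)) 0 u \<partial>lam) \<longlonglongrightarrow> (\<integral>u. 0 \<partial>lam)"
    proof (rule integral_dominated_convergence[where w = "\<lambda>u. (P_bound / (r / 2) ^ m) * indicator (cball 0 (3 * r)) u"])
      show "integrable lam (\<lambda>u. (P_bound / (r / 2) ^ m) * indicator (cball 0 (3 * r)) u)"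
        using emeasure_lam_cball_finite[of "3 * r"] by (intro integrable_mult_right integrable_real_indicator) auto
      show "AE u in lam. (\<lambda>n. p (t (n + K)) (\<tau>' (n + K)) u - p (t (n + K)) 0 u) \<longlonglongrightarrow> 0"
      proof (rule AE_I2)
        fix u
        show "(\<lambda>n. p (t (n + K)) (\<tau>' (n + K)) u - p (t (n + K)) 0 u) \<longlonglongrightarrow> 0"
        proof (cases "u = 0")
          case False
          have l0: "(\<lambda>n. u + \<tau>' (n + K)) \<longlonglongrightarrow> u + 0"
            by (intro tendsto_add tendsto_const LIMSEQ_ignore_initial_segment[OF lim'])
          have l: "(\<lambda>n. bump r (u + \<tau>' (n + K))) \<longlonglongrightarrow> bump r (u + 0)"
            by (rule continuous_on_tendsto_compose[OF continuous_bump[of UNIV r] l0]) auto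
          have "(\<lambda>n. \<bar>bump r (u + \<tau>' (n + K)) - bump r u\<bar> * (P_bound / norm u ^ m)) \<longlonglongrightarrow> \<bar>bump r (u + 0) - bump r u\<bar> * (P_bound / norm u ^ m)"
            by (intro tendsto_intros l)
          then have l': "(\<lambda>n. \<bar>bump r (u + \<tau>' (n + K)) - bump r u\<bar> * (P_bound / norm u ^ m)) \<longlonglongrightarrow> 0" by simp
          show ?thesis
            by (rule Lim_null_comparison[OF _ l'])
              (intro always_eventually allI, simp only: dp norm_scaleR, intro mult_left_mono, use pb[OF False] in \<open>auto simp only: norm_scaleR abs_ge_zero\<close>)
        qed (simp add: p_def P.zero_left)
      qed
      show "AE u in lam. norm (p (t (n + K)) (\<tau>' (n + K)) u - p (t (n + K)) 0 u) \<le> (P_bound / (r / 2) ^ m) * indicator (cball 0 (3 * r)) u" for n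
      proof (rule AE_I2)
        fix u :: 'a
        have k: "norm (\<tau>' (n + K)) < r / 2" by (rule K) simp
        have a: "norm (u + \<tau>' (n + K)) \<le> norm u + norm (\<tau>' (n + K))" "norm u \<le> norm (u + \<tau>' (n + K)) + norm (\<tau>' (n + K))"
          using norm_triangle_ineq norm_triangle_ineq4[of "u + \<tau>' (n + K)" "\<tau>' (n + K)"] by auto
        consider "norm u \<le> r / 2" | "r / 2 < norm u" "norm u \<le> 3 * r" | "3 * r < norm u" by linarith
        then show "norm (p (t (n + K)) (\<tau>' (n + K)) u - p (t (n + K)) 0 u) \<le> (P_bound / (r / 2) ^ m) * indicator (cball 0 (3 * r)) u"
        proof cases
          case 1
          then have "bump r (u + \<tau>' (n + K)) = 1" "bump r u = 1" using a k r_pos by (auto intro!: bump_eq_1(1))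
          then show ?thesis using P_bound(1) r_pos by (simp add: dp)
        next
          case 2
          then have u0: "u \<noteq> 0" using r_pos by auto
          have "norm ((1 / N (t (n + K)) u ^ (m + 1)) *\<^sub>R P u \<nu>) \<le> P_bound / norm u ^ m" by (rule pb[OF u0])
          also have "\<dots> \<le> P_bound / (r / 2) ^ m"
            using 2 r_pos P_bound(1) u0 by (intro divide_left_mono power_mono mult_pos_pos zero_less_power) auto
          finally have "\<bar>bump r (u + \<tau>' (n + K)) - bump r u\<bar> * norm ((1 / N (t (n + K)) u ^ (m + 1)) *\<^sub>R P u \<nu>) \<le> 1 * (P_bound / (r / 2) ^ m)"
            using bump_bounds[of r u] bump_bounds[of r "u + \<tau>' (n + K)"] by (intro mult_mono) auto
          then show ?thesis unfolding dp norm_scaleR[of "_ - _"] using 2 by simp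
        next
          case 3
          then have "bump r (u + \<tau>' (n + K)) = 0" "bump r u = 0" using a k r_pos by (auto intro!: bump_eq_0(1))
          then show ?thesis using P_bound(1) r_pos by (simp add: dp)
        qed
      qed
    qed auto
    then have "(\<lambda>n. \<integral>u. p (t n) (\<tau>' n) u - p (t n) 0 u \<partial>lam) \<longlonglongrightarrow> (\<integral>u. 0 \<partial>lam)"
      by (rule LIMSEQ_offset)
    then show ?thesis using ip odd by simp
  qed
  moreover have "(\<lambda>n. \<integral>u. q (t n) (\<tau>' n) u \<partial>lam) \<longlonglongrightarrow> - sg * poisson_const"
  proof -
    let ?S = "\<lambda>v. 1 / sqrt (1 + (norm v)\<^sup>2) ^ (m + 1)"
    \<comment> \<open>Scaling by \<open>\<bar>t n\<bar>\<close> brings the pole to height 1; the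
      cut-off then spreads out to the constant 1 and \<open>poisson_integral\<close>
      applies.\<close>
    have eq: "(\<integral>u. q (t n) (\<tau>' n) u \<partial>lam) = - sg * (\<integral>v. bump r (\<bar>t n\<bar> *\<^sub>R v + \<tau>' n) * ?S v \<partial>lam)" for n
    proof -
      have t0: "0 < \<bar>t n\<bar>" using t(1) by simp
      have Nt: "N (t n) (\<bar>t n\<bar> *\<^sub>R v) = \<bar>t n\<bar> * sqrt (1 + (norm v)\<^sup>2)" for v :: 'a
      proof -
        have "(norm (\<bar>t n\<bar> *\<^sub>R v))\<^sup>2 + (t n)\<^sup>2 = (t n)\<^sup>2 * (1 + (norm v)\<^sup>2)" by (simp add: power_mult_distrib algebra_simps)
        then show ?thesis unfolding N_def by (simp add: real_sqrt_mult)
      qed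
      have sg: "t n / \<bar>t n\<bar> = - sg" using t(2)[of n] t0 by (simp add: field_simps)
      have "q (t n) (\<tau>' n) (\<bar>t n\<bar> *\<^sub>R v + 0) = (1 / \<bar>t n\<bar> ^ m) * (- sg * (bump r (\<bar>t n\<bar> *\<^sub>R v + \<tau>' n) * ?S v))" for v
      proof -
        have "t n / (\<bar>t n\<bar> * sqrt (1 + (norm v)\<^sup>2)) ^ (m + 1) = (1 / \<bar>t n\<bar> ^ m) * ((t n / \<bar>t n\<bar>) * ?S v)"
          by (simp add: power_mult_distrib)
        then show ?thesis unfolding q_def add_0_right Nt sg by simp
      qed
      then have "(\<integral>v. q (t n) (\<tau>' n) (\<bar>t n\<bar> *\<^sub>R v + 0) \<partial>lam) = (1 / \<bar>t n\<bar> ^ m) * (- sg * (\<integral>v. bump r (\<bar>t n\<bar> *\<^sub>R v + \<tau>' n) * ?S v \<partial>lam))"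
        by (simp only: integral_mult_right_zero)
      moreover have "(\<integral>v. q (t n) (\<tau>' n) (\<bar>t n\<bar> *\<^sub>R v + 0) \<partial>lam) = (1 / \<bar>\<bar>t n\<bar>\<bar> ^ m) *\<^sub>R (\<integral>u. q (t n) (\<tau>' n) u \<partial>lam)"
        using t0 by (intro integral_lam_similarity) (auto simp: span_zero)
      ultimately have "(1 / \<bar>t n\<bar> ^ m) * (\<integral>u. q (t n) (\<tau>' n) u \<partial>lam)
          = (1 / \<bar>t n\<bar> ^ m) * (- sg * (\<integral>v. bump r (\<bar>t n\<bar> *\<^sub>R v + \<tau>' n) * ?S v \<partial>lam))"
        by (simp only: abs_idempotent real_scaleR_def)
      then show ?thesis
        by (rule mult_left_cancel[THEN iffD1, rotated]) (use t0 in simp)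
    qed
    have "(\<lambda>n. \<integral>v. bump r (\<bar>t n\<bar> *\<^sub>R v + \<tau>' n) * ?S v \<partial>lam) \<longlonglongrightarrow> (\<integral>v. ?S v \<partial>lam)"
    proof (rule integral_dominated_convergence[where w = ?S])
      show "AE v in lam. (\<lambda>n. bump r (\<bar>t n\<bar> *\<^sub>R v + \<tau>' n) * ?S v) \<longlonglongrightarrow> ?S v"
      proof (rule AE_I2)
        fix v :: 'a
        have "(\<lambda>n. \<bar>t n\<bar> *\<^sub>R v + \<tau>' n) \<longlonglongrightarrow> \<bar>0\<bar> *\<^sub>R v + 0" by (intro tendsto_intros limt lim')
        from continuous_on_tendsto_compose[OF continuous_bump[of UNIV r] this]
        have "(\<lambda>n. bump r (\<bar>t n\<bar> *\<^sub>R v + \<tau>' n)) \<longlonglongrightarrow> 1" using bump_eq_1(1)[OF r_pos, of "0::'a"] r_pos by simp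
        from tendsto_mult[OF this tendsto_const[of "?S v"]]
        show "(\<lambda>n. bump r (\<bar>t n\<bar> *\<^sub>R v + \<tau>' n) * ?S v) \<longlonglongrightarrow> ?S v" by simp
      qed
      show "AE v in lam. norm (bump r (\<bar>t n\<bar> *\<^sub>R v + \<tau>' n) * ?S v) \<le> ?S v" for n
      proof (rule AE_I2)
        fix v :: 'a
        have "bump r (\<bar>t n\<bar> *\<^sub>R v + \<tau>' n) * ?S v \<le> 1 * ?S v"
          by (intro mult_right_mono bump_bounds) auto
        then show "norm (bump r (\<bar>t n\<bar> *\<^sub>R v + \<tau>' n) * ?S v) \<le> ?S v"
          using bump_bounds(1)[of r "\<bar>t n\<bar> *\<^sub>R v + \<tau>' n"] by (simp add: abs_mult)
      qed
      show "integrable lam ?S" by (rule poisson_integral(1))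
    qed measurable
    then have "(\<lambda>n. - sg * (\<integral>v. bump r (\<bar>t n\<bar> *\<^sub>R v + \<tau>' n) * ?S v \<partial>lam)) \<longlonglongrightarrow> - sg * poisson_const"
      unfolding poisson_integral(2) by (intro tendsto_intros)
    then show ?thesis unfolding eq .
  qed
  ultimately have "(\<lambda>n. G (bump r) (\<tau> n) 0) \<longlonglongrightarrow> 0 - (- sg * poisson_const) *\<^sub>R e0"
    unfolding decomp by (intro tendsto_intros)
  then show ?thesis by simp
qed

lemma nontangential_flux:
  assumes \<tau>: "\<And>n. \<tau> n = \<tau>' n + t n *\<^sub>R \<nu>" "\<And>n. \<tau>' n \<in> T" and lim: "\<tau> \<longlonglongrightarrow> 0" and nz: "\<And>n. \<tau> n \<noteq> 0"
    and cone: "\<And>n. 2 * \<delta> * norm (\<tau> n) \<le> \<bar>t n\<bar>" and sg: "\<And>n. t n = - sg * \<bar>t n\<bar>"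
  shows "\<And>n. integrable lam (\<lambda>u. indicator (ball 0 (2 * r)) u *\<^sub>R kern (\<tau> n) u)"
    and "(\<lambda>n. \<integral>u. indicator (ball 0 (2 * r)) u *\<^sub>R kern (\<tau> n) u \<partial>lam)
      \<longlonglongrightarrow> A0 + annulus_part + (sg * poisson_const) *\<^sub>R e0"
proof -
  define \<kappa> where "\<kappa> = \<delta> / (1 + 2 * \<delta>)"
  have \<kappa>: "0 < \<kappa>" using \<delta> by (simp add: \<kappa>_def)
  note cb = cone_bounds[OF \<tau>(1) \<tau>(2) cone, folded \<kappa>_def]
  have cb1: "\<kappa> * norm (\<tau> n) \<le> norm (u + \<psi> u *\<^sub>R \<nu> - \<tau> n)" "\<kappa> * norm u \<le> norm (u + \<psi> u *\<^sub>R \<nu> - \<tau> n)" if "u \<in> T" for n u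
    using cb[OF that, of 1] by auto
  have a: "0 < \<kappa> * norm (\<tau> n)" for n using \<kappa> nz[of n] by simp
  have t0: "t n \<noteq> 0" for n
  proof -
    have "0 < 2 * \<delta> * norm (\<tau> n)" using \<delta> nz[of n] by simp
    then show ?thesis using cone[of n] by auto
  qed
  have nz': "u + (s * \<psi> u) *\<^sub>R \<nu> \<noteq> \<tau> n" if "u \<in> T" "s \<in> {0..1}" for n u s
    using cb(1)[OF that, of n] a[of n] by auto
  show int: "integrable lam (\<lambda>u. indicator (ball 0 (2 * r)) u *\<^sub>R kern (\<tau> n) u)" for n
    by (rule integrable_kern[OF _ a[of n]]) (use cb1 in \<open>auto simp: indicator_def split: if_splits\<close>)
  have int1: "integrable lam (\<lambda>u. bump r u *\<^sub>R kern (\<tau> n) u)" for n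
  proof (rule integrable_kern[OF _ a[of n]])
    fix u assume u: "u \<in> T"
    show "\<bar>bump r u\<bar> \<le> 1" using bump_bounds[of r u] by auto
    show "norm u \<le> 2 * r \<and> \<kappa> * norm (\<tau> n) \<le> norm (u + \<psi> u *\<^sub>R \<nu> - \<tau> n)" if "bump r u \<noteq> 0"
      using bump_eq_0(1)[OF r_pos, of u] that cb1(1)[OF u] by force
  qed auto
  let ?q = "\<lambda>u. indicator (ball 0 (2 * r)) u - bump r u"
  have \<kappa>r: "0 < \<kappa> * r" using \<kappa> r_pos by simp
  have q: "\<bar>?q u\<bar> \<le> 1" "?q u \<noteq> 0 \<Longrightarrow> norm u \<le> 2 * r \<and> \<kappa> * r \<le> norm (u + \<psi> u *\<^sub>R \<nu> - \<tau> n)" if "u \<in> T" for n u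
  proof -
    show "\<bar>?q u\<bar> \<le> 1" by (rule cutoff_bounds(1))
    assume "?q u \<noteq> 0"
    from cutoff_bounds(2)[OF this] have u: "norm u \<le> 2 * r" "r \<le> norm u" by auto
    have "\<kappa> * r \<le> \<kappa> * norm u" using u \<kappa> by (intro mult_left_mono) auto
    also have "\<dots> \<le> norm (u + \<psi> u *\<^sub>R \<nu> - \<tau> n)" by (rule cb1(2)[OF that])
    finally show "norm u \<le> 2 * r \<and> \<kappa> * r \<le> norm (u + \<psi> u *\<^sub>R \<nu> - \<tau> n)" using u by simp
  qed
  note intq = integrable_kern[OF _ \<kappa>r q]
  have limq: "(\<lambda>n. \<integral>u. ?q u *\<^sub>R kern (\<tau> n) u \<partial>lam) \<longlonglongrightarrow> annulus_part"
    unfolding annulus_part_def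
  proof (rule integral_dominated_convergence[where w = "\<lambda>u. (P_bound * D_bound / (\<kappa> * r) ^ m) * indicator (cball 0 (2 * r)) u"])
    show "integrable lam (\<lambda>u. (P_bound * D_bound / (\<kappa> * r) ^ m) * indicator (cball 0 (2 * r)) u)"
      using emeasure_lam_cball_finite[of "2 * r"] by (intro integrable_mult_right integrable_real_indicator) auto
    show "AE u in lam. norm (?q u *\<^sub>R kern (\<tau> n) u) \<le> (P_bound * D_bound / (\<kappa> * r) ^ m) * indicator (cball 0 (2 * r)) u" for n
      using AE_flat by eventually_elim (rule intq(2), measurable)
    show "AE u in lam. (\<lambda>n. ?q u *\<^sub>R kern (\<tau> n) u) \<longlonglongrightarrow> ?q u *\<^sub>R kern 0 u"
      using AE_flat
    proof eventually_elim
      case (elim u)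
      show ?case
      proof (cases "?q u = 0")
        case False
        from cutoff_bounds(2)[OF False] have "r \<le> norm (u + \<psi> u *\<^sub>R \<nu>)" using graph_ge[OF elim] by auto
        then have "u + \<psi> u *\<^sub>R \<nu> - 0 \<noteq> 0" using r_pos by auto
        then show ?thesis unfolding kern_def E_def by (intro tendsto_intros lim P.tendsto) auto
      qed simp
    qed
  qed measurable
  \<comment> \<open>The deformation controls only the difference between \<open>s = 1\<close> and
    \<open>s = 0\<close>, so the value on the hyperplane is added back and supplied by
    \<open>flat_limit\<close>.\<close>
  have eq: "(\<integral>u. indicator (ball 0 (2 * r)) u *\<^sub>R kern (\<tau> n) u \<partial>lam)
      = (G (bump r) (\<tau> n) 1 - G (bump r) (\<tau> n) 0) + (\<integral>u. ?q u *\<^sub>R kern (\<tau> n) u \<partial>lam) + G (bump r) (\<tau> n) 0" for n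
  proof -
    have "(\<integral>u. indicator (ball 0 (2 * r)) u *\<^sub>R kern (\<tau> n) u \<partial>lam) = (\<integral>u. bump r u *\<^sub>R kern (\<tau> n) u + ?q u *\<^sub>R kern (\<tau> n) u \<partial>lam)"
      by (simp add: scaleR_add_left[symmetric])
    also have "\<dots> = (\<integral>u. bump r u *\<^sub>R kern (\<tau> n) u \<partial>lam) + (\<integral>u. ?q u *\<^sub>R kern (\<tau> n) u \<partial>lam)"
      by (rule Bochner_Integration.integral_add[OF int1]) (rule intq(1), measurable)
    finally show ?thesis by (simp add: G_def kern_def)
  qed
  show "(\<lambda>n. \<integral>u. indicator (ball 0 (2 * r)) u *\<^sub>R kern (\<tau> n) u \<partial>lam)
      \<longlonglongrightarrow> A0 + annulus_part + (sg * poisson_const) *\<^sub>R e0"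
    unfolding eq
    by (intro tendsto_add limq interpolation_limit[OF \<tau> lim nz'] flat_limit[OF \<tau> lim t0 sg])
qed

end

section \<open>Boundary charts as graphs\<close>

lemma boundary_chart_directional:
  assumes c: "boundary_chart L W V \<phi> g" and L: "subspace L" and y: "y \<in> V" "\<phi> y = 0" and v: "v \<in> L" "g y \<bullet> v \<noteq> 0"
  shows "\<forall>\<^sub>F s in at_right 0. y + s *\<^sub>R v \<in> V \<and> sgn (\<phi> (y + s *\<^sub>R v)) = sgn (g y \<bullet> v)"
proof -
  have VL: "openin (top_of_set L) V" and d: "(\<phi> has_derivative (\<lambda>h. g y \<bullet> h)) (at y within L)"
    using c y by (auto simp: boundary_chart_def)
  have yL: "y \<in> L" using VL y(1) openin_imp_subset by blast
  have v0: "v \<noteq> 0" using v(2) by auto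
  have in_L: "y + s *\<^sub>R v \<in> L" for s using L yL v(1) by (simp add: subspace_add subspace_scale)
  define e where "e = \<bar>g y \<bullet> v\<bar> / (2 * norm v)"
  have e: "0 < e" using v(2) v0 by (simp add: e_def)
  obtain d1 where d1: "0 < d1" "\<And>z. z \<in> L \<Longrightarrow> norm (z - y) < d1 \<Longrightarrow> \<bar>\<phi> z - \<phi> y - g y \<bullet> (z - y)\<bar> \<le> e * norm (z - y)"
    using d e unfolding has_derivative_within_alt by (metis real_norm_def)
  obtain d2 where d2: "0 < d2" "\<And>z. z \<in> L \<Longrightarrow> dist z y < d2 \<Longrightarrow> z \<in> V"
    using VL y(1) unfolding openin_euclidean_subtopology_iff by blast
  have "y + s *\<^sub>R v \<in> V \<and> sgn (\<phi> (y + s *\<^sub>R v)) = sgn (g y \<bullet> v)" if s: "0 < s" "s < min d1 d2 / norm v" for s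
  proof -
    have n: "norm (s *\<^sub>R v) < min d1 d2" using s v0 by (simp add: field_simps)
    have "\<bar>\<phi> (y + s *\<^sub>R v) - s * (g y \<bullet> v)\<bar> \<le> e * norm (s *\<^sub>R v)"
      using d1(2)[OF in_L[of s]] n y(2) by simp
    also have "\<dots> = s * \<bar>g y \<bullet> v\<bar> / 2" using s v0 by (simp add: e_def)
    finally have "\<bar>\<phi> (y + s *\<^sub>R v) - s * (g y \<bullet> v)\<bar> \<le> s * \<bar>g y \<bullet> v\<bar> / 2" .
    moreover have "0 < s * \<bar>g y \<bullet> v\<bar>" using s v(2) by simp
    moreover have "\<bar>s * (g y \<bullet> v)\<bar> = s * \<bar>g y \<bullet> v\<bar>" using s by (simp add: abs_mult)
    ultimately have "\<bar>\<phi> (y + s *\<^sub>R v) - s * (g y \<bullet> v)\<bar> < \<bar>s * (g y \<bullet> v)\<bar>" by linarith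
    moreover have "sgn a = sgn b" if "\<bar>a - b\<bar> < \<bar>b\<bar>" for a b :: real
      using that by (auto simp: sgn_if abs_if split: if_splits)
    ultimately have "sgn (\<phi> (y + s *\<^sub>R v)) = sgn (s * (g y \<bullet> v))" by blast
    then have "sgn (\<phi> (y + s *\<^sub>R v)) = sgn (g y \<bullet> v)" using s by (simp add: sgn_mult)
    moreover have "y + s *\<^sub>R v \<in> V" using d2(2)[OF in_L[of s]] n by (simp add: dist_norm)
    ultimately show ?thesis by simp
  qed
  moreover have "0 < min d1 d2 / norm v" using d1(1) d2(1) v0 by simp
  ultimately show ?thesis unfolding eventually_at_right_field by blast
qed

text \<open>If the unit normals \<open>a\<close> and \<open>b\<close> of two charts differed, the
  direction \<open>b - a\<close> would point into \<open>W\<close> for the first chart and out of it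
  for the second.\<close>

lemma chart_normal_unique:
  assumes L: "subspace L" and c1: "boundary_chart L W V1 \<phi>1 g1" and c2: "boundary_chart L W V2 \<phi>2 g2"
    and y: "y \<in> V1" "y \<in> V2" "\<phi>1 y = 0" "\<phi>2 y = 0"
  shows "g1 y /\<^sub>R norm (g1 y) = g2 y /\<^sub>R norm (g2 y)"
proof (rule ccontr)
  define a b where "a = g1 y /\<^sub>R norm (g1 y)" and "b = g2 y /\<^sub>R norm (g2 y)"
  assume "g1 y /\<^sub>R norm (g1 y) \<noteq> g2 y /\<^sub>R norm (g2 y)"
  then have ab: "a \<noteq> b" by (simp add: a_def b_def)
  have g: "g1 y \<noteq> 0" "g2 y \<noteq> 0" "g1 y \<in> L" "g2 y \<in> L" using c1 c2 y by (auto simp: boundary_chart_def)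
  then have n: "norm a = 1" "norm b = 1" "a \<in> L" "b \<in> L" using L by (auto simp: a_def b_def subspace_scale)
  have "0 < (norm (a - b))\<^sup>2" using ab by simp
  also have "(norm (a - b))\<^sup>2 = 2 - 2 * (a \<bullet> b)" using n(1,2) by (simp add: power2_norm_eq_inner inner_simps inner_commute norm_eq_1)
  finally have "a \<bullet> b < 1" by simp
  then have "a \<bullet> (b - a) < 0" "0 < b \<bullet> (b - a)" using n(1,2) by (simp_all add: inner_diff_right norm_eq_1 inner_commute)
  then have s: "g1 y \<bullet> (b - a) < 0" "0 < g2 y \<bullet> (b - a)"
    using g by (auto simp: a_def b_def mult_less_0_iff zero_less_mult_iff)
  have W: "W \<inter> V1 = {y \<in> V1. \<phi>1 y < 0}" "W \<inter> V2 = {y \<in> V2. \<phi>2 y < 0}"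
    using c1 c2 by (simp_all add: boundary_chart_def)
  have vL: "b - a \<in> L" using n L by (simp add: subspace_diff)
  have "\<forall>\<^sub>F s in at_right 0. y + s *\<^sub>R (b - a) \<in> V1 \<and> sgn (\<phi>1 (y + s *\<^sub>R (b - a))) = sgn (g1 y \<bullet> (b - a))"
    using s by (intro boundary_chart_directional[OF c1 L] y vL) auto
  moreover have "\<forall>\<^sub>F s in at_right 0. y + s *\<^sub>R (b - a) \<in> V2 \<and> sgn (\<phi>2 (y + s *\<^sub>R (b - a))) = sgn (g2 y \<bullet> (b - a))"
    using s by (intro boundary_chart_directional[OF c2 L] y vL) auto
  ultimately have "\<forall>\<^sub>F s :: real in at_right 0. False"
  proof eventually_elim
    case (elim s')
    let ?z = "y + s' *\<^sub>R (b - a)"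
    have "\<phi>1 ?z < 0" "0 < \<phi>2 ?z" using elim s by (auto simp: sgn_if split: if_splits)
    then have "?z \<in> {y \<in> V1. \<phi>1 y < 0}" "?z \<in> V2" "?z \<notin> {y \<in> V2. \<phi>2 y < 0}" using elim by auto
    then show ?case unfolding W[symmetric] by simp
  qed
  then show False by (simp add: trivial_limit_at_right_real)
qed

lemma exterior_normal_eq:
  assumes L: "subspace L" and c: "boundary_chart L W V \<phi> g" and y: "y \<in> V" "\<phi> y = 0"
  shows "exterior_normal L W y = g y /\<^sub>R norm (g y)"
proof -
  have zero: "\<phi>' y = 0" if "boundary_chart L W V' \<phi>' g'" "y \<in> V'" "y \<in> (top_of_set L) frontier_of W" for V' \<phi>' g'
    using that unfolding boundary_chart_def by blast
  have fr: "y \<in> (top_of_set L) frontier_of W" using c y unfolding boundary_chart_def by blast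
  have reg: "regular_point L W y" unfolding regular_point_def using fr c y by blast
  have "(THE \<nu>. \<exists>V \<phi> g. y \<in> V \<and> boundary_chart L W V \<phi> g \<and> \<nu> = g y /\<^sub>R norm (g y)) = g y /\<^sub>R norm (g y)"
  proof (rule the_equality)
    show "\<exists>V \<phi> g'. y \<in> V \<and> boundary_chart L W V \<phi> g' \<and> g y /\<^sub>R norm (g y) = g' y /\<^sub>R norm (g' y)" using c y by blast
    fix \<nu> assume "\<exists>V \<phi> g. y \<in> V \<and> boundary_chart L W V \<phi> g \<and> \<nu> = g y /\<^sub>R norm (g y)"
    then obtain V' \<phi>' g' where c': "y \<in> V'" "boundary_chart L W V' \<phi>' g'" "\<nu> = g' y /\<^sub>R norm (g' y)" by blast
    then show "\<nu> = g y /\<^sub>R norm (g y)"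
      using chart_normal_unique[OF L c'(2) c c'(1) y(1) zero[OF c'(2,1) fr] y(2)] by simp
  qed
  then show ?thesis unfolding exterior_normal_def using reg by simp
qed

context hyperplane begin

definition Lsp :: "'a set" where "Lsp = {u + s *\<^sub>R \<nu> | u s. u \<in> T}"

lemma LspI: "u \<in> T \<Longrightarrow> u + s *\<^sub>R \<nu> \<in> Lsp" by (auto simp: Lsp_def)

lemma Lsp_decomp: "y \<in> Lsp \<Longrightarrow> y = proj y + (y \<bullet> \<nu>) *\<^sub>R \<nu>"
  using proj_add_\<nu> by (auto simp: Lsp_def inner_add_left span_\<nu> \<nu>\<nu>)

lemma subspace_Lsp: "subspace Lsp"
proof -
  have "Lsp = {x + y |x y. x \<in> T \<and> y \<in> span {\<nu>}}" by (auto simp: Lsp_def span_singleton)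
  then show ?thesis using subspace_sums[of T "span {\<nu>}"] by simp
qed

lemma inner_decomp: "a \<in> Lsp \<Longrightarrow> u \<in> T \<Longrightarrow> a \<bullet> (u + s *\<^sub>R \<nu>) = proj a \<bullet> u + s * (a \<bullet> \<nu>)"
  using inner_span_proj[of u a] by (simp add: inner_add_right inner_commute)

text \<open>The implicit function theorem in the slice, done by hand to have the slope bound
  \<delta> and the exact description of the sides of the zero set in one cylinder. The local
  solution is then extended to the whole space by \<open>proj\<close> and cut off.\<close>

lemma chart_graph:
  assumes c: "boundary_chart Lsp W V \<phi> g" and x: "x \<in> V" "\<phi> x = 0" and \<nu>: "\<nu> = g x /\<^sub>R norm (g x)"
    and \<delta>: "0 < \<delta>" "\<delta> \<le> 1"
  obtains \<psi> d\<psi> r h where "0 < r" "0 < h" "graph M m B \<nu> \<psi> d\<psi>" "\<psi> 0 = 0" "d\<psi> 0 = 0"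
    "\<And>u. u \<in> T \<Longrightarrow> \<bar>\<psi> u\<bar> \<le> \<delta> * norm u"
    "\<And>u. u \<in> T \<Longrightarrow> norm u < 2 * r \<Longrightarrow> \<bar>\<psi> u\<bar> < h"
    "\<And>u s. u \<in> T \<Longrightarrow> norm u < 2 * r \<Longrightarrow> \<bar>s\<bar> < h \<Longrightarrow> x + u + s *\<^sub>R \<nu> \<in> V \<and>
        (\<phi> (x + u + s *\<^sub>R \<nu>) < 0 \<longleftrightarrow> s < \<psi> u) \<and> (\<phi> (x + u + s *\<^sub>R \<nu>) = 0 \<longleftrightarrow> s = \<psi> u)"
    "\<And>u. u \<in> T \<Longrightarrow> norm u < 2 * r \<Longrightarrow>
        g (x + u + \<psi> u *\<^sub>R \<nu>) /\<^sub>R norm (g (x + u + \<psi> u *\<^sub>R \<nu>)) = (\<nu> - d\<psi> u) /\<^sub>R sqrt (1 + (norm (d\<psi> u))\<^sup>2)"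
proof -
  have VL: "openin (top_of_set Lsp) V" and gcont: "continuous_on V g"
    and gL: "\<And>y. y \<in> V \<Longrightarrow> g y \<in> Lsp" "\<And>y. y \<in> V \<Longrightarrow> g y \<noteq> 0"
    and d\<phi>: "\<And>y. y \<in> V \<Longrightarrow> (\<phi> has_derivative (\<lambda>h. g y \<bullet> h)) (at y within Lsp)"
    using c by (auto simp: boundary_chart_def)
  have VsL: "V \<subseteq> Lsp" using VL openin_imp_subset by blast
  define c0 where "c0 = norm (g x)"
  have c0: "0 < c0" "g x = c0 *\<^sub>R \<nu>" using gL(2)[OF x(1)] \<nu> by (auto simp: c0_def)
  \<comment> \<open>With the gradient within \<open>e1 * norm (g x)\<close> of \<open>g x\<close>,
    slopes are at most \<open>e1 / (1 - e1)\<close>, which is at most \<delta> for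
    \<open>e1 = \<delta> / 2\<close> and \<open>\<delta> \<le> 1\<close>.\<close>
  define e1 where "e1 = \<delta> / 2"
  have e1: "0 < e1" "e1 \<le> 1/2" using \<delta> by (auto simp: e1_def)
  obtain \<eta>1 where \<eta>1: "0 < \<eta>1" "\<And>z. z \<in> Lsp \<Longrightarrow> dist z x < \<eta>1 \<Longrightarrow> z \<in> V"
    using VL x(1) unfolding openin_euclidean_subtopology_iff by blast
  obtain \<eta>2 where \<eta>2: "0 < \<eta>2" "\<And>z. z \<in> V \<Longrightarrow> dist z x < \<eta>2 \<Longrightarrow> dist (g z) (g x) < e1 * c0"
    using gcont x(1) e1 c0 unfolding continuous_on_iff by (metis mult_pos_pos)
  define \<eta> where "\<eta> = min \<eta>1 \<eta>2"
  have \<eta>: "0 < \<eta>" "\<And>z. z \<in> Lsp \<Longrightarrow> dist z x < \<eta> \<Longrightarrow> z \<in> V" "\<And>z. z \<in> Lsp \<Longrightarrow> dist z x < \<eta> \<Longrightarrow> norm (g z - g x) < e1 * c0"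
    using \<eta>1 \<eta>2 by (auto simp: \<eta>_def dist_norm)
  have g\<nu>: "(1 - e1) * c0 \<le> g z \<bullet> \<nu>" "norm (proj (g z)) \<le> e1 * c0" if "z \<in> Lsp" "dist z x < \<eta>" for z
  proof -
    have n: "norm (g z - g x) \<le> e1 * c0" using \<eta>(3)[OF that] by simp
    have "\<bar>(g z - g x) \<bullet> \<nu>\<bar> \<le> e1 * c0" using Cauchy_Schwarz_ineq2[of "g z - g x" \<nu>] n norm_\<nu> by simp
    then show "(1 - e1) * c0 \<le> g z \<bullet> \<nu>" using c0(2) \<nu>\<nu> by (simp add: inner_diff_left algebra_simps abs_le_iff)
    have "proj (g x) = 0" using c0(2) by (simp add: linear_scale[OF linear_proj] proj_\<nu>)
    then have "proj (g z) = proj (g z - g x)" by (simp add: linear_diff[OF linear_proj])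
    then show "norm (proj (g z)) \<le> e1 * c0" using norm_proj_le[of "g z - g x"] n by simp
  qed
  have g\<nu>0: "0 < g z \<bullet> \<nu>" if "z \<in> Lsp" "dist z x < \<eta>" for z
  proof -
    have "0 < (1 - e1) * c0" using e1 c0 by simp
    then show ?thesis using g\<nu>(1)[OF that] by linarith
  qed
  \<comment> \<open>\<phi> is known to be differentiable only relative to \<open>Lsp\<close>;
    segments between points of the slice stay in it and in the ball.\<close>
  have mvt: "\<exists>\<xi>\<in>closed_segment y' y. \<xi> \<in> Lsp \<and> dist \<xi> x < \<eta> \<and> \<phi> y - \<phi> y' = g \<xi> \<bullet> (y - y')"
    if y: "y \<in> Lsp" "dist y x < \<eta>" "y' \<in> Lsp" "dist y' x < \<eta>" for y y'
  proof -
    let ?l = "\<lambda>t. y' + t *\<^sub>R (y - y')"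
    have lL: "?l t \<in> Lsp" for t using y subspace_Lsp by (simp add: subspace_add subspace_scale subspace_diff)
    have seg: "?l t \<in> closed_segment y' y" if "t \<in> {0..1}" for t
      using that by (auto simp: closed_segment_def algebra_simps intro!: exI[of _ t])
    have ball: "dist (?l t) x < \<eta>" if "t \<in> {0..1}" for t
    proof -
      have "closed_segment y' y \<subseteq> ball x \<eta>"
        using y by (intro closed_segment_subset convex_ball) (auto simp: dist_commute)
      then show ?thesis using seg[OF that] by (auto simp: dist_commute)
    qed
    have "\<exists>t\<in>{0..1}. \<phi> (?l 1) - \<phi> (?l 0) = (\<lambda>k. g (?l t) \<bullet> (k *\<^sub>R (y - y'))) (1 - 0)"
    proof (rule mvt_very_simple[of 0 1 "\<lambda>t. \<phi> (?l t)" "\<lambda>t k. g (?l t) \<bullet> (k *\<^sub>R (y - y'))"])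
      fix t :: real assume t: "0 \<le> t" "t \<le> 1"
      have "(?l has_derivative (\<lambda>k. k *\<^sub>R (y - y'))) (at t within {0..1})" by (auto intro!: derivative_eq_intros)
      moreover have "(\<phi> has_derivative (\<lambda>h. g (?l t) \<bullet> h)) (at (?l t) within ?l ` {0..1})"
        by (rule has_derivative_subset[OF d\<phi>[OF \<eta>(2)[OF lL ball]]]) (use t lL in auto)
      ultimately show "((\<lambda>t. \<phi> (?l t)) has_derivative (\<lambda>k. g (?l t) \<bullet> (k *\<^sub>R (y - y')))) (at t within {0..1})"
        by (rule has_derivative_in_compose)
    qed auto
    then obtain t where "t \<in> {0..1}" "\<phi> y - \<phi> y' = g (?l t) \<bullet> (y - y')" by auto
    then show ?thesis using seg ball lL by (intro bexI[of _ "?l t"]) auto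
  qed
  have xL: "x \<in> Lsp" using x VsL by blast
  define h where "h = \<eta> / 2"
  have h: "0 < h" using \<eta> by (simp add: h_def)
  let ?Y = "\<lambda>u s. x + u + s *\<^sub>R \<nu>"
  have YL: "?Y u s \<in> Lsp" if "u \<in> T" for u s
    using LspI[OF that, of s] xL subspace_Lsp by (simp add: add.assoc subspace_add)
  have Yd: "dist (?Y u s) x < \<eta>" if "norm u < h" "\<bar>s\<bar> \<le> h" for u s
  proof -
    have "dist (?Y u s) x \<le> norm u + \<bar>s\<bar>" using norm_triangle_ineq[of u "s *\<^sub>R \<nu>"] norm_\<nu> by (simp add: dist_norm add.assoc)
    then show ?thesis using that by (simp add: h_def)
  qed
  have mono: "\<phi> (?Y u s) < \<phi> (?Y u s')" if as: "u \<in> T" "norm u < h" "\<bar>s\<bar> \<le> h" "\<bar>s'\<bar> \<le> h" "s < s'" for u s s'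
  proof -
    obtain \<xi> where \<xi>: "\<xi> \<in> Lsp" "dist \<xi> x < \<eta>" "\<phi> (?Y u s') - \<phi> (?Y u s) = g \<xi> \<bullet> (?Y u s' - ?Y u s)"
      using mvt[OF YL[OF as(1)] Yd[OF as(2,4)] YL[OF as(1)] Yd[OF as(2,3)]] by blast
    have "?Y u s' - ?Y u s = (s' - s) *\<^sub>R \<nu>" by (simp add: algebra_simps)
    then have "\<phi> (?Y u s') - \<phi> (?Y u s) = (s' - s) * (g \<xi> \<bullet> \<nu>)" using \<xi>(3) by simp
    then show ?thesis using g\<nu>0[OF \<xi>(1,2)] as(5) by (metis diff_gt_0_iff_gt mult_pos_pos)
  qed
  have cont\<phi>: "continuous_on {z \<in> Lsp. dist z x < \<eta>} \<phi>"
    unfolding continuous_on_eq_continuous_within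
  proof
    fix z assume z: "z \<in> {z \<in> Lsp. dist z x < \<eta>}"
    have "continuous (at z within Lsp) \<phi>" using has_derivative_continuous[OF d\<phi>[OF \<eta>(2)]] z by auto
    then show "continuous (at z within {z \<in> Lsp. dist z x < \<eta>}) \<phi>" by (rule continuous_within_subset) auto
  qed
  \<comment> \<open>By monotonicity along \<nu> the function is negative at the bottom and positive
    at the top of the axis; by continuity this persists over a small ball of base points, and the
    zero in between defines \<open>\<psi>0\<close>.\<close>
  have signs: "\<exists>\<rho>>0. \<rho> \<le> h \<and> (\<forall>u\<in>T. norm u < \<rho> \<longrightarrow> \<phi> (?Y u (- h)) < 0 \<and> 0 < \<phi> (?Y u h))"
  proof -
    have z: "\<phi> (?Y 0 (- h)) < 0" "0 < \<phi> (?Y 0 h)"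
      using mono[of 0 "- h" 0] mono[of 0 0 h] h x(2) by (auto simp: span_zero)
    have cY: "continuous_on (T \<inter> ball 0 h) (\<lambda>u. \<phi> (?Y u s))" if "\<bar>s\<bar> \<le> h" for s
      by (rule continuous_on_compose2[OF cont\<phi>]) (use that YL Yd in \<open>auto intro!: continuous_intros\<close>)
    have c1: "continuous_on (T \<inter> ball 0 h) (\<lambda>u. \<phi> (?Y u (- h)))" "continuous_on (T \<inter> ball 0 h) (\<lambda>u. \<phi> (?Y u h))"
      by (rule cY, use h in simp)+
    have 0: "0 \<in> T \<inter> ball 0 h" using h by (simp add: span_zero)
    obtain \<rho>1 where \<rho>1: "0 < \<rho>1" "\<And>u. u \<in> T \<inter> ball 0 h \<Longrightarrow> dist u 0 < \<rho>1 \<Longrightarrow> dist (\<phi> (?Y u (- h))) (\<phi> (?Y 0 (- h))) < - \<phi> (?Y 0 (- h))"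
      using c1(1) 0 z(1) unfolding continuous_on_iff by (metis neg_0_less_iff_less)
    obtain \<rho>2 where \<rho>2: "0 < \<rho>2" "\<And>u. u \<in> T \<inter> ball 0 h \<Longrightarrow> dist u 0 < \<rho>2 \<Longrightarrow> dist (\<phi> (?Y u h)) (\<phi> (?Y 0 h)) < \<phi> (?Y 0 h)"
      using c1(2) 0 z(2) unfolding continuous_on_iff by metis
    have "\<phi> (?Y u (- h)) < 0 \<and> 0 < \<phi> (?Y u h)" if "u \<in> T" "norm u < min h (min \<rho>1 \<rho>2)" for u
      using \<rho>1(2)[of u] \<rho>2(2)[of u] that by (auto simp: dist_real_def)
    then show ?thesis using h \<rho>1 \<rho>2 by (intro exI[of _ "min h (min \<rho>1 \<rho>2)"]) auto
  qed
  then obtain \<rho> where \<rho>: "0 < \<rho>" "\<rho> \<le> h" "\<And>u. u \<in> T \<Longrightarrow> norm u < \<rho> \<Longrightarrow> \<phi> (?Y u (- h)) < 0 \<and> 0 < \<phi> (?Y u h)" by blast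
  have ex: "\<exists>s. \<bar>s\<bar> < h \<and> \<phi> (?Y u s) = 0" if u: "u \<in> T" "norm u < \<rho>" for u
  proof -
    have "continuous_on {- h..h} (\<lambda>s. \<phi> (?Y u s))"
      by (rule continuous_on_compose2[OF cont\<phi>]) (use u \<rho> YL Yd in \<open>auto intro!: continuous_intros simp: abs_le_iff\<close>)
    then obtain s where "- h \<le> s" "s \<le> h" "\<phi> (?Y u s) = 0"
      using IVT'[of "\<lambda>s. \<phi> (?Y u s)" "- h" 0 h] \<rho>(3)[OF u] h by force
    moreover have "s \<noteq> h" "s \<noteq> - h" using \<rho>(3)[OF u] calculation(3) by auto
    ultimately show ?thesis by (intro exI[of _ s]) auto
  qed
  define \<psi>0 where "\<psi>0 u = (SOME s. \<bar>s\<bar> < h \<and> \<phi> (?Y u s) = 0)" for u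
  have \<psi>0: "\<bar>\<psi>0 u\<bar> < h" "\<phi> (?Y u (\<psi>0 u)) = 0" if "u \<in> T" "norm u < \<rho>" for u
    using someI_ex[OF ex[OF that]] by (auto simp: \<psi>0_def)
  have side: "\<phi> (?Y u s) < 0 \<longleftrightarrow> s < \<psi>0 u" "\<phi> (?Y u s) = 0 \<longleftrightarrow> s = \<psi>0 u" if u: "u \<in> T" "norm u < \<rho>" and s: "\<bar>s\<bar> < h" for u s
  proof -
    have n: "norm u < h" using u \<rho> by simp
    have "s < \<psi>0 u \<Longrightarrow> \<phi> (?Y u s) < 0" "\<psi>0 u < s \<Longrightarrow> 0 < \<phi> (?Y u s)"
      using mono[OF u(1) n, of s "\<psi>0 u"] mono[OF u(1) n, of "\<psi>0 u" s] \<psi>0[OF u] s by auto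
    then show "\<phi> (?Y u s) < 0 \<longleftrightarrow> s < \<psi>0 u" "\<phi> (?Y u s) = 0 \<longleftrightarrow> s = \<psi>0 u"
      using \<psi>0(2)[OF u] by (cases s "\<psi>0 u" rule: linorder_cases; force)+
  qed
  \<comment> \<open>The mean value theorem between two boundary points, solved for the height
    difference. It yields the Lipschitz bound \<open>lip\<close> and, letting the points merge, the
    derivative.\<close>
  have diff: "\<exists>\<xi>\<in>closed_segment (?Y v (\<psi>0 v)) (?Y u (\<psi>0 u)). \<xi> \<in> Lsp \<and> dist \<xi> x < \<eta> \<and>
      \<psi>0 u - \<psi>0 v = - (proj (g \<xi>) \<bullet> (u - v)) / (g \<xi> \<bullet> \<nu>)" if u: "u \<in> T" "norm u < \<rho>" and v: "v \<in> T" "norm v < \<rho>" for u v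
  proof -
    have a: "?Y u (\<psi>0 u) \<in> Lsp" "dist (?Y u (\<psi>0 u)) x < \<eta>" "?Y v (\<psi>0 v) \<in> Lsp" "dist (?Y v (\<psi>0 v)) x < \<eta>"
      using YL[OF u(1)] YL[OF v(1)] Yd[of u "\<psi>0 u"] Yd[of v "\<psi>0 v"] \<psi>0[OF u] \<psi>0[OF v] u v \<rho> by auto
    obtain \<xi> where \<xi>: "\<xi> \<in> closed_segment (?Y v (\<psi>0 v)) (?Y u (\<psi>0 u))" "\<xi> \<in> Lsp" "dist \<xi> x < \<eta>"
      "\<phi> (?Y u (\<psi>0 u)) - \<phi> (?Y v (\<psi>0 v)) = g \<xi> \<bullet> (?Y u (\<psi>0 u) - ?Y v (\<psi>0 v))"
      using mvt[OF a] by blast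
    have eq: "?Y u (\<psi>0 u) - ?Y v (\<psi>0 v) = (u - v) + (\<psi>0 u - \<psi>0 v) *\<^sub>R \<nu>" by (simp add: algebra_simps)
    have "0 = g \<xi> \<bullet> (?Y u (\<psi>0 u) - ?Y v (\<psi>0 v))"
      using \<xi>(4) unfolding \<psi>0(2)[OF u] \<psi>0(2)[OF v] by simp
    also have "\<dots> = proj (g \<xi>) \<bullet> (u - v) + (\<psi>0 u - \<psi>0 v) * (g \<xi> \<bullet> \<nu>)"
      unfolding eq by (rule inner_decomp[OF gL(1)[OF \<eta>(2)[OF \<xi>(2,3)]] span_diff[OF u(1) v(1)]])
    finally have "\<psi>0 u - \<psi>0 v = - (proj (g \<xi>) \<bullet> (u - v)) / (g \<xi> \<bullet> \<nu>)"
      using g\<nu>0[OF \<xi>(2,3)] by (simp add: field_simps)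
    with \<xi> show ?thesis by blast
  qed
  have lip: "\<bar>\<psi>0 u - \<psi>0 v\<bar> \<le> \<delta> * norm (u - v)" if u: "u \<in> T" "norm u < \<rho>" and v: "v \<in> T" "norm v < \<rho>" for u v
  proof -
    obtain \<xi> where \<xi>: "\<xi> \<in> Lsp" "dist \<xi> x < \<eta>" "\<psi>0 u - \<psi>0 v = - (proj (g \<xi>) \<bullet> (u - v)) / (g \<xi> \<bullet> \<nu>)"
      using diff[OF u v] by blast
    have p: "0 < g \<xi> \<bullet> \<nu>" by (rule g\<nu>0[OF \<xi>(1,2)])
    have "\<bar>proj (g \<xi>) \<bullet> (u - v)\<bar> \<le> norm (proj (g \<xi>)) * norm (u - v)" by (rule Cauchy_Schwarz_ineq2)
    also have "\<dots> \<le> e1 * c0 * norm (u - v)" by (intro mult_right_mono g\<nu>(2)[OF \<xi>(1,2)]) auto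
    also have "\<dots> \<le> \<delta> * (g \<xi> \<bullet> \<nu>) * norm (u - v)"
    proof (rule mult_right_mono)
      have "e1 * c0 \<le> \<delta> * ((1 - e1) * c0)" using e1 c0(1) \<delta> by (simp add: e1_def)
      also have "\<dots> \<le> \<delta> * (g \<xi> \<bullet> \<nu>)" using g\<nu>(1)[OF \<xi>(1,2)] \<delta> by (intro mult_left_mono) auto
      finally show "e1 * c0 \<le> \<delta> * (g \<xi> \<bullet> \<nu>)" .
    qed simp
    finally show ?thesis unfolding \<xi>(3) using p by (simp add: field_simps)
  qed
  have zero: "\<psi>0 0 = 0" using side(2)[of 0 0] x(2) \<rho> h by (simp add: span_zero)
  \<comment> \<open>The implicit derivative: minus the tangential over the normal component of the
    gradient of \<phi>.\<close>
  define A where "A z = - (1 / (g z \<bullet> \<nu>)) *\<^sub>R proj (g z)" for z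
  define Z where "Z = {z \<in> Lsp. dist z x < \<eta>}"
  have contA: "continuous_on Z A"
    unfolding A_def
    by (intro continuous_intros continuous_on_subset[OF gcont]) (use g\<nu>0 \<eta>(2) in \<open>force simp: Z_def\<close>)+
  have AT: "A z \<in> T" for z unfolding A_def by (intro span_scale proj_in_span)
  have diffA: "\<exists>\<xi>\<in>closed_segment (?Y v (\<psi>0 v)) (?Y u (\<psi>0 u)). \<xi> \<in> Z \<and> \<psi>0 u - \<psi>0 v = A \<xi> \<bullet> (u - v)"
    if "u \<in> T" "norm u < \<rho>" "v \<in> T" "norm v < \<rho>" for u v
    using diff[OF that] by (auto simp: A_def Z_def)
  define Y0 where "Y0 u = ?Y u (\<psi>0 u)" for u
  have Y0Z: "Y0 u \<in> Z" if "u \<in> T" "norm u < \<rho>" for u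
    using YL[OF that(1)] Yd[of u "\<psi>0 u"] \<psi>0[OF that] that \<rho> by (auto simp: Z_def Y0_def)
  have Y0lip: "dist (Y0 u) (Y0 v) \<le> 2 * norm (u - v)" if "u \<in> T" "norm u < \<rho>" "v \<in> T" "norm v < \<rho>" for u v
  proof -
    have "Y0 u - Y0 v = (u - v) + (\<psi>0 u - \<psi>0 v) *\<^sub>R \<nu>" by (simp add: Y0_def algebra_simps)
    then have "dist (Y0 u) (Y0 v) \<le> norm (u - v) + \<bar>\<psi>0 u - \<psi>0 v\<bar>"
      using norm_triangle_ineq[of "u - v" "(\<psi>0 u - \<psi>0 v) *\<^sub>R \<nu>"] norm_\<nu> by (simp add: dist_norm)
    also have "\<dots> \<le> norm (u - v) + 1 * norm (u - v)"
      using lip[OF that] \<delta> by (intro add_left_mono) (meson mult_right_mono norm_ge_zero order_trans)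
    finally show ?thesis by simp
  qed
  \<comment> \<open>\<open>\<psi>1\<close> is constant along the orthogonal complement of
    \<open>T\<close>, which makes it differentiable in the full space on the open set
    \<open>O1\<close>.\<close>
  define O1 where "O1 = {v. norm (proj v) < \<rho>}"
  have O1: "open O1" unfolding O1_def by (intro open_Collect_less continuous_intros)
  define \<psi>1 where "\<psi>1 v = \<psi>0 (proj v)" for v
  define d\<psi>1 where "d\<psi>1 v = A (Y0 (proj v))" for v
  have contd: "continuous_on O1 d\<psi>1"
    unfolding d\<psi>1_def
  proof (rule continuous_on_compose2[OF contA])
    show "continuous_on O1 (\<lambda>v. Y0 (proj v))"
      unfolding continuous_on_iff
    proof (intro ballI allI impI)
      fix v and e :: real assume v: "v \<in> O1" and "0 < e"
      have "dist (Y0 (proj v')) (Y0 (proj v)) < e" if "v' \<in> O1" "dist v' v < e / 2" for v'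
      proof -
        have "dist (Y0 (proj v')) (Y0 (proj v)) \<le> 2 * norm (proj v' - proj v)"
          using v that(1) by (intro Y0lip) (auto simp: O1_def)
        also have "\<dots> \<le> 2 * norm (v' - v)" using norm_proj_le[of "v' - v"] by (simp add: linear_diff[OF linear_proj])
        finally show ?thesis using that(2) by (simp add: dist_norm)
      qed
      then show "\<exists>d>0. \<forall>x'\<in>O1. dist x' v < d \<longrightarrow> dist (Y0 (proj x')) (Y0 (proj v)) < e"
        using \<open>0 < e\<close> by (intro exI[of _ "e / 2"]) auto
    qed
  qed (use Y0Z in \<open>auto simp: O1_def\<close>)
  have deriv1: "(\<psi>1 has_derivative (\<lambda>k. d\<psi>1 v \<bullet> k)) (at v)" if v: "v \<in> O1" for v
    unfolding has_derivative_at_alt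
  proof (intro conjI allI impI)
    show "bounded_linear ((\<bullet>) (d\<psi>1 v))" by (rule bounded_linear_inner_right)
    fix e :: real assume e: "0 < e"
    have pv: "proj v \<in> T" "norm (proj v) < \<rho>" using v by (auto simp: O1_def)
    obtain d1 where d1: "0 < d1" "\<And>z. z \<in> Z \<Longrightarrow> dist z (Y0 (proj v)) < d1 \<Longrightarrow> dist (A z) (A (Y0 (proj v))) < e"
      using contA Y0Z[OF pv] e unfolding continuous_on_iff by metis
    obtain d2 where d2: "0 < d2" "ball v d2 \<subseteq> O1" using O1 v openE by blast
    show "\<exists>d>0. \<forall>y. norm (y - v) < d \<longrightarrow> norm (\<psi>1 y - \<psi>1 v - d\<psi>1 v \<bullet> (y - v)) \<le> e * norm (y - v)"
    proof (intro exI[of _ "min d2 (d1 / 2)"] conjI allI impI)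
      fix y assume y: "norm (y - v) < min d2 (d1 / 2)"
      then have "y \<in> O1" using d2(2) by (auto simp: dist_norm norm_minus_commute)
      then have py: "proj y \<in> T" "norm (proj y) < \<rho>" by (auto simp: O1_def)
      obtain \<xi> where \<xi>: "\<xi> \<in> closed_segment (Y0 (proj v)) (Y0 (proj y))" "\<xi> \<in> Z" "\<psi>0 (proj y) - \<psi>0 (proj v) = A \<xi> \<bullet> (proj y - proj v)"
        using diffA[OF py pv] by (auto simp: Y0_def)
      have np: "norm (proj y - proj v) \<le> norm (y - v)" using norm_proj_le[of "y - v"] by (simp add: linear_diff[OF linear_proj])
      have "dist \<xi> (Y0 (proj v)) \<le> dist (Y0 (proj y)) (Y0 (proj v))"
        using dist_in_closed_segment[OF \<xi>(1)] by (simp add: dist_commute)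
      also have "\<dots> \<le> 2 * norm (proj y - proj v)" by (rule Y0lip[OF py pv])
      also have "\<dots> < d1" using np y by simp
      finally have "dist (A \<xi>) (A (Y0 (proj v))) < e" by (rule d1(2)[OF \<xi>(2)])
      then have nA: "norm (A \<xi> - A (Y0 (proj v))) \<le> e" by (simp add: dist_norm)
      have "d\<psi>1 v \<bullet> (y - v) = A (Y0 (proj v)) \<bullet> (proj y - proj v)"
        using inner_span_proj[OF AT, of "Y0 (proj v)" "y - v"] by (simp add: d\<psi>1_def linear_diff[OF linear_proj])
      then have "\<psi>1 y - \<psi>1 v - d\<psi>1 v \<bullet> (y - v) = (A \<xi> - A (Y0 (proj v))) \<bullet> (proj y - proj v)"
        using \<xi>(3) by (simp add: \<psi>1_def inner_diff_left)
      also have "norm \<dots> \<le> norm (A \<xi> - A (Y0 (proj v))) * norm (proj y - proj v)"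
        using Cauchy_Schwarz_ineq2 by simp
      also have "\<dots> \<le> e * norm (y - v)" using nA np e by (intro mult_mono) auto
      finally show "norm (\<psi>1 y - \<psi>1 v - d\<psi>1 v \<bullet> (y - v)) \<le> e * norm (y - v)" .
    qed (use d1(1) d2(1) in auto)
  qed
  \<comment> \<open>The cut-off is 1 up to \<beta> and 0 from
    \<open>2 * \<beta> = \<rho> / 2\<close> on, well inside the domain of \<open>\<psi>0\<close>.
    Hence \<open>O1\<close>, where \<psi> is a product of differentiable functions, and
    \<open>O2\<close>, where it vanishes, cover everything.\<close>
  define \<beta> where "\<beta> = \<rho> / 4"
  have \<beta>: "0 < \<beta>" "2 * \<beta> < \<rho>" using \<rho> by (auto simp: \<beta>_def)
  define \<psi> where "\<psi> v = bump \<beta> (proj v) * \<psi>1 v" for v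
  define d\<psi> where "d\<psi> v = \<psi>1 v *\<^sub>R dbump \<beta> (proj v) + bump \<beta> (proj v) *\<^sub>R d\<psi>1 v" for v
  define O2 where "O2 = {v. 2 * \<beta> < norm (proj v)}"
  have O2: "open O2" unfolding O2_def by (intro open_Collect_less continuous_intros)
  have O12: "O1 \<union> O2 = UNIV" using \<beta> by (auto simp: O1_def O2_def)
  have z2: "\<psi> v = 0" "d\<psi> v = 0" if "v \<in> O2" for v
    using that bump_eq_0[OF \<beta>(1), of "proj v"] by (auto simp: O2_def \<psi>_def d\<psi>_def)
  have deriv: "(\<psi> has_derivative (\<lambda>k. d\<psi> v \<bullet> k)) (at v)" for v
  proof (cases "v \<in> O1")
    case True
    have "((\<lambda>v. bump \<beta> (proj v)) has_derivative (\<lambda>k. dbump \<beta> (proj v) \<bullet> proj k)) (at v)"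
      by (rule has_derivative_compose[OF linear_imp_has_derivative[OF linear_proj] bump_deriv])
    moreover have "dbump \<beta> (proj v) \<bullet> proj k = dbump \<beta> (proj v) \<bullet> k" for k
      by (rule inner_span_proj) (simp add: dbump_def span_scale)
    ultimately have "((\<lambda>v. bump \<beta> (proj v)) has_derivative (\<lambda>k. dbump \<beta> (proj v) \<bullet> k)) (at v)" by simp
    from has_derivative_mult[OF this deriv1[OF True]] show ?thesis
      unfolding \<psi>_def[abs_def] d\<psi>_def by (simp add: inner_add_left mult.commute add.commute)
  next
    case False
    then have v: "v \<in> O2" using O12 by blast
    have "((\<lambda>_. 0::real) has_derivative (\<lambda>k. 0)) (at v)" by simp
    then have "(\<psi> has_derivative (\<lambda>k. 0)) (at v)"
      by (rule has_derivative_transform_within_open[OF _ O2 v]) (simp add: z2)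
    then show ?thesis using z2(2)[OF v] by simp
  qed
  have "continuous_on O1 d\<psi>"
    unfolding d\<psi>_def[abs_def]
    by (intro continuous_intros contd continuous_on_compose2[OF continuous_bump[of UNIV]] continuous_on_compose2[OF continuous_dbump[of UNIV]]
        has_derivative_continuous_on[OF has_derivative_at_withinI[OF deriv1]]) auto
  moreover have "continuous_on O2 d\<psi>" using z2(2) by (simp cong: continuous_on_cong)
  ultimately have cont: "continuous_on UNIV d\<psi>" using continuous_on_open_Un[OF O1 O2] O12 by simp
  have d\<psi>T: "d\<psi> v \<in> T" for v
    unfolding d\<psi>_def by (intro span_add span_scale) (auto simp: dbump_def d\<psi>1_def AT span_scale)
  have graph: "graph M m B \<nu> \<psi> d\<psi>" by unfold_locales (rule deriv d\<psi>T cont)+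
  \<comment> \<open>\<open>2 * r = \<beta>\<close>: on the cylinder of radius \<open>2 * r\<close>
    the cut-off is 1 and \<psi> is the true solution.\<close>
  define r where "r = \<beta> / 2"
  have r: "0 < r" using \<beta> by (simp add: r_def)
  have near: "\<psi> u = \<psi>0 u" "d\<psi> u = A (Y0 u)" "norm u < \<rho>" if "u \<in> T" "norm u < 2 * r" for u
    using that bump_eq_1[OF \<beta>(1), of u] \<beta> by (auto simp: \<psi>_def d\<psi>_def \<psi>1_def d\<psi>1_def proj_span r_def)
  have A0: "A (Y0 0) = 0"
  proof -
    have "proj (g x) = 0" using c0(2) by (simp add: linear_scale[OF linear_proj] proj_\<nu>)
    then show ?thesis by (simp add: Y0_def zero A_def)
  qed
  \<comment> \<open>The gradient of \<phi> is its normal component times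
    \<open>\<nu> - d\<psi> u\<close>, by the choice of \<open>A\<close>; the normal component is
    positive, so it drops out when normalizing.\<close>
  have norm_eq: "g (x + u + \<psi> u *\<^sub>R \<nu>) /\<^sub>R norm (g (x + u + \<psi> u *\<^sub>R \<nu>)) = (\<nu> - d\<psi> u) /\<^sub>R sqrt (1 + (norm (d\<psi> u))\<^sup>2)"
    if u: "u \<in> T" "norm u < 2 * r" for u
  proof -
    note n = near[OF u]
    have y: "x + u + \<psi> u *\<^sub>R \<nu> = Y0 u" by (simp add: Y0_def n)
    have Yz: "Y0 u \<in> Z" by (rule Y0Z[OF u(1) n(3)])
    then have p: "0 < g (Y0 u) \<bullet> \<nu>" using g\<nu>0 by (auto simp: Z_def)
    have gY: "g (Y0 u) \<in> Lsp" using gL(1)[OF \<eta>(2)] Yz by (auto simp: Z_def)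
    let ?c = "g (Y0 u) \<bullet> \<nu>"
    have "g (Y0 u) = ?c *\<^sub>R (\<nu> - d\<psi> u)"
    proof -
      have "?c *\<^sub>R (\<nu> - d\<psi> u) = ?c *\<^sub>R \<nu> + (?c * (1 / ?c)) *\<^sub>R proj (g (Y0 u))"
        by (simp add: n(2) A_def scaleR_add_right)
      also have "\<dots> = proj (g (Y0 u)) + ?c *\<^sub>R \<nu>" using p by simp
      finally show ?thesis using Lsp_decomp[OF gY] by simp
    qed
    moreover have "norm (\<nu> - d\<psi> u) = sqrt (1 + (norm (d\<psi> u))\<^sup>2)"
    proof -
      have "(norm (- d\<psi> u + 1 *\<^sub>R \<nu>))\<^sup>2 = (norm (- d\<psi> u))\<^sup>2 + 1\<^sup>2" by (rule norm_add_\<nu>) (intro span_neg d\<psi>T)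
      then show ?thesis by (simp add: real_sqrt_unique add.commute)
    qed
    ultimately have "g (Y0 u) /\<^sub>R norm (g (Y0 u)) = (?c *\<^sub>R (\<nu> - d\<psi> u)) /\<^sub>R (?c * sqrt (1 + (norm (d\<psi> u))\<^sup>2))"
      using p by (metis abs_of_pos norm_scaleR)
    then show ?thesis unfolding y using p by simp
  qed
  show ?thesis
  proof (rule that[OF r h graph])
    show "\<psi> 0 = 0" "d\<psi> 0 = 0" using near[of 0] r zero A0 by (auto simp: span_zero)
    show "\<bar>\<psi> u\<bar> \<le> \<delta> * norm u" if u: "u \<in> T" for u
    proof (cases "norm u < \<rho>")
      case True
      have "\<bar>\<psi> u\<bar> = bump \<beta> u * \<bar>\<psi>0 u\<bar>" using bump_bounds(1)[of \<beta> u] by (simp add: \<psi>_def \<psi>1_def proj_span[OF u] abs_mult)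
      also have "\<dots> \<le> 1 * \<bar>\<psi>0 u\<bar>" by (intro mult_right_mono bump_bounds) auto
      also have "\<bar>\<psi>0 u\<bar> \<le> \<delta> * norm u" using lip[OF u True, of 0] zero \<rho> by (simp add: span_zero)
      finally show ?thesis by simp
    next
      case False
      then have "u \<in> O2" using \<beta> u by (simp add: O2_def proj_span)
      then show ?thesis using z2 \<delta> by simp
    qed
    show "\<bar>\<psi> u\<bar> < h" if "u \<in> T" "norm u < 2 * r" for u using near[OF that] \<psi>0 that by simp
    show "x + u + s *\<^sub>R \<nu> \<in> V \<and> (\<phi> (x + u + s *\<^sub>R \<nu>) < 0 \<longleftrightarrow> s < \<psi> u) \<and> (\<phi> (x + u + s *\<^sub>R \<nu>) = 0 \<longleftrightarrow> s = \<psi> u)"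
      if "u \<in> T" "norm u < 2 * r" "\<bar>s\<bar> < h" for u s
      using near[OF that(1,2)] side[OF that(1) _ that(3)] \<eta>(2)[OF YL[OF that(1)] Yd[of u s]] that \<rho> by auto
  qed (rule norm_eq)
qed

end

section \<open>Paravectors, slices and the kernel\<close>

lemma inner_blade: "u \<bullet> blade A = u $ A"
  by (simp add: blade_def inner_axis)

lemma blade_nth: "blade A $ C = (if A = C then 1 else 0)"
  by (simp add: blade_def axis_def eq_commute)

lemma inner_blade_blade: "blade A \<bullet> blade C = (if A = C then 1 else 0)"
  by (simp add: inner_blade blade_nth)

lemma bounded_bilinear_cl_mult: "bounded_bilinear (\<odot>)"
  using bilinear_cl_mult by (simp add: bilinear_conv_bounded_bilinear)

interpretation cl: bounded_bilinear "(\<odot>)" by (rule bounded_bilinear_cl_mult)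

lemma strict_mono_idx: "strict_mono (idx :: 'n::{finite,linorder} \<Rightarrow> nat)"
proof (rule strict_monoI)
  fix i j :: 'n assume "i < j"
  then have "{k. k \<le> i} \<subset> {k. k \<le> j}" by (auto intro: order_trans) (metis leD mem_Collect_eq order_refl)
  then show "idx i < idx j" unfolding idx_def by (intro psubset_card_mono) auto
qed

text \<open>\<open>idx\<close> is injective with values in \<open>{1..CARD('n)}\<close>, hence onto,
  so it really numbers the generators.\<close>

lemma card_idx_le:
  assumes "p \<le> CARD('n)"
  shows "card {i :: 'n::{finite,linorder}. idx i \<le> p} = p"
proof -
  have inj: "inj (idx :: 'n \<Rightarrow> nat)" by (rule strict_mono_imp_inj_on[OF strict_mono_idx])
  have "range (idx :: 'n \<Rightarrow> nat) \<subseteq> {1..CARD('n)}"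
  proof
    fix k assume "k \<in> range (idx :: 'n \<Rightarrow> nat)"
    then obtain i :: 'n where i: "k = idx i" by auto
    have "0 < card {j. j \<le> i}" by (rule card_gt_0_iff[THEN iffD2]) auto
    moreover have "card {j. j \<le> i} \<le> CARD('n)" by (rule card_mono) auto
    ultimately show "k \<in> {1..CARD('n)}" by (simp add: i idx_def)
  qed
  moreover have "card (range (idx :: 'n \<Rightarrow> nat)) = CARD('n)" by (rule card_image[OF inj])
  ultimately have rng: "range (idx :: 'n \<Rightarrow> nat) = {1..CARD('n)}" by (intro card_subset_eq) auto
  have "idx ` {i :: 'n. idx i \<le> p} = {1..p}"
  proof
    show "idx ` {i :: 'n. idx i \<le> p} \<subseteq> {1..p}" using rng by auto
    show "{1..p} \<subseteq> idx ` {i :: 'n. idx i \<le> p}"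
    proof
      fix k assume k: "k \<in> {1..p}"
      then have "k \<in> range (idx :: 'n \<Rightarrow> nat)" using rng assms by auto
      then show "k \<in> idx ` {i :: 'n. idx i \<le> p}" using k by auto
    qed
  qed
  then have "card (idx ` {i :: 'n. idx i \<le> p}) = p" by simp
  moreover have "card (idx ` {i :: 'n. idx i \<le> p}) = card {i :: 'n. idx i \<le> p}"
    by (rule card_image[OF inj_on_subset[OF inj]]) auto
  ultimately show ?thesis by simp
qed

text \<open>Symmetrizing the double sum brings in the anticommutators, which vanish off the
  diagonal; hence the factor 2 on both sides.\<close>

lemma vector_square:
  fixes a :: "'n::{finite,linorder} \<Rightarrow> real"
  shows "(\<Sum>i\<in>UNIV. a i *\<^sub>R gen i) \<odot> (\<Sum>i\<in>UNIV. a i *\<^sub>R gen i) = - (\<Sum>i\<in>UNIV. (a i)\<^sup>2) *\<^sub>R cl_one"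
proof -
  let ?v = "\<Sum>i\<in>UNIV. a i *\<^sub>R gen i"
  have e: "?v \<odot> ?v = (\<Sum>i\<in>UNIV. \<Sum>j\<in>UNIV. (a i * a j) *\<^sub>R (gen i \<odot> gen j))"
    unfolding cl.sum_left unfolding cl.sum_right by (simp add: cl.scaleR_left cl.scaleR_right mult.commute)
  also have "\<dots> = (\<Sum>i\<in>UNIV. \<Sum>j\<in>UNIV. (a i * a j) *\<^sub>R (gen j \<odot> gen i))"
    by (subst sum.swap) (simp add: mult.commute)
  finally have "?v \<odot> ?v + ?v \<odot> ?v = (\<Sum>i\<in>UNIV. \<Sum>j\<in>UNIV. (a i * a j) *\<^sub>R (gen i \<odot> gen j + gen j \<odot> gen i))"
    using e by (simp add: sum.distrib scaleR_add_right)
  also have "\<dots> = (\<Sum>i\<in>UNIV. \<Sum>j\<in>UNIV. if j = i then (- 2 * (a i)\<^sup>2) *\<^sub>R cl_one else 0)"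
    unfolding gen_relations by (intro sum.cong refl) (auto simp: power2_eq_square)
  also have "\<dots> = (2::real) *\<^sub>R (- (\<Sum>i\<in>UNIV. (a i)\<^sup>2) *\<^sub>R cl_one)"
    by (simp add: scaleR_sum_left[symmetric] sum_distrib_left[symmetric] sum_negf)
  finally have "(2::real) *\<^sub>R (?v \<odot> ?v) = (2::real) *\<^sub>R (- (\<Sum>i\<in>UNIV. (a i)\<^sup>2) *\<^sub>R cl_one)"
    by (simp only: scaleR_2)
  then show ?thesis by (rule scaleR_left_imp_eq[rotated]) simp
qed

lemma paravector_expand:
  assumes "z \<in> (paravectors :: 'n::{finite,linorder} clifford set)"
  shows "z = (z $ {}) *\<^sub>R cl_one + (\<Sum>i\<in>UNIV. (z $ {i}) *\<^sub>R gen i)"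
  using assms unfolding paravectors_def
proof (induction rule: span_induct)
  case base
  have "linear (\<lambda>z :: 'n clifford. z - ((z $ {}) *\<^sub>R cl_one + (\<Sum>i\<in>UNIV. (z $ {i}) *\<^sub>R gen i)))"
    by (rule linearI) (simp_all add: scaleR_add_left sum.distrib scaleR_diff_right scaleR_add_right scaleR_sum_right)
  then show ?case using linear_subspace_kernel by fastforce
next
  case (step z)
  then consider "z = cl_one" | i where "z = gen i" by auto
  then show ?case
    by cases (auto simp: blade_nth if_distrib[of "\<lambda>c. c *\<^sub>R _"] cong: if_cong)
qed

lemma linear_para_conj: "linear para_conj"
  unfolding para_conj_def
  by (auto intro!: linearI simp: scaleR_add_left sum.distrib scaleR_diff_right scaleR_sum_right)

lemma paravector_norm:
  assumes "z \<in> (paravectors :: 'n::{finite,linorder} clifford set)"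
  shows "(norm z)\<^sup>2 = (z $ {})\<^sup>2 + (\<Sum>i\<in>UNIV. (z $ {i})\<^sup>2)"
proof -
  have "(norm z)\<^sup>2 = z \<bullet> ((z $ {}) *\<^sub>R cl_one + (\<Sum>i\<in>UNIV. (z $ {i}) *\<^sub>R gen i))"
    unfolding power2_norm_eq_inner using paravector_expand[OF assms] by simp
  then show ?thesis by (simp add: inner_add_right inner_sum_right inner_blade power2_eq_square)
qed

text \<open>This identity makes the Clifford product with the conjugate an instance of the locale
  \<open>flux\<close>; the mirror image \<open>self_mult_conj\<close> inverts the Cauchy
  kernel.\<close>

lemma conj_mult_self:
  assumes "z \<in> (paravectors :: 'n::{finite,linorder} clifford set)"
  shows "para_conj z \<odot> z = (norm z)\<^sup>2 *\<^sub>R cl_one"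
proof -
  let ?v = "\<Sum>i\<in>UNIV. (z $ {i}) *\<^sub>R gen i"
  have "para_conj z \<odot> z = ((z $ {}) *\<^sub>R cl_one - ?v) \<odot> ((z $ {}) *\<^sub>R cl_one + ?v)"
    using paravector_expand[OF assms] by (simp add: para_conj_def)
  also have "\<dots> = (z $ {})\<^sup>2 *\<^sub>R cl_one - ?v \<odot> ?v"
    by (simp add: cl.diff_left cl.add_right cl.scaleR_left cl.scaleR_right cl_one_mult mult_cl_one power2_eq_square scaleR_diff_right scaleR_add_right)
  also have "\<dots> = (norm z)\<^sup>2 *\<^sub>R cl_one"
    unfolding vector_square paravector_norm[OF assms] by (simp add: scaleR_add_left)
  finally show ?thesis .
qed

lemma self_mult_conj:
  assumes "z \<in> (paravectors :: 'n::{finite,linorder} clifford set)"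
  shows "z \<odot> para_conj z = (norm z)\<^sup>2 *\<^sub>R cl_one"
proof -
  let ?v = "\<Sum>i\<in>UNIV. (z $ {i}) *\<^sub>R gen i"
  have "z \<odot> para_conj z = ((z $ {}) *\<^sub>R cl_one + ?v) \<odot> ((z $ {}) *\<^sub>R cl_one - ?v)"
    using paravector_expand[OF assms] by (simp add: para_conj_def)
  also have "\<dots> = (z $ {})\<^sup>2 *\<^sub>R cl_one - ?v \<odot> ?v"
    by (simp add: cl.diff_right cl.add_left cl.scaleR_left cl.scaleR_right cl_one_mult mult_cl_one power2_eq_square scaleR_diff_right scaleR_add_right)
  also have "\<dots> = (norm z)\<^sup>2 *\<^sub>R cl_one"
    unfolding vector_square paravector_norm[OF assms] by (simp add: scaleR_add_left)
  finally show ?thesis .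
qed

lemma Rp1_paravectors: "Rp1 p \<subseteq> paravectors" and Rq_paravectors: "Rq p \<subseteq> paravectors"
  unfolding Rp1_def Rq_def paravectors_def by (intro span_mono; auto)+

definition base_p :: "nat \<Rightarrow> 'n::{finite,linorder} clifford set" where
  "base_p p = insert cl_one (gen ` {i. idx i \<le> p})"

lemma blade_inject: "blade A = blade C \<longleftrightarrow> A = C"
  using inner_blade_blade[of A C] inner_blade_blade[of C C] by (metis zero_neq_one)

lemma orthonormal_base_p: "orthonormal_set (base_p p :: 'n::{finite,linorder} clifford set)"
proof
  show "finite (base_p p :: 'n clifford set)" by (simp add: base_p_def)
  fix b c :: "'n clifford" assume "b \<in> base_p p" "c \<in> base_p p"
  then obtain A C where "b = blade A" "c = blade C" by (auto simp: base_p_def)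
  then show "b \<bullet> c = (if b = c then 1 else 0)" by (simp add: inner_blade_blade blade_inject)
qed

lemma card_base_p:
  assumes "p \<le> CARD('n)"
  shows "card (base_p p :: 'n::{finite,linorder} clifford set) = p + 1"
proof -
  have "card (gen ` {i :: 'n. idx i \<le> p}) = p"
    using card_idx_le[OF assms] by (subst card_image) (auto simp: inj_on_def blade_inject)
  moreover have "cl_one \<notin> gen ` {i :: 'n. idx i \<le> p}" by (auto simp: blade_inject)
  ultimately show ?thesis by (simp add: base_p_def)
qed

lemma linear_p_part: "linear (p_part p)" and linear_q_part: "linear (q_part p)"
  unfolding p_part_def q_part_def
  by (auto intro!: linearI simp: scaleR_add_left sum.distrib scaleR_add_right scaleR_sum_right)

lemma p_part_gen: "p_part p (gen i) = (if idx i \<le> p then gen i else 0)"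
  and q_part_gen: "q_part p (gen i) = (if p < idx i then gen i else 0)"
  by (auto simp: p_part_def q_part_def blade_nth if_distrib[of "\<lambda>c. c *\<^sub>R _"] cong: if_cong)

lemma p_part_one: "p_part p cl_one = cl_one" and q_part_one: "q_part p cl_one = 0"
  by (simp_all add: p_part_def q_part_def blade_nth)

lemma p_part_Rp1: "x \<in> Rp1 p \<Longrightarrow> p_part p x = x"
  by (rule linear_eq_on[OF linear_p_part linear_ident, of _ "insert cl_one (gen ` {i. idx i \<le> p})"])
    (auto simp: Rp1_def p_part_gen p_part_one)

lemma q_part_Rp1: "x \<in> Rp1 p \<Longrightarrow> q_part p x = 0"
  by (rule linear_eq_on[OF linear_q_part linear_zero, of _ "insert cl_one (gen ` {i. idx i \<le> p})"])
    (auto simp: Rp1_def q_part_gen q_part_one)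

lemma p_part_Rq: "x \<in> Rq p \<Longrightarrow> p_part p x = 0"
  by (rule linear_eq_on[OF linear_p_part linear_zero, of _ "gen ` {i. p < idx i}"]) (auto simp: Rq_def p_part_gen)

lemma q_part_Rq: "x \<in> Rq p \<Longrightarrow> q_part p x = x"
  by (rule linear_eq_on[OF linear_q_part linear_ident, of _ "gen ` {i. p < idx i}"]) (auto simp: Rq_def q_part_gen)

lemma Rp1_inner_Rq: "x \<in> Rp1 p \<Longrightarrow> w \<in> Rq p \<Longrightarrow> x \<bullet> w = 0"
proof -
  assume x: "x \<in> Rp1 p" and w: "w \<in> Rq p"
  have o: "orthogonal x (gen j)" if "p < idx j" for j
  proof -
    have "orthogonal (gen j) x"
      by (rule orthogonal_to_span[OF x[unfolded Rp1_def]])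
        (use that in \<open>auto simp: orthogonal_def inner_blade_blade\<close>)
    then show ?thesis by (simp add: orthogonal_commute)
  qed
  have "orthogonal x w"
    by (rule orthogonal_to_span[OF w[unfolded Rq_def]]) (use o in auto)
  then show ?thesis by (simp add: orthogonal_def)
qed

text \<open>The sphere is defined algebraically by \<open>w \<odot> w = - cl_one\<close>;
  \<open>vector_square\<close> translates this into unit length.\<close>

lemma unit_sphere_norm:
  assumes "w \<in> (unit_sphere p :: 'n::{finite,linorder} clifford set)"
  shows "norm w = 1" "w \<in> Rq p" "w \<odot> w = - cl_one"
proof -
  show w: "w \<in> Rq p" "w \<odot> w = - cl_one" using assms by (auto simp: unit_sphere_def)
  have para: "w \<in> paravectors" using w(1) Rq_paravectors by blast
  have "p_part p w = 0" by (rule p_part_Rq[OF w(1)])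
  then have "p_part p w $ {} = 0" by simp
  then have w0: "w $ {} = 0" by (simp add: p_part_def blade_nth)
  have "w = (\<Sum>i\<in>UNIV. (w $ {i}) *\<^sub>R gen i)" using paravector_expand[OF para] w0 by simp
  then have "w \<odot> w = - (\<Sum>i\<in>UNIV. (w $ {i})\<^sup>2) *\<^sub>R cl_one" using vector_square[of "\<lambda>i. w $ {i}"] by simp
  also have "(\<Sum>i\<in>UNIV. (w $ {i})\<^sup>2) = (norm w)\<^sup>2" using paravector_norm[OF para] w0 by simp
  finally have "- (norm w)\<^sup>2 *\<^sub>R cl_one = - (1::real) *\<^sub>R (cl_one :: 'n clifford)" using w(2) by simp
  moreover have "(cl_one :: 'n clifford) \<noteq> 0" using inner_blade_blade[of "{} :: 'n set" "{}"] by force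
  ultimately have "(norm w)\<^sup>2 = 1" by (simp only: scaleR_cancel_right simp_thms neg_equal_iff_equal)
  then show "norm w = 1" using norm_ge_zero[of w] by (simp add: power2_eq_1_iff)
qed

context
  fixes p :: nat and \<eta> :: "'n::{finite,linorder} clifford"
  assumes \<eta>: "\<eta> \<in> unit_sphere p" and p_le: "p \<le> CARD('n)"
begin

lemma slice_parts:
  assumes "xp \<in> Rp1 p"
  shows "p_part p (xp + r *\<^sub>R \<eta>) = xp" "q_part p (xp + r *\<^sub>R \<eta>) = r *\<^sub>R \<eta>"
  using assms unit_sphere_norm(2)[OF \<eta>]
  by (simp_all add: linear_add[OF linear_p_part] linear_add[OF linear_q_part] linear_scale[OF linear_p_part]
      linear_scale[OF linear_q_part] p_part_Rp1 q_part_Rp1 p_part_Rq q_part_Rq)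

lemma slice_space_eq_span: "slice_space p \<eta> = span (insert \<eta> (base_p p))"
proof -
  have "Rp1 p = span (base_p p)" by (simp add: Rp1_def base_p_def)
  then have "slice_space p \<eta> = {x + y |x y. x \<in> span (base_p p) \<and> y \<in> span {\<eta>}}"
    by (auto simp: slice_space_def span_singleton)
  also have "\<dots> = span (base_p p \<union> {\<eta>})" by (rule span_Un[symmetric])
  finally show ?thesis by simp
qed

lemma subspace_slice: "subspace (slice_space p \<eta>)"
  unfolding slice_space_eq_span by (rule subspace_span)

lemma orthonormal_slice: "orthonormal_set (insert \<eta> (base_p p))"
  and dim_slice: "dim (slice_space p \<eta>) = p + 2"
proof -
  interpret b: orthonormal_set "base_p p :: 'n clifford set" by (rule orthonormal_base_p)
  have eb: "b \<bullet> \<eta> = 0" if "b \<in> base_p p" for b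
    by (rule Rp1_inner_Rq[OF _ unit_sphere_norm(2)[OF \<eta>]]) (use that in \<open>auto simp: Rp1_def base_p_def intro: span_base\<close>)
  have eb': "\<eta> \<bullet> b = 0" if "b \<in> base_p p" for b using eb[OF that] by (simp add: inner_commute)
  have ee: "\<eta> \<bullet> \<eta> = 1" using unit_sphere_norm(1)[OF \<eta>] by (simp add: norm_eq_1)
  have nb: "\<eta> \<notin> base_p p" using eb ee by force
  show o: "orthonormal_set (insert \<eta> (base_p p))"
    by standard (use b.finite_B b.inner_B eb eb' ee nb in \<open>auto\<close>)
  interpret c: orthonormal_set "insert \<eta> (base_p p)" by (rule o)
  have "independent (insert \<eta> (base_p p))"
    by (rule pairwise_orthogonal_independent) (use c.inner_B c.norm_B in \<open>force simp: pairwise_def orthogonal_def\<close>)+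
  then have "dim (span (insert \<eta> (base_p p))) = card (insert \<eta> (base_p p))" by (rule dim_span_eq_card_independent)
  also have "\<dots> = p + 2" using nb b.finite_B card_base_p[OF p_le] by simp
  finally show "dim (slice_space p \<eta>) = p + 2" unfolding slice_space_eq_span .
qed

lemma slice_paravectors: "slice_space p \<eta> \<subseteq> paravectors"
proof -
  have "subspace (paravectors :: 'n clifford set)" unfolding paravectors_def by (rule subspace_span)
  moreover have "Rp1 p \<subseteq> paravectors" "\<eta> \<in> paravectors"
    using Rp1_paravectors unit_sphere_norm(2)[OF \<eta>] Rq_paravectors by blast+
  ultimately show ?thesis by (auto simp: slice_space_def subspace_add subspace_scale subset_iff)
qed

text \<open>Off the axis the direction of \<open>t\<close> is \<eta> or \<open>- \<eta>\<close>, so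
  of the two coefficients one is 1 and the other 0, and the surviving kernel is evaluated at
  \<open>t\<close> itself.\<close>

lemma slice_kernel_eq:
  assumes t: "t \<in> slice_space p \<eta>"
  shows "slice_kernel p \<eta> y t = cauchy_kernel p (y - t)"
proof -
  obtain xp r where t: "t = xp + r *\<^sub>R \<eta>" "xp \<in> Rp1 p" using assms by (auto simp: slice_space_def)
  have parts: "p_part p t = xp" "q_part p t = r *\<^sub>R \<eta>" unfolding t(1) by (rule slice_parts[OF t(2)])+
  have n: "norm (q_part p t) = \<bar>r\<bar>" using unit_sphere_norm(1)[OF \<eta>] by (simp add: parts)
  have \<eta>0: "\<eta> \<noteq> 0" using unit_sphere_norm(1)[OF \<eta>] by auto
  have ee: "\<eta> \<odot> \<eta> = - cl_one" by (rule unit_sphere_norm(3)[OF \<eta>])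
  have half: "(1/2) *\<^sub>R (a + a) = a" for a :: "'n clifford" by (simp add: scaleR_2[symmetric])
  have w: "(1/2) *\<^sub>R (cl_one - \<eta> \<odot> \<eta>) = cl_one" "cl_one + \<eta> \<odot> \<eta> = 0"
    "cl_one - (- \<eta>) \<odot> \<eta> = 0" "(1/2) *\<^sub>R (cl_one + (- \<eta>) \<odot> \<eta>) = cl_one"
    unfolding cl.minus_left ee by (simp_all only: diff_minus_eq_add half minus_minus add.right_inverse diff_self)
  consider "0 < r" | "r < 0" | "r = 0" by linarith
  then show ?thesis
  proof cases
    case 1
    then have "q_dir p t = \<eta>" using \<eta>0 by (simp add: q_dir_def parts unit_sphere_norm(1)[OF \<eta>])
    then have "slice_kernel p \<eta> y t = cauchy_kernel p (y - (xp + r *\<^sub>R \<eta>))"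
      using 1 unfolding slice_kernel_def Let_def parts(1) n
      by (simp only: w scaleR_zero_right cl.zero_left cl_one_mult abs_of_pos add_0_right)
    then show ?thesis by (simp add: t(1))
  next
    case 2
    then have "q_dir p t = - \<eta>" using \<eta>0 by (simp add: q_dir_def parts unit_sphere_norm(1)[OF \<eta>] divide_inverse)
    then have "slice_kernel p \<eta> y t = cauchy_kernel p (y - (xp - \<bar>r\<bar> *\<^sub>R \<eta>))"
      unfolding slice_kernel_def Let_def parts(1) n
      by (simp only: w scaleR_zero_right cl.zero_left cl_one_mult add_0_left)
    then show ?thesis using 2 by (simp add: t(1))
  next
    \<comment> \<open>On the axis both kernels coincide and the coefficients add up to 1, whatever
      direction \<open>q_dir\<close> chooses.\<close>
    case 3
    let ?w = "q_dir p t"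
    have "slice_kernel p \<eta> y t = ((1/2) *\<^sub>R (cl_one - ?w \<odot> \<eta>) + (1/2) *\<^sub>R (cl_one + ?w \<odot> \<eta>)) \<odot> cauchy_kernel p (y - xp)"
      using 3 n parts by (simp add: slice_kernel_def Let_def cl.add_left)
    also have "(1/2) *\<^sub>R (cl_one - ?w \<odot> \<eta>) + (1/2) *\<^sub>R (cl_one + ?w \<odot> \<eta>) = cl_one"
      by (simp add: scaleR_add_right[symmetric] scaleR_2[symmetric])
    finally show ?thesis using 3 t(1) by (simp add: cl_one_mult)
  qed
qed

text \<open>The parity of the stem function makes one formula with fixed \<eta> valid for both signs
  of \<open>r\<close>. For \<open>r = 0\<close> oddness forces the second component to vanish, so
  the arbitrary direction of \<open>q_dir\<close> has no influence.\<close>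

lemma slice_function:
  assumes D: "reflection_invariant D" "stem_function D F" and y: "y = xp + r *\<^sub>R \<eta>" "xp \<in> Rp1 p"
    and DR: "D \<subseteq> Rp1 p \<times> UNIV" and mem: "y \<in> sym_completion p D"
  shows "(xp, r) \<in> D" "induced p F y = fst (F (xp, r)) + \<eta> \<odot> snd (F (xp, r))"
proof -
  have parts: "p_part p y = xp" "q_part p y = r *\<^sub>R \<eta>" unfolding y(1) by (rule slice_parts[OF y(2)])+
  have n: "norm (q_part p y) = \<bar>r\<bar>" using unit_sphere_norm(1)[OF \<eta>] by (simp add: parts)
  obtain xp' r' w where z: "y = xp' + r' *\<^sub>R w" "w \<in> unit_sphere p" "0 \<le> r'" "(xp', r') \<in> D"
    using mem by (auto simp: sym_completion_def)
  have xp': "xp' \<in> Rp1 p" using z(4) DR by blast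
  have "p_part p y = xp'" "q_part p y = r' *\<^sub>R w"
    using xp' unit_sphere_norm(2)[OF z(2)] unfolding z(1)
    by (simp_all add: linear_add[OF linear_p_part] linear_add[OF linear_q_part] linear_scale[OF linear_p_part]
      linear_scale[OF linear_q_part] p_part_Rp1 q_part_Rp1 p_part_Rq q_part_Rq)
  then have "xp' = xp" "r' = \<bar>r\<bar>" using parts n z(3) unit_sphere_norm(1)[OF z(2)] by auto
  then have mem': "(xp, \<bar>r\<bar>) \<in> D" using z(4) by simp
  then have "(xp, - \<bar>r\<bar>) \<in> D" using D(1) by (force simp: reflection_invariant_def)
  then show mem2: "(xp, r) \<in> D" using mem' by (cases "0 \<le> r") auto
  have stem: "fst (F (xp, - r)) = fst (F (xp, r))" "snd (F (xp, - r)) = - snd (F (xp, r))"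
    using D(2) mem2 by (auto simp: stem_function_def)
  have \<eta>0: "\<eta> \<noteq> 0" using unit_sphere_norm(1)[OF \<eta>] by auto
  have ind: "induced p F y = fst (F (xp, \<bar>r\<bar>)) + q_dir p y \<odot> snd (F (xp, \<bar>r\<bar>))"
    by (simp only: induced_def parts(1) n)
  consider "0 < r" | "r < 0" | "r = 0" by linarith
  then show "induced p F y = fst (F (xp, r)) + \<eta> \<odot> snd (F (xp, r))"
  proof cases
    case 1
    then have "q_dir p y = \<eta>" using \<eta>0 by (simp add: q_dir_def parts unit_sphere_norm(1)[OF \<eta>])
    then show ?thesis using 1 ind by simp
  next
    case 2
    then have "q_dir p y = - \<eta>" using \<eta>0 by (simp add: q_dir_def parts unit_sphere_norm(1)[OF \<eta>] divide_inverse)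
    then show ?thesis using 2 ind stem by (simp add: cl.minus_left cl.minus_right)
  next
    case 3
    then have "snd (F (xp, r)) = - snd (F (xp, r))" using stem(2) by simp
    then have "2 *\<^sub>R snd (F (xp, r)) = 0" by (metis add.right_inverse scaleR_2)
    then have "snd (F (xp, r)) = 0" by simp
    then show ?thesis using 3 ind by (simp add: cl.zero_right)
  qed
qed

text \<open>By orthogonality of \<open>Rp1 p\<close> and \<eta> the map from \<open>(xp, r)\<close>
  to \<open>xp + r *\<^sub>R \<eta>\<close> is isometric, so the exponent is kept and only the
  constant changes.\<close>

lemma slice_function_hoelder:
  assumes D: "reflection_invariant D" "stem_function D F" "D \<subseteq> Rp1 p \<times> UNIV" and F: "hoelder_continuous_on D F"
    and f: "\<And>y. y \<in> sym_completion p D \<Longrightarrow> f y = induced p F y"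
  obtains \<alpha> C where "0 < \<alpha>" "\<alpha> \<le> 1" "0 \<le> C"
    "\<And>y y'. y \<in> slice p \<eta> (sym_completion p D) \<Longrightarrow> y' \<in> slice p \<eta> (sym_completion p D) \<Longrightarrow>
      norm (f y - f y') \<le> C * norm (y - y') powr \<alpha>"
proof -
  obtain \<alpha> C where F: "0 < \<alpha>" "\<alpha> \<le> 1" "\<And>x y. x \<in> D \<Longrightarrow> y \<in> D \<Longrightarrow> dist (F x) (F y) \<le> C * dist x y powr \<alpha>"
    using F by (auto simp: hoelder_continuous_on_def)
  obtain K where K: "0 < K" "\<And>a b :: 'n clifford. norm (a \<odot> b) \<le> norm a * norm b * K"
    using cl.pos_bounded by blast
  have "norm (f y - f y') \<le> ((1 + K) * \<bar>C\<bar>) * norm (y - y') powr \<alpha>"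
    if y: "y \<in> slice p \<eta> (sym_completion p D)" and y': "y' \<in> slice p \<eta> (sym_completion p D)" for y y'
  proof -
    obtain xp r where 1: "y = xp + r *\<^sub>R \<eta>" "xp \<in> Rp1 p" "y \<in> sym_completion p D"
      using y by (auto simp: slice_def slice_space_def)
    obtain xp' r' where 2: "y' = xp' + r' *\<^sub>R \<eta>" "xp' \<in> Rp1 p" "y' \<in> sym_completion p D"
      using y' by (auto simp: slice_def slice_space_def)
    note a = slice_function[OF D(1,2) 1(1,2) D(3) 1(3)] and b = slice_function[OF D(1,2) 2(1,2) D(3) 2(3)]
    have "dist (xp, r) (xp', r') = norm (y - y')"
    proof -
      have e: "y - y' = (xp - xp') + (r - r') *\<^sub>R \<eta>" by (simp add: 1 2 algebra_simps)
      have "xp - xp' \<in> Rp1 p" using 1(2) 2(2) unfolding Rp1_def by (rule span_diff)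
      then have "(xp - xp') \<bullet> \<eta> = 0" by (rule Rp1_inner_Rq[OF _ unit_sphere_norm(2)[OF \<eta>]])
      moreover from this have "\<eta> \<bullet> (xp - xp') = 0" by (simp only: inner_commute)
      moreover have "\<eta> \<bullet> \<eta> = 1" using unit_sphere_norm(1)[OF \<eta>] by (simp add: norm_eq_1)
      ultimately have "(norm (y - y'))\<^sup>2 = (norm (xp - xp'))\<^sup>2 + (r - r')\<^sup>2"
        unfolding e power2_norm_eq_inner inner_add_left inner_add_right inner_scaleR_left inner_scaleR_right
        by (simp add: power2_eq_square)
      then show ?thesis by (simp add: dist_Pair_Pair dist_norm norm_Pair real_sqrt_unique)
    qed
    then have dF: "dist (F (xp, r)) (F (xp', r')) \<le> \<bar>C\<bar> * norm (y - y') powr \<alpha>"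
      using F(3)[OF a(1) b(1)] by (smt (verit) abs_ge_self mult_right_mono powr_ge_zero)
    have "f y - f y' = (fst (F (xp, r)) - fst (F (xp', r'))) + \<eta> \<odot> (snd (F (xp, r)) - snd (F (xp', r')))"
      using f[OF 1(3)] f[OF 2(3)] a(2) b(2) by (simp add: cl.diff_right algebra_simps)
    also have "norm \<dots> \<le> norm (fst (F (xp, r)) - fst (F (xp', r'))) + norm (\<eta> \<odot> (snd (F (xp, r)) - snd (F (xp', r'))))"
      by (rule norm_triangle_ineq)
    also have "\<dots> \<le> dist (F (xp, r)) (F (xp', r')) + dist (F (xp, r)) (F (xp', r')) * K"
    proof (rule add_mono)
      show "norm (fst (F (xp, r)) - fst (F (xp', r'))) \<le> dist (F (xp, r)) (F (xp', r'))"
        using dist_fst_le[of "F (xp, r)" "F (xp', r')"] by (simp add: dist_norm)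
      have "norm (\<eta> \<odot> (snd (F (xp, r)) - snd (F (xp', r')))) \<le> norm \<eta> * norm (snd (F (xp, r)) - snd (F (xp', r'))) * K"
        by (rule K(2))
      also have "\<dots> \<le> dist (F (xp, r)) (F (xp', r')) * K"
        using dist_snd_le[of "F (xp, r)" "F (xp', r')"] unit_sphere_norm(1)[OF \<eta>] K(1)
        by (simp add: dist_norm mult_right_mono)
      finally show "norm (\<eta> \<odot> (snd (F (xp, r)) - snd (F (xp', r')))) \<le> dist (F (xp, r)) (F (xp', r')) * K" .
    qed
    also have "\<dots> = (1 + K) * dist (F (xp, r)) (F (xp', r'))" by (simp add: algebra_simps)
    also have "\<dots> \<le> (1 + K) * (\<bar>C\<bar> * norm (y - y') powr \<alpha>)" using dF K(1) by (intro mult_left_mono) auto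
    finally show ?thesis by simp
  qed
  then show ?thesis using F(1,2) K(1) by (intro that[of \<alpha> "(1 + K) * \<bar>C\<bar>"]) auto
qed

end

section \<open>The surface measure\<close>

lemma unit_cube_eq: "unit_cube p = (span_cube (base_p p) :: 'n::{finite,linorder} clifford set)"
proof
  have sp: "Rp1 p = span (base_p p :: 'n clifford set)" by (simp add: Rp1_def base_p_def)
  show "unit_cube p \<subseteq> (span_cube (base_p p) :: 'n clifford set)"
    unfolding unit_cube_def span_cube_def sp by (auto simp: base_p_def inner_blade)
  show "(span_cube (base_p p) :: 'n clifford set) \<subseteq> unit_cube p"
  proof
    fix x :: "'n clifford" assume x: "x \<in> span_cube (base_p p)"
    have "0 \<le> x $ A \<and> x $ A \<le> 1" for A
    proof (cases "blade A \<in> base_p p")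
      case True
      then show ?thesis using x by (force simp: span_cube_def inner_blade)
    next
      case False
      have "orthogonal (blade A) x"
      proof (rule orthogonal_to_span[where S = "base_p p :: 'n clifford set"])
        show "x \<in> span (base_p p)" using x by (simp add: span_cube_def)
        fix y :: "'n clifford" assume y: "y \<in> base_p p"
        then obtain C where C: "y = blade C" by (auto simp: base_p_def)
        then show "orthogonal (blade A) y" using y False by (auto simp: orthogonal_def inner_blade_blade)
      qed
      then have "x $ A = 0" by (simp add: orthogonal_def inner_commute inner_blade)
      then show ?thesis by simp
    qed
    then show "x \<in> unit_cube p" using x by (auto simp: unit_cube_def span_cube_def sp)
  qed
qed

text \<open>Positivity and finiteness of the measure of the unit cube make the normalization
  meaningful. Every orthonormal set of \<open>p + 1\<close> vectors gives the same constant, which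
  therefore cancels.\<close>

lemma area_measure_surface_measure:
  assumes p: "p \<le> CARD('n::{finite,linorder})"
  shows "area_measure (surface_measure p :: 'n clifford measure) (p + 1)"
proof -
  let ?c = "hausdorff_outer (p + 1) (unit_cube p :: 'n clifford set)"
  let ?H = "hausdorff_outer (p + 1) :: 'n clifford set \<Rightarrow> ennreal"
  interpret b: orthonormal_set "base_p p :: 'n clifford set" by (rule orthonormal_base_p)
  note cb = card_base_p[OF p]
  have c: "0 < ?c" "?c < \<infinity>"
    using b.hausdorff_span_cube_positive b.hausdorff_span_cube_finite by (simp_all add: cb unit_cube_eq)
  have ms: "measure_space UNIV (sets borel) ?H" by (rule hausdorff_measure_space) simp
  then have ms': "measure_space UNIV (sets borel) (\<lambda>A. ?H A / ?c)"
    by (auto simp: measure_space_def positive_def countably_additive_def divide_ennreal_def)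
  have sM: "sets (surface_measure p :: 'n clifford measure) = sets borel"
    using sets.sigma_sets_eq[of "borel :: 'n clifford measure"] by (simp add: surface_measure_def)
  have eM: "emeasure (surface_measure p) A = ?H A / ?c" if "A \<in> sets borel" for A
    unfolding surface_measure_def using ms' that
    by (intro emeasure_measure_of_sigma) (auto simp: measure_space_def)
  show ?thesis
  proof
    show "sets (surface_measure p :: 'n clifford measure) = sets borel" by (rule sM)
    fix A :: "'n clifford set" and f :: "'n clifford \<Rightarrow> 'n clifford" and K :: real
    assume A: "A \<in> sets borel" "f ` A \<in> sets borel" "0 < K" "\<And>x y. x \<in> A \<Longrightarrow> y \<in> A \<Longrightarrow> dist (f x) (f y) \<le> K * dist x y"
    have "?H (f ` A) \<le> ennreal (K ^ (p + 1)) * ?H A" using A(3,4) by (rule hausdorff_outer_Lipschitz)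
    then have "?H (f ` A) / ?c \<le> (ennreal (K ^ (p + 1)) * ?H A) / ?c" by (rule divide_right_mono_ennreal)
    then show "emeasure (surface_measure p) (f ` A) \<le> ennreal (K ^ (p + 1)) * emeasure (surface_measure p) A"
      using A by (simp add: eM ennreal_times_divide)
  next
    fix B :: "'n clifford set" and A :: "'n clifford set" assume B: "orthonormal_set B" "card B = p + 1" and A: "A \<in> sets borel"
    interpret B: orthonormal_set B by (rule B)
    have "?H (span_cube B) = ?c"
      using b.hausdorff_span_cube_le[OF B(1)] B.hausdorff_span_cube_le[OF orthonormal_base_p, of p] B(2) cb
      by (intro antisym) (simp_all add: unit_cube_eq)
    then have "?H (A \<inter> span B) = ?c * emeasure (flat_measure B) A"
      using B.hausdorff_Int_span[of A] A B(2) by simp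
    then have "emeasure (surface_measure p) (A \<inter> span B) = ?c * emeasure (flat_measure B) A / ?c"
      using A B.sets_span_B by (simp add: eM sets.Int)
    also have "\<dots> = emeasure (flat_measure B) A"
      using c by (metis ennreal_mult_divide_eq infinity_ennreal_def less_irrefl mult.commute)
    finally show "emeasure (surface_measure p) (A \<inter> span B) = emeasure (flat_measure B) A" .
  qed simp
qed

section \<open>Boundary values\<close>

lemma borel_measurable_bilinear:
  fixes Q :: "'a::euclidean_space \<Rightarrow> 'b::euclidean_space \<Rightarrow> 'c::euclidean_space"
  assumes Q: "bounded_bilinear Q" and f: "f \<in> borel_measurable N" "g \<in> borel_measurable N"
  shows "(\<lambda>x. Q (f x) (g x)) \<in> borel_measurable N"
proof -
  have "continuous_on UNIV (\<lambda>z. Q (fst z) (snd z))"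
    by (intro bounded_bilinear.continuous_on[OF Q] continuous_intros)
  from borel_measurable_continuous_Pair[OF f this] show ?thesis .
qed

context flux_origin
begin

context
  fixes Q :: "'b \<Rightarrow> 'c::euclidean_space \<Rightarrow> 'd::euclidean_space" and \<phi> :: "'a \<Rightarrow> 'c" and \<phi>0 :: 'c
    and C \<alpha> \<kappa> :: real and q :: "nat \<Rightarrow> 'a \<Rightarrow> real" and \<tau> :: "nat \<Rightarrow> 'a"
  assumes Q: "bounded_bilinear Q" and \<phi>_meas: "\<phi> \<in> borel_measurable borel"
    and \<alpha>: "0 < \<alpha>" "\<alpha> \<le> 1" and C: "0 \<le> C"
    and \<phi>: "\<And>u. u \<in> T \<Longrightarrow> norm u < 2 * r \<Longrightarrow> norm (\<phi> u - \<phi>0) \<le> C * norm u powr \<alpha>"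
    and q_meas: "\<And>n. q n \<in> borel_measurable borel"
    and q: "\<And>n u. \<bar>q n u\<bar> \<le> indicator (ball 0 (2 * r)) u"
    and q_lim: "\<And>u. u \<in> T \<Longrightarrow> u \<noteq> 0 \<Longrightarrow> (\<lambda>n. q n u) \<longlonglongrightarrow> indicator (ball 0 (2 * r)) u"
    and \<tau>: "\<tau> \<longlonglongrightarrow> 0" and \<kappa>: "0 < \<kappa>" "\<And>n u. u \<in> T \<Longrightarrow> \<kappa> * norm u \<le> norm (u + \<psi> u *\<^sub>R \<nu> - \<tau> n)"
begin

interpretation Q: bounded_bilinear Q by (rule Q)

text \<open>The factor \<open>\<phi> u - \<phi>0\<close> gains \<open>norm u powr \<alpha>\<close>
  over the critical order of the kernel, so dominated convergence applies. Cut-offs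
  \<open>q n\<close> and poles \<open>\<tau> n\<close> are general: \<open>\<tau> n = 0\<close> with
  shrinking excisions gives the principal value, constant \<open>q n\<close> with moving poles the
  non-tangential limit.\<close>

lemma hoelder_difference:
  shows "\<And>n. integrable lam (\<lambda>u. q n u *\<^sub>R Q (kern (\<tau> n) u) (\<phi> u - \<phi>0))"
    and "integrable lam (\<lambda>u. indicator (ball 0 (2 * r)) u *\<^sub>R Q (kern 0 u) (\<phi> u - \<phi>0))"
    and "(\<lambda>n. \<integral>u. q n u *\<^sub>R Q (kern (\<tau> n) u) (\<phi> u - \<phi>0) \<partial>lam)
      \<longlonglongrightarrow> (\<integral>u. indicator (ball 0 (2 * r)) u *\<^sub>R Q (kern 0 u) (\<phi> u - \<phi>0) \<partial>lam)"
proof -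
  obtain K where K: "0 < K" "\<And>a b. norm (Q a b) \<le> norm a * norm b * K" using Q.pos_bounded by blast
  define B1 where "B1 = (P_bound * D_bound / \<kappa> ^ m) * C * K"
  let ?w = "\<lambda>u. B1 * (indicator (cball 0 (2 * r)) u * norm u powr (\<alpha> - real m))"
  have w: "integrable lam ?w"
    using r_pos by (intro integrable_mult_right integrable_norm_powr \<alpha>) auto
  have zero: "\<phi> 0 - \<phi>0 = 0" using \<phi>[of 0] r_pos by (simp add: span_zero)
  have bound: "norm (q n u *\<^sub>R Q (kern (\<tau> n) u) (\<phi> u - \<phi>0)) \<le> ?w u" if u: "u \<in> T" for n u
  proof (cases "norm u < 2 * r \<and> u \<noteq> 0")
    case False
    then have "q n u = 0 \<or> \<phi> u - \<phi>0 = 0" using q[of n u] zero by (auto simp: indicator_def)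
    moreover have "0 \<le> ?w u" using P_bound(1) D_bound_nonneg \<kappa>(1) C K(1) by (simp add: B1_def)
    ultimately show ?thesis by (auto simp: Q.zero_right)
  next
    case True
    then have nu: "0 < norm u" "norm u < 2 * r" by auto
    have k: "norm (kern (\<tau> n) u) \<le> P_bound * D_bound / (\<kappa> * norm u) ^ m"
      by (rule norm_kern_le) (use nu \<kappa> u in auto)
    have "norm (q n u *\<^sub>R Q (kern (\<tau> n) u) (\<phi> u - \<phi>0)) \<le> 1 * norm (Q (kern (\<tau> n) u) (\<phi> u - \<phi>0))"
      unfolding norm_scaleR using q[of n u] nu(2) by (intro mult_right_mono) (auto simp: indicator_def)
    also have "\<dots> \<le> norm (kern (\<tau> n) u) * norm (\<phi> u - \<phi>0) * K" using K(2) by simp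
    also have "\<dots> \<le> (P_bound * D_bound / (\<kappa> * norm u) ^ m) * (C * norm u powr \<alpha>) * K"
      using k \<phi>[OF u nu(2)] K(1) P_bound(1) D_bound_nonneg \<kappa>(1)
      by (intro mult_right_mono mult_mono) auto
    also have "\<dots> = B1 * (norm u powr \<alpha> / norm u ^ m)" by (simp add: B1_def power_mult_distrib)
    also have "\<dots> = ?w u" using nu by (simp add: powr_diff powr_realpow)
    finally show ?thesis .
  qed
  have meas: "(\<lambda>u. q' u *\<^sub>R Q (kern \<sigma> u) (\<phi> u - \<phi>0)) \<in> borel_measurable lam"
    if "q' \<in> borel_measurable borel" for q' \<sigma>
    using that \<phi>_meas
    by (intro borel_measurable_scaleR borel_measurable_bilinear[OF Q] borel_measurable_diff) (simp_all cong: measurable_cong_sets)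
  have pt: "AE u in lam. (\<lambda>n. q n u *\<^sub>R Q (kern (\<tau> n) u) (\<phi> u - \<phi>0)) \<longlonglongrightarrow> indicator (ball 0 (2 * r)) u *\<^sub>R Q (kern 0 u) (\<phi> u - \<phi>0)"
    using AE_flat
  proof eventually_elim
    case (elim u)
    show ?case
    proof (cases "u = 0")
      case True
      then show ?thesis by (simp add: zero Q.zero_right)
    next
      case False
      have "norm u \<le> norm (u + \<psi> u *\<^sub>R \<nu>)" by (rule norm_le_add_\<nu>[OF elim])
      then have "u + \<psi> u *\<^sub>R \<nu> - 0 \<noteq> 0" using False by auto
      then have "(\<lambda>n. kern (\<tau> n) u) \<longlonglongrightarrow> kern 0 u"
        unfolding kern_def E_def by (intro tendsto_intros \<tau> P.tendsto) auto
      then show ?thesis by (intro tendsto_scaleR q_lim elim False Q.tendsto tendsto_const)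
    qed
  qed
  have b': "AE u in lam. norm (q n u *\<^sub>R Q (kern (\<tau> n) u) (\<phi> u - \<phi>0)) \<le> ?w u" for n
    using AE_flat by eventually_elim (rule bound)
  note dct = meas[OF borel_measurable_indicator] meas[OF q_meas] w pt b'
  show "integrable lam (\<lambda>u. indicator (ball 0 (2 * r)) u *\<^sub>R Q (kern 0 u) (\<phi> u - \<phi>0))"
    by (rule integrable_dominated_convergence[OF dct]) auto
  show "integrable lam (\<lambda>u. q n u *\<^sub>R Q (kern (\<tau> n) u) (\<phi> u - \<phi>0))" for n
    by (rule integrable_dominated_convergence2[OF dct]) auto
  show "(\<lambda>n. \<integral>u. q n u *\<^sub>R Q (kern (\<tau> n) u) (\<phi> u - \<phi>0) \<partial>lam)
      \<longlonglongrightarrow> (\<integral>u. indicator (ball 0 (2 * r)) u *\<^sub>R Q (kern 0 u) (\<phi> u - \<phi>0) \<partial>lam)"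
    by (rule integral_dominated_convergence[OF dct]) auto
qed

lemma hoelder_density_limit:
  assumes int: "\<And>n. integrable lam (\<lambda>u. q n u *\<^sub>R kern (\<tau> n) u)"
    and lim: "(\<lambda>n. \<integral>u. q n u *\<^sub>R kern (\<tau> n) u \<partial>lam) \<longlonglongrightarrow> A"
  shows "\<And>n. integrable lam (\<lambda>u. q n u *\<^sub>R Q (kern (\<tau> n) u) (\<phi> u))"
    and "(\<lambda>n. \<integral>u. q n u *\<^sub>R Q (kern (\<tau> n) u) (\<phi> u) \<partial>lam)
      \<longlonglongrightarrow> (\<integral>u. indicator (ball 0 (2 * r)) u *\<^sub>R Q (kern 0 u) (\<phi> u - \<phi>0) \<partial>lam) + Q A \<phi>0"
proof -
  have split: "(\<lambda>u. q n u *\<^sub>R Q (kern (\<tau> n) u) (\<phi> u))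
    = (\<lambda>u. q n u *\<^sub>R Q (kern (\<tau> n) u) (\<phi> u - \<phi>0) + Q (q n u *\<^sub>R kern (\<tau> n) u) \<phi>0)" for n
    by (simp add: Q.diff_right Q.scaleR_left scaleR_diff_right)
  note bl = Q.bounded_linear_left[of \<phi>0]
  note i2 = integrable_bounded_linear[OF bl int]
  show "integrable lam (\<lambda>u. q n u *\<^sub>R Q (kern (\<tau> n) u) (\<phi> u))" for n
    unfolding split by (rule Bochner_Integration.integrable_add[OF hoelder_difference(1) i2])
  have eq: "(\<integral>u. q n u *\<^sub>R Q (kern (\<tau> n) u) (\<phi> u) \<partial>lam)
    = (\<integral>u. q n u *\<^sub>R Q (kern (\<tau> n) u) (\<phi> u - \<phi>0) \<partial>lam) + Q (\<integral>u. q n u *\<^sub>R kern (\<tau> n) u \<partial>lam) \<phi>0" for n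
    unfolding split Bochner_Integration.integral_add[OF hoelder_difference(1) i2] integral_bounded_linear[OF bl int] ..
  show "(\<lambda>n. \<integral>u. q n u *\<^sub>R Q (kern (\<tau> n) u) (\<phi> u) \<partial>lam)
      \<longlonglongrightarrow> (\<integral>u. indicator (ball 0 (2 * r)) u *\<^sub>R Q (kern 0 u) (\<phi> u - \<phi>0) \<partial>lam) + Q A \<phi>0"
    unfolding eq by (intro tendsto_add hoelder_difference(3) Q.tendsto lim tendsto_const)
qed

end

end

section \<open>The kernel away from the boundary point\<close>

lemma norm_cauchy_kernel_le:
  obtains c where "0 < c" "\<And>p w. norm (cauchy_kernel p w :: 'n::{finite,linorder} clifford) \<le> c / \<bar>sphere_area p\<bar> / norm w ^ (p + 1)"
proof -
  have "bounded_linear (para_conj :: 'n clifford \<Rightarrow> 'n clifford)"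
    by (simp add: linear_para_conj linear_conv_bounded_linear[symmetric])
  from bounded_linear.pos_bounded[OF this] obtain c where c: "0 < c" "\<And>w :: 'n clifford. norm (para_conj w) \<le> norm w * c" by blast
  have "norm (cauchy_kernel p w) \<le> c / \<bar>sphere_area p\<bar> / norm w ^ (p + 1)" for p and w :: "'n clifford"
  proof (cases "w = 0")
    case True
    then show ?thesis using c(1) by (simp add: cauchy_kernel_def)
  next
    case False
    have "norm (cauchy_kernel p w) = 1 / \<bar>sphere_area p\<bar> / norm w ^ (p + 2) * norm (para_conj w)"
      by (simp only: cauchy_kernel_def norm_scaleR abs_divide abs_one power_abs abs_norm_cancel)
    also have "\<dots> \<le> 1 / \<bar>sphere_area p\<bar> / norm w ^ (p + 2) * (norm w * c)" by (intro mult_left_mono c) auto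
    also have "\<dots> = c / \<bar>sphere_area p\<bar> / norm w ^ (p + 1)" using False by (simp add: field_simps)
    finally show ?thesis .
  qed
  with c(1) show ?thesis by (rule that)
qed

lemma tendsto_para_conj [tendsto_intros]:
  assumes "(f \<longlongrightarrow> (a :: 'n::{finite,linorder} clifford)) F"
  shows "((\<lambda>x. para_conj (f x)) \<longlongrightarrow> para_conj a) F"
  by (rule bounded_linear.tendsto[OF _ assms]) (simp add: linear_para_conj linear_conv_bounded_linear[symmetric])

lemma tendsto_cauchy_kernel:
  assumes "(f \<longlongrightarrow> (a :: 'n::{finite,linorder} clifford)) F" "a \<noteq> 0"
  shows "((\<lambda>x. cauchy_kernel p (f x)) \<longlongrightarrow> cauchy_kernel p a) F"
  unfolding cauchy_kernel_def using assms by (intro tendsto_intros) auto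

lemma measurable_cauchy_kernel:
  assumes [measurable]: "f \<in> borel_measurable N"
  shows "(\<lambda>x. cauchy_kernel p (f x) :: 'n::{finite,linorder} clifford) \<in> borel_measurable N"
proof -
  have "para_conj \<in> borel_measurable (borel :: 'n clifford measure)"
    by (intro borel_measurable_continuous_onI linear_continuous_on)
      (simp add: linear_para_conj linear_conv_bounded_linear[symmetric])
  from measurable_compose[OF assms this] have [measurable]: "(\<lambda>x. para_conj (f x)) \<in> borel_measurable N" .
  show ?thesis unfolding cauchy_kernel_def by measurable
qed

lemma mult_cauchy_kernel:
  assumes "w \<in> (paravectors :: 'n::{finite,linorder} clifford set)" "w \<noteq> 0" "sphere_area p \<noteq> 0"
  shows "(sphere_area p * norm w ^ p) *\<^sub>R (w \<odot> cauchy_kernel p w) = cl_one"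
  using assms by (simp add: cauchy_kernel_def cl.scaleR_right self_mult_conj power2_eq_square)

text \<open>Off a ball around \<open>x\<close> the distances to \<open>t\<close> and to the base
  point \<open>t0\<close> satisfy \<open>norm (y - t0) \<le> k * norm (y - t)\<close> for all
  \<open>t\<close> near \<open>x\<close>, so the weight at \<open>t0\<close> dominates all the
  kernels at once, even on an unbounded boundary.\<close>

lemma far_integral:
  fixes M :: "'n::{finite,linorder} clifford measure" and v :: "'n clifford \<Rightarrow> 'n clifford"
  assumes M: "sets M = sets borel" and v: "v \<in> borel_measurable borel"
    and G: "integrable M (\<lambda>y. norm (v y) / norm (y - t0) ^ (p + 1))" and v0: "v t0 = 0"
    and A: "A \<in> sets borel" and \<rho>: "0 < \<rho>" "\<And>y. y \<in> A \<Longrightarrow> \<rho> \<le> dist y x"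
  shows "dist t x \<le> \<rho> / 2 \<Longrightarrow> set_integrable M A (\<lambda>y. cauchy_kernel p (y - t) \<odot> v y)"
    and "t' \<longlonglongrightarrow> x \<Longrightarrow> (\<lambda>n. LINT y:A|M. cauchy_kernel p (y - t' n) \<odot> v y) \<longlonglongrightarrow> (LINT y:A|M. cauchy_kernel p (y - x) \<odot> v y)"
proof -
  have [measurable_cong]: "sets M = sets borel" by (rule M)
  note [measurable] = v A
  obtain c where c: "0 < c" "\<And>w :: 'n clifford. norm (cauchy_kernel p w) \<le> c / \<bar>sphere_area p\<bar> / norm w ^ (p + 1)"
    using norm_cauchy_kernel_le by metis
  obtain K where K: "0 < K" "\<And>a b :: 'n clifford. norm (a \<odot> b) \<le> norm a * norm b * K" using cl.pos_bounded by blast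
  \<comment> \<open>From \<open>norm (y - t0) \<le> norm (y - t) + norm (t - t0)\<close>, where the
    last term is at most \<open>\<rho> / 2 + dist x t0\<close> and \<open>norm (y - t)\<close> is at
    least \<open>\<rho> / 2\<close>.\<close>
  define k where "k = 1 + (\<rho> / 2 + dist x t0) * 2 / \<rho>"
  have k: "0 < k" using \<rho>(1) by (simp add: k_def add_pos_nonneg)
  let ?w = "\<lambda>y. (c / \<bar>sphere_area p\<bar> * k ^ (p + 1) * K) * (norm (v y) / norm (y - t0) ^ (p + 1))"
  have w: "integrable M ?w" by (intro integrable_mult_right G)
  have bound: "norm (indicator A y *\<^sub>R (cauchy_kernel p (y - t) \<odot> v y)) \<le> ?w y" if t: "dist t x \<le> \<rho> / 2" for t y
  proof (cases "y \<in> A \<and> y \<noteq> t0")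
    case False
    \<comment> \<open>At \<open>y = t0\<close> the weight is 0 because division by 0 gives 0; there
      \<open>v0\<close> makes the left-hand side vanish too.\<close>
    have "0 \<le> ?w y" using c(1) K(1) k by simp
    then show ?thesis using False v0 by (auto simp: cl.zero_right)
  next
    case True
    have d: "\<rho> / 2 \<le> norm (y - t)" using \<rho>(2)[of y] True t dist_triangle[of y x t] by (simp add: dist_norm norm_minus_commute)
    have "norm (y - t0) \<le> norm (y - t) + (\<rho> / 2 + dist x t0)"
      using t dist_triangle[of y t0 t] dist_triangle[of t t0 x] by (simp add: dist_norm)
    also have "\<dots> \<le> norm (y - t) + (\<rho> / 2 + dist x t0) * (norm (y - t) * 2 / \<rho>)"
    proof -
      have "(\<rho> / 2 + dist x t0) * 1 \<le> (\<rho> / 2 + dist x t0) * (norm (y - t) * 2 / \<rho>)"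
        using d \<rho>(1) by (intro mult_left_mono) (auto simp: field_simps)
      then show ?thesis by simp
    qed
    also have "\<dots> = k * norm (y - t)" by (simp add: k_def algebra_simps)
    finally have le: "norm (y - t0) \<le> k * norm (y - t)" .
    have pos: "0 < norm (y - t0)" "0 < norm (y - t)" using True d \<rho>(1) by auto
    have "1 / norm (y - t) ^ (p + 1) \<le> k ^ (p + 1) / norm (y - t0) ^ (p + 1)"
    proof -
      have "norm (y - t0) ^ (p + 1) \<le> (k * norm (y - t)) ^ (p + 1)" using le by (intro power_mono) auto
      then show ?thesis using pos by (simp add: field_simps power_mult_distrib del: power_Suc)
    qed
    then have ck: "norm (cauchy_kernel p (y - t)) \<le> c / \<bar>sphere_area p\<bar> * (k ^ (p + 1) / norm (y - t0) ^ (p + 1))"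
      using c(1) by (intro order_trans[OF c(2)] order_trans[OF eq_refl mult_left_mono]) auto
    have "norm (indicator A y *\<^sub>R (cauchy_kernel p (y - t) \<odot> v y)) \<le> norm (cauchy_kernel p (y - t)) * norm (v y) * K"
      using K(2) True by simp
    also have "\<dots> \<le> (c / \<bar>sphere_area p\<bar> * (k ^ (p + 1) / norm (y - t0) ^ (p + 1))) * norm (v y) * K"
      using K(1) by (intro mult_right_mono ck) auto
    also have "\<dots> = ?w y" by (simp add: field_simps)
    finally show ?thesis .
  qed
  have meas [measurable]: "(\<lambda>y. indicator A y *\<^sub>R (cauchy_kernel p (y - t) \<odot> v y)) \<in> borel_measurable M" for t
  proof -
    have "(\<lambda>y. cauchy_kernel p (y - t) \<odot> v y) \<in> borel_measurable borel"
      by (intro borel_measurable_bilinear[OF bounded_bilinear_cl_mult] measurable_cauchy_kernel v) measurable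
    then show ?thesis by measurable
  qed
  show "set_integrable M A (\<lambda>y. cauchy_kernel p (y - t) \<odot> v y)" if t: "dist t x \<le> \<rho> / 2"
    unfolding set_integrable_def
    by (rule Bochner_Integration.integrable_bound[OF w meas])
      (intro AE_I2 order_trans[OF bound[OF t]], simp only: real_norm_def abs_ge_self)
  assume t': "t' \<longlonglongrightarrow> x"
  from tendstoD[OF t', of "\<rho> / 2"] \<rho>(1) obtain n0 where n0: "\<And>n. n0 \<le> n \<Longrightarrow> dist (t' n) x < \<rho> / 2"
    by (auto simp: eventually_sequentially)
  have "(\<lambda>n. LINT y:A|M. cauchy_kernel p (y - t' (n + n0)) \<odot> v y) \<longlonglongrightarrow> (LINT y:A|M. cauchy_kernel p (y - x) \<odot> v y)"
    unfolding set_lebesgue_integral_def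
  proof (rule integral_dominated_convergence[where w = ?w])
    show "AE y in M. norm (indicator A y *\<^sub>R (cauchy_kernel p (y - t' (n + n0)) \<odot> v y)) \<le> ?w y" for n
      using bound[of "t' (n + n0)"] n0[of "n + n0"] by (intro AE_I2) auto
    show "AE y in M. (\<lambda>n. indicator A y *\<^sub>R (cauchy_kernel p (y - t' (n + n0)) \<odot> v y))
        \<longlonglongrightarrow> indicator A y *\<^sub>R (cauchy_kernel p (y - x) \<odot> v y)"
    proof (rule AE_I2)
      fix y
      show "(\<lambda>n. indicator A y *\<^sub>R (cauchy_kernel p (y - t' (n + n0)) \<odot> v y)) \<longlonglongrightarrow> indicator A y *\<^sub>R (cauchy_kernel p (y - x) \<odot> v y)"
      proof (cases "y \<in> A")
        case True
        then have "y - x \<noteq> 0" using \<rho> by force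
        then show ?thesis
          using LIMSEQ_ignore_initial_segment[OF t', of n0]
          by (intro tendsto_scaleR cl.tendsto tendsto_cauchy_kernel tendsto_intros) auto
      qed simp
    qed
  qed (rule meas meas w)+
  then show "(\<lambda>n. LINT y:A|M. cauchy_kernel p (y - t' n) \<odot> v y) \<longlonglongrightarrow> (LINT y:A|M. cauchy_kernel p (y - x) \<odot> v y)"
    by (rule LIMSEQ_offset)
qed

lemma sphere_area_pos: "0 < sphere_area p"
  unfolding sphere_area_def by (intro divide_pos_pos mult_pos_pos zero_less_power Gamma_real_pos) auto

text \<open>The situation inside one slice: \<open>W\<close> is the section of the domain and the
  slice kernel has become the Cauchy kernel. Integrability at the single point \<open>t0\<close> is
  what controls the size of the boundary far from \<open>x\<close>.\<close>

locale cauchy_boundary =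
  fixes p :: nat and \<eta> :: "'n::{finite,linorder} clifford" and W :: "'n clifford set"
    and f :: "'n clifford \<Rightarrow> 'n clifford" and x t0 :: "'n clifford" and \<alpha> C :: real
  assumes \<eta>: "\<eta> \<in> unit_sphere p" and p_le: "p \<le> CARD('n)"
    and W_open: "openin (top_of_set (slice_space p \<eta>)) W"
    and reg: "regular_point (slice_space p \<eta>) W x"
    and \<alpha>: "0 < \<alpha>" "\<alpha> \<le> 1" and C: "0 \<le> C"
    and hoelder: "\<And>y y'. \<lbrakk>y \<in> top_of_set (slice_space p \<eta>) frontier_of W; y' \<in> top_of_set (slice_space p \<eta>) frontier_of W\<rbrakk>
      \<Longrightarrow> norm (f y - f y') \<le> C * norm (y - y') powr \<alpha>"
    and t0: "t0 \<in> W"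
    and integrable_t0: "set_integrable (surface_measure p) (top_of_set (slice_space p \<eta>) frontier_of W)
      (\<lambda>y. cauchy_kernel p (y - t0) \<odot> exterior_normal (slice_space p \<eta>) W y \<odot> f y)"
begin

abbreviation "L \<equiv> slice_space p \<eta>"
abbreviation "\<mu> \<equiv> surface_measure p :: 'n clifford measure"
abbreviation "Bd \<equiv> top_of_set L frontier_of W"

definition v :: "'n clifford \<Rightarrow> 'n clifford" where
  "v y = indicator Bd y *\<^sub>R (exterior_normal L W y \<odot> f y)"

sublocale area_measure \<mu> "p + 1"
  by (rule area_measure_surface_measure[OF p_le])

lemma closed_L: "closed L" by (rule closed_subspace[OF subspace_slice[OF \<eta> p_le]])

lemma closed_Bd: "closed Bd"
  using closedin_closed_trans[OF closedin_frontier_of closed_L] by simp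

lemma Bd_subset: "Bd \<subseteq> L" using closedin_subset[OF closedin_frontier_of[of "top_of_set L" W]] by simp

lemma W_subset: "W \<subseteq> L" using openin_subset[OF W_open] by simp

lemma x_Bd: "x \<in> Bd" using reg by (simp add: regular_point_def)

lemma x_L: "x \<in> L" using x_Bd Bd_subset by blast

lemma W_Int_Bd: "W \<inter> Bd = {}"
  using interior_of_openin[OF W_open] by (auto simp: frontier_of_def)

lemma Bd_closure: "Bd \<subseteq> closure W"
  using closure_of_subtopology_subset[of euclidean L W] by (auto simp: frontier_of_def)

lemma measurable_f: "(\<lambda>y. indicator Bd y *\<^sub>R f y) \<in> borel_measurable borel"
proof (rule borel_measurable_continuous_on_indicator)
  show "Bd \<in> sets borel" by (rule borel_closed[OF closed_Bd])
  show "continuous_on Bd f"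
    unfolding continuous_on_def
  proof (intro ballI)
    fix y assume y: "y \<in> Bd"
    have "((\<lambda>z. C * norm (z - y) powr \<alpha>) \<longlongrightarrow> C * norm (y - y) powr \<alpha>) (at y within Bd)"
      using \<alpha> by (intro tendsto_intros) auto
    then have "((\<lambda>z. C * norm (z - y) powr \<alpha>) \<longlongrightarrow> 0) (at y within Bd)" by simp
    then have "((\<lambda>z. f z - f y) \<longlongrightarrow> 0) (at y within Bd)"
      by (rule Lim_null_comparison[rotated]) (use hoelder y in \<open>auto simp: eventually_at_filter\<close>)
    then show "(f \<longlongrightarrow> f y) (at y within Bd)" by (rule LIM_zero_cancel)
  qed
qed

text \<open>
  The normal \<open>n\<close> is not known to be measurable off the chart; \<open>n f\<close> is recovered from the integrand at
  \<open>t0\<close> by inverting the kernel.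
\<close>

lemma v_integrable:
  shows measurable_v: "v \<in> borel_measurable borel"
    and "integrable \<mu> (\<lambda>y. norm (v y) / norm (y - t0) ^ (p + 1))"
proof -
  define h0 where "h0 = (\<lambda>y. indicator Bd y *\<^sub>R (cauchy_kernel p (y - t0) \<odot> exterior_normal L W y \<odot> f y))"
  have h0: "integrable \<mu> h0" using integrable_t0 by (simp add: set_integrable_def h0_def)
  have eq: "v y = (sphere_area p * norm (y - t0) ^ p) *\<^sub>R ((y - t0) \<odot> h0 y)" for y
  proof (cases "y \<in> Bd")
    case True
    have w: "y - t0 \<in> paravectors"
      using subspace_diff[OF subspace_slice[OF \<eta> p_le]] True Bd_subset t0 W_subset slice_paravectors[OF \<eta> p_le] by blast
    have nz: "y - t0 \<noteq> 0" using True t0 W_Int_Bd by auto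
    have "(sphere_area p * norm (y - t0) ^ p) *\<^sub>R ((y - t0) \<odot> h0 y)
      = ((sphere_area p * norm (y - t0) ^ p) *\<^sub>R ((y - t0) \<odot> cauchy_kernel p (y - t0))) \<odot> (exterior_normal L W y \<odot> f y)"
      using True by (simp add: h0_def cl.scaleR_left cl_mult_assoc)
    also have "\<dots> = v y"
      using sphere_area_pos[of p] True by (simp only: mult_cauchy_kernel[OF w nz] cl_one_mult) (simp add: v_def)
    finally show ?thesis by simp
  qed (simp add: v_def h0_def cl.zero_right)
  have [measurable]: "h0 \<in> borel_measurable borel" using borel_measurable_integrable[OF h0] by (simp cong: measurable_cong_sets add: sets_M)
  have "(\<lambda>y. (sphere_area p * norm (y - t0) ^ p) *\<^sub>R ((y - t0) \<odot> h0 y)) \<in> borel_measurable borel"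
    by (intro borel_measurable_scaleR borel_measurable_bilinear[OF bounded_bilinear_cl_mult]) measurable
  then show v [measurable]: "v \<in> borel_measurable borel" using eq by (simp add: fun_eq_iff[symmetric] cong: measurable_cong)
  obtain K where K: "0 < K" "\<And>a b :: 'n clifford. norm (a \<odot> b) \<le> norm a * norm b * K" using cl.pos_bounded by blast
  show "integrable \<mu> (\<lambda>y. norm (v y) / norm (y - t0) ^ (p + 1))"
  proof (rule Bochner_Integration.integrable_bound)
    show "integrable \<mu> (\<lambda>y. (sphere_area p * K) *\<^sub>R h0 y)" by (intro integrable_scaleR_right h0)
    show "(\<lambda>y. norm (v y) / norm (y - t0) ^ (p + 1)) \<in> borel_measurable \<mu>" by measurable
    show "AE y in \<mu>. norm (norm (v y) / norm (y - t0) ^ (p + 1)) \<le> norm ((sphere_area p * K) *\<^sub>R h0 y)"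
    proof (rule AE_I2)
      fix y
      show "norm (norm (v y) / norm (y - t0) ^ (p + 1)) \<le> norm ((sphere_area p * K) *\<^sub>R h0 y)"
      proof (cases "y = t0")
        case False
        then have pos: "0 < norm (y - t0)" by simp
        have "norm (v y) = sphere_area p * norm (y - t0) ^ p * norm ((y - t0) \<odot> h0 y)"
          using sphere_area_pos[of p] by (subst eq) simp
        also have "\<dots> \<le> sphere_area p * norm (y - t0) ^ p * (norm (y - t0) * norm (h0 y) * K)"
          using sphere_area_pos[of p] by (intro mult_left_mono K) auto
        finally have "norm (v y) / norm (y - t0) ^ (p + 1) \<le> sphere_area p * K * norm (h0 y)"
          using pos by (simp add: field_simps)
        then show ?thesis using K(1) sphere_area_pos[of p] by simp
      qed simp
    qed
  qed
qed

lemma v_t0: "v t0 = 0" using t0 W_Int_Bd by (auto simp: v_def indicator_def)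

lemmas far = far_integral[OF sets_M v_integrable v_t0]

end

text \<open>Ties the abstract graph to \<open>W\<close>: within the cylinder \<open>W\<close> lies
  below the graph and its boundary is the graph. The bilinear map is the product with the conjugate,
  and \<open>m = p + 1\<close>.\<close>

locale cauchy_graph = cauchy_boundary p \<eta> W f x t0 \<alpha> C
  + flux_origin "surface_measure p :: 'n clifford measure" "p + 1" B \<nu> \<psi> d\<psi> x "\<lambda>z b. para_conj z \<odot> b" cl_one \<delta> r
  for p and \<eta> :: "'n::{finite,linorder} clifford" and W f x t0 \<alpha> C B \<nu> \<psi> d\<psi> \<delta> r +
  fixes h :: real
  assumes h_pos: "0 < h" and L_eq: "slice_space p \<eta> = {u + s *\<^sub>R \<nu> | u s. u \<in> span B}"
    and \<psi>_h: "\<And>u. u \<in> span B \<Longrightarrow> norm u < 2 * r \<Longrightarrow> \<bar>\<psi> u\<bar> < h"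
    and cylinder: "\<And>u s. \<lbrakk>u \<in> span B; norm u < 2 * r; \<bar>s\<bar> < h\<rbrakk> \<Longrightarrow>
        (x + u + s *\<^sub>R \<nu> \<in> W \<longleftrightarrow> s < \<psi> u) \<and> (x + u + s *\<^sub>R \<nu> \<in> top_of_set (slice_space p \<eta>) frontier_of W \<longleftrightarrow> s = \<psi> u)"
    and normal: "\<And>u. u \<in> span B \<Longrightarrow> norm u < 2 * r \<Longrightarrow>
        exterior_normal (slice_space p \<eta>) W (x + u + \<psi> u *\<^sub>R \<nu>) = (\<nu> - d\<psi> u) /\<^sub>R sqrt (1 + (norm (d\<psi> u))\<^sup>2)"
begin

definition cyl :: "'n clifford set" where "cyl = {y. norm (proj (y - x)) < 2 * r \<and> \<bar>(y - x) \<bullet> \<nu>\<bar> < h}"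
definition S :: "'n clifford set" where "S = T \<inter> ball 0 (2 * r)"
definition \<phi> :: "'n clifford \<Rightarrow> 'n clifford" where "\<phi> u = indicator Bd (\<Phi> u) *\<^sub>R f (\<Phi> u)"
text \<open>Radius of a ball around \<open>x\<close> whose points all lie in
  \<open>cyl\<close>.\<close>

definition \<rho> :: real where "\<rho> = min (2 * r) h"
text \<open>The principal value: the part off the cylinder, the Hoelder part, and the flux part.\<close>

definition PV :: "'n clifford" where
  "PV = (LINT y:Bd - cyl|\<mu>. cauchy_kernel p (y - x) \<odot> v y)
    + (1 / sphere_area p) *\<^sub>R ((\<integral>u. indicator (ball 0 (2 * r)) u *\<^sub>R (kern 0 u \<odot> (\<phi> u - f x)) \<partial>lam) + (A0 + annulus_part) \<odot> f x)"

lemma decomp: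
  assumes "y \<in> L"
  shows "y - x = proj (y - x) + ((y - x) \<bullet> \<nu>) *\<^sub>R \<nu>" "proj (y - x) \<in> T"
proof -
  have "y - x \<in> L" using subspace_diff[OF subspace_slice[OF \<eta> p_le] assms x_L] .
  then obtain u s where u: "y - x = u + s *\<^sub>R \<nu>" "u \<in> T" using L_eq by auto
  have pr: "proj (y - x) = u" unfolding u(1) by (rule proj_add_\<nu>[OF u(2)])
  have s: "(y - x) \<bullet> \<nu> = s" unfolding u(1) by (simp add: inner_add_left span_\<nu>[OF u(2)] \<nu>\<nu>)
  show "y - x = proj (y - x) + ((y - x) \<bullet> \<nu>) *\<^sub>R \<nu>" "proj (y - x) \<in> T" unfolding pr s using u by auto
qed

lemma open_cyl: "open cyl"
  unfolding cyl_def by (intro open_Collect_conj open_Collect_less continuous_intros continuous_on_compose2[OF continuous_on_proj]) auto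

lemma image_S: "\<Phi> ` S = Bd \<inter> cyl"
proof (intro equalityI subsetI)
  fix y assume "y \<in> \<Phi> ` S"
  then obtain u where u: "u \<in> T" "norm u < 2 * r" "y = \<Phi> u" by (auto simp: S_def)
  have d: "y - x = u + \<psi> u *\<^sub>R \<nu>" by (simp add: u(3) \<Phi>_def)
  have "(y - x) \<bullet> \<nu> = \<psi> u" unfolding d by (simp add: inner_add_left span_\<nu>[OF u(1)] \<nu>\<nu>)
  moreover have "proj (y - x) = u" unfolding d by (rule proj_add_\<nu>[OF u(1)])
  moreover have "y \<in> Bd" using cylinder[OF u(1,2) \<psi>_h[OF u(1,2)]] by (simp add: u(3) \<Phi>_def)
  ultimately show "y \<in> Bd \<inter> cyl" using u \<psi>_h[OF u(1,2)] by (simp add: cyl_def)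
next
  fix y assume y: "y \<in> Bd \<inter> cyl"
  define u s where "u = proj (y - x)" and "s = (y - x) \<bullet> \<nu>"
  note d = decomp[of y, folded u_def s_def]
  have yL: "y \<in> L" using y Bd_subset by blast
  have us: "norm u < 2 * r" "\<bar>s\<bar> < h" using y by (auto simp: cyl_def u_def s_def)
  have e: "y = x + u + s *\<^sub>R \<nu>" using d(1)[OF yL] by (simp add: algebra_simps)
  have "s = \<psi> u" using cylinder[OF d(2)[OF yL] us] y e by auto
  then show "y \<in> \<Phi> ` S" using e d(2)[OF yL] us by (auto simp: S_def \<Phi>_def)
qed

lemma far_dist: "y \<in> Bd - cyl \<Longrightarrow> \<rho> \<le> dist y x"
proof -
  assume "y \<in> Bd - cyl"
  then have "2 * r \<le> norm (proj (y - x)) \<or> h \<le> \<bar>(y - x) \<bullet> \<nu>\<bar>" by (auto simp: cyl_def)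
  moreover have "norm (proj (y - x)) \<le> dist y x" using norm_proj_le by (simp add: dist_norm)
  moreover have "\<bar>(y - x) \<bullet> \<nu>\<bar> \<le> dist y x" using Cauchy_Schwarz_ineq2[of "y - x" \<nu>] by (simp add: dist_norm norm_\<nu>)
  ultimately show ?thesis by (auto simp: \<rho>_def)
qed

lemma \<rho>_pos: "0 < \<rho>" using r_pos h_pos by (simp add: \<rho>_def)

lemma sets_S [measurable]: "S \<in> sets borel"
  unfolding S_def by (intro sets.Int borel_closed closed_span sets_ball)

lemma measurable_\<phi> [measurable]: "\<phi> \<in> borel_measurable borel"
  using measurable_compose[OF measurable_\<Phi> measurable_f] by (simp add: \<phi>_def[abs_def])

lemma \<phi>_eq: "u \<in> S \<Longrightarrow> \<phi> u = f (\<Phi> u)"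
proof -
  assume "u \<in> S"
  then have "\<Phi> u \<in> Bd" using image_S by blast
  then show ?thesis by (simp add: \<phi>_def)
qed

text \<open>The Jacobian cancels the normalization of the unit normal, which leaves the vector
  \<open>\<nu> - d\<psi> u\<close> of \<open>kern\<close>.\<close>

lemma density:
  assumes u: "u \<in> S"
  shows "J u *\<^sub>R (cauchy_kernel p (\<Phi> u - t) \<odot> v (\<Phi> u)) = (1 / sphere_area p) *\<^sub>R (kern (t - x) u \<odot> \<phi> u)"
proof -
  have uT: "u \<in> T" "norm u < 2 * r" using u by (auto simp: S_def)
  have "\<Phi> u \<in> Bd" using image_S u by blast
  then have v: "v (\<Phi> u) = (1 / J u) *\<^sub>R ((\<nu> - d\<psi> u) \<odot> \<phi> u)"
    using normal[OF uT] by (simp add: v_def \<phi>_eq[OF u] \<Phi>_def J_def cl.scaleR_left divide_inverse)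
  have w: "u + \<psi> u *\<^sub>R \<nu> - (t - x) = \<Phi> u - t" by (simp add: \<Phi>_def)
  have "J u \<noteq> 0" using J_ge_1[of u] by auto
  then have "J u *\<^sub>R (cauchy_kernel p (\<Phi> u - t) \<odot> v (\<Phi> u)) = cauchy_kernel p (\<Phi> u - t) \<odot> ((\<nu> - d\<psi> u) \<odot> \<phi> u)"
    by (simp add: v cl.scaleR_right)
  also have "\<dots> = (1 / sphere_area p) *\<^sub>R (kern (t - x) u \<odot> \<phi> u)"
    unfolding kern_def E_def w cauchy_kernel_def
    by (simp add: cl.scaleR_left cl_mult_assoc)
  finally show ?thesis .
qed

text \<open>\<open>Z\<close> is the region kept: the complement of an excised set for the principal
  value, everything for the non-tangential limit.\<close>

lemma near_integral:
  assumes Z [measurable]: "Z \<in> sets borel"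
    and int: "integrable lam (\<lambda>u. (indicator (ball 0 (2 * r)) u * indicator Z u) *\<^sub>R (kern (t - x) u \<odot> \<phi> u))"
  shows "set_integrable \<mu> (\<Phi> ` (S \<inter> Z)) (\<lambda>y. cauchy_kernel p (y - t) \<odot> v y)"
    and "(LINT y:\<Phi> ` (S \<inter> Z)|\<mu>. cauchy_kernel p (y - t) \<odot> v y)
      = (1 / sphere_area p) *\<^sub>R (\<integral>u. (indicator (ball 0 (2 * r)) u * indicator Z u) *\<^sub>R (kern (t - x) u \<odot> \<phi> u) \<partial>lam)"
proof -
  have SZ [measurable]: "S \<inter> Z \<in> sets borel" by measurable
  have SZT: "S \<inter> Z \<subseteq> T" by (auto simp: S_def)
  note [measurable] = measurable_v
  have hm: "(\<lambda>y. cauchy_kernel p (y - t) \<odot> v y) \<in> borel_measurable borel"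
    by (intro borel_measurable_bilinear[OF bounded_bilinear_cl_mult] measurable_cauchy_kernel measurable_v) measurable
  have m: "(\<lambda>y. indicator (\<Phi> ` (S \<inter> Z)) y *\<^sub>R (cauchy_kernel p (y - t) \<odot> v y)) \<in> borel_measurable borel"
    by (intro borel_measurable_scaleR borel_measurable_indicator sets_\<Phi>_image SZ SZT hm)
  note ig = integral_graph[OF SZ SZT m]
  have meas: "(\<lambda>u. kern (t - x) u \<odot> \<phi> u) \<in> borel_measurable borel"
    by (intro borel_measurable_bilinear[OF bounded_bilinear_cl_mult]) measurable
  have eq: "AE u in lam. (1 / sphere_area p) *\<^sub>R ((indicator (ball 0 (2 * r)) u * indicator Z u) *\<^sub>R (kern (t - x) u \<odot> \<phi> u))
      = indicator (S \<inter> Z) u *\<^sub>R (J u *\<^sub>R (cauchy_kernel p (\<Phi> u - t) \<odot> v (\<Phi> u)))"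
    using AE_flat
  proof eventually_elim
    case (elim u)
    show ?case
    proof (cases "u \<in> S \<inter> Z")
      case True
      then show ?thesis using density[of u t] by (simp add: S_def)
    next
      case False
      then have "indicator (ball 0 (2 * r)) u * indicator Z u = (0::real)" using elim by (auto simp: S_def indicator_def)
      then show ?thesis using False by simp
    qed
  qed
  have m1: "(\<lambda>u. (1 / sphere_area p) *\<^sub>R ((indicator (ball 0 (2 * r)) u * indicator Z u) *\<^sub>R (kern (t - x) u \<odot> \<phi> u))) \<in> borel_measurable lam"
    using meas by measurable
  have "(\<lambda>u. cauchy_kernel p (\<Phi> u - t) \<odot> v (\<Phi> u)) \<in> borel_measurable borel"
    using measurable_compose[OF measurable_\<Phi> hm] .
  then have m2: "(\<lambda>u. indicator (S \<inter> Z) u *\<^sub>R (J u *\<^sub>R (cauchy_kernel p (\<Phi> u - t) \<odot> v (\<Phi> u)))) \<in> borel_measurable lam"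
    by measurable
  show "set_integrable \<mu> (\<Phi> ` (S \<inter> Z)) (\<lambda>y. cauchy_kernel p (y - t) \<odot> v y)"
    unfolding ig(1) using integrable_scaleR_right[OF int, of "1 / sphere_area p"] integrable_cong_AE[OF m1 m2 eq] by simp
  show "(LINT y:\<Phi> ` (S \<inter> Z)|\<mu>. cauchy_kernel p (y - t) \<odot> v y)
      = (1 / sphere_area p) *\<^sub>R (\<integral>u. (indicator (ball 0 (2 * r)) u * indicator Z u) *\<^sub>R (kern (t - x) u \<odot> \<phi> u) \<partial>lam)"
    unfolding ig(2) by (simp only: integral_cong_AE[OF m1 m2 eq, symmetric] integral_scaleR_right)
qed

lemma \<phi>_hoelder: "u \<in> T \<Longrightarrow> norm u < 2 * r \<Longrightarrow> norm (\<phi> u - f x) \<le> (C * 2 powr \<alpha>) * norm u powr \<alpha>"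
proof -
  assume u: "u \<in> T" "norm u < 2 * r"
  then have uS: "u \<in> S" by (simp add: S_def)
  have "norm (\<phi> u - f x) \<le> C * norm (\<Phi> u - x) powr \<alpha>"
    unfolding \<phi>_eq[OF uS] by (rule hoelder[OF _ x_Bd]) (use image_S uS in blast)
  \<comment> \<open>As \<open>\<delta> \<le> 1\<close>, the graph point is at distance at most
    \<open>2 * norm u\<close> from \<open>x\<close>.\<close>
  also have "\<dots> \<le> C * (2 * norm u) powr \<alpha>"
  proof (intro mult_left_mono powr_mono2 C)
    have "norm (\<Phi> u - x) \<le> norm u + \<bar>\<psi> u\<bar>" using norm_triangle_ineq[of u "\<psi> u *\<^sub>R \<nu>"] by (simp add: \<Phi>_def norm_\<nu>)
    also have "\<bar>\<psi> u\<bar> \<le> 1 * norm u" by (rule order_trans[OF \<psi>_le[OF u(1)] mult_right_mono[OF \<delta>(2)]]) simp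
    finally show "norm (\<Phi> u - x) \<le> 2 * norm u" by simp
  qed (use \<alpha> in auto)
  finally show ?thesis by (simp add: powr_mult)
qed

lemma C'_nonneg: "0 \<le> C * 2 powr \<alpha>" using C by simp

lemma principal_value: "has_principal_value \<mu> Bd x (\<lambda>y. cauchy_kernel p (y - x) \<odot> v y) PV"
  unfolding has_principal_value_def
proof (intro conjI allI impI)
  let ?h = "\<lambda>y. cauchy_kernel p (y - x) \<odot> v y"
  have BdB [measurable]: "Bd \<in> sets borel" by (rule borel_closed[OF closed_Bd])
  have sb [measurable]: "{y \<in> Bd. \<epsilon> < dist y x} \<in> sets borel" for \<epsilon>
  proof -
    have "{y. \<epsilon> < dist y x} \<in> sets borel" by measurable
    from sets.Int[OF BdB this] show ?thesis by (simp add: Int_def)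
  qed
  have cylB [measurable]: "cyl \<in> sets borel" by (rule borel_open[OF open_cyl])
  show si: "set_integrable \<mu> {y \<in> Bd. \<epsilon> < dist y x} ?h" if \<epsilon>: "0 < \<epsilon>" for \<epsilon>
    by (rule far(1)[OF sb \<epsilon>, where x = x]) (use \<epsilon> in auto)
  show "((\<lambda>\<epsilon>. LINT y:{y \<in> Bd. \<epsilon> < dist y x}|\<mu>. ?h y) \<longlongrightarrow> PV) (at_right 0)"
    unfolding tendsto_at_iff_sequentially comp_def
  proof (intro allI impI)
    fix \<epsilon> :: "nat \<Rightarrow> real" assume \<epsilon>: "\<forall>i. \<epsilon> i \<in> {0<..} - {0}" "\<epsilon> \<longlonglongrightarrow> 0"
    then have \<epsilon>p: "0 < \<epsilon> n" for n by auto
    let ?Z = "\<lambda>n. {u. \<epsilon> n < norm (u + \<psi> u *\<^sub>R \<nu>)}"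
    let ?q = "\<lambda>n u. indicator (ball 0 (2 * r)) u * indicator (?Z n) u :: real"
    have Z [measurable]: "?Z n \<in> sets borel" for n by measurable
    have ub: "norm u \<le> norm (u + \<psi> u *\<^sub>R \<nu> - 0)" if "u \<in> T" for u using norm_le_add_\<nu>[OF that] by simp
    have kint: "integrable lam (\<lambda>u. ?q n u *\<^sub>R kern 0 u)" for n
    proof (rule integrable_kern[OF _ \<epsilon>p[of n]])
      fix u assume u: "?q n u \<noteq> 0"
      then show "norm u \<le> 2 * r \<and> \<epsilon> n \<le> norm (u + \<psi> u *\<^sub>R \<nu> - 0)" by (auto simp: indicator_def split: if_splits)
    qed (auto simp: indicator_def)
    have qlim: "(\<lambda>n. ?q n u) \<longlonglongrightarrow> indicator (ball 0 (2 * r)) u" if u: "u \<in> T" "u \<noteq> 0" for u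
    proof (rule tendsto_eventually)
      have "0 < norm (u + \<psi> u *\<^sub>R \<nu>)" using ub[OF u(1)] u(2) by (auto intro: less_le_trans)
      from order_tendstoD(2)[OF \<epsilon>(2) this] show "\<forall>\<^sub>F n in sequentially. ?q n u = indicator (ball 0 (2 * r)) u"
        by eventually_elim auto
    qed
    \<comment> \<open>Constant pole 0: the lower bound on the distance holds with constant
      1.\<close>
    note hd = hoelder_density_limit[OF bounded_bilinear_cl_mult measurable_\<phi> \<alpha> C'_nonneg \<phi>_hoelder _ _ qlim tendsto_const
        zero_less_one, where A = "A0 + annulus_part"]
    have i: "integrable lam (\<lambda>u. ?q n u *\<^sub>R (kern 0 u \<odot> \<phi> u))" for n
      by (rule hd(1)) (use ub kint principal_value_flux[OF \<epsilon>p \<epsilon>(2)] in \<open>auto simp: indicator_def\<close>)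
    have l: "(\<lambda>n. \<integral>u. ?q n u *\<^sub>R (kern 0 u \<odot> \<phi> u) \<partial>lam) \<longlonglongrightarrow>
        (\<integral>u. indicator (ball 0 (2 * r)) u *\<^sub>R (kern 0 u \<odot> (\<phi> u - f x)) \<partial>lam) + (A0 + annulus_part) \<odot> f x"
      by (rule hd(2)) (use ub kint principal_value_flux[OF \<epsilon>p \<epsilon>(2)] in \<open>auto simp: indicator_def\<close>)
    \<comment> \<open>Once \<open>\<epsilon> n < \<rho>\<close> the excised part of the boundary
      lies in the cylinder, so the integral off the cylinder no longer depends on
      \<open>n\<close>.\<close>
    have ev: "\<forall>\<^sub>F n in sequentially. (LINT y:Bd - cyl|\<mu>. ?h y) + (1 / sphere_area p) *\<^sub>R (\<integral>u. ?q n u *\<^sub>R (kern 0 u \<odot> \<phi> u) \<partial>lam)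
        = (LINT y:{y \<in> Bd. \<epsilon> n < dist y x}|\<mu>. ?h y)"
      using order_tendstoD(2)[OF \<epsilon>(2) \<rho>_pos]
    proof eventually_elim
      case (elim n)
      have d: "dist (\<Phi> u) x = norm (u + \<psi> u *\<^sub>R \<nu>)" for u by (simp add: dist_norm \<Phi>_def)
      have "\<Phi> ` (S \<inter> ?Z n) = \<Phi> ` S \<inter> {y. \<epsilon> n < dist y x}" by (auto simp: d)
      then have N: "\<Phi> ` (S \<inter> ?Z n) = {y \<in> Bd. \<epsilon> n < dist y x} \<inter> cyl" unfolding image_S by auto
      have F: "Bd - cyl = {y \<in> Bd. \<epsilon> n < dist y x} - cyl" using far_dist elim by force
      note near = near_integral[of "?Z n" x, unfolded diff_self, OF Z i]
      have "(LINT y:(Bd - cyl) \<union> \<Phi> ` (S \<inter> ?Z n)|\<mu>. ?h y) = (LINT y:Bd - cyl|\<mu>. ?h y) + (LINT y:\<Phi> ` (S \<inter> ?Z n)|\<mu>. ?h y)"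
      proof (rule set_integral_Un)
        show "(Bd - cyl) \<inter> \<Phi> ` (S \<inter> ?Z n) = {}" unfolding N by auto
        show "set_integrable \<mu> (Bd - cyl) ?h" by (rule far(1)[OF _ \<rho>_pos far_dist]) (use \<rho>_pos in auto)
        show "set_integrable \<mu> (\<Phi> ` (S \<inter> ?Z n)) ?h" by (rule near(1))
      qed
      moreover have "(Bd - cyl) \<union> \<Phi> ` (S \<inter> ?Z n) = {y \<in> Bd. \<epsilon> n < dist y x}" unfolding N F by blast
      ultimately show ?case unfolding near(2) by simp
    qed
    show "(\<lambda>n. LINT y:{y \<in> Bd. \<epsilon> n < dist y x}|\<mu>. ?h y) \<longlonglongrightarrow> PV"
      unfolding PV_def by (rule Lim_transform_eventually[OF _ ev]) (intro tendsto_intros l)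
  qed
qed

text \<open>The source of the 1/2: half of the flux through a sphere around the pole passes through
  a hyperplane. The index shift is \<open>m + 1 = p + 2\<close>.\<close>

lemma poisson_const_eq: "poisson_const / sphere_area p = 1 / 2"
proof -
  have "0 < Gamma (real (p + 2) / 2)" "0 < Gamma (1/2 :: real)" by (rule Gamma_real_pos; simp)+
  moreover have "A / G / (2 * A / G) = 1 / 2" if "0 < A" "0 < G" for A G :: real using that by simp
  moreover have "p + 1 + 1 = p + 2" by simp
  ultimately show ?thesis unfolding poisson_const_def sphere_area_def by (metis zero_less_power)
qed

lemma nontangential_limit:
  assumes t: "\<And>n. t n \<in> L" "\<And>n. t n \<noteq> x" "t \<longlonglongrightarrow> x"
    and cone: "\<And>n. 2 * \<delta> * norm (t n - x) \<le> \<bar>(t n - x) \<bullet> \<nu>\<bar>" and sg: "\<And>n. (t n - x) \<bullet> \<nu> = - sg * \<bar>(t n - x) \<bullet> \<nu>\<bar>"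
  shows "(\<lambda>n. LINT y:Bd|\<mu>. cauchy_kernel p (y - t n) \<odot> v y) \<longlonglongrightarrow> PV + (sg / 2) *\<^sub>R f x"
proof -
  have BdB [measurable]: "Bd \<in> sets borel" by (rule borel_closed[OF closed_Bd])
  have cylB [measurable]: "cyl \<in> sets borel" by (rule borel_open[OF open_cyl])
  let ?\<tau> = "\<lambda>n. t n - x"
  have \<tau>0: "?\<tau> \<longlonglongrightarrow> 0" using t(3) by (simp add: LIM_zero)
  note dc = decomp[OF t(1)]
  note nf = nontangential_flux[of ?\<tau> "\<lambda>n. proj (t n - x)" "\<lambda>n. (t n - x) \<bullet> \<nu>", OF dc \<tau>0 _ cone sg]
  define \<kappa> where "\<kappa> = \<delta> / (1 + 2 * \<delta>)"
  have \<kappa>: "0 < \<kappa>" using \<delta> by (simp add: \<kappa>_def)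
  have cb: "\<kappa> * norm u \<le> norm (u + \<psi> u *\<^sub>R \<nu> - (t n - x))" if "u \<in> T" for u n
    using cone_bounds(2)[OF dc cone that, of 1] by (simp add: \<kappa>_def)
  note hd = hoelder_density_limit[OF bounded_bilinear_cl_mult measurable_\<phi> \<alpha> C'_nonneg \<phi>_hoelder _ _ _ \<tau>0 \<kappa> cb,
      where q = "\<lambda>_. indicator (ball 0 (2 * r))" and A = "A0 + annulus_part + (sg * poisson_const) *\<^sub>R cl_one"]
  have i: "integrable lam (\<lambda>u. indicator (ball 0 (2 * r)) u *\<^sub>R (kern (t n - x) u \<odot> \<phi> u))" for n
    by (rule hd(1)) (use nf t(2) in auto)
  have l: "(\<lambda>n. \<integral>u. indicator (ball 0 (2 * r)) u *\<^sub>R (kern (t n - x) u \<odot> \<phi> u) \<partial>lam) \<longlonglongrightarrow>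
      (\<integral>u. indicator (ball 0 (2 * r)) u *\<^sub>R (kern 0 u \<odot> (\<phi> u - f x)) \<partial>lam) + (A0 + annulus_part + (sg * poisson_const) *\<^sub>R cl_one) \<odot> f x"
    by (rule hd(2)) (use nf t(2) in auto)
  have farset: "Bd - cyl \<in> sets borel" by measurable
  note farl = far(2)[OF farset \<rho>_pos far_dist t(3)]
  have "\<forall>\<^sub>F n in sequentially. dist (t n) x < \<rho> / 2" using tendstoD[OF t(3), of "\<rho> / 2"] \<rho>_pos by simp
  then have ev: "\<forall>\<^sub>F n in sequentially. (LINT y:Bd - cyl|\<mu>. cauchy_kernel p (y - t n) \<odot> v y)
      + (1 / sphere_area p) *\<^sub>R (\<integral>u. indicator (ball 0 (2 * r)) u *\<^sub>R (kern (t n - x) u \<odot> \<phi> u) \<partial>lam)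
      = (LINT y:Bd|\<mu>. cauchy_kernel p (y - t n) \<odot> v y)"
  proof eventually_elim
    case (elim n)
    have near: "set_integrable \<mu> (\<Phi> ` S) (\<lambda>y. cauchy_kernel p (y - t n) \<odot> v y)"
      "(LINT y:\<Phi> ` S|\<mu>. cauchy_kernel p (y - t n) \<odot> v y)
        = (1 / sphere_area p) *\<^sub>R (\<integral>u. indicator (ball 0 (2 * r)) u *\<^sub>R (kern (t n - x) u \<odot> \<phi> u) \<partial>lam)"
      using near_integral[of UNIV "t n"] i[of n] by simp_all
    have "(LINT y:(Bd - cyl) \<union> \<Phi> ` S|\<mu>. cauchy_kernel p (y - t n) \<odot> v y)
        = (LINT y:Bd - cyl|\<mu>. cauchy_kernel p (y - t n) \<odot> v y) + (LINT y:\<Phi> ` S|\<mu>. cauchy_kernel p (y - t n) \<odot> v y)"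
      by (rule set_integral_Un[OF _ far(1)[OF farset \<rho>_pos far_dist] near(1)]) (use image_S elim in auto)
    moreover have "(Bd - cyl) \<union> \<Phi> ` S = Bd" unfolding image_S by blast
    ultimately show ?case unfolding near(2) by simp
  qed
  have lim: "(\<lambda>n. LINT y:Bd|\<mu>. cauchy_kernel p (y - t n) \<odot> v y) \<longlonglongrightarrow>
      (LINT y:Bd - cyl|\<mu>. cauchy_kernel p (y - x) \<odot> v y) + (1 / sphere_area p) *\<^sub>R
        ((\<integral>u. indicator (ball 0 (2 * r)) u *\<^sub>R (kern 0 u \<odot> (\<phi> u - f x)) \<partial>lam)
          + (A0 + annulus_part + (sg * poisson_const) *\<^sub>R cl_one) \<odot> f x)"
    by (rule Lim_transform_eventually[OF _ ev]) (intro tendsto_intros l farl)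
  have "(1 / sphere_area p) *\<^sub>R ((sg * poisson_const) *\<^sub>R f x) = (sg / 2) *\<^sub>R f x"
    using poisson_const_eq by (simp add: field_simps)
  then show ?thesis
    using lim by (simp only: PV_def cl.add_left cl.scaleR_left cl_one_mult scaleR_add_right add.assoc)
qed

end

text \<open>The unit directions from \<open>x\<close> to points of the closed cone form a compact
  set on which \<open>z \<bullet> \<nu>\<close> has no zero, as a zero would lie in the tangent
  hyperplane; the minimum of its modulus is the constant.\<close>

lemma nontangential_cone_constant:
  fixes L :: "'a::euclidean_space set"
  assumes L: "closed L" and K: "nontangential_cone L \<nu> x K"
  obtains c where "0 < c" "\<And>t. t \<in> K \<Longrightarrow> c * norm (t - x) \<le> \<bar>(t - x) \<bullet> \<nu>\<bar>"
proof -
  have KL: "K \<subseteq> L" and scale: "\<And>t s. t \<in> K \<Longrightarrow> 0 < s \<Longrightarrow> x + s *\<^sub>R (t - x) \<in> K"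
    and tan: "closure K \<inter> {y \<in> L. (y - x) \<bullet> \<nu> = 0} \<subseteq> {x}"
    using K by (auto simp: nontangential_cone_def)
  define S where "S = sphere 0 1 \<inter> (\<lambda>y. y - x) ` closure K"
  have S: "compact S" unfolding S_def by (intro compact_Int_closed compact_sphere closed_translation_subtract closed_closure)
  have cont: "continuous_on S (\<lambda>z. \<bar>z \<bullet> \<nu>\<bar>)" by (intro continuous_intros)
  have inS: "(1 / norm (t - x)) *\<^sub>R (t - x) \<in> S" if "t \<in> K" "t \<noteq> x" for t
  proof -
    have "x + (1 / norm (t - x)) *\<^sub>R (t - x) \<in> closure K" using scale[OF that(1)] that(2) closure_subset[of K] by auto
    then have "(1 / norm (t - x)) *\<^sub>R (t - x) \<in> (\<lambda>y. y - x) ` closure K" by (rule rev_image_eqI) simp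
    then show ?thesis using that(2) by (simp add: S_def)
  qed
  show ?thesis
  proof (cases "S = {}")
    case True
    then have "t = x" if "t \<in> K" for t using inS[OF that] by blast
    then show ?thesis by (intro that[of 1]) auto
  next
    case False
    obtain z0 where z0: "z0 \<in> S" "\<And>z. z \<in> S \<Longrightarrow> \<bar>z0 \<bullet> \<nu>\<bar> \<le> \<bar>z \<bullet> \<nu>\<bar>"
      using continuous_attains_inf[OF S False cont] by blast
    have "z0 \<bullet> \<nu> \<noteq> 0"
    proof
      assume z: "z0 \<bullet> \<nu> = 0"
      obtain y where y: "y \<in> closure K" "z0 = y - x" using z0(1) by (auto simp: S_def)
      have "y \<in> L" using y(1) KL L by (meson closure_minimal subset_iff)
      then have "y = x" using tan y z by auto
      then show False using z0(1) y by (simp add: S_def)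
    qed
    moreover have "\<bar>z0 \<bullet> \<nu>\<bar> * norm (t - x) \<le> \<bar>(t - x) \<bullet> \<nu>\<bar>" if t: "t \<in> K" for t
    proof (cases "t = x")
      case False
      then have "\<bar>z0 \<bullet> \<nu>\<bar> \<le> \<bar>(t - x) \<bullet> \<nu>\<bar> / norm (t - x)" using z0(2)[OF inS[OF t False]] by simp
      then show ?thesis using False by (simp add: field_simps)
    qed simp
    ultimately show ?thesis by (intro that[of "\<bar>z0 \<bullet> \<nu>\<bar>"]) auto
  qed
qed

section \<open>The jump relation in a slice\<close>

context cauchy_boundary
begin

text \<open>The slope \<delta> stays free, so that it can be adapted to a cone given beforehand; the
  cylinder depends on it.\<close>

lemma local_graph:
  assumes \<delta>: "0 < \<delta>" "\<delta> \<le> 1"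
  obtains B \<psi> d\<psi> r h where "cauchy_graph p \<eta> W f x t0 \<alpha> C B (exterior_normal L W x) \<psi> d\<psi> \<delta> r h"
proof -
  have sL: "subspace L" by (rule subspace_slice[OF \<eta> p_le])
  obtain V \<phi> g where V: "x \<in> V" and c: "boundary_chart L W V \<phi> g"
    using reg by (auto simp: regular_point_def)
  have \<phi>x: "\<phi> x = 0" using c V x_Bd unfolding boundary_chart_def by blast
  define \<nu> where "\<nu> = exterior_normal L W x"
  have \<nu>g: "\<nu> = g x /\<^sub>R norm (g x)" unfolding \<nu>_def by (rule exterior_normal_eq[OF sL c V \<phi>x])
  have gx: "g x \<in> L" "g x \<noteq> 0" using c V by (auto simp: boundary_chart_def)
  have \<nu>L: "\<nu> \<in> L" unfolding \<nu>g by (rule subspace_scale[OF sL gx(1)])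
  have n\<nu>: "norm \<nu> = 1" using gx(2) by (simp add: \<nu>g)
  then have \<nu>1: "\<nu> \<bullet> \<nu> = 1" by (simp add: norm_eq_1)
  define T' where "T' = {u \<in> L. u \<bullet> \<nu> = 0}"
  have sT: "subspace T'"
    using sL by (auto simp: T'_def subspace_def inner_add_left)
  obtain B where B: "B \<subseteq> T'" "pairwise orthogonal B" "\<And>b. b \<in> B \<Longrightarrow> norm b = 1" "independent B" "span B = T'"
    by (rule orthonormal_basis_subspace[OF sT]) blast
  have oB: "orthonormal_set B"
  proof
    show "finite B" using B(4) by (rule independent_imp_finite)
    show "b \<bullet> b' = (if b = b' then 1 else 0)" if "b \<in> B" "b' \<in> B" for b b'
      using B(2,3) that by (auto simp: pairwise_def orthogonal_def norm_eq_1)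
  qed
  have B\<nu>: "b \<bullet> \<nu> = 0" if "b \<in> B" for b using B(1) that by (auto simp: T'_def)
  have L_eq: "L = {u + s *\<^sub>R \<nu> | u s. u \<in> span B}"
  proof (intro equalityI subsetI)
    fix y assume y: "y \<in> L"
    have "y - (y \<bullet> \<nu>) *\<^sub>R \<nu> \<in> span B"
      unfolding B(5) T'_def using y sL \<nu>L \<nu>1 by (auto simp: subspace_diff subspace_scale inner_diff_left)
    moreover have "y = (y - (y \<bullet> \<nu>) *\<^sub>R \<nu>) + (y \<bullet> \<nu>) *\<^sub>R \<nu>" by simp
    ultimately show "y \<in> {u + s *\<^sub>R \<nu> | u s. u \<in> span B}" by blast
  next
    fix y assume "y \<in> {u + s *\<^sub>R \<nu> | u s. u \<in> span B}"
    then show "y \<in> L" unfolding B(5) T'_def using sL \<nu>L by (auto intro: subspace_add subspace_scale)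
  qed
  have card: "card B = p + 1"
  proof -
    have \<nu>B: "\<nu> \<notin> B" using B\<nu> \<nu>1 by force
    have "pairwise orthogonal (insert \<nu> B)"
      using B(2) B\<nu> by (auto simp: pairwise_insert orthogonal_def inner_commute)
    moreover have "0 \<notin> insert \<nu> B" using B(3) n\<nu> by force
    ultimately have "independent (insert \<nu> B)" by (rule pairwise_orthogonal_independent)
    then have "dim (span (insert \<nu> B)) = card (insert \<nu> B)" by (rule dim_span_eq_card_independent)
    moreover have "span (insert \<nu> B) = L"
    proof -
      have "span (B \<union> {\<nu>}) = {u + w |u w. u \<in> span B \<and> w \<in> span {\<nu>}}" by (rule span_Un)
      also have "\<dots> = L" unfolding L_eq by (auto simp: span_singleton)
      finally show ?thesis by simp
    qed
    ultimately show ?thesis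
      using dim_slice[OF \<eta> p_le] \<nu>B independent_imp_finite[OF B(4)] by simp
  qed
  interpret o: orthonormal_set B by (rule oB)
  interpret hyperplane \<mu> "p + 1" B \<nu>
    by unfold_locales (use card n\<nu> B\<nu> in auto)
  have Lsp: "Lsp = L" unfolding Lsp_def using L_eq by simp
  obtain \<psi> d\<psi> r h where g: "0 < r" "0 < h" "graph \<mu> (p + 1) B \<nu> \<psi> d\<psi>" "\<psi> 0 = 0" "d\<psi> 0 = 0"
    "\<And>u. u \<in> T \<Longrightarrow> \<bar>\<psi> u\<bar> \<le> \<delta> * norm u"
    "\<And>u. u \<in> T \<Longrightarrow> norm u < 2 * r \<Longrightarrow> \<bar>\<psi> u\<bar> < h"
    "\<And>u s. u \<in> T \<Longrightarrow> norm u < 2 * r \<Longrightarrow> \<bar>s\<bar> < h \<Longrightarrow> x + u + s *\<^sub>R \<nu> \<in> V \<and>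
        (\<phi> (x + u + s *\<^sub>R \<nu>) < 0 \<longleftrightarrow> s < \<psi> u) \<and> (\<phi> (x + u + s *\<^sub>R \<nu>) = 0 \<longleftrightarrow> s = \<psi> u)"
    "\<And>u. u \<in> T \<Longrightarrow> norm u < 2 * r \<Longrightarrow>
        g (x + u + \<psi> u *\<^sub>R \<nu>) /\<^sub>R norm (g (x + u + \<psi> u *\<^sub>R \<nu>)) = (\<nu> - d\<psi> u) /\<^sub>R sqrt (1 + (norm (d\<psi> u))\<^sup>2)"
    by (rule chart_graph[OF c[folded Lsp] V \<phi>x \<nu>g \<delta>]) (rule that; assumption)
  interpret graph \<mu> "p + 1" B \<nu> \<psi> d\<psi> x by (rule g(3))
  have sq: "para_conj (u + s *\<^sub>R \<nu>) \<odot> (u + s *\<^sub>R \<nu>) = (norm (u + s *\<^sub>R \<nu>))\<^sup>2 *\<^sub>R cl_one"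
    if u: "u \<in> span B" for u s
  proof -
    have "u + s *\<^sub>R \<nu> \<in> L" using u L_eq by blast
    then have "u + s *\<^sub>R \<nu> \<in> paravectors" using slice_paravectors[OF \<eta> p_le] by blast
    then show ?thesis by (rule conj_mult_self)
  qed
  have "bounded_linear (para_conj :: 'n clifford \<Rightarrow> 'n clifford)"
    using linear_para_conj by (simp add: linear_conv_bounded_linear)
  from bounded_bilinear.comp1[OF bounded_bilinear_cl_mult this]
  interpret flux \<mu> "p + 1" B \<nu> \<psi> d\<psi> x "\<lambda>z b. para_conj z \<odot> b" cl_one
    by (intro flux.intro flux_axioms.intro g(3) sq)
  interpret flux_origin \<mu> "p + 1" B \<nu> \<psi> d\<psi> x "\<lambda>z b. para_conj z \<odot> b" cl_one \<delta> r
    by unfold_locales (use g(1,4-6) \<delta> in auto)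
  have "cauchy_graph p \<eta> W f x t0 \<alpha> C B \<nu> \<psi> d\<psi> \<delta> r h"
  proof unfold_locales
    fix u s assume u: "u \<in> span B" and u2: "norm u < 2 * r"
    show "\<bar>\<psi> u\<bar> < h" by (rule g(7)[OF u u2])
    note g8 = g(8)[OF u u2]
    show "(x + u + s *\<^sub>R \<nu> \<in> W) = (s < \<psi> u) \<and> (x + u + s *\<^sub>R \<nu> \<in> Bd) = (s = \<psi> u)" if "\<bar>s\<bar> < h"
      using g8[OF that] c unfolding boundary_chart_def by blast
    have "exterior_normal L W (x + u + \<psi> u *\<^sub>R \<nu>) = g (x + u + \<psi> u *\<^sub>R \<nu>) /\<^sub>R norm (g (x + u + \<psi> u *\<^sub>R \<nu>))"
      by (rule exterior_normal_eq[OF sL c]) (use g8[OF g(7)[OF u u2]] in auto)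
    then show "exterior_normal L W (x + u + \<psi> u *\<^sub>R \<nu>) = (\<nu> - d\<psi> u) /\<^sub>R sqrt (1 + (norm (d\<psi> u))\<^sup>2)"
      using g(9)[OF u u2] by simp
  qed (use g(2) L_eq in auto)
  then show ?thesis unfolding \<nu>_def by (rule that)
qed

lemma plemelj:
  assumes K: "nontangential_cone L (exterior_normal L W x) x K" and S: "S \<subseteq> L"
    and side: "sg = 1 \<and> S \<subseteq> W \<or> sg = - 1 \<and> S \<inter> closure W = {}"
    and I: "has_principal_value \<mu> Bd x (\<lambda>y. cauchy_kernel p (y - x) \<odot> v y) I"
  shows "((\<lambda>t. LINT y:Bd|\<mu>. cauchy_kernel p (y - t) \<odot> v y) \<longlongrightarrow> I + (sg / 2) *\<^sub>R f x) (at x within S \<inter> K)"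
proof -
  obtain c where c: "0 < c" "\<And>t. t \<in> K \<Longrightarrow> c * norm (t - x) \<le> \<bar>(t - x) \<bullet> exterior_normal L W x\<bar>"
    using nontangential_cone_constant[OF closed_L K] by blast
  \<comment> \<open>\<open>cone_bounds\<close> needs the cone to rise at twice the slope of the
    graph, \<open>2 * \<delta> \<le> c\<close>.\<close>
  define \<delta> where "\<delta> = min 1 (c / 2)"
  have \<delta>: "0 < \<delta>" "\<delta> \<le> 1" "2 * \<delta> \<le> c" using c(1) by (auto simp: \<delta>_def)
  define \<nu> where "\<nu> = exterior_normal L W x"
  obtain B \<psi> d\<psi> r h where "cauchy_graph p \<eta> W f x t0 \<alpha> C B \<nu> \<psi> d\<psi> \<delta> r h"
    unfolding \<nu>_def by (rule local_graph[OF \<delta>(1,2)])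
  then interpret g: cauchy_graph p \<eta> W f x t0 \<alpha> C B \<nu> \<psi> d\<psi> \<delta> r h .
  \<comment> \<open>The graph, and with it the expression \<open>g.PV\<close>, depends on the cone
    through \<delta>; uniqueness of limits identifies it with the given \<open>I\<close>.\<close>
  have PV: "g.PV = I"
    using I g.principal_value unfolding has_principal_value_def
    by (intro tendsto_unique[OF trivial_limit_at_right_real]) auto
  show ?thesis
    unfolding tendsto_at_iff_sequentially comp_def
  proof (intro allI impI)
    fix X :: "nat \<Rightarrow> 'n clifford" assume X: "\<forall>i. X i \<in> S \<inter> K - {x}" "X \<longlonglongrightarrow> x"
    obtain n0 where n0: "\<And>n. n0 \<le> n \<Longrightarrow> dist (X n) x < g.\<rho>"
      using tendstoD[OF X(2) g.\<rho>_pos] by (auto simp: eventually_sequentially)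
    \<comment> \<open>Dropping \<open>n0\<close> terms puts the whole sequence into the cylinder, as
      \<open>nontangential_limit\<close> asks for its conditions at every \<open>n\<close>.\<close>
    define t where "t n = X (n + n0)" for n
    have t: "t n \<in> S" "t n \<in> K" "t n \<noteq> x" "dist (t n) x < g.\<rho>" "t n \<in> L" for n
      using X(1) n0[of "n + n0"] S by (auto simp: t_def)
    have cone: "2 * \<delta> * norm (t n - x) \<le> \<bar>(t n - x) \<bullet> \<nu>\<bar>" for n
      using c(2)[OF t(2), folded \<nu>_def, of n] mult_right_mono[OF \<delta>(3), of "norm (t n - x)"] by simp
    \<comment> \<open>In the cone the height of \<open>t n\<close> exceeds in modulus that of the
      graph over the same base point, so the side of the graph decides the sign of the height: below
      it inside \<open>W\<close>, above it outside the closure.\<close>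
    have sign: "(t n - x) \<bullet> \<nu> = - sg * \<bar>(t n - x) \<bullet> \<nu>\<bar>" for n
    proof -
      define u s where "u = g.proj (t n - x)" and "s = (t n - x) \<bullet> \<nu>"
      note d = g.decomp[OF t(5), of n, folded u_def s_def]
      have us: "norm u \<le> norm (t n - x)" "\<bar>s\<bar> \<le> norm (t n - x)"
        using g.norm_proj_le Cauchy_Schwarz_ineq2[of "t n - x" \<nu>] by (auto simp: u_def s_def g.norm_\<nu>)
      then have small: "norm u < 2 * r" "\<bar>s\<bar> < h" using t(4)[of n] by (auto simp: g.\<rho>_def dist_norm)
      have e: "t n = x + u + s *\<^sub>R \<nu>" using d(1) by (simp add: algebra_simps)
      note cyl = g.cylinder[OF d(2) small, folded e]
      have "\<bar>\<psi> u\<bar> \<le> \<delta> * norm (t n - x)" using g.\<psi>_le[OF d(2)] us(1) \<delta>(1) by (meson mult_left_mono less_imp_le order_trans)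
      moreover have "0 < \<delta> * norm (t n - x)" using \<delta>(1) t(3)[of n] by simp
      ultimately have \<psi>s: "\<bar>\<psi> u\<bar> < \<bar>s\<bar>" using cone[of n, folded s_def] by linarith
      from side show ?thesis
      proof
        assume "sg = 1 \<and> S \<subseteq> W"
        then have "s < \<psi> u" "sg = 1" using t(1)[of n] cyl by auto
        then show ?thesis using \<psi>s unfolding s_def[symmetric] by auto
      next
        assume a: "sg = - 1 \<and> S \<inter> closure W = {}"
        then have "t n \<notin> W" "t n \<notin> Bd" using t(1)[of n] Bd_closure closure_subset[of W] by auto
        then have "\<psi> u < s" using cyl by auto
        then show ?thesis using \<psi>s a unfolding s_def[symmetric] by auto
      qed
    qed
    have tx: "t \<longlonglongrightarrow> x" unfolding t_def using X(2) by (rule LIMSEQ_ignore_initial_segment)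
    have "(\<lambda>n. LINT y:Bd|\<mu>. cauchy_kernel p (y - t n) \<odot> v y) \<longlonglongrightarrow> I + (sg / 2) *\<^sub>R f x"
      using g.nontangential_limit[OF t(5,3) tx cone sign] unfolding PV .
    then show "(\<lambda>n. LINT y:Bd|\<mu>. cauchy_kernel p (y - X n) \<odot> v y) \<longlonglongrightarrow> I + (sg / 2) *\<^sub>R f x"
      unfolding t_def by (rule LIMSEQ_offset)
  qed
qed

lemma principal_value_exists: "\<exists>I. has_principal_value \<mu> Bd x (\<lambda>y. cauchy_kernel p (y - x) \<odot> v y) I"
proof -
  obtain B \<psi> d\<psi> r h where "cauchy_graph p \<eta> W f x t0 \<alpha> C B (exterior_normal L W x) \<psi> d\<psi> 1 r h"
    by (rule local_graph[of 1]) auto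
  then interpret g: cauchy_graph p \<eta> W f x t0 \<alpha> C B "exterior_normal L W x" \<psi> d\<psi> 1 r h .
  show ?thesis using g.principal_value by blast
qed

end

lemma has_principal_value_cong:
  assumes "\<And>y. y \<in> B \<Longrightarrow> h y = k y"
  shows "has_principal_value M B x h I \<longleftrightarrow> has_principal_value M B x k I"
proof -
  have "(\<lambda>y. indicator {y \<in> B. \<epsilon> < dist y x} y *\<^sub>R h y) = (\<lambda>y. indicator {y \<in> B. \<epsilon> < dist y x} y *\<^sub>R k y)" for \<epsilon>
    using assms by (auto simp: indicator_def)
  then show ?thesis unfolding has_principal_value_def set_integrable_def set_lebesgue_integral_def by (simp only:)
qed

theorem theorem3p8:
  fixes p q :: nat
    and D :: "('n::{finite,linorder} clifford \<times> real) set"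
    and F :: "'n clifford \<times> real \<Rightarrow> 'n clifford \<times> 'n clifford"
    and f :: "'n clifford \<Rightarrow> 'n clifford"
    and U :: "'n clifford set"
    and \<eta> x :: "'n clifford"
  assumes "q \<ge> 1" and "CARD('n) = p + q"
    and "domain_in (Rp1 p \<times> UNIV) D" and "reflection_invariant D"
    and "domain_in paravectors (sym_completion p D)" and "p_symmetric p (sym_completion p D)"
    and "stem_function D F" and "hoelder_continuous_on D F"
    and "\<forall>z\<in>sym_completion p D. f z = induced p F z"
    and "domain_in paravectors U" and "p_symmetric p U"
    and "\<eta> \<in> unit_sphere p"
    and "slice p \<eta> U \<subseteq> slice p \<eta> (sym_completion p D)"
    and "slice_boundary p \<eta> U \<subseteq> slice p \<eta> (sym_completion p D)"
    and "\<forall>t \<in> slice p \<eta> U \<union> (slice p \<eta> (sym_completion p D) - closure (slice p \<eta> U)).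
           set_integrable (surface_measure p) (slice_boundary p \<eta> U) (cauchy_integrand p \<eta> U f t)"
    and "regular_point (slice_space p \<eta>) (slice p \<eta> U) x"
  shows "\<exists>I. has_principal_value (surface_measure p) (slice_boundary p \<eta> U) x
               (cauchy_integrand p \<eta> U f x) I \<and>
             has_nt_limit (slice_space p \<eta>) (slice p \<eta> U) x
               (slice p \<eta> U)
               (\<lambda>t. LINT y:slice_boundary p \<eta> U|surface_measure p. cauchy_integrand p \<eta> U f t y)
               ((1/2) *\<^sub>R (f x + 2 *\<^sub>R I)) \<and>
             has_nt_limit (slice_space p \<eta>) (slice p \<eta> U) x
               (slice p \<eta> (sym_completion p D) - closure (slice p \<eta> U))
               (\<lambda>t. LINT y:slice_boundary p \<eta> U|surface_measure p. cauchy_integrand p \<eta> U f t y)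
               ((1/2) *\<^sub>R (- f x + 2 *\<^sub>R I))"
proof -
  note \<eta> = \<open>\<eta> \<in> unit_sphere p\<close>
  have p_le: "p \<le> CARD('n)" using assms(2) by simp
  define W where "W = slice p \<eta> U"
  let ?L = "slice_space p \<eta>"
  have Bd_def: "slice_boundary p \<eta> U = top_of_set ?L frontier_of W"
    by (simp add: slice_boundary_def W_def)
  have D: "D \<subseteq> Rp1 p \<times> UNIV" using assms(3) openin_imp_subset by (force simp: domain_in_def)
  obtain \<alpha> C where \<alpha>: "0 < \<alpha>" "\<alpha> \<le> 1" "0 \<le> C" and
    hoelder: "\<And>y y'. y \<in> slice p \<eta> (sym_completion p D) \<Longrightarrow> y' \<in> slice p \<eta> (sym_completion p D) \<Longrightarrow>
      norm (f y - f y') \<le> C * norm (y - y') powr \<alpha>"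
    using slice_function_hoelder[OF \<eta> p_le assms(4,7) D assms(8)] assms(9) by metis
  \<comment> \<open>The slice is contained in the paravectors, so relative openness restricts to
    it.\<close>
  have W_open: "openin (top_of_set ?L) W"
  proof -
    obtain O' where "open O'" "U = paravectors \<inter> O'" using assms(10) by (auto simp: domain_in_def openin_open)
    moreover from this have "W = ?L \<inter> O'"
      using slice_paravectors[OF \<eta> p_le] by (auto simp: W_def slice_def)
    ultimately show ?thesis by (auto simp: openin_open)
  qed
  \<comment> \<open>A regular point is a boundary point, and the empty set has none; this yields the
    base point \<open>t0\<close>.\<close>
  have "W \<noteq> {}"
  proof
    assume "W = {}"
    then have "top_of_set ?L frontier_of W = {}" by (simp add: frontier_of_def)
    then show False using assms(16) by (simp add: regular_point_def W_def)
  qed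
  then obtain t0 where t0: "t0 \<in> W" by blast
  have integrand: "cauchy_integrand p \<eta> U f t y = cauchy_kernel p (y - t) \<odot> exterior_normal ?L W y \<odot> f y" if "t \<in> ?L" for t y
    using slice_kernel_eq[OF \<eta> p_le, of t y] that by (simp add: cauchy_integrand_def W_def)
  interpret cauchy_boundary p \<eta> W f x t0 \<alpha> C
  proof
    show "set_integrable (surface_measure p) (top_of_set (slice_space p \<eta>) frontier_of W)
      (\<lambda>y. cauchy_kernel p (y - t0) \<odot> exterior_normal (slice_space p \<eta>) W y \<odot> f y)"
    proof -
      have "t0 \<in> ?L" using t0 openin_subset[OF W_open] by auto
      then have "cauchy_integrand p \<eta> U f t0 = (\<lambda>y. cauchy_kernel p (y - t0) \<odot> exterior_normal ?L W y \<odot> f y)"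
        by (simp add: integrand fun_eq_iff)
      then show ?thesis using bspec[OF assms(15), of t0] t0 by (simp add: Bd_def W_def)
    qed
    show "norm (f y - f y') \<le> C * norm (y - y') powr \<alpha>"
      if "y \<in> top_of_set (slice_space p \<eta>) frontier_of W" "y' \<in> top_of_set (slice_space p \<eta>) frontier_of W" for y y'
      using that assms(14) by (intro hoelder) (auto simp: Bd_def)
  qed (use \<eta> p_le W_open \<alpha> t0 assms(16) in \<open>auto simp: W_def\<close>)
  have integrand_v: "cauchy_integrand p \<eta> U f t y = cauchy_kernel p (y - t) \<odot> v y" if "t \<in> ?L" "y \<in> slice_boundary p \<eta> U" for t y
    using that by (simp add: integrand v_def cl_mult_assoc Bd_def)
  obtain I where I: "has_principal_value \<mu> Bd x (\<lambda>y. cauchy_kernel p (y - x) \<odot> v y) I"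
    using principal_value_exists by blast
  \<comment> \<open>Both sides of the boundary at once: \<open>sg = 1\<close> inside
    \<open>W\<close>, \<open>sg = - 1\<close> off its closure.\<close>
  have nt: "has_nt_limit (slice_space p \<eta>) W x S
      (\<lambda>t. LINT y:slice_boundary p \<eta> U|surface_measure p. cauchy_integrand p \<eta> U f t y) (I + (sg / 2) *\<^sub>R f x)"
    if S: "S \<subseteq> ?L" and side: "sg = 1 \<and> S \<subseteq> W \<or> sg = - 1 \<and> S \<inter> closure W = {}" for S sg
    unfolding has_nt_limit_def
  proof (intro allI impI)
    fix K assume K: "nontangential_cone (slice_space p \<eta>) (exterior_normal (slice_space p \<eta>) W x) x K"
    \<comment> \<open>Agreement of the integrals for \<open>t\<close> in the slice is enough,
      because the limit is taken within \<open>S\<close>, a part of the slice.\<close>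
    have eq: "(LINT y:Bd|\<mu>. cauchy_kernel p (y - t) \<odot> v y) = (LINT y:slice_boundary p \<eta> U|surface_measure p. cauchy_integrand p \<eta> U f t y)"
      if "t \<in> ?L" for t
      unfolding set_lebesgue_integral_def Bd_def using integrand_v[OF that]
      by (intro Bochner_Integration.integral_cong refl) (auto simp: indicator_def Bd_def)
    show "((\<lambda>t. LINT y:slice_boundary p \<eta> U|surface_measure p. cauchy_integrand p \<eta> U f t y) \<longlongrightarrow> I + (sg / 2) *\<^sub>R f x)
        (at x within S \<inter> K)"
      by (rule Lim_transform_eventually[OF plemelj[OF K S side I]])
        (use S eq in \<open>auto simp: eventually_at_filter intro!: always_eventually\<close>)
  qed
  have 1: "has_principal_value (surface_measure p) (slice_boundary p \<eta> U) x (cauchy_integrand p \<eta> U f x) I"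
    using I has_principal_value_cong[of "slice_boundary p \<eta> U" "cauchy_integrand p \<eta> U f x" "\<lambda>y. cauchy_kernel p (y - x) \<odot> v y"]
      integrand_v x_L by (simp add: Bd_def)
  have "slice p \<eta> Y \<subseteq> ?L" for Y by (auto simp: slice_def)
  then have "has_nt_limit (slice_space p \<eta>) W x W
      (\<lambda>t. LINT y:slice_boundary p \<eta> U|surface_measure p. cauchy_integrand p \<eta> U f t y) (I + (1 / 2) *\<^sub>R f x)"
    "has_nt_limit (slice_space p \<eta>) W x (slice p \<eta> (sym_completion p D) - closure W)
      (\<lambda>t. LINT y:slice_boundary p \<eta> U|surface_measure p. cauchy_integrand p \<eta> U f t y) (I + (- 1 / 2) *\<^sub>R f x)"
    by (intro nt; auto simp: W_def)+
  moreover have "I + (1 / 2) *\<^sub>R f x = (1/2) *\<^sub>R (f x + 2 *\<^sub>R I)" "I + (- 1 / 2) *\<^sub>R f x = (1/2) *\<^sub>R (- f x + 2 *\<^sub>R I)"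
    by (simp_all add: algebra_simps)
  ultimately show ?thesis using 1 unfolding W_def by auto
qed

end
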